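(* Let $V$ be a simple vertex operator algebra, $G$ a finite group of automorphisms of $V$, and $\mathcal S$ a finite $G$-stable set of pairwise inequivalent irreducible twisted $V$-modules. Let $\mathcal M=\bigoplus_{(g,M)\in\mathcal S}M$, and let $\mathcal A_\alpha(G,\mathcal S)$, its modules $W^j_\lambda$ and the spaces $M^j_\lambda$ ($j\in J$, $\lambda\in\Lambda_j$) be as defined in the context. Then, as an $\mathcal A_\alpha(G,\mathcal S)\otimes V^G$-module, $$\mathcal M=\bigoplus_{j\in J,\ \lambda\in\Lambda_j}W^j_\lambda\otimes M^j_\lambda .$$ Moreover: (1) Each $M^j_\lambda$ is a nonzero irreducible $V^G$-module. (2) $M^{j_1}_{\lambda_1}$ and $M^{j_2}_{\lambda_2}$ are isomorphic $V^G$-modules if and only if $j_1=j_2$ and $\lambda_1=\lambda_2$. In particular, for every $g\in G$, every irreducible $g$-twisted $V$-module is a completely reducible $V^G$-module.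
   Context: $V^G=\{v\in V: av=v\ \forall a\in G\}$ is the fixed-point vertex operator subalgebra; $T=|G|$. Twisted modules: for $g\in G$ and $V^{(g,r)}=\{u: gu=e^{-2\pi\sqrt{-1}r/T}u\}$, a $g$-twisted module $(M,Y_M)$ has $Y_M(u,z)=\sum_{k\in r/T+\mathbb Z}u_kz^{-k-1}$ for $u\in V^{(g,r)}$ and satisfies the usual twisted Jacobi identity; irreducible $g$-twisted modules are ordinary, i.e. graded by $L(0)$-eigenvalues with finite-dimensional eigenspaces. $G$-action: let $\mathcal T$ be the set of pairs $(g,M)$ with $g\in G$ and $M$ an irreducible $g$-twisted $V$-module, one $M$ for each isomorphism class. For $a\in G$, $M\cdot a$ is the space $M$ with $Y_{M\cdot a}(u,z)=Y_M(au,z)$; it is an irreducible $a^{-1}ga$-twisted module. Set $(g,M)\cdot a=(a^{-1}ga,M\cdot a)$, where $M\cdot a$ is replaced by its isomorphic representative; this is a right action of $G$ on $\mathcal T$. $\mathcal S\subset\mathcal T$ is $G$-stable if closed under it. Cocycle: for $(g,M)\in\mathcal S$ and $a\in G$ let $(aga^{-1},N)\in\mathcal S$ be the element $(g,M)\cdot a^{-1}$ and fix a linear isomorphism $\phi(a,(g,M)):M\to N$ with $\phi(a,(g,M))Y_M(u,z)=Y_N(au,z)\phi(a,(g,M))$ for all $u\in V$, and $\phi(1,(g,M))=\mathrm{id}$. Scalars $\alpha_{(g,M)}(a,b)\in\mathbb C^\times$ are defined by $\phi(a,(g,M)\cdot b^{-1})\,\phi(b,(g,M))=\alpha_{(g,M)}(a,b)\,\phi(ab,(g,M))$.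 Algebra: $\mathbb C\mathcal S=\bigoplus_{(g,M)\in\mathcal S}\mathbb C\,e(g,M)$ with $e(g,M)e(h,N)=\delta_{(g,M),(h,N)}e(h,N)$. $\mathcal A_\alpha(G,\mathcal S)=\mathbb C[G]\otimes\mathbb C\mathcal S$ has basis $a\otimes e(g,M)$ and multiplication $$(a\otimes e(g,M))\cdot(b\otimes e(h,N))=\alpha_{(h,N)}(a,b)\,ab\otimes e((g,M)\cdot b)\,e(h,N).$$ It is a finite-dimensional semisimple associative algebra (Dong–Yamskulna). It acts on $\mathcal M$ by $(a\otimes e(g,M))\cdot w=\delta_{(g,M),(h,N)}\,\phi(a,(g,M))w$ for $w\in N$, $(h,N)\in\mathcal S$, and this action commutes with that of $V^G$. Modules: $G_{(g,M)}=\{a\in G: ag=ga,\ M\cdot a\simeq M \text{ as } g\text{-twisted modules}\}$ is the stabilizer of $(g,M)$; $S(g,M)=\mathrm{Span}\{a\otimes e(g,M): a\in G_{(g,M)}\}$ is a subalgebra isomorphic to the twisted group algebra $\mathbb C^{\alpha_{(g,M)}}[G_{(g,M)}]$, and $D(g,M)=\mathrm{Span}\{a\otimes e(g,M): a\in G\}$ is a left ideal which is a right $S(g,M)$-module. Decompose $\mathcal S=\bigcup_{j\in J}\mathcal O_j$ into $G$-orbits and fix $(g_j,M^j)\in\mathcal O_j$. Let $G_j=G_{(g_j,M^j)}$, let $\Lambda_j$ be the set of irreducible characters of $\mathbb C^{\alpha_{(g_j,M^j)}}[G_j]$, and for $\lambda\in\Lambda_j$ let $W_{j,\lambda}$ be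 the corresponding simple module. Set $$W^j_\lambda=D(g_j,M^j)\otimes_{S(g_j,M^j)}W_{j,\lambda},\qquad M^j_\lambda=\mathrm{Hom}_{\mathbb C^{\alpha_{(g_j,M^j)}}[G_j]}(W_{j,\lambda},M^j).$$ Here $\mathbb C^{\alpha_{(g_j,M^j)}}[G_j]$ acts on $M^j$ by $a\mapsto\phi(a,(g_j,M^j))$, and $M^j_\lambda$ is a $V^G$-module via the commuting action of $V^G$ on $M^j$. *)

theory Defs
  imports
    Complex_Main
    "HOL-Library.Function_Algebras"
    "HOL-Library.Groups_Big_Fun"
    "HOL-Combinatorics.Permutations"
begin
class complex_vector = ab_group_add +
  fixes scaleC :: "complex \<Rightarrow> 'a \<Rightarrow> 'a"  (infixr "*\<^sub>C" 75)
  assumes scaleC_add_right: "a *\<^sub>C (x + y) = a *\<^sub>C x + a *\<^sub>C y"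
    and scaleC_add_left: "(a + b) *\<^sub>C x = a *\<^sub>C x + b *\<^sub>C x"
    and scaleC_scaleC: "a *\<^sub>C (b *\<^sub>C x) = (a * b) *\<^sub>C x"
    and scaleC_one: "1 *\<^sub>C x = x"

instantiation complex :: complex_vector
begin

definition scaleC_complex :: "complex \<Rightarrow> complex \<Rightarrow> complex"
  where "scaleC_complex a x = a * x"

instance
  by standard (simp_all add: scaleC_complex_def algebra_simps)

end

instantiation "fun" :: (type, complex_vector) complex_vector
begin

definition scaleC_fun :: "complex \<Rightarrow> ('a \<Rightarrow> 'b) \<Rightarrow> 'a \<Rightarrow> 'b"
  where "scaleC_fun a f = (\<lambda>i. a *\<^sub>C f i)"

instance
  by standard
    (simp_all add: scaleC_fun_def fun_eq_iff scaleC_add_right scaleC_add_left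
      scaleC_scaleC scaleC_one)

end

interpretation cvec: vector_space "scaleC :: complex \<Rightarrow> 'a \<Rightarrow> 'a::complex_vector"
  by standard (simp_all add: scaleC_add_right scaleC_add_left scaleC_scaleC scaleC_one)

text \<open>Throughout, spaces are linear subspaces of an ambient type, and maps between them are
  total functions of which only the values on the subspace matter.\<close>

definition lin_map :: "'a::complex_vector set \<Rightarrow> 'b::complex_vector set \<Rightarrow> ('a \<Rightarrow> 'b) \<Rightarrow> bool"
  where "lin_map U X f \<longleftrightarrow>
    (\<forall>x\<in>U. f x \<in> X) \<and>
    (\<forall>x\<in>U. \<forall>y\<in>U. f (x + y) = f x + f y) \<and>
    (\<forall>c. \<forall>x\<in>U. f (c *\<^sub>C x) = c *\<^sub>C f x)"

definition lin_iso :: "'a::complex_vector set \<Rightarrow> 'b::complex_vector set \<Rightarrow> ('a \<Rightarrow> 'b) \<Rightarrow> bool"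
  where "lin_iso U X f \<longleftrightarrow> lin_map U X f \<and> bij_betw f U X"

definition fin_dim :: "'a::complex_vector set \<Rightarrow> bool"
  where "fin_dim U \<longleftrightarrow> (\<exists>B. finite B \<and> cvec.span B = U)"

definition trace_on :: "'a::complex_vector set \<Rightarrow> ('a \<Rightarrow> 'a) \<Rightarrow> complex"
  where "trace_on U f =
    (let B = (SOME B. cvec.independent B \<and> cvec.span B = U)
     in \<Sum>b\<in>B. cvec.representation B (f b) b)"

text \<open>Coordinate spaces: \<open>fspace I\<close> has basis \<open>bvec i\<close> for \<open>i \<in> I\<close> when \<open>I\<close> is finite.\<close>

definition bvec :: "'i \<Rightarrow> 'i \<Rightarrow> complex"
  where "bvec i = (\<lambda>j. if j = i then 1 else 0)"

definition fspace :: "'i set \<Rightarrow> ('i \<Rightarrow> complex) set"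
  where "fspace I = {x. \<forall>i. i \<notin> I \<longrightarrow> x i = 0}"

text \<open>This is the direct sum only for finite \<open>I\<close>, the only case needed.\<close>

definition dsum :: "'i set \<Rightarrow> ('i \<Rightarrow> 'a::complex_vector set) \<Rightarrow> ('i \<Rightarrow> 'a) set"
  where "dsum I X = {f. \<forall>i. if i \<in> I then f i \<in> X i else f i = 0}"

definition incl :: "'i \<Rightarrow> 'a::complex_vector \<Rightarrow> 'i \<Rightarrow> 'a"
  where "incl i x = (\<lambda>j. if j = i then x else 0)"

definition bilinear_forms ::
    "'a::complex_vector set \<Rightarrow> 'b::complex_vector set \<Rightarrow> ('a \<Rightarrow> 'b \<Rightarrow> complex) set"
  where "bilinear_forms U W = {\<beta>.
    (\<forall>w\<in>W. lin_map U UNIV (\<lambda>d. \<beta> d w)) \<and> (\<forall>d\<in>U. lin_map W UNIV (\<beta> d))}"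

text \<open>Here \<open>r d s\<close> is the right action of \<open>s \<in> K\<close> on \<open>U\<close> and \<open>l s w\<close> its left action
  on \<open>W\<close>.\<close>

definition balanced_forms ::
    "'s set \<Rightarrow> ('a \<Rightarrow> 's \<Rightarrow> 'a) \<Rightarrow> ('s \<Rightarrow> 'b \<Rightarrow> 'b) \<Rightarrow>
      'a::complex_vector set \<Rightarrow> 'b::complex_vector set \<Rightarrow> ('a \<Rightarrow> 'b \<Rightarrow> complex) set"
  where "balanced_forms K r l U W = {\<beta> \<in> bilinear_forms U W.
    \<forall>d\<in>U. \<forall>s\<in>K. \<forall>w\<in>W. \<beta> (r d s) w = \<beta> d (l s w)}"

text \<open>The tensor product of \<open>U\<close> and \<open>W\<close> is realised inside the dual of the space \<open>F\<close> of bilinear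
  forms (for the tensor product over the complex numbers) or of balanced forms (for the tensor
  product over an algebra), as the span of the evaluations \<open>\<beta> \<mapsto> \<beta> d w\<close>. Since linear
  functionals on a vector space separate points, it has the usual universal property: this is
  \<open>tensor_universal\<close> below.\<close>

definition tens :: "('a \<Rightarrow> 'b \<Rightarrow> complex) set \<Rightarrow> 'a \<Rightarrow> 'b \<Rightarrow> ('a \<Rightarrow> 'b \<Rightarrow> complex) \<Rightarrow> complex"
  where "tens F d w = (\<lambda>\<beta>. if \<beta> \<in> F then \<beta> d w else 0)"

definition tensor_space ::
    "('a \<Rightarrow> 'b \<Rightarrow> complex) set \<Rightarrow> 'a set \<Rightarrow> 'b set \<Rightarrow> (('a \<Rightarrow> 'b \<Rightarrow> complex) \<Rightarrow> complex) set"
  where "tensor_space F U W = cvec.span {tens F d w |d w. d \<in> U \<and> w \<in> W}"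

text \<open>The endomorphism \<open>f \<otimes> g\<close>, see \<open>tensor_map_tens\<close> below.\<close>

definition tensor_map ::
    "('a \<Rightarrow> 'b \<Rightarrow> complex) set \<Rightarrow> ('a \<Rightarrow> 'a) \<Rightarrow> ('b \<Rightarrow> 'b) \<Rightarrow>
      (('a \<Rightarrow> 'b \<Rightarrow> complex) \<Rightarrow> complex) \<Rightarrow> ('a \<Rightarrow> 'b \<Rightarrow> complex) \<Rightarrow> complex"
  where "tensor_map F f g t = (\<lambda>\<beta>. if \<beta> \<in> F then t (\<lambda>d w. \<beta> (f d) (g w)) else 0)"

lemma tensor_map_tens:
  assumes "\<And>\<beta>. \<beta> \<in> F \<Longrightarrow> (\<lambda>d w. \<beta> (f d) (g w)) \<in> F"
  shows "tensor_map F f g (tens F d w) = tens F (f d) (g w)"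
  using assms by (auto simp: tensor_map_def tens_def fun_eq_iff)

lemma tens_bilinear:
  assumes "F \<subseteq> bilinear_forms U W" "cvec.subspace U" "cvec.subspace W"
  shows "w \<in> W \<Longrightarrow> lin_map U (tensor_space F U W) (\<lambda>d. tens F d w)"
    and "d \<in> U \<Longrightarrow> lin_map W (tensor_space F U W) (tens F d)"
proof -
  have gen: "tens F d w \<in> tensor_space F U W" if "d \<in> U" "w \<in> W" for d w
    unfolding tensor_space_def by (rule cvec.span_base) (use that in blast)
  show "lin_map U (tensor_space F U W) (\<lambda>d. tens F d w)" if "w \<in> W"
    using assms(1) that gen
    by (auto simp: lin_map_def tens_def fun_eq_iff bilinear_forms_def scaleC_fun_def
        scaleC_complex_def plus_fun_def subset_iff)
  show "lin_map W (tensor_space F U W) (tens F d)" if "d \<in> U"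
    using assms(1) that gen
    by (auto simp: lin_map_def tens_def fun_eq_iff bilinear_forms_def scaleC_fun_def
        scaleC_complex_def plus_fun_def subset_iff)
qed

lemma tens_balanced:
  assumes "d \<in> U" "s \<in> K" "w \<in> W"
  shows "tens (balanced_forms K r l U W) (r d s) w = tens (balanced_forms K r l U W) d (l s w)"
  using assms by (auto simp: tens_def balanced_forms_def fun_eq_iff)

lemma tensor_universal:
  fixes \<beta> :: "'a::complex_vector \<Rightarrow> 'b::complex_vector \<Rightarrow> 'x::complex_vector"
  assumes lin1: "\<And>w. w \<in> W \<Longrightarrow> lin_map U UNIV (\<lambda>d. \<beta> d w)"
    and lin2: "\<And>d. d \<in> U \<Longrightarrow> lin_map W UNIV (\<beta> d)"
    and bal: "\<And>d s w. d \<in> U \<Longrightarrow> s \<in> K \<Longrightarrow> w \<in> W \<Longrightarrow> \<beta> (r d s) w = \<beta> d (l s w)"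
  shows "\<exists>h. lin_map (tensor_space (balanced_forms K r l U W) U W) UNIV h \<and>
    (\<forall>d\<in>U. \<forall>w\<in>W. h (tens (balanced_forms K r l U W) d w) = \<beta> d w)"
proof -
  let ?F = "balanced_forms K r l U W"
  let ?T = "tensor_space ?F U W"
  define B :: "'x set" where "B = cvec.extend_basis {}"
  have indB: "cvec.independent B" and spB: "cvec.span B = UNIV"
    unfolding B_def
    by (simp_all add: cvec.independent_extend_basis cvec.span_extend_basis cvec.independent_empty)
  define co where "co b d w = cvec.representation B (\<beta> d w) b" for b d w
  have co_F: "co b \<in> ?F" for b
    using lin1 lin2 bal
    by (auto simp: balanced_forms_def bilinear_forms_def lin_map_def co_def scaleC_complex_def
        cvec.representation_add[OF indB] cvec.representation_scale[OF indB] spB)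
  have fin: "finite {b. t (co b) \<noteq> 0}" if "t \<in> ?T" for t
    using that unfolding tensor_space_def
  proof (induction rule: cvec.span_induct_alt)
    case base
    then show ?case by simp
  next
    case (step c x y)
    then obtain d w where x: "x = tens ?F d w" by blast
    have "finite {b. x (co b) \<noteq> 0}"
      using cvec.finite_representation[of B "\<beta> d w"] by (simp add: x tens_def co_F co_def)
    moreover have "{b. (c *\<^sub>C x + y) (co b) \<noteq> 0} \<subseteq> {b. x (co b) \<noteq> 0} \<union> {b. y (co b) \<noteq> 0}"
      by (auto simp: scaleC_fun_def scaleC_complex_def)
    ultimately show ?case using step by (meson finite_UnI finite_subset)
  qed
  define h where "h t = (\<Sum>b | t (co b) \<noteq> 0. t (co b) *\<^sub>C b)" for t
  have h_eq: "h t = (\<Sum>b\<in>C. t (co b) *\<^sub>C b)" if "finite C" "{b. t (co b) \<noteq> 0} \<subseteq> C" for t C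
    unfolding h_def by (rule sum.mono_neutral_left) (use that in auto)
  have sub: "cvec.subspace ?T" unfolding tensor_space_def by (rule cvec.subspace_span)
  have "h (s + t) = h s + h t" if "s \<in> ?T" "t \<in> ?T" for s t
  proof -
    let ?C = "{b. s (co b) \<noteq> 0} \<union> {b. t (co b) \<noteq> 0}"
    have "finite ?C" using fin that by simp
    then have "h (s + t) = (\<Sum>b\<in>?C. (s + t) (co b) *\<^sub>C b)"
      and "h s = (\<Sum>b\<in>?C. s (co b) *\<^sub>C b)" and "h t = (\<Sum>b\<in>?C. t (co b) *\<^sub>C b)"
      by (intro h_eq; auto)+
    then show ?thesis by (simp add: scaleC_add_left sum.distrib)
  qed
  moreover have "h (c *\<^sub>C t) = c *\<^sub>C h t" if "t \<in> ?T" for c t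
  proof -
    have "h (c *\<^sub>C t) = (\<Sum>b | t (co b) \<noteq> 0. (c *\<^sub>C t) (co b) *\<^sub>C b)"
      by (rule h_eq[OF fin[OF that]]) (auto simp: scaleC_fun_def scaleC_complex_def)
    then show ?thesis
      by (simp add: h_def cvec.scale_sum_right scaleC_fun_def scaleC_complex_def)
  qed
  moreover have "h (tens ?F d w) = \<beta> d w" for d w
    by (simp add: h_def tens_def co_F co_def cvec.sum_nonzero_representation_eq indB spB)
  ultimately show ?thesis by (intro exI[of _ h]) (auto simp: lin_map_def)
qed

text \<open>\<open>vmode V u n\<close> is the mode \<open>u\<^sub>n\<close>, the coefficient of \<open>z\<^bsup>-n-1\<^esup>\<close> in \<open>Y(u,z)\<close>.\<close>

record 'v voa =
  vspace :: "'v set"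
  vmode :: "'v \<Rightarrow> int \<Rightarrow> 'v \<Rightarrow> 'v"
  vac :: 'v
  conf :: 'v

definition vir :: "('v, 'z) voa_scheme \<Rightarrow> int \<Rightarrow> 'v \<Rightarrow> 'v"
  where "vir V n = vmode V (conf V) (n + 1)"

definition weight_space :: "('v::complex_vector, 'z) voa_scheme \<Rightarrow> int \<Rightarrow> 'v set"
  where "weight_space V n = {v \<in> vspace V. vir V 0 v = of_int n *\<^sub>C v}"

text \<open>The Jacobi identity is stated by comparing the coefficients of
  \<open>z\<^sub>0\<^bsup>-l-1\<^esup> z\<^sub>1\<^bsup>-m-1\<^esup> z\<^sub>2\<^bsup>-n-1\<^esup>\<close>; by truncation all but finitely many summands vanish.\<close>

locale vertex_operator_algebra =
  fixes V :: "'v::complex_vector voa"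
  assumes subspace: "cvec.subspace (vspace V)"
    and vac_in: "vac V \<in> vspace V"
    and conf_in: "conf V \<in> vspace V"
    and mode_linear: "u \<in> vspace V \<Longrightarrow> lin_map (vspace V) (vspace V) (vmode V u n)"
    and field_linear: "v \<in> vspace V \<Longrightarrow> lin_map (vspace V) (vspace V) (\<lambda>u. vmode V u n v)"
    and truncation: "u \<in> vspace V \<Longrightarrow> v \<in> vspace V \<Longrightarrow> \<exists>N. \<forall>n\<ge>N. vmode V u n v = 0"
    and vacuum: "v \<in> vspace V \<Longrightarrow> vmode V (vac V) n v = (if n = -1 then v else 0)"
    and creation: "u \<in> vspace V \<Longrightarrow> vmode V u (-1) (vac V) = u"
      "u \<in> vspace V \<Longrightarrow> n \<ge> 0 \<Longrightarrow> vmode V u n (vac V) = 0"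
    and jacobi: "\<lbrakk>u \<in> vspace V; v \<in> vspace V; w \<in> vspace V\<rbrakk> \<Longrightarrow>
      Sum_any (\<lambda>i::nat. (of_int m gchoose i) *\<^sub>C vmode V (vmode V u (l + int i) v) (m + n - int i) w) =
      Sum_any (\<lambda>i::nat. ((-1) ^ i * (of_int l gchoose i)) *\<^sub>C
        (vmode V u (m + l - int i) (vmode V v (n + int i) w) -
         ((-1) powi l) *\<^sub>C vmode V v (n + l - int i) (vmode V u (m + int i) w)))"
    and virasoro: "\<exists>c. \<forall>m n. \<forall>v\<in>vspace V.
      vir V m (vir V n v) - vir V n (vir V m v) =
      of_int (m - n) *\<^sub>C vir V (m + n) v +
      (if m + n = 0 then ((of_int (m ^ 3 - m) / 12) * c) *\<^sub>C v else 0)"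
    and derivative: "u \<in> vspace V \<Longrightarrow> v \<in> vspace V \<Longrightarrow>
      vmode V (vir V (-1) u) n v = (- of_int n) *\<^sub>C vmode V u (n - 1) v"
    and grading: "cvec.span (\<Union>n. weight_space V n) = vspace V"
    and weight_finite: "fin_dim (weight_space V n)"
    and weight_bounded: "\<exists>N. \<forall>n<N. weight_space V n = {0}"

definition simple_voa :: "'v::complex_vector voa \<Rightarrow> bool"
  where "simple_voa V \<longleftrightarrow> vspace V \<noteq> {0} \<and>
    (\<forall>I. cvec.subspace I \<and> I \<subseteq> vspace V \<and> (\<forall>u\<in>vspace V. \<forall>n. \<forall>v\<in>I. vmode V u n v \<in> I)
      \<longrightarrow> I = {0} \<or> I = vspace V)"

text \<open>Automorphisms are normalised to be the identity off \<open>vspace V\<close>, so that they form a group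
  under \<open>(\<circ>)\<close> and are determined by their action on \<open>V\<close>.\<close>

definition voa_aut :: "'v::complex_vector voa \<Rightarrow> ('v \<Rightarrow> 'v) \<Rightarrow> bool"
  where "voa_aut V a \<longleftrightarrow> a permutes vspace V \<and> lin_map (vspace V) (vspace V) a \<and>
    (\<forall>u\<in>vspace V. \<forall>n. \<forall>v\<in>vspace V. a (vmode V u n v) = vmode V (a u) n (a v)) \<and>
    a (vac V) = vac V \<and> a (conf V) = conf V"

definition finite_aut_group :: "'v::complex_vector voa \<Rightarrow> ('v \<Rightarrow> 'v) set \<Rightarrow> bool"
  where "finite_aut_group V G \<longleftrightarrow> finite G \<and> (\<forall>a\<in>G. voa_aut V a) \<and> id \<in> G \<and>
    (\<forall>a\<in>G. \<forall>b\<in>G. a \<circ> b \<in> G) \<and> (\<forall>a\<in>G. inv a \<in> G)"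

definition fixed_voa :: "'v voa \<Rightarrow> ('v \<Rightarrow> 'v) set \<Rightarrow> 'v voa"
  where "fixed_voa V G = V\<lparr>vspace := {v \<in> vspace V. \<forall>a\<in>G. a v = v}\<rparr>"

text \<open>\<open>mmode M u k\<close> is the coefficient of \<open>z\<^bsup>-k-1\<^esup>\<close> in \<open>Y\<^sub>M(u,z)\<close> for rational \<open>k\<close>.\<close>

record ('v, 'm) tmod =
  mspace :: "'m set"
  mmode :: "'v \<Rightarrow> rat \<Rightarrow> 'm \<Rightarrow> 'm"

definition eigenspace_aut :: "'v::complex_vector voa \<Rightarrow> ('v \<Rightarrow> 'v) \<Rightarrow> nat \<Rightarrow> nat \<Rightarrow> 'v set"
  where "eigenspace_aut V g T r =
    {u \<in> vspace V. g u = exp (- (2 * of_real pi * \<i> * of_nat r / of_nat T)) *\<^sub>C u}"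

text \<open>The order of \<open>g\<close> divides \<open>T\<close> in all uses, so that \<open>V\<close> is spanned by the spaces
  \<open>eigenspace_aut V g T r\<close> with \<open>r < T\<close>. In the twisted Jacobi identity (again in terms of
  coefficients, with \<open>m \<in> r/T + \<int>\<close>) the factor \<open>((z\<^sub>1-z\<^sub>0)/z\<^sub>2)\<^bsup>-r/T\<^esup>\<close> has been absorbed using
  \<open>z\<^sub>2\<^bsup>-1\<^esup>((z\<^sub>1-z\<^sub>0)/z\<^sub>2)\<^bsup>-r/T\<^esup> \<delta>((z\<^sub>1-z\<^sub>0)/z\<^sub>2) = z\<^sub>1\<^bsup>-1\<^esup>((z\<^sub>2+z\<^sub>0)/z\<^sub>1)\<^bsup>r/T\<^esup> \<delta>((z\<^sub>2+z\<^sub>0)/z\<^sub>1)\<close>.\<close>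

locale twisted_module =
  fixes V :: "'v::complex_vector voa" and g :: "'v \<Rightarrow> 'v" and T :: nat
    and M :: "('v, 'm::complex_vector) tmod"
  assumes subspace: "cvec.subspace (mspace M)"
    and mode_linear: "u \<in> vspace V \<Longrightarrow> lin_map (mspace M) (mspace M) (mmode M u k)"
    and field_linear: "w \<in> mspace M \<Longrightarrow> lin_map (vspace V) (mspace M) (\<lambda>u. mmode M u k w)"
    and truncation: "u \<in> vspace V \<Longrightarrow> w \<in> mspace M \<Longrightarrow> \<exists>N. \<forall>k\<ge>N. mmode M u k w = 0"
    and exponents: "\<lbrakk>r < T; u \<in> eigenspace_aut V g T r; w \<in> mspace M;
      k - of_nat r / of_nat T \<notin> \<int>\<rbrakk> \<Longrightarrow> mmode M u k w = 0"
    and vacuum: "w \<in> mspace M \<Longrightarrow> mmode M (vac V) k w = (if k = -1 then w else 0)"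
    and jacobi: "\<lbrakk>r < T; u \<in> eigenspace_aut V g T r; v \<in> vspace V; w \<in> mspace M;
      m - of_nat r / of_nat T \<in> \<int>\<rbrakk> \<Longrightarrow>
      Sum_any (\<lambda>i::nat. (of_rat m gchoose i) *\<^sub>C
        mmode M (vmode V u (l + int i) v) (m + n - of_nat i) w) =
      Sum_any (\<lambda>i::nat. ((-1) ^ i * (of_int l gchoose i)) *\<^sub>C
        (mmode M u (m + of_int l - of_nat i) (mmode M v (n + of_nat i) w) -
         ((-1) powi l) *\<^sub>C mmode M v (n + of_int l - of_nat i) (mmode M u (m + of_nat i) w)))"

definition L0_eigenspace :: "'v voa \<Rightarrow> ('v, 'm::complex_vector) tmod \<Rightarrow> complex \<Rightarrow> 'm set"
  where "L0_eigenspace V M c = {w \<in> mspace M. mmode M (conf V) 1 w = c *\<^sub>C w}"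

definition ordinary :: "'v voa \<Rightarrow> ('v, 'm::complex_vector) tmod \<Rightarrow> bool"
  where "ordinary V M \<longleftrightarrow>
    cvec.span (\<Union>c. L0_eigenspace V M c) = mspace M \<and> (\<forall>c. fin_dim (L0_eigenspace V M c))"

definition submod :: "'v voa \<Rightarrow> ('v, 'm::complex_vector) tmod \<Rightarrow> 'm set \<Rightarrow> bool"
  where "submod V M N \<longleftrightarrow> cvec.subspace N \<and> N \<subseteq> mspace M \<and>
    (\<forall>u\<in>vspace V. \<forall>k. \<forall>w\<in>N. mmode M u k w \<in> N)"

definition irreducible_twisted ::
    "'v::complex_vector voa \<Rightarrow> ('v \<Rightarrow> 'v) \<Rightarrow> nat \<Rightarrow> ('v, 'm::complex_vector) tmod \<Rightarrow> bool"
  where "irreducible_twisted V g T M \<longleftrightarrow> twisted_module V g T M \<and> ordinary V M \<and>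
    mspace M \<noteq> {0} \<and> (\<forall>N. submod V M N \<longrightarrow> N = {0} \<or> N = mspace M)"

definition tmod_iso ::
    "'v voa \<Rightarrow> ('v, 'm::complex_vector) tmod \<Rightarrow> ('v, 'n::complex_vector) tmod \<Rightarrow> bool"
  where "tmod_iso V M N \<longleftrightarrow> (\<exists>f. lin_iso (mspace M) (mspace N) f \<and>
    (\<forall>u\<in>vspace V. \<forall>k. \<forall>w\<in>mspace M. f (mmode M u k w) = mmode N u k (f w)))"

text \<open>Untwisted modules are twisted modules for the identity, with \<open>T = 1\<close>.\<close>

abbreviation irreducible_mod :: "'v::complex_vector voa \<Rightarrow> ('v, 'm::complex_vector) tmod \<Rightarrow> bool"
  where "irreducible_mod V M \<equiv> irreducible_twisted V id 1 M"

definition completely_reducible ::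
    "'v::complex_vector voa \<Rightarrow> ('v, 'm::complex_vector) tmod \<Rightarrow> bool"
  where "completely_reducible V M \<longleftrightarrow> (\<exists>X.
    (\<forall>N\<in>X. submod V M N \<and> irreducible_mod V (M\<lparr>mspace := N\<rparr>)) \<and>
    cvec.span (\<Union>X) = mspace M \<and> (\<forall>N\<in>X. N \<inter> cvec.span (\<Union>(X - {N})) = {0}))"

type_synonym ('v, 'm) tpair = "('v \<Rightarrow> 'v) \<times> ('v, 'm) tmod"

definition twist :: "('v, 'm) tmod \<Rightarrow> ('v \<Rightarrow> 'v) \<Rightarrow> ('v, 'm) tmod"
  where "twist M a = M\<lparr>mmode := \<lambda>u. mmode M (a u)\<rparr>"

definition stable_set ::
    "'v::complex_vector voa \<Rightarrow> ('v \<Rightarrow> 'v) set \<Rightarrow> ('v, 'm::complex_vector) tpair set \<Rightarrow> bool"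
  where "stable_set V G S \<longleftrightarrow> finite S \<and>
    (\<forall>(g, M)\<in>S. g \<in> G \<and> irreducible_twisted V g (card G) M) \<and>
    (\<forall>(g, M)\<in>S. \<forall>(h, N)\<in>S. g = h \<and> tmod_iso V M N \<longrightarrow> (g, M) = (h, N)) \<and>
    (\<forall>(g, M)\<in>S. \<forall>a\<in>G. \<exists>N. (inv a \<circ> g \<circ> a, N) \<in> S \<and> tmod_iso V (twist M a) N)"

text \<open>\<open>pact V S p a\<close> is \<open>p \<cdot> a\<close>.\<close>

definition pact ::
    "'v::complex_vector voa \<Rightarrow> ('v, 'm::complex_vector) tpair set \<Rightarrow>
      ('v, 'm) tpair \<Rightarrow> ('v \<Rightarrow> 'v) \<Rightarrow> ('v, 'm) tpair"
  where "pact V S p a = (THE q. q \<in> S \<and> fst q = inv a \<circ> fst p \<circ> a \<and>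
    tmod_iso V (twist (snd p) a) (snd q))"

definition stabilizer ::
    "'v::complex_vector voa \<Rightarrow> ('v \<Rightarrow> 'v) set \<Rightarrow> ('v, 'm::complex_vector) tpair \<Rightarrow> ('v \<Rightarrow> 'v) set"
  where "stabilizer V G p =
    {a \<in> G. a \<circ> fst p = fst p \<circ> a \<and> tmod_iso V (twist (snd p) a) (snd p)}"

definition intertwiners ::
    "'v::complex_vector voa \<Rightarrow> ('v \<Rightarrow> 'v) set \<Rightarrow> ('v, 'm::complex_vector) tpair set \<Rightarrow>
      (('v \<Rightarrow> 'v) \<Rightarrow> ('v, 'm) tpair \<Rightarrow> 'm \<Rightarrow> 'm) \<Rightarrow> bool"
  where "intertwiners V G S \<phi> \<longleftrightarrow> (\<forall>p\<in>S.
    (\<forall>a\<in>G. lin_iso (mspace (snd p)) (mspace (snd (pact V S p (inv a)))) (\<phi> a p) \<and>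
      (\<forall>u\<in>vspace V. \<forall>k. \<forall>w\<in>mspace (snd p).
        \<phi> a p (mmode (snd p) u k w) = mmode (snd (pact V S p (inv a))) (a u) k (\<phi> a p w))) \<and>
    (\<forall>w\<in>mspace (snd p). \<phi> id p w = w))"

text \<open>\<open>cocycle V S \<phi> p a b\<close> is the scalar \<open>\<alpha>\<^sub>p(a,b)\<close>.\<close>

definition cocycle ::
    "'v::complex_vector voa \<Rightarrow> ('v, 'm::complex_vector) tpair set \<Rightarrow>
      (('v \<Rightarrow> 'v) \<Rightarrow> ('v, 'm) tpair \<Rightarrow> 'm \<Rightarrow> 'm) \<Rightarrow>
      ('v, 'm) tpair \<Rightarrow> ('v \<Rightarrow> 'v) \<Rightarrow> ('v \<Rightarrow> 'v) \<Rightarrow> complex"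
  where "cocycle V S \<phi> p a b = (THE c. c \<noteq> 0 \<and> (\<forall>w\<in>mspace (snd p).
    \<phi> a (pact V S p (inv b)) (\<phi> b p w) = c *\<^sub>C \<phi> (a \<circ> b) p w))"

record 'a calg =
  acarrier :: "'a set"
  amult :: "'a \<Rightarrow> 'a \<Rightarrow> 'a"
  aone :: 'a

definition alg_module ::
    "'a::complex_vector calg \<Rightarrow> 'w::complex_vector set \<Rightarrow> ('a \<Rightarrow> 'w \<Rightarrow> 'w) \<Rightarrow> bool"
  where "alg_module A W \<rho> \<longleftrightarrow> cvec.subspace W \<and>
    (\<forall>x\<in>acarrier A. lin_map W W (\<rho> x)) \<and>
    (\<forall>w\<in>W. lin_map (acarrier A) W (\<lambda>x. \<rho> x w)) \<and>
    (\<forall>x\<in>acarrier A. \<forall>y\<in>acarrier A. \<forall>w\<in>W. \<rho> (amult A x y) w = \<rho> x (\<rho> y w)) \<and>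
    (\<forall>w\<in>W. \<rho> (aone A) w = w)"

definition simple_alg_module ::
    "'a::complex_vector calg \<Rightarrow> 'w::complex_vector set \<Rightarrow> ('a \<Rightarrow> 'w \<Rightarrow> 'w) \<Rightarrow> bool"
  where "simple_alg_module A W \<rho> \<longleftrightarrow> alg_module A W \<rho> \<and> W \<noteq> {0} \<and>
    (\<forall>U. cvec.subspace U \<and> U \<subseteq> W \<and> (\<forall>x\<in>acarrier A. \<forall>w\<in>U. \<rho> x w \<in> U) \<longrightarrow> U = {0} \<or> U = W)"

definition alg_character ::
    "'a calg \<Rightarrow> 'w::complex_vector set \<Rightarrow> ('a \<Rightarrow> 'w \<Rightarrow> 'w) \<Rightarrow> 'a \<Rightarrow> complex"
  where "alg_character A W \<rho> = (\<lambda>x. if x \<in> acarrier A then trace_on W (\<rho> x) else 0)"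

text \<open>For a finite-dimensional algebra every simple module is finite-dimensional, hence is
  isomorphic to one whose space is a subspace of \<open>nat \<Rightarrow> complex\<close>.\<close>

definition irr_characters :: "'a::complex_vector calg \<Rightarrow> ('a \<Rightarrow> complex) set"
  where "irr_characters A =
    {alg_character A W \<rho> |(W :: (nat \<Rightarrow> complex) set) \<rho>. simple_alg_module A W \<rho>}"

definition twisted_group_algebra ::
    "('v \<Rightarrow> 'v) set \<Rightarrow> (('v \<Rightarrow> 'v) \<Rightarrow> ('v \<Rightarrow> 'v) \<Rightarrow> complex) \<Rightarrow> (('v \<Rightarrow> 'v) \<Rightarrow> complex) calg"
  where "twisted_group_algebra H \<alpha> =
    \<lparr>acarrier = fspace H,
     amult = (\<lambda>x y. \<Sum>a\<in>H. \<Sum>b\<in>H. (x a * y b * \<alpha> a b) *\<^sub>C bvec (a \<circ> b)),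
     aone = bvec id\<rparr>"

text \<open>The algebra \<open>\<A>\<^sub>\<alpha>(G,\<S>)\<close>, with \<open>bvec (a, p)\<close> in the role of \<open>a \<otimes> e(p)\<close>. The product
  \<open>e(p \<cdot> b) e(q)\<close> is \<open>e(q)\<close> if \<open>p \<cdot> b = q\<close> and zero otherwise.\<close>

definition stable_algebra ::
    "'v::complex_vector voa \<Rightarrow> ('v \<Rightarrow> 'v) set \<Rightarrow> ('v, 'm::complex_vector) tpair set \<Rightarrow>
      (('v \<Rightarrow> 'v) \<Rightarrow> ('v, 'm) tpair \<Rightarrow> 'm \<Rightarrow> 'm) \<Rightarrow>
      (('v \<Rightarrow> 'v) \<times> ('v, 'm) tpair \<Rightarrow> complex) calg"
  where "stable_algebra V G S \<phi> =
    \<lparr>acarrier = fspace (G \<times> S),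
     amult = (\<lambda>x y. \<Sum>(a, p)\<in>G \<times> S. \<Sum>(b, q)\<in>G \<times> S. (x (a, p) * y (b, q)) *\<^sub>C
       (if pact V S p b = q then cocycle V S \<phi> q a b *\<^sub>C bvec (a \<circ> b, q) else 0)),
     aone = (\<Sum>p\<in>S. bvec (id, p))\<rparr>"

text \<open>Modules for \<open>A \<otimes> U\<close>, given by the actions of the associative algebra \<open>A\<close> and of the
  vertex operator algebra \<open>U\<close>.\<close>

record ('a, 'v, 'x) bimod =
  bspace :: "'x set"
  bact :: "'a \<Rightarrow> 'x \<Rightarrow> 'x"
  bmode :: "'v \<Rightarrow> rat \<Rightarrow> 'x \<Rightarrow> 'x"

definition bimod_iso ::
    "'a calg \<Rightarrow> 'v voa \<Rightarrow> ('a, 'v, 'x::complex_vector) bimod \<Rightarrow>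
      ('a, 'v, 'y::complex_vector) bimod \<Rightarrow> bool"
  where "bimod_iso A U X Y \<longleftrightarrow> (\<exists>f. lin_iso (bspace X) (bspace Y) f \<and>
    (\<forall>a\<in>acarrier A. \<forall>x\<in>bspace X. f (bact X a x) = bact Y a (f x)) \<and>
    (\<forall>u\<in>vspace U. \<forall>k. \<forall>x\<in>bspace X. f (bmode X u k x) = bmode Y u k (f x)))"

definition bimod_dsum ::
    "'i set \<Rightarrow> ('i \<Rightarrow> ('a, 'v, 'x::complex_vector) bimod) \<Rightarrow> ('a, 'v, 'i \<Rightarrow> 'x) bimod"
  where "bimod_dsum I X =
    \<lparr>bspace = dsum I (\<lambda>i. bspace (X i)),
     bact = (\<lambda>a f i. if i \<in> I then bact (X i) a (f i) else 0),
     bmode = (\<lambda>u k f i. if i \<in> I then bmode (X i) u k (f i) else 0)\<rparr>"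

definition bimod_tensor ::
    "'w::complex_vector set \<Rightarrow> ('a \<Rightarrow> 'w \<Rightarrow> 'w) \<Rightarrow> ('v, 'n::complex_vector) tmod \<Rightarrow>
      ('a, 'v, ('w \<Rightarrow> 'n \<Rightarrow> complex) \<Rightarrow> complex) bimod"
  where "bimod_tensor W \<rho> N =
    (let F = bilinear_forms W (mspace N) in
      \<lparr>bspace = tensor_space F W (mspace N),
       bact = (\<lambda>a. tensor_map F (\<rho> a) id),
       bmode = (\<lambda>u k. tensor_map F id (mmode N u k))\<rparr>)"

definition total_bimod ::
    "'v::complex_vector voa \<Rightarrow> ('v \<Rightarrow> 'v) set \<Rightarrow> ('v, 'm::complex_vector) tpair set \<Rightarrow>
      (('v \<Rightarrow> 'v) \<Rightarrow> ('v, 'm) tpair \<Rightarrow> 'm \<Rightarrow> 'm) \<Rightarrow>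
      (('v \<Rightarrow> 'v) \<times> ('v, 'm) tpair \<Rightarrow> complex, 'v, ('v, 'm) tpair \<Rightarrow> 'm) bimod"
  where "total_bimod V G S \<phi> =
    \<lparr>bspace = dsum S (\<lambda>p. mspace (snd p)),
     bact = (\<lambda>x f. \<Sum>(a, p)\<in>G \<times> S. x (a, p) *\<^sub>C incl (pact V S p (inv a)) (\<phi> a p (f p))),
     bmode = (\<lambda>u k f p. if p \<in> S then mmode (snd p) u k (f p) else 0)\<rparr>"

definition orbit_representatives ::
    "'v::complex_vector voa \<Rightarrow> ('v \<Rightarrow> 'v) set \<Rightarrow> ('v, 'm::complex_vector) tpair set \<Rightarrow>
      'j set \<Rightarrow> ('j \<Rightarrow> ('v, 'm) tpair) \<Rightarrow> bool"
  where "orbit_representatives V G S J rep \<longleftrightarrow>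
    (\<forall>j\<in>J. rep j \<in> S) \<and> (\<forall>p\<in>S. \<exists>!j. j \<in> J \<and> p \<in> pact V S (rep j) ` G)"

definition stab_algebra ::
    "'v::complex_vector voa \<Rightarrow> ('v \<Rightarrow> 'v) set \<Rightarrow> ('v, 'm::complex_vector) tpair set \<Rightarrow>
      (('v \<Rightarrow> 'v) \<Rightarrow> ('v, 'm) tpair \<Rightarrow> 'm \<Rightarrow> 'm) \<Rightarrow> ('v, 'm) tpair \<Rightarrow> (('v \<Rightarrow> 'v) \<Rightarrow> complex) calg"
  where "stab_algebra V G S \<phi> p = twisted_group_algebra (stabilizer V G p) (cocycle V S \<phi> p)"

definition S_span ::
    "'v::complex_vector voa \<Rightarrow> ('v \<Rightarrow> 'v) set \<Rightarrow> ('v, 'm::complex_vector) tpair \<Rightarrow>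
      (('v \<Rightarrow> 'v) \<times> ('v, 'm) tpair \<Rightarrow> complex) set"
  where "S_span V G p = cvec.span {bvec (a, p) |a. a \<in> stabilizer V G p}"

definition D_span ::
    "('v \<Rightarrow> 'v) set \<Rightarrow> ('v, 'm) tpair \<Rightarrow> (('v \<Rightarrow> 'v) \<times> ('v, 'm) tpair \<Rightarrow> complex) set"
  where "D_span G p = cvec.span {bvec (a, p) |a. a \<in> G}"

text \<open>The forms defining \<open>D(p) \<otimes>\<^bsub>S(p)\<^esub> W\<close> for a module \<open>(W, \<rho>)\<close> of the twisted group algebra
  of the stabilizer, which becomes an \<open>S(p)\<close>-module through the isomorphism
  \<open>a \<otimes> e(p) \<mapsto> a\<close>, that is, \<open>s \<mapsto> (\<lambda>a. s (a, p))\<close>.\<close>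

definition induced_forms ::
    "'v::complex_vector voa \<Rightarrow> ('v \<Rightarrow> 'v) set \<Rightarrow> ('v, 'm::complex_vector) tpair set \<Rightarrow>
      (('v \<Rightarrow> 'v) \<Rightarrow> ('v, 'm) tpair \<Rightarrow> 'm \<Rightarrow> 'm) \<Rightarrow> ('v, 'm) tpair \<Rightarrow>
      'w::complex_vector set \<Rightarrow> ((('v \<Rightarrow> 'v) \<Rightarrow> complex) \<Rightarrow> 'w \<Rightarrow> 'w) \<Rightarrow>
      ((('v \<Rightarrow> 'v) \<times> ('v, 'm) tpair \<Rightarrow> complex) \<Rightarrow> 'w \<Rightarrow> complex) set"
  where "induced_forms V G S \<phi> p W \<rho> =
    balanced_forms (S_span V G p) (amult (stable_algebra V G S \<phi>)) (\<lambda>s. \<rho> (\<lambda>a. s (a, p)))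
      (D_span G p) W"

definition induced_space ::
    "'v::complex_vector voa \<Rightarrow> ('v \<Rightarrow> 'v) set \<Rightarrow> ('v, 'm::complex_vector) tpair set \<Rightarrow>
      (('v \<Rightarrow> 'v) \<Rightarrow> ('v, 'm) tpair \<Rightarrow> 'm \<Rightarrow> 'm) \<Rightarrow> ('v, 'm) tpair \<Rightarrow>
      'w::complex_vector set \<Rightarrow> ((('v \<Rightarrow> 'v) \<Rightarrow> complex) \<Rightarrow> 'w \<Rightarrow> 'w) \<Rightarrow>
      (((('v \<Rightarrow> 'v) \<times> ('v, 'm) tpair \<Rightarrow> complex) \<Rightarrow> 'w \<Rightarrow> complex) \<Rightarrow> complex) set"
  where "induced_space V G S \<phi> p W \<rho> =
    tensor_space (induced_forms V G S \<phi> p W \<rho>) (D_span G p) W"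

definition induced_act ::
    "'v::complex_vector voa \<Rightarrow> ('v \<Rightarrow> 'v) set \<Rightarrow> ('v, 'm::complex_vector) tpair set \<Rightarrow>
      (('v \<Rightarrow> 'v) \<Rightarrow> ('v, 'm) tpair \<Rightarrow> 'm \<Rightarrow> 'm) \<Rightarrow> ('v, 'm) tpair \<Rightarrow>
      'w::complex_vector set \<Rightarrow> ((('v \<Rightarrow> 'v) \<Rightarrow> complex) \<Rightarrow> 'w \<Rightarrow> 'w) \<Rightarrow>
      (('v \<Rightarrow> 'v) \<times> ('v, 'm) tpair \<Rightarrow> complex) \<Rightarrow>
      (((('v \<Rightarrow> 'v) \<times> ('v, 'm) tpair \<Rightarrow> complex) \<Rightarrow> 'w \<Rightarrow> complex) \<Rightarrow> complex) \<Rightarrow>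
      (((('v \<Rightarrow> 'v) \<times> ('v, 'm) tpair \<Rightarrow> complex) \<Rightarrow> 'w \<Rightarrow> complex) \<Rightarrow> complex)"
  where "induced_act V G S \<phi> p W \<rho> x =
    tensor_map (induced_forms V G S \<phi> p W \<rho>) (amult (stable_algebra V G S \<phi>) x) id"

text \<open>The space of homomorphisms from \<open>(W, \<rho>)\<close> to the module \<open>M\<close> of the pair \<open>p = (g, M)\<close>, on
  which an element \<open>x\<close> of the twisted group algebra acts as \<open>\<Sum>\<^sub>a x(a) \<phi>(a, p)\<close>. Homomorphisms
  are normalised to vanish off \<open>W\<close>.\<close>

definition hom_mod ::
    "'v::complex_vector voa \<Rightarrow> ('v \<Rightarrow> 'v) set \<Rightarrow> ('v, 'm::complex_vector) tpair set \<Rightarrow>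
      (('v \<Rightarrow> 'v) \<Rightarrow> ('v, 'm) tpair \<Rightarrow> 'm \<Rightarrow> 'm) \<Rightarrow> ('v, 'm) tpair \<Rightarrow>
      'w::complex_vector set \<Rightarrow> ((('v \<Rightarrow> 'v) \<Rightarrow> complex) \<Rightarrow> 'w \<Rightarrow> 'w) \<Rightarrow> ('v, 'w \<Rightarrow> 'm) tmod"
  where "hom_mod V G S \<phi> p W \<rho> =
    \<lparr>mspace = {f. lin_map W (mspace (snd p)) f \<and> (\<forall>w. w \<notin> W \<longrightarrow> f w = 0) \<and>
       (\<forall>x\<in>acarrier (stab_algebra V G S \<phi> p). \<forall>w\<in>W.
         f (\<rho> x w) = (\<Sum>a\<in>stabilizer V G p. x a *\<^sub>C \<phi> a p (f w)))},
     mmode = (\<lambda>u k f w. if w \<in> W then mmode (snd p) u k (f w) else 0)\<rparr>"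

end

theory Submission
  imports Defs "HOL-Computational_Algebra.Formal_Power_Series" "HOL-Computational_Algebra.Fundamental_Theorem_Algebra"
begin

text \<open>By the Jacobi identity every product \<open>u\<^sub>q v\<^sub>n w\<close> of modes in a twisted module is a combination of
  single modes \<open>x\<^sub>k w\<close>, simultaneously for finitely many vectors in modules twisted by different
  automorphisms. Together with Schur's lemma this gives a density theorem: prescribed vectors can be
  reached by one combination of modes of \<open>V\<close> as soon as they satisfy the linear relations of the given ones.
  Applying it to all translates \<open>\<phi>(a) w\<^sub>i\<close> and averaging over \<open>G\<close> yields a density theorem for \<open>V\<^sup>G\<close>, in which only
  relations under the stabilizers matter. Hence the spaces \<open>Hom(W\<^sub>\<lambda>, M)\<close> are irreducible and pairwise
  inequivalent. They are nonzero because the operators \<open>\<phi>(a)\<close> on \<open>M\<close>, for \<open>a\<close> in the stabilizer, are linearly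
  independent: they intertwine distinct automorphisms of \<open>V\<close>, and \<open>V \<otimes> M \<rightarrow> M((z))\<close> is injective as \<open>V\<close> is simple.
  The decomposition itself is evaluation, \<open>(a \<otimes> w) \<otimes> f \<mapsto> \<phi>(a) f(w)\<close>.\<close>

section \<open>Linear algebra\<close>

text \<open>The modules are infinite dimensional, so Schur's lemma in scalar form needs a source of
  eigenvalues: an endomorphism commuting with all modes preserves the finite-dimensional eigenspaces
  of \<open>L(0)\<close>. Between the modules of different pairs it must give zero even when the
  automorphisms differ; this holds because a twisted module remembers its automorphism through the
  exponents at which vectors act. One density theorem, for simple modules over a bare set of
  operators, serves twice: with modes as operators it gives irreducibility and inequivalence, with
  group elements as operators it gives Burnside's theorem for projective representations. The latter
  replaces the structure theory of semisimple algebras: it shows that characters separate simple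
  modules, that there are finitely many characters, and that isotypic parts are independent.
  Averaging supplies complements. Inequivalence is a graph argument: the graph of an isomorphism
  \<open>h\<close> is closed under the fixed-point modes, whereas density moves a pair
  \<open>(f, h f)\<close> to \<open>(f, 0)\<close>.\<close>

lemma scaleC_fun_apply [simp]: "(c *\<^sub>C f) x = c *\<^sub>C f x"
  by (simp add: scaleC_fun_def)

lemma scaleC_complex_simp [simp]: "c *\<^sub>C (x :: complex) = c * x"
  by (simp add: scaleC_complex_def)

lemma sum_apply: "(\<Sum>i\<in>A. f i) x = (\<Sum>i\<in>A. f i x)"
  by (induction A rule: infinite_finite_induct) auto

lemma lin_mapI:
  assumes "\<And>x. x \<in> U \<Longrightarrow> f x \<in> X"
    and "\<And>x y. x \<in> U \<Longrightarrow> y \<in> U \<Longrightarrow> f (x + y) = f x + f y"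
    and "\<And>c x. x \<in> U \<Longrightarrow> f (c *\<^sub>C x) = c *\<^sub>C f x"
  shows "lin_map U X f"
  using assms by (auto simp: lin_map_def)

lemma lin_map_in: "lin_map U X f \<Longrightarrow> x \<in> U \<Longrightarrow> f x \<in> X"
  by (auto simp: lin_map_def)

lemma lin_map_add: "lin_map U X f \<Longrightarrow> x \<in> U \<Longrightarrow> y \<in> U \<Longrightarrow> f (x + y) = f x + f y"
  by (auto simp: lin_map_def)

lemma lin_map_scale: "lin_map U X f \<Longrightarrow> x \<in> U \<Longrightarrow> f (c *\<^sub>C x) = c *\<^sub>C f x"
  by (auto simp: lin_map_def)

lemma lin_map_zero:
  assumes "lin_map U X f" "cvec.subspace U"
  shows "f 0 = 0"
  using lin_map_scale[OF assms(1) cvec.subspace_0[OF assms(2)], of 0] by simp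

lemma lin_map_sum:
  assumes "lin_map U X f" "cvec.subspace U" "\<And>i. i \<in> I \<Longrightarrow> x i \<in> U"
  shows "f (\<Sum>i\<in>I. x i) = (\<Sum>i\<in>I. f (x i))"
  using assms(3)
proof (induction I rule: infinite_finite_induct)
  case (insert j F)
  have "(\<Sum>i\<in>F. x i) \<in> U" using insert by (intro cvec.subspace_sum[OF assms(2)]) auto
  then show ?case using insert lin_map_add[OF assms(1)] by simp
qed (auto simp: lin_map_zero[OF assms(1,2)])

lemma lin_map_lincomb:
  assumes "lin_map U X f" "cvec.subspace U" "\<And>i. i \<in> I \<Longrightarrow> x i \<in> U"
  shows "f (\<Sum>i\<in>I. c i *\<^sub>C x i) = (\<Sum>i\<in>I. c i *\<^sub>C f (x i))"
proof -
  have "f (\<Sum>i\<in>I. c i *\<^sub>C x i) = (\<Sum>i\<in>I. f (c i *\<^sub>C x i))"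
    using assms by (intro lin_map_sum) (auto intro: cvec.subspace_scale)
  also have "\<dots> = (\<Sum>i\<in>I. c i *\<^sub>C f (x i))"
    using assms by (intro sum.cong) (auto simp: lin_map_scale)
  finally show ?thesis .
qed

lemma lin_map_diff:
  assumes "lin_map U X f" "cvec.subspace U" "x \<in> U" "y \<in> U"
  shows "f (x - y) = f x - f y"
proof -
  have "f (x + (- 1) *\<^sub>C y) = f x + (- 1) *\<^sub>C f y"
    using assms by (metis lin_map_add lin_map_scale cvec.subspace_scale)
  then show ?thesis by simp
qed

lemma lin_map_comp: "lin_map U X f \<Longrightarrow> lin_map X Y g \<Longrightarrow> lin_map U Y (\<lambda>x. g (f x))"
  by (auto simp: lin_map_def)

lemma lin_map_mono: "lin_map U X f \<Longrightarrow> U' \<subseteq> U \<Longrightarrow> X \<subseteq> X' \<Longrightarrow> lin_map U' X' f"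
  by (auto simp: lin_map_def subset_iff)

lemma lin_map_cong: "lin_map U X f \<Longrightarrow> cvec.subspace U \<Longrightarrow> (\<And>x. x \<in> U \<Longrightarrow> f x = g x) \<Longrightarrow> lin_map U X g"
  unfolding lin_map_def by (metis cvec.subspace_add cvec.subspace_scale)

lemma lin_map_kernel:
  assumes "lin_map U X f" "cvec.subspace U"
  shows "cvec.subspace {x \<in> U. f x = 0}"
  using assms lin_map_zero[OF assms]
  by (intro cvec.subspaceI)
    (auto simp: cvec.subspace_0 cvec.subspace_add cvec.subspace_scale lin_map_add lin_map_scale)

lemma lin_map_image:
  assumes "lin_map U X f" "cvec.subspace U"
  shows "cvec.subspace (f ` U)"
proof (rule cvec.subspaceI)
  show "0 \<in> f ` U" using lin_map_zero[OF assms] cvec.subspace_0[OF assms(2)] by (metis imageI)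
  show "x + y \<in> f ` U" if "x \<in> f ` U" "y \<in> f ` U" for x y
    using that lin_map_add[OF assms(1)] cvec.subspace_add[OF assms(2)] by (auto simp: image_iff) metis
  show "c *\<^sub>C x \<in> f ` U" if "x \<in> f ` U" for c x
    using that lin_map_scale[OF assms(1)] cvec.subspace_scale[OF assms(2)] by (auto simp: image_iff) metis
qed

lemma lin_map_inj_on:
  assumes "lin_map U X f" "cvec.subspace U" "\<And>x. x \<in> U \<Longrightarrow> f x = 0 \<Longrightarrow> x = 0"
  shows "inj_on f U"
proof (rule inj_onI)
  fix x y assume *: "x \<in> U" "y \<in> U" "f x = f y"
  then have "f (x - y) = 0" by (simp add: lin_map_diff[OF assms(1,2)])
  then show "x = y" using assms(3)[of "x - y"] * cvec.subspace_diff[OF assms(2)] by auto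
qed

lemma lin_iso_inv:
  assumes "lin_iso U X f" "cvec.subspace U"
  shows "lin_iso X U (inv_into U f)"
proof -
  have f: "lin_map U X f" and bij: "bij_betw f U X" using assms by (auto simp: lin_iso_def)
  have inj: "inj_on f U" and im: "f ` U = X" using bij by (auto simp: bij_betw_def)
  let ?g = "inv_into U f"
  have g: "?g x \<in> U" "f (?g x) = x" if "x \<in> X" for x
    using that im by (auto intro: inv_into_into f_inv_into_f)
  have "?g (x + y) = ?g x + ?g y" if "x \<in> X" "y \<in> X" for x y
    using that g inj by (intro inv_into_f_eq) (auto simp: cvec.subspace_add[OF assms(2)] lin_map_add[OF f])
  moreover have "?g (c *\<^sub>C x) = c *\<^sub>C ?g x" if "x \<in> X" for c x
    using that g inj by (intro inv_into_f_eq) (auto simp: cvec.subspace_scale[OF assms(2)] lin_map_scale[OF f])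
  ultimately show ?thesis
    using g bij_betw_inv_into[OF bij] by (auto simp: lin_iso_def lin_map_def)
qed

lemma lin_map_span_image:
  assumes f: "lin_map U X f" and U: "cvec.subspace U" and x: "x \<in> cvec.span B" and B: "B \<subseteq> U"
    and Y: "cvec.subspace Y" and fB: "\<And>b. b \<in> B \<Longrightarrow> f b \<in> Y"
  shows "f x \<in> Y"
proof -
  have "x \<in> U \<and> f x \<in> Y"
    using x
  proof (induction rule: cvec.span_induct_alt)
    case base
    then show ?case using lin_map_zero[OF f U] U Y by (simp add: cvec.subspace_0)
  next
    case (step c b y)
    then show ?case using B fB U Y
      by (auto simp: lin_map_add[OF f] lin_map_scale[OF f] subset_iff cvec.subspace_add cvec.subspace_scale)
  qed
  then show ?thesis by simp
qed

lemma lin_map_eq_on_span: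
  assumes "lin_map U X f" "lin_map U X g" "cvec.subspace U" "B \<subseteq> U" "x \<in> cvec.span B"
    and "\<And>b. b \<in> B \<Longrightarrow> f b = g b"
  shows "f x = g x"
proof -
  have "x \<in> U \<and> f x = g x"
    using assms(5)
  proof (induction rule: cvec.span_induct_alt)
    case base
    then show ?case using lin_map_zero[OF assms(1,3)] lin_map_zero[OF assms(2,3)] assms(3)
      by (simp add: cvec.subspace_0)
  next
    case (step c b y)
    then show ?case using assms
      by (auto simp: lin_map_add lin_map_scale subset_iff cvec.subspace_add cvec.subspace_scale)
  qed
  then show ?thesis by simp
qed

lemma obtain_finite_basis:
  assumes "fin_dim U" "cvec.subspace X" "X \<subseteq> U"
  obtains B where "finite B" "cvec.independent B" "cvec.span B = X"
proof -
  obtain C where C: "finite C" "cvec.span C = U" using assms(1) by (auto simp: fin_dim_def)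
  obtain B where B: "B \<subseteq> X" "cvec.independent B" "X \<subseteq> cvec.span B"
    using cvec.maximal_independent_subset by blast
  have "finite B" using cvec.independent_span_bound[of C B] B C assms(3) by auto
  moreover have "cvec.span B = X" using B assms(2) by (metis cvec.span_subspace)
  ultimately show ?thesis using that B(2) by blast
qed

lemma fin_dim_subset: "fin_dim U \<Longrightarrow> cvec.subspace X \<Longrightarrow> X \<subseteq> U \<Longrightarrow> fin_dim X"
  by (metis obtain_finite_basis fin_dim_def)

lemma fin_dim_span: "finite B \<Longrightarrow> fin_dim (cvec.span B)"
  by (auto simp: fin_dim_def)

lemma fin_dim_image:
  assumes "fin_dim U" "lin_map U X f" "cvec.subspace U"
  shows "fin_dim (f ` U)"
proof -
  obtain B where B: "finite B" "cvec.span B = U" using assms(1) by (auto simp: fin_dim_def)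
  then have BU: "B \<subseteq> U" by (metis cvec.span_superset)
  have "f x \<in> cvec.span (f ` B)" if "x \<in> U" for x
    using that B BU by (intro lin_map_span_image[OF assms(2,3), of x B]) (auto intro: cvec.span_base)
  moreover have "cvec.span (f ` B) \<subseteq> f ` U"
    using BU by (intro cvec.span_minimal lin_map_image[OF assms(2,3)]) auto
  ultimately have "cvec.span (f ` B) = f ` U" by blast
  then show ?thesis using B by (auto simp: fin_dim_def)
qed

text \<open>An indexed family may take a value twice, and then its image can be independent; in that
  case the relation is the difference of the two equal members. Otherwise the image has more
  elements than a spanning set.\<close>

lemma family_dependent:
  assumes "finite I" "finite B" "card B < card I" "\<And>i. i \<in> I \<Longrightarrow> x i \<in> cvec.span B"
  shows "\<exists>c. (\<exists>i\<in>I. c i \<noteq> 0) \<and> (\<Sum>i\<in>I. c i *\<^sub>C x i) = 0"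
proof (cases "inj_on x I")
  case True
  then have "card (x ` I) > card B" using assms by (simp add: card_image)
  then have "cvec.dependent (x ` I)"
    using cvec.independent_span_bound[OF assms(2), of "x ` I"] assms(4) by (force simp: not_less)
  then obtain u where "\<exists>v\<in>x ` I. u v \<noteq> 0" "(\<Sum>v\<in>x ` I. u v *\<^sub>C v) = 0"
    using cvec.dependent_finite[of "x ` I"] assms(1) by auto
  then show ?thesis using True by (intro exI[of _ "u \<circ> x"]) (auto simp: sum.reindex)
next
  case False
  then obtain i j where ij: "i \<in> I" "j \<in> I" "i \<noteq> j" "x i = x j" by (auto simp: inj_on_def)
  let ?c = "\<lambda>k. if k = i then 1 else if k = j then -1 else (0::complex)"
  have "(\<Sum>k\<in>I. ?c k *\<^sub>C x k) = (\<Sum>k\<in>{i,j}. ?c k *\<^sub>C x k)"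
    by (rule sum.mono_neutral_right) (use ij assms(1) in auto)
  also have "\<dots> = 0" using ij by simp
  finally show ?thesis using ij(1) by (intro exI[of _ ?c]) auto
qed

lemma functional_separates:
  assumes "(x::'a::complex_vector) \<noteq> 0"
  shows "\<exists>l. lin_map UNIV (UNIV :: complex set) l \<and> l x \<noteq> 0"
proof -
  define B :: "'a set" where "B = cvec.extend_basis {}"
  have B: "cvec.independent B" "cvec.span B = UNIV"
    by (simp_all add: B_def cvec.independent_extend_basis cvec.independent_empty cvec.span_extend_basis)
  have "\<exists>b. cvec.representation B x b \<noteq> 0"
  proof (rule ccontr)
    assume "\<nexists>b. cvec.representation B x b \<noteq> 0"
    then show False
      using cvec.sum_nonzero_representation_eq[OF B(1), of x] B assms by simp
  qed
  then obtain b where "cvec.representation B x b \<noteq> 0" by blast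
  moreover have "lin_map UNIV (UNIV :: complex set) (\<lambda>y. cvec.representation B y b)"
    using B by (auto intro!: lin_mapI simp: cvec.representation_add cvec.representation_scale)
  ultimately show ?thesis by blast
qed

lemma linear_extension:
  assumes "cvec.subspace U"
  shows "\<exists>\<pi>. lin_map UNIV U \<pi> \<and> (\<forall>x\<in>U. \<pi> x = x)"
proof -
  interpret vector_space_pair "scaleC :: complex \<Rightarrow> 'a \<Rightarrow> 'a" "scaleC :: complex \<Rightarrow> 'a \<Rightarrow> 'a" ..
  have "Vector_Spaces.linear scaleC scaleC (\<lambda>x :: 'a. x)"
    by (rule cvec.linear_ident)
  then obtain g where g: "range g \<subseteq> U" "Vector_Spaces.linear scaleC scaleC g" "\<forall>v\<in>U. g v = v"
    using linear_exists_left_inverse_on[of "\<lambda>x. x" U] assms by auto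
  then interpret g: Vector_Spaces.linear scaleC scaleC g by simp
  show ?thesis using g by (intro exI[of _ g]) (auto intro!: lin_mapI simp: g.add g.scale)
qed

text \<open>Multiplying the coefficients by \<open>c - \<beta>\<close> stays in the subspace, hence so does multiplying by
  the interpolation polynomial of \<open>c\<^sub>0\<close>.\<close>

lemma lagrange_extraction:
  assumes U: "cvec.subspace U" and C: "finite C" "c0 \<in> C" "inj_on \<beta> C"
    and P: "P (\<lambda>_. 1)"
    and step: "\<And>g b. P g \<Longrightarrow> P (\<lambda>c. (\<beta> c - b) * g c)"
    and mem: "\<And>g. P g \<Longrightarrow> (\<Sum>c\<in>C. g c *\<^sub>C x c) \<in> U"
  shows "x c0 \<in> U"
proof -
  have "P (\<lambda>c. \<Prod>d\<in>D. (\<beta> c - \<beta> d))" if "finite D" for D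
    using that P by induction (auto intro: step)
  then have "P (\<lambda>c. \<Prod>d\<in>C - {c0}. (\<beta> c - \<beta> d))" using C by auto
  from mem[OF this] have "(\<Sum>c\<in>C. (\<Prod>d\<in>C - {c0}. (\<beta> c - \<beta> d)) *\<^sub>C x c) \<in> U" .
  also have "(\<Sum>c\<in>C. (\<Prod>d\<in>C - {c0}. (\<beta> c - \<beta> d)) *\<^sub>C x c) =
      (\<Sum>c\<in>{c0}. (\<Prod>d\<in>C - {c0}. (\<beta> c - \<beta> d)) *\<^sub>C x c)"
  proof (rule sum.mono_neutral_right)
    show "\<forall>i\<in>C - {c0}. (\<Prod>d\<in>C - {c0}. (\<beta> i - \<beta> d)) *\<^sub>C x i = 0"
    proof
      fix i assume "i \<in> C - {c0}"
      then have "(\<Prod>d\<in>C - {c0}. (\<beta> i - \<beta> d)) = 0" using C(1) by (intro prod_zero) auto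
      then show "(\<Prod>d\<in>C - {c0}. (\<beta> i - \<beta> d)) *\<^sub>C x i = 0" by simp
    qed
  qed (use C in auto)
  finally have *: "(\<Prod>d\<in>C - {c0}. (\<beta> c0 - \<beta> d)) *\<^sub>C x c0 \<in> U" by simp
  have "(\<Prod>d\<in>C - {c0}. (\<beta> c0 - \<beta> d)) \<noteq> 0"
    using C by (auto simp: inj_on_def)
  then show ?thesis
    using cvec.subspace_scale[OF U *, of "inverse (\<Prod>d\<in>C - {c0}. (\<beta> c0 - \<beta> d))"]
    by simp
qed

text \<open>On the span of the \<open>x c\<close> the operator \<open>T - b\<close> multiplies the
  coefficient of \<open>x c\<close> by \<open>c - b\<close>, which is the step that
  \<open>lagrange_extraction\<close> asks for. The purpose is that submodules inherit the grading by
  eigenvalues of \<open>L(0)\<close>.\<close>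

lemma eigen_components_in_subspace:
  assumes U: "cvec.subspace U" and T: "lin_map M M T" "cvec.subspace M"
    and stable: "\<And>x. x \<in> U \<Longrightarrow> T x \<in> U"
    and C: "finite C" "\<And>c. c \<in> C \<Longrightarrow> x c \<in> M \<and> T (x c) = c *\<^sub>C x c"
    and sum: "(\<Sum>c\<in>C. x c) \<in> U" and c0: "c0 \<in> C"
  shows "x c0 \<in> U"
proof (rule lagrange_extraction[OF U C(1) c0, of "\<lambda>c. c" "\<lambda>g. (\<Sum>c\<in>C. g c *\<^sub>C x c) \<in> U"])
  show "(\<Sum>c\<in>C. ((c - b) * g c) *\<^sub>C x c) \<in> U" if g: "(\<Sum>c\<in>C. g c *\<^sub>C x c) \<in> U" for g b
  proof -
    have "T (\<Sum>c\<in>C. g c *\<^sub>C x c) = (\<Sum>c\<in>C. g c *\<^sub>C T (x c))"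
      using C by (intro lin_map_lincomb[OF T]) auto
    also have "\<dots> = (\<Sum>c\<in>C. (c * g c) *\<^sub>C x c)"
      using C by (intro sum.cong) (auto simp: mult.commute)
    finally have "(\<Sum>c\<in>C. ((c - b) * g c) *\<^sub>C x c) = T (\<Sum>c\<in>C. g c *\<^sub>C x c) - b *\<^sub>C (\<Sum>c\<in>C. g c *\<^sub>C x c)"
      by (simp add: cvec.scale_sum_right left_diff_distrib cvec.scale_left_diff_distrib sum_subtractf)
    then show ?thesis using stable[OF g] g U by (simp add: cvec.subspace_diff cvec.subspace_scale)
  qed
qed (use sum in auto)

lemma span_eigenspaces_decomp:
  assumes x: "x \<in> cvec.span (\<Union>c. E c)" and E: "\<And>c. cvec.subspace (E c)"
  obtains C y where "finite C" "\<And>c. c \<in> C \<Longrightarrow> y c \<in> E c" "x = (\<Sum>c\<in>C. y c)"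
proof -
  have "\<exists>C y. finite C \<and> (\<forall>c. y c \<in> E c) \<and> x = (\<Sum>c\<in>C. y c)"
    using x
  proof (induction rule: cvec.span_induct_alt)
    case base
    show ?case by (rule exI[of _ "{}"]) (auto intro!: exI[of _ "\<lambda>_. 0"] simp: cvec.subspace_0[OF E])
  next
    case (step a z w)
    then obtain C y where C: "finite C" "\<forall>c. y c \<in> E c" "w = (\<Sum>c\<in>C. y c)" by blast
    obtain c0 where c0: "z \<in> E c0" using step by blast
    let ?y = "\<lambda>c. (if c = c0 then a *\<^sub>C z else 0) + (if c \<in> C then y c else 0)"
    have "(\<Sum>c\<in>insert c0 C. ?y c) = a *\<^sub>C z + w"
    proof -
      have "(\<Sum>c\<in>insert c0 C. if c \<in> C then y c else 0) = (\<Sum>c\<in>C. if c \<in> C then y c else 0)"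
        by (rule sum.mono_neutral_right) (use C in auto)
      then show ?thesis using C by (simp only: sum.distrib) (simp add: sum.delta)
    qed
    moreover have "?y c \<in> E c" for c
      using C c0 E by (auto intro!: cvec.subspace_add cvec.subspace_scale simp: cvec.subspace_0)
    ultimately show ?case using C(1) by (intro exI[of _ "insert c0 C"] exI[of _ ?y]) auto
  qed
  then show ?thesis using that by blast
qed

text \<open>Induction on the degree through a root \<open>c\<close> of \<open>p\<close>: with
  \<open>p = (X - c) q\<close> and \<open>y = q(f) x\<close>, either \<open>y\<close> is an
  eigenvector for \<open>c\<close>, or \<open>y = 0\<close> is a relation of smaller degree for the
  same \<open>x\<close>.\<close>

lemma eigenvector_of_poly_relation:
  fixes f :: "'a::complex_vector \<Rightarrow> 'a"
  assumes f: "lin_map U U f" and U: "cvec.subspace U"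
  shows "p \<noteq> 0 \<Longrightarrow> degree p < N \<Longrightarrow> x \<in> U \<Longrightarrow> x \<noteq> 0 \<Longrightarrow> (\<Sum>i<N. coeff p i *\<^sub>C (f ^^ i) x) = 0 \<Longrightarrow>
    \<exists>c. \<exists>y\<in>U. y \<noteq> 0 \<and> f y = c *\<^sub>C y"
proof (induction "degree p" arbitrary: p N)
  case 0
  have "degree p = 0" using 0(1) by simp
  then obtain a where p: "p = [:a:]" by (rule degree_eq_zeroE)
  with 0(2) have a: "a \<noteq> 0" by simp
  have "(\<Sum>i<N. coeff p i *\<^sub>C (f ^^ i) x) = (\<Sum>i\<in>{0}. coeff p i *\<^sub>C (f ^^ i) x)"
    using 0(1,3) by (intro sum.mono_neutral_right) (auto simp: coeff_eq_0)
  then show ?case using 0(5,6) p a by simp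
next
  case (Suc n)
  have "\<not> constant (poly p)" using Suc.hyps(2) constant_degree[of p] by simp
  then obtain c where "poly p c = 0" using fundamental_theorem_of_algebra by blast
  then obtain q where q: "p = [:- c, 1:] * q" by (auto simp: poly_eq_0_iff_dvd dvd_def)
  have q0: "q \<noteq> 0" using Suc.prems q by auto
  have "degree p = degree [:- c, 1:] + degree q" unfolding q by (rule degree_mult_eq) (use q0 in auto)
  then have dq: "degree q = n" using Suc.hyps(2) by simp
  obtain K where N: "N = Suc K" using Suc.prems by (cases N) auto
  have dqK: "degree q < K" using Suc.prems Suc.hyps(2) dq N by simp
  have iter: "(f ^^ i) x \<in> U" for i by (induction i) (use Suc.prems lin_map_in[OF f] in auto)
  define y where "y = (\<Sum>i<K. coeff q i *\<^sub>C (f ^^ i) x)"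
  have yU: "y \<in> U" unfolding y_def using iter by (intro cvec.subspace_sum[OF U] cvec.subspace_scale[OF U])
  have fy: "f y = (\<Sum>i<K. coeff q i *\<^sub>C (f ^^ Suc i) x)"
    unfolding y_def using lin_map_lincomb[OF f U, of "{..<K}" "\<lambda>i. (f ^^ i) x" "coeff q"] iter by simp
  have y': "y = (\<Sum>i<Suc K. coeff q i *\<^sub>C (f ^^ i) x)"
    unfolding y_def using dqK by (simp add: coeff_eq_0)
  \<comment> \<open>Here \<open>pCons 0 q\<close> is \<open>X q\<close>, and \<open>X q\<close>
    evaluated at \<open>f\<close> on \<open>x\<close> is \<open>f y\<close>; so the relation for
    \<open>p\<close> reads \<open>f y - c y = 0\<close>.\<close>
  have "p = pCons 0 q - smult c q" using q by simp
  then have "(\<Sum>i<Suc K. coeff p i *\<^sub>C (f ^^ i) x) =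
      (\<Sum>i<Suc K. coeff (pCons 0 q) i *\<^sub>C (f ^^ i) x) - (\<Sum>i<Suc K. (c * coeff q i) *\<^sub>C (f ^^ i) x)"
    by (simp add: cvec.scale_left_diff_distrib sum_subtractf del: sum.lessThan_Suc)
  also have "(\<Sum>i<Suc K. coeff (pCons 0 q) i *\<^sub>C (f ^^ i) x) = f y"
    by (subst sum.lessThan_Suc_shift) (simp add: fy)
  also have "(\<Sum>i<Suc K. (c * coeff q i) *\<^sub>C (f ^^ i) x) = c *\<^sub>C y"
    by (simp add: y' cvec.scale_sum_right del: sum.lessThan_Suc)
  finally have fyc: "f y = c *\<^sub>C y" using Suc.prems N by simp
  show ?case
  proof (cases "y = 0")
    case True
    then show ?thesis using Suc.hyps(1)[of q K] dq q0 dqK Suc.prems y_def by simp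
  next
    case False
    then show ?thesis using fyc yU by blast
  qed
qed

text \<open>One iterate more than the size of a spanning set forces a linear relation, that is, a
  nonzero polynomial in \<open>f\<close> that kills \<open>x\<close>.\<close>

lemma eigenvector_exists:
  assumes "fin_dim U" "U \<noteq> {0}" "lin_map U U f" "cvec.subspace U"
  shows "\<exists>c. \<exists>y\<in>U. y \<noteq> 0 \<and> f y = c *\<^sub>C y"
proof -
  obtain x where x: "x \<in> U" "x \<noteq> 0" using assms cvec.subspace_0 by blast
  have iter: "(f ^^ i) x \<in> U" for i by (induction i) (use x lin_map_in[OF assms(3)] in auto)
  obtain B where B: "finite B" "cvec.span B = U" using assms(1) by (auto simp: fin_dim_def)
  let ?N = "Suc (card B)"
  obtain c where c: "\<exists>i\<in>{..<?N}. c i \<noteq> 0" "(\<Sum>i<?N. c i *\<^sub>C (f ^^ i) x) = 0"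
    using family_dependent[of "{..<?N}" B "\<lambda>i. (f ^^ i) x"] B iter by auto
  define p where "p = (\<Sum>i<?N. monom (c i) i)"
  have cp: "coeff p i = (if i < ?N then c i else 0)" for i
    by (simp add: p_def coeff_sum del: sum.lessThan_Suc)
  have "p \<noteq> 0" using c(1) cp by (metis coeff_0 lessThan_iff)
  moreover have "degree p < ?N" using cp by (intro degree_lessI) (auto simp: \<open>p \<noteq> 0\<close>)
  moreover have "(\<Sum>i<?N. coeff p i *\<^sub>C (f ^^ i) x) = 0"
    using c(2) cp by (simp cong: sum.cong_simp del: sum.lessThan_Suc)
  ultimately show ?thesis using eigenvector_of_poly_relation[OF assms(3,4)] x by blast
qed

text \<open>\<open>trace_on\<close> picks its basis by choice, so comparing the traces of isomorphic
  modules requires this. Expanding each \<open>b\<close> in \<open>C\<close> and each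
  \<open>f d\<close> in \<open>B\<close> turns both traces into the same double sum.\<close>

lemma trace_basis_independent:
  assumes B: "cvec.independent B" "finite B" "cvec.span B = U"
    and C: "cvec.independent C" "finite C" "cvec.span C = U" and f: "lin_map U U f"
  shows "(\<Sum>b\<in>B. cvec.representation B (f b) b) = (\<Sum>b\<in>C. cvec.representation C (f b) b)"
proof -
  have U: "cvec.subspace U" using B(3) by auto
  have BU: "b \<in> U" if "b \<in> B" for b using B(3) that cvec.span_base by blast
  have CU: "b \<in> U" if "b \<in> C" for b using C(3) that cvec.span_base by blast
  let ?r = "cvec.representation B" and ?s = "cvec.representation C"
  have rlin: "?r (\<Sum>i\<in>I. c i *\<^sub>C x i) b = (\<Sum>i\<in>I. c i * ?r (x i) b)" if "\<And>i. i \<in> I \<Longrightarrow> x i \<in> U" for I c b and x :: "'a \<Rightarrow> 'a"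
    using that B by (subst cvec.representation_sum) (auto simp: cvec.representation_scale intro: cvec.span_scale)
  have slin: "?s (\<Sum>i\<in>I. c i *\<^sub>C x i) b = (\<Sum>i\<in>I. c i * ?s (x i) b)" if "\<And>i. i \<in> I \<Longrightarrow> x i \<in> U" for I c b and x :: "'a \<Rightarrow> 'a"
    using that C by (subst cvec.representation_sum) (auto simp: cvec.representation_scale intro: cvec.span_scale)
  have rB: "(\<Sum>b\<in>B. ?r x b *\<^sub>C b) = x" if "x \<in> U" for x
    using that B by (intro cvec.sum_representation_eq) auto
  have sC: "(\<Sum>b\<in>C. ?s x b *\<^sub>C b) = x" if "x \<in> U" for x
    using that C by (intro cvec.sum_representation_eq) auto
  have "(\<Sum>b\<in>B. ?r (f b) b) = (\<Sum>b\<in>B. \<Sum>d\<in>C. ?s b d * ?r (f d) b)"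
  proof (rule sum.cong[OF refl])
    fix b assume b: "b \<in> B"
    have "f b = f (\<Sum>d\<in>C. ?s b d *\<^sub>C d)" using sC[OF BU[OF b]] by simp
    also have "\<dots> = (\<Sum>d\<in>C. ?s b d *\<^sub>C f d)" using CU by (intro lin_map_lincomb[OF f U])
    finally have "f b = (\<Sum>d\<in>C. ?s b d *\<^sub>C f d)" .
    then show "?r (f b) b = (\<Sum>d\<in>C. ?s b d * ?r (f d) b)"
      using rlin[of C f "?s b" b] CU lin_map_in[OF f] by simp
  qed
  also have "\<dots> = (\<Sum>d\<in>C. \<Sum>b\<in>B. ?r (f d) b * ?s b d)"
    by (subst sum.swap) (simp add: mult.commute)
  also have "\<dots> = (\<Sum>d\<in>C. ?s (f d) d)"
  proof (rule sum.cong[OF refl])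
    fix d assume d: "d \<in> C"
    have "f d = (\<Sum>b\<in>B. ?r (f d) b *\<^sub>C b)" using rB[OF lin_map_in[OF f CU[OF d]]] by simp
    then have "?s (f d) d = ?s (\<Sum>b\<in>B. ?r (f d) b *\<^sub>C b) d" by simp
    then show "(\<Sum>b\<in>B. ?r (f d) b * ?s b d) = ?s (f d) d"
      using slin[of B "\<lambda>b. b" "?r (f d)" d] BU by simp
  qed
  finally show ?thesis .
qed

lemma trace_on_eq:
  assumes B: "cvec.independent B" "finite B" "cvec.span B = U" and f: "lin_map U U f"
  shows "trace_on U f = (\<Sum>b\<in>B. cvec.representation B (f b) b)"
proof -
  define C where "C = (SOME B. cvec.independent B \<and> cvec.span B = U)"
  have C: "cvec.independent C \<and> cvec.span C = U"
    unfolding C_def by (rule someI[of _ B]) (use B in auto)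
  have "finite C" using cvec.independent_span_bound[OF B(2), of C] C B cvec.span_superset by blast
  then show ?thesis
    using trace_basis_independent[OF _ _ _ B f, of C] C by (simp add: trace_on_def C_def Let_def)
qed

lemma trace_on_cong:
  assumes "fin_dim U" "lin_map U U f" "cvec.subspace U" "\<And>x. x \<in> U \<Longrightarrow> f x = g x"
  shows "trace_on U f = trace_on U g"
proof -
  obtain B where B: "finite B" "cvec.independent B" "cvec.span B = U"
    using obtain_finite_basis[OF assms(1,3)] by blast
  have g: "lin_map U U g" using assms by (blast intro: lin_map_cong)
  have "b \<in> U" if "b \<in> B" for b using B(3) that cvec.span_base by blast
  then show ?thesis
    unfolding trace_on_eq[OF B(2,1,3) assms(2)] trace_on_eq[OF B(2,1,3) g]
    by (intro sum.cong) (auto simp: assms(4))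
qed

lemma lin_iso_basis:
  assumes h: "lin_iso U X h" and U: "cvec.subspace U"
    and B: "cvec.independent B" "finite B" "cvec.span B = U"
  shows "cvec.independent (h ` B)" "cvec.span (h ` B) = X"
    and "x \<in> U \<Longrightarrow> b \<in> B \<Longrightarrow> cvec.representation (h ` B) (h x) (h b) = cvec.representation B x b"
proof -
  have hl: "lin_map U X h" and inj: "inj_on h U" and im: "h ` U = X"
    using h by (auto simp: lin_iso_def bij_betw_def)
  have BU: "B \<subseteq> U" using B(3) cvec.span_superset by blast
  have injB: "inj_on h B" using inj BU by (rule inj_on_subset)
  show ind: "cvec.independent (h ` B)"
  proof -
    have "False" if "\<exists>v\<in>h ` B. u v \<noteq> 0" "(\<Sum>v\<in>h ` B. u v *\<^sub>C v) = 0" for u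
    proof -
      have "h (\<Sum>b\<in>B. u (h b) *\<^sub>C b) = (\<Sum>b\<in>B. u (h b) *\<^sub>C h b)"
        using BU by (intro lin_map_lincomb[OF hl U]) auto
      also have "\<dots> = 0" using that(2) injB by (simp add: sum.reindex)
      finally have "h (\<Sum>b\<in>B. u (h b) *\<^sub>C b) = h 0" using lin_map_zero[OF hl U] by simp
      moreover have "(\<Sum>b\<in>B. u (h b) *\<^sub>C b) \<in> U"
        using BU by (intro cvec.subspace_sum[OF U] cvec.subspace_scale[OF U]) auto
      ultimately have "(\<Sum>b\<in>B. u (h b) *\<^sub>C b) = 0"
        using inj cvec.subspace_0[OF U] by (auto simp: inj_on_def)
      then have "\<forall>b\<in>B. u (h b) = 0"
        using cvec.dependent_finite[OF B(2)] B(1) by (auto dest!: spec[of _ "\<lambda>b. u (h b)"])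
      then show False using that(1) by auto
    qed
    then show ?thesis using cvec.dependent_finite[of "h ` B"] B(2) by blast
  qed
  have "h x \<in> cvec.span (h ` B)" if "x \<in> U" for x
    using that B BU by (intro lin_map_span_image[OF hl U, of x B]) (auto intro: cvec.span_base)
  moreover have "cvec.span (h ` B) \<subseteq> h ` U"
    using BU by (intro cvec.span_minimal lin_map_image[OF hl U]) auto
  ultimately show sp: "cvec.span (h ` B) = X" using im by blast
  show "cvec.representation (h ` B) (h x) (h b) = cvec.representation B x b" if x: "x \<in> U" and b: "b \<in> B"
  proof -
    let ?f = "\<lambda>v. if v \<in> h ` B then cvec.representation B x (inv_into B h v) else 0"
    have "cvec.representation (h ` B) (h x) = ?f"
    proof (rule cvec.representation_eqI[OF ind])
      show "h x \<in> cvec.span (h ` B)" using sp im x by auto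
      show "finite {v. ?f v \<noteq> 0}" by (rule finite_subset[of _ "h ` B"]) (use B in auto)
      have "(\<Sum>v | ?f v \<noteq> 0. ?f v *\<^sub>C v) = (\<Sum>v\<in>h ` B. ?f v *\<^sub>C v)"
        by (rule sum.mono_neutral_left) (use B in auto)
      also have "\<dots> = (\<Sum>b\<in>B. cvec.representation B x b *\<^sub>C h b)"
        using injB by (simp add: sum.reindex)
      also have "\<dots> = h (\<Sum>b\<in>B. cvec.representation B x b *\<^sub>C b)"
        using BU by (intro lin_map_lincomb[OF hl U, symmetric]) auto
      also have "(\<Sum>b\<in>B. cvec.representation B x b *\<^sub>C b) = x"
        using x B by (intro cvec.sum_representation_eq) auto
      finally show "(\<Sum>v | ?f v \<noteq> 0. ?f v *\<^sub>C v) = h x" .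
    qed (auto split: if_splits)
    then show ?thesis using b injB by simp
  qed
qed

lemma trace_on_iso:
  assumes h: "lin_iso U X h" and U: "cvec.subspace U" and fd: "fin_dim U"
    and f: "lin_map U U f" and g: "lin_map X X g" and hf: "\<And>x. x \<in> U \<Longrightarrow> h (f x) = g (h x)"
  shows "trace_on U f = trace_on X g"
proof -
  obtain B where B: "finite B" "cvec.independent B" "cvec.span B = U"
    using obtain_finite_basis[OF fd U] by blast
  note hB = lin_iso_basis[OF h U B(2,1,3)]
  have BU: "b \<in> U" if "b \<in> B" for b using B(3) that cvec.span_base by blast
  have "inj_on h B" using h BU by (auto simp: lin_iso_def bij_betw_def inj_on_def)
  then have "trace_on X g = (\<Sum>b\<in>B. cvec.representation (h ` B) (g (h b)) (h b))"
    using trace_on_eq[OF hB(1) _ hB(2) g] B(1) by (simp add: sum.reindex)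
  also have "\<dots> = (\<Sum>b\<in>B. cvec.representation B (f b) b)"
    by (intro sum.cong refl) (metis BU hf hB(3) lin_map_in[OF f])
  finally show ?thesis using trace_on_eq[OF B(2,1,3) f] by simp
qed

text \<open>The trace is the dimension, which is nonzero in characteristic zero. Together with
  \<open>trace_on_zero\<close> it tells apart the characters of two modules on which one algebra
  element acts as the identity and as zero.\<close>

lemma trace_on_id:
  assumes "fin_dim U" "cvec.subspace U" "U \<noteq> {0}" "\<And>x. x \<in> U \<Longrightarrow> f x = x"
  shows "trace_on U f \<noteq> 0"
proof -
  obtain B where B: "finite B" "cvec.independent B" "cvec.span B = U"
    using obtain_finite_basis[OF assms(1,2)] by blast
  have BU: "b \<in> U" if "b \<in> B" for b using B(3) that cvec.span_base by blast
  have "lin_map U U f" using assms(4) cvec.subspace_add[OF assms(2)] cvec.subspace_scale[OF assms(2)]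
    by (auto simp: lin_map_def)
  then have "trace_on U f = (\<Sum>b\<in>B. cvec.representation B (f b) b)" by (rule trace_on_eq[OF B(2,1,3)])
  also have "\<dots> = of_nat (card B)"
    using B BU assms(4) by (simp add: cvec.representation_basis)
  finally show ?thesis using B assms(3) by (cases "B = {}") auto
qed

lemma trace_on_zero:
  assumes "fin_dim U" "cvec.subspace U" "\<And>x. x \<in> U \<Longrightarrow> f x = 0"
  shows "trace_on U f = 0"
proof -
  obtain B where B: "finite B" "cvec.independent B" "cvec.span B = U"
    using obtain_finite_basis[OF assms(1,2)] by blast
  have BU: "b \<in> U" if "b \<in> B" for b using B(3) that cvec.span_base by blast
  have "lin_map U U f" using assms(3) cvec.subspace_0[OF assms(2)]
    cvec.subspace_add[OF assms(2)] cvec.subspace_scale[OF assms(2)] by (auto simp: lin_map_def)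
  then have "trace_on U f = (\<Sum>b\<in>B. cvec.representation B (f b) b)" by (rule trace_on_eq[OF B(2,1,3)])
  then show ?thesis using BU assms(3) by (simp add: cvec.representation_zero)
qed

text \<open>The set \<open>irr_characters\<close> ranges over modules carried by subspaces of
  \<open>nat \<Rightarrow> complex\<close>. Coordinates with respect to an enumerated basis move any
  finite-dimensional module there.\<close>

lemma fin_dim_embedding:
  fixes U :: "'a::complex_vector set"
  assumes "fin_dim U" "cvec.subspace U"
  shows "\<exists>(X :: (nat \<Rightarrow> complex) set) h. lin_iso U X h \<and> cvec.subspace X"
proof -
  obtain B where B: "finite B" "cvec.independent B" "cvec.span B = U"
    using obtain_finite_basis[OF assms] by blast
  obtain e where e: "bij_betw e {..<card B} B" using B(1) ex_bij_betw_nat_finite[of B] by (auto simp: atLeast0LessThan)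
  define h where "h x = (\<lambda>n. if n < card B then cvec.representation B x (e n) else 0)" for x
  have hl: "lin_map U UNIV h"
    using B by (intro lin_mapI) (auto simp: h_def fun_eq_iff cvec.representation_add cvec.representation_scale)
  have "x = 0" if "x \<in> U" "h x = 0" for x
  proof -
    have "cvec.representation B x b = 0" if b: "b \<in> B" for b
    proof -
      obtain n where "n < card B" "b = e n" using e b by (auto simp: bij_betw_def)
      then show ?thesis using fun_cong[OF \<open>h x = 0\<close>, of n] by (simp add: h_def)
    qed
    then show ?thesis using cvec.sum_representation_eq[OF B(2), of x B] B that by simp
  qed
  then have "inj_on h U" by (intro lin_map_inj_on[OF hl assms(2)])
  then have "lin_iso U (h ` U) h" using hl by (auto simp: lin_iso_def bij_betw_def lin_map_def)
  then show ?thesis using lin_map_image[OF hl assms(2)] by blast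
qed

section \<open>Density for simple modules over a set of operators\<close>

text \<open>Only a set of operators is given, with no algebra structure: the same notions then apply
  to the modes \<open>(u, k)\<close> acting on a twisted module and to the elements of a group
  acting projectively.\<close>

definition opmod :: "'o set \<Rightarrow> 'a::complex_vector set \<Rightarrow> ('o \<Rightarrow> 'a \<Rightarrow> 'a) \<Rightarrow> bool"
  where "opmod \<Omega> U r \<longleftrightarrow> cvec.subspace U \<and> (\<forall>x\<in>\<Omega>. lin_map U U (r x))"

definition opsub :: "'o set \<Rightarrow> 'a::complex_vector set \<Rightarrow> ('o \<Rightarrow> 'a \<Rightarrow> 'a) \<Rightarrow> 'a set \<Rightarrow> bool"
  where "opsub \<Omega> U r N \<longleftrightarrow> cvec.subspace N \<and> N \<subseteq> U \<and> (\<forall>x\<in>\<Omega>. \<forall>w\<in>N. r x w \<in> N)"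

definition opsimple :: "'o set \<Rightarrow> 'a::complex_vector set \<Rightarrow> ('o \<Rightarrow> 'a \<Rightarrow> 'a) \<Rightarrow> bool"
  where "opsimple \<Omega> U r \<longleftrightarrow> opmod \<Omega> U r \<and> U \<noteq> {0} \<and> (\<forall>N. opsub \<Omega> U r N \<longrightarrow> N = {0} \<or> N = U)"

definition ophom :: "'o set \<Rightarrow> 'a::complex_vector set \<Rightarrow> ('o \<Rightarrow> 'a \<Rightarrow> 'a) \<Rightarrow>
    'b::complex_vector set \<Rightarrow> ('o \<Rightarrow> 'b \<Rightarrow> 'b) \<Rightarrow> ('a \<Rightarrow> 'b) \<Rightarrow> bool"
  where "ophom \<Omega> U r X s f \<longleftrightarrow> lin_map U X f \<and> (\<forall>x\<in>\<Omega>. \<forall>w\<in>U. f (r x w) = s x (f w))"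

lemma opmod_sub: "opmod \<Omega> U r \<Longrightarrow> opsub \<Omega> U r N \<Longrightarrow> opmod \<Omega> N r"
  by (auto simp: opmod_def opsub_def lin_map_def subset_iff)

lemma ophom_kernel:
  assumes "ophom \<Omega> U r X s f" "opmod \<Omega> U r" "opmod \<Omega> X s"
  shows "opsub \<Omega> U r {w \<in> U. f w = 0}"
  using assms lin_map_kernel[of U X f] lin_map_zero[of X X]
  by (auto simp: ophom_def opmod_def opsub_def lin_map_in)

lemma ophom_image:
  assumes "ophom \<Omega> U r X s f" "opmod \<Omega> U r"
  shows "opsub \<Omega> X s (f ` U)"
proof -
  have "s x (f w) \<in> f ` U" if "x \<in> \<Omega>" "w \<in> U" for x w
    using that assms lin_map_in[of U U "r x" w] by (auto simp: ophom_def opmod_def intro!: image_eqI[of _ f "r x w"])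
  then show ?thesis
    using assms lin_map_image[of U X f] by (auto simp: ophom_def opmod_def opsub_def lin_map_in)
qed

lemma schur_inj:
  assumes "opsimple \<Omega> U r" "opmod \<Omega> X s" "ophom \<Omega> U r X s f" "x \<in> U" "f x \<noteq> 0"
  shows "inj_on f U" "\<And>y. y \<in> U \<Longrightarrow> f y = 0 \<Longrightarrow> y = 0"
proof -
  have U: "opmod \<Omega> U r" "cvec.subspace U" using assms by (auto simp: opsimple_def opmod_def)
  have "{w \<in> U. f w = 0} = {0} \<or> {w \<in> U. f w = 0} = U"
    using ophom_kernel[OF assms(3) U(1) assms(2)] assms(1) by (auto simp: opsimple_def)
  then show *: "y = 0" if "y \<in> U" "f y = 0" for y using that assms(4,5) by blast
  then show "inj_on f U" using assms(3) U by (intro lin_map_inj_on[of U X f]) (auto simp: ophom_def)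
qed

lemma schur_iso:
  assumes "opsimple \<Omega> U r" "opsimple \<Omega> X s" "ophom \<Omega> U r X s f" "x \<in> U" "f x \<noteq> 0"
  shows "lin_iso U X f"
proof -
  have U: "opmod \<Omega> U r" "opmod \<Omega> X s" using assms by (auto simp: opsimple_def)
  have "f ` U = {0} \<or> f ` U = X"
    using ophom_image[OF assms(3) U(1)] assms(2) by (auto simp: opsimple_def)
  then have "f ` U = X" using assms(4,5) by auto
  then show ?thesis
    using schur_inj(1)[OF assms(1) U(2) assms(3-5)] assms(3)
    by (auto simp: lin_iso_def bij_betw_def ophom_def)
qed

text \<open>The space \<open>U\<close> may be infinite dimensional, so the eigenvalue is found on a
  finite-dimensional subspace \<open>E\<close> preserved by \<open>f\<close>, which is not asked to
  be stable under the operators. The kernel of \<open>f - c\<close> on all of \<open>U\<close> is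
  then a nonzero submodule.\<close>

lemma schur_scalar:
  assumes U: "opsimple \<Omega> U r" and f: "ophom \<Omega> U r U r f"
    and E: "fin_dim E" "cvec.subspace E" "E \<noteq> {0}" "E \<subseteq> U" "\<And>x. x \<in> E \<Longrightarrow> f x \<in> E"
  shows "\<exists>c. \<forall>x\<in>U. f x = c *\<^sub>C x"
proof -
  have fl: "lin_map U U f" using f by (auto simp: ophom_def)
  have U': "cvec.subspace U" "opmod \<Omega> U r" using U by (auto simp: opsimple_def opmod_def)
  have "lin_map E E f" using fl E by (auto simp: lin_map_def subset_iff)
  then obtain c y where y: "y \<in> E" "y \<noteq> 0" "f y = c *\<^sub>C y" using eigenvector_exists[of E f] E by blast
  let ?h = "\<lambda>x. f x - c *\<^sub>C x"
  have "ophom \<Omega> U r U r ?h"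
    unfolding ophom_def
  proof (intro conjI ballI lin_mapI)
    show "?h x \<in> U" if "x \<in> U" for x
      using that U' lin_map_in[OF fl] by (auto intro: cvec.subspace_diff cvec.subspace_scale)
    show "?h (r x w) = r x (?h w)" if "x \<in> \<Omega>" "w \<in> U" for x w
    proof -
      have rx: "lin_map U U (r x)" using U' that by (auto simp: opmod_def)
      show ?thesis using that f U' lin_map_in[OF fl]
        by (simp add: ophom_def lin_map_diff[OF rx] lin_map_scale[OF rx] cvec.subspace_scale)
    qed
  qed (simp_all add: lin_map_add[OF fl] lin_map_scale[OF fl] scaleC_add_right cvec.scale_right_diff_distrib mult.commute)
  then have "opsub \<Omega> U r {x \<in> U. ?h x = 0}" using ophom_kernel U' by blast
  then have "{x \<in> U. ?h x = 0} = {0} \<or> {x \<in> U. ?h x = 0} = U" using U by (auto simp: opsimple_def)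
  moreover have "y \<in> {x \<in> U. ?h x = 0}" using y E by auto
  ultimately have "{x \<in> U. ?h x = 0} = U" using y(2) by blast
  then have "\<forall>x\<in>U. f x = c *\<^sub>C x" by auto
  then show ?thesis by blast
qed

lemma ophom_inv:
  assumes "ophom \<Omega> U r X s f" "lin_iso U X f" "opmod \<Omega> U r"
  shows "ophom \<Omega> X s U r (inv_into U f)"
proof -
  have U: "cvec.subspace U" using assms by (auto simp: opmod_def)
  have iso: "lin_iso X U (inv_into U f)" by (rule lin_iso_inv[OF assms(2) U])
  have bij: "bij_betw f U X" using assms by (auto simp: lin_iso_def)
  have "inv_into U f (s x y) = r x (inv_into U f y)" if "x \<in> \<Omega>" "y \<in> X" for x y
  proof (rule inv_into_f_eq)
    have "inv_into U f y \<in> U" using that bij by (auto simp: bij_betw_def intro: inv_into_into)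
    then show "r x (inv_into U f y) \<in> U" "f (r x (inv_into U f y)) = s x y"
      using that assms bij f_inv_into_f[of y f U] by (auto simp: ophom_def opmod_def bij_betw_def lin_map_def)
  qed (use bij in \<open>auto simp: bij_betw_def\<close>)
  then show ?thesis using iso by (auto simp: ophom_def lin_iso_def)
qed

lemma ophom_comp: "ophom \<Omega> U r X s f \<Longrightarrow> ophom \<Omega> X s Y t g \<Longrightarrow> ophom \<Omega> U r Y t (\<lambda>x. g (f x))"
  by (auto simp: ophom_def lin_map_def)

lemma dsum_in: "y \<in> dsum I X \<Longrightarrow> i \<in> I \<Longrightarrow> y i \<in> X i"
  by (auto simp: dsum_def split: if_splits)

lemma dsum_out: "y \<in> dsum I X \<Longrightarrow> i \<notin> I \<Longrightarrow> y i = 0"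
  by (auto simp: dsum_def split: if_splits)

lemma dsumI: "(\<And>i. i \<in> I \<Longrightarrow> y i \<in> X i) \<Longrightarrow> (\<And>i. i \<notin> I \<Longrightarrow> y i = 0) \<Longrightarrow> y \<in> dsum I X"
  by (auto simp: dsum_def)

lemma subspace_dsum:
  assumes "\<And>i. i \<in> I \<Longrightarrow> cvec.subspace (X i)"
  shows "cvec.subspace (dsum I X)"
  using assms
  by (auto intro!: cvec.subspaceI dsumI simp: dsum_in dsum_out cvec.subspace_0 cvec.subspace_add cvec.subspace_scale)

lemma sum_incl: "finite I \<Longrightarrow> y \<in> dsum I X \<Longrightarrow> (\<Sum>i\<in>I. incl i (y i)) = y"
  by (auto simp: fun_eq_iff sum_apply incl_def sum.delta dsum_out)

lemma incl_in_dsum: "i \<in> I \<Longrightarrow> x \<in> X i \<Longrightarrow> (\<And>j. j \<in> I \<Longrightarrow> 0 \<in> X j) \<Longrightarrow> incl i x \<in> dsum I X"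
  by (auto simp: incl_def dsum_def)

lemma incl_add: "incl i (x + y) = incl i x + incl i y"
  by (auto simp: incl_def)

lemma incl_scale: "incl i (c *\<^sub>C x) = c *\<^sub>C incl i x"
  by (auto simp: incl_def)

lemma incl_zero [simp]: "incl i 0 = 0"
  by (auto simp: incl_def)

text \<open>A submodule of a finite direct sum of simple modules is the kernel of an endomorphism, the
  projection onto a complement; by Schur's lemma that endomorphism is a matrix of scalars, so
  membership in the submodule is decided by linear relations.\<close>

theorem density:
  fixes U :: "'k \<Rightarrow> 'a::complex_vector set" and r :: "'k \<Rightarrow> 'o \<Rightarrow> 'a \<Rightarrow> 'a" and \<kappa> :: "'i \<Rightarrow> 'k"
  assumes fin: "finite I"
    and simple: "\<And>i. i \<in> I \<Longrightarrow> opsimple \<Omega> (U (\<kappa> i)) (r (\<kappa> i))"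
    and schur: "\<And>i j f. i \<in> I \<Longrightarrow> j \<in> I \<Longrightarrow> ophom \<Omega> (U (\<kappa> i)) (r (\<kappa> i)) (U (\<kappa> j)) (r (\<kappa> j)) f \<Longrightarrow>
      \<exists>c. (\<forall>x\<in>U (\<kappa> i). f x = c *\<^sub>C x) \<and> (\<kappa> i \<noteq> \<kappa> j \<longrightarrow> c = 0)"
    and N: "cvec.subspace N" "N \<subseteq> dsum I (\<lambda>i. U (\<kappa> i))"
    and closed: "\<And>x y. x \<in> \<Omega> \<Longrightarrow> y \<in> N \<Longrightarrow> (\<lambda>i. if i \<in> I then r (\<kappa> i) x (y i) else 0) \<in> N"
    and w: "w \<in> N" and y: "y \<in> dsum I (\<lambda>i. U (\<kappa> i))"
    and rel: "\<And>c k. (\<Sum>i\<in>{i \<in> I. \<kappa> i = k}. c i *\<^sub>C w i) = 0 \<Longrightarrow> (\<Sum>i\<in>{i \<in> I. \<kappa> i = k}. c i *\<^sub>C y i) = 0"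
  shows "y \<in> N"
proof -
  let ?D = "dsum I (\<lambda>i. U (\<kappa> i))"
  define A where "A x y = (\<lambda>i. if i \<in> I then r (\<kappa> i) x (y i) else 0)" for x and y :: "'i \<Rightarrow> 'a"
  have subU: "cvec.subspace (U (\<kappa> i))" if "i \<in> I" for i
    using simple[OF that] by (auto simp: opsimple_def opmod_def)
  have lr: "lin_map (U (\<kappa> i)) (U (\<kappa> i)) (r (\<kappa> i) x)" if "i \<in> I" "x \<in> \<Omega>" for i x
    using simple[OF that(1)] that by (auto simp: opsimple_def opmod_def)
  note r0 = lin_map_zero[OF lr subU]
  have subD: "cvec.subspace ?D" using subU by (rule subspace_dsum)
  have dU: "z i \<in> U (\<kappa> i)" if "z \<in> ?D" "i \<in> I" for z i
    using dsum_in[OF that] .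
  have lA: "lin_map ?D ?D (A x)" if x: "x \<in> \<Omega>" for x
    by (intro lin_mapI dsumI)
      (auto simp: A_def fun_eq_iff intro: lin_map_in[OF lr[OF _ x]] lin_map_add[OF lr[OF _ x]]
        lin_map_scale[OF lr[OF _ x]] dU)
  have incD: "incl i u \<in> ?D" if "i \<in> I" "u \<in> U (\<kappa> i)" for i u
    using that subU by (intro incl_in_dsum) (auto simp: cvec.subspace_0)
  have Ainc: "A x (incl i u) = incl i (r (\<kappa> i) x u)" if "i \<in> I" "x \<in> \<Omega>" for i x u
    using that r0 by (auto simp: A_def incl_def fun_eq_iff)
  define P where "P J = {y \<in> ?D. \<forall>i. i \<notin> J \<longrightarrow> y i = 0}" for J
  have subP: "cvec.subspace (P J)" for J
    unfolding P_def by (auto intro!: cvec.subspaceI simp: cvec.subspace_0[OF subD] cvec.subspace_add[OF subD] cvec.subspace_scale[OF subD])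
  have AP: "A x p \<in> P J" if "p \<in> P J" "x \<in> \<Omega>" for p x J
    using that lin_map_in[OF lA] r0 by (auto simp: P_def A_def)
  let ?J = "{J. J \<subseteq> I \<and> N \<inter> P J \<subseteq> {0}}"
  have "finite ?J" by (rule finite_subset[of _ "Pow I"]) (use fin in auto)
  moreover have "{} \<in> ?J" by (auto simp: P_def fun_eq_iff)
  \<comment> \<open>A maximal set \<open>J\<close> of coordinates for which \<open>P J\<close> meets
    \<open>N\<close> in zero only; \<open>P J\<close> turns out to be a complement of
    \<open>N\<close>.\<close>
  ultimately obtain J where J: "J \<in> ?J" and max: "\<And>K. K \<in> ?J \<Longrightarrow> J \<subseteq> K \<Longrightarrow> K = J"
    using finite_has_maximal[of ?J] by (metis (no_types, lifting) empty_iff)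
  have JI: "J \<subseteq> I" and NJ: "\<And>z. z \<in> N \<Longrightarrow> z \<in> P J \<Longrightarrow> z = 0" using J by auto
  define Q where "Q = {n + p |n p. n \<in> N \<and> p \<in> P J}"
  have subQ: "cvec.subspace Q" unfolding Q_def by (rule cvec.subspace_sums[OF N(1) subP])
  have AQ: "A x z \<in> Q" if z: "z \<in> Q" "x \<in> \<Omega>" for x z
  proof -
    obtain n p where np: "z = n + p" "n \<in> N" "p \<in> P J" using z by (auto simp: Q_def)
    have "A x z = A x n + A x p" unfolding np(1)
      using lin_map_add[OF lA[OF z(2)]] np N(2) by (auto simp: P_def)
    moreover have "A x n \<in> N" using closed[OF z(2) np(2)] by (simp add: A_def)
    ultimately show ?thesis using AP[OF np(3) z(2)] by (auto simp: Q_def)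
  qed
  have incQ: "incl i u \<in> Q" if i: "i \<in> I" and u: "u \<in> U (\<kappa> i)" for i u
  proof -
    let ?K = "{u \<in> U (\<kappa> i). incl i u \<in> Q}"
    have "opsub \<Omega> (U (\<kappa> i)) (r (\<kappa> i)) ?K"
      unfolding opsub_def
    proof (intro conjI ballI cvec.subspaceI)
      show "r (\<kappa> i) x z \<in> ?K" if "x \<in> \<Omega>" "z \<in> ?K" for x z
        using that AQ[of "incl i z" x] Ainc[OF i, of x z] lin_map_in[OF lr[OF i]] by auto
    qed (use subU[OF i] subQ in \<open>auto simp: incl_add incl_scale cvec.subspace_0 cvec.subspace_add cvec.subspace_scale\<close>)
    then have "?K = {0} \<or> ?K = U (\<kappa> i)" using simple[OF i] by (auto simp: opsimple_def)
    moreover have "?K \<noteq> {0}"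
    proof
      assume K0: "?K = {0}"
      \<comment> \<open>If the summand \<open>i\<close> met \<open>N + P J\<close> trivially, an
        element of \<open>N\<close> supported on \<open>insert i J\<close> would have
        \<open>i\<close>-th entry zero, so \<open>J\<close> could be enlarged by \<open>i\<close>.
        Maximality puts \<open>i\<close> into \<open>J\<close>, but then the summand lies in
        \<open>P J\<close> anyway.\<close>
      have "N \<inter> P (insert i J) \<subseteq> {0}"
      proof
        fix n assume n: "n \<in> N \<inter> P (insert i J)"
        let ?p = "n - incl i (n i)"
        have ni: "n i \<in> U (\<kappa> i)" using n i N(2) dU[of n i] by auto
        have "?p \<in> P J"
          using n i incD[OF i ni] cvec.subspace_diff[OF subD, of n "incl i (n i)"] N(2)
          by (auto simp: P_def incl_def)
        then have "- ?p \<in> P J" by (rule cvec.subspace_neg[OF subP])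
        then have "n + (- ?p) \<in> Q" using n unfolding Q_def by blast
        then have "n i = 0" using K0 ni by auto
        then have "n \<in> P J" using n by (auto simp: P_def)
        then show "n \<in> {0}" using NJ n by auto
      qed
      then have "insert i J = J" using max[of "insert i J"] i JI by auto
      then have "i \<in> J" by auto
      have "incl i z \<in> Q" if z: "z \<in> U (\<kappa> i)" for z
      proof -
        have "incl i z \<in> P J" using incD[OF i z] \<open>i \<in> J\<close> by (auto simp: P_def incl_def)
        moreover have "incl i z = 0 + incl i z" by simp
        ultimately show ?thesis unfolding Q_def using cvec.subspace_0[OF N(1)] by blast
      qed
      then have "?K = U (\<kappa> i)" by auto
      then show False using K0 simple[OF i] by (auto simp: opsimple_def)
    qed
    ultimately show ?thesis using u by auto
  qed
  have ex: "\<exists>!p. p \<in> P J \<and> z - p \<in> N" if z: "z \<in> ?D" for z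
  proof -
    have "(\<Sum>i\<in>I. incl i (z i)) \<in> Q"
      using z by (intro cvec.subspace_sum[OF subQ] incQ) (auto intro: dU)
    then have "z \<in> Q" using sum_incl[OF fin z] by simp
    then obtain n p where np: "z = n + p" "n \<in> N" "p \<in> P J" by (auto simp: Q_def)
    show ?thesis
    proof (rule ex1I[of _ p])
      show "p \<in> P J \<and> z - p \<in> N" using np by simp
      fix q assume q: "q \<in> P J \<and> z - q \<in> N"
      have "z - p \<in> N" using np by simp
      then have "(z - p) - (z - q) \<in> N" using q by (blast intro: cvec.subspace_diff[OF N(1)])
      moreover have "q - p \<in> P J" using np q by (intro cvec.subspace_diff[OF subP]) auto
      ultimately show "q = p" using NJ[of "q - p"] by simp
    qed
  qed
  define \<pi> where "\<pi> z = (THE p. p \<in> P J \<and> z - p \<in> N)" for z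
  have \<pi>: "\<pi> z \<in> P J" "z - \<pi> z \<in> N" if "z \<in> ?D" for z
    using theI'[OF ex[OF that]] by (auto simp: \<pi>_def)
  have \<pi>I: "\<pi> z = p" if "z \<in> ?D" "p \<in> P J" "z - p \<in> N" for z p
    using ex[OF that(1)] \<pi>[OF that(1)] that by blast
  have l\<pi>: "lin_map ?D ?D \<pi>"
  proof (rule lin_mapI)
    show "\<pi> z \<in> ?D" if "z \<in> ?D" for z using \<pi>[OF that] by (auto simp: P_def)
    show "\<pi> (z + v) = \<pi> z + \<pi> v" if "z \<in> ?D" "v \<in> ?D" for z v
    proof (rule \<pi>I)
      have "z + v - (\<pi> z + \<pi> v) = (z - \<pi> z) + (v - \<pi> v)" by simp
      then show "z + v - (\<pi> z + \<pi> v) \<in> N" using \<pi> that cvec.subspace_add[OF N(1)] by metis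
    qed (use that \<pi> subD subP in \<open>auto intro: cvec.subspace_add\<close>)
    show "\<pi> (c *\<^sub>C z) = c *\<^sub>C \<pi> z" if "z \<in> ?D" for c z
    proof (rule \<pi>I)
      have "c *\<^sub>C z - c *\<^sub>C \<pi> z = c *\<^sub>C (z - \<pi> z)" by (rule cvec.scale_right_diff_distrib[symmetric])
      then show "c *\<^sub>C z - c *\<^sub>C \<pi> z \<in> N" using \<pi> that cvec.subspace_scale[OF N(1)] by metis
    qed (use that \<pi> subD subP in \<open>auto intro: cvec.subspace_scale\<close>)
  qed
  have \<pi>A: "\<pi> (A x z) = A x (\<pi> z)" if "z \<in> ?D" "x \<in> \<Omega>" for x z
  proof (rule \<pi>I)
    have "\<pi> z \<in> ?D" using that lin_map_in[OF l\<pi>] by auto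
    then have "A x z - A x (\<pi> z) = A x (z - \<pi> z)" using lin_map_diff[OF lA subD] that by simp
    then show "A x z - A x (\<pi> z) \<in> N" using closed[OF that(2) \<pi>(2)[OF that(1)]] by (simp add: A_def)
  qed (use that lin_map_in[OF lA] AP \<pi> in auto)
  have hom: "ophom \<Omega> (U (\<kappa> i)) (r (\<kappa> i)) (U (\<kappa> j)) (r (\<kappa> j)) (\<lambda>u. \<pi> (incl i u) j)" if "i \<in> I" "j \<in> I" for i j
    unfolding ophom_def
  proof (intro conjI ballI lin_mapI)
    show "\<pi> (incl i u) j \<in> U (\<kappa> j)" if "u \<in> U (\<kappa> i)" for u
      using lin_map_in[OF l\<pi> incD[OF \<open>i \<in> I\<close> that]] \<open>j \<in> I\<close> by (rule dsum_in)
    show "\<pi> (incl i (r (\<kappa> i) x u)) j = r (\<kappa> j) x (\<pi> (incl i u) j)" if "x \<in> \<Omega>" "u \<in> U (\<kappa> i)" for x u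
      using \<pi>A[OF incD[OF \<open>i \<in> I\<close> that(2)] that(1)] Ainc[OF \<open>i \<in> I\<close> that(1)] \<open>j \<in> I\<close> by (simp add: A_def)
  qed (use incD[OF \<open>i \<in> I\<close>] in \<open>simp_all add: incl_add incl_scale lin_map_add[OF l\<pi>] lin_map_scale[OF l\<pi>]\<close>)
  have "\<exists>c. \<forall>i\<in>I. \<forall>j\<in>I. (\<forall>x\<in>U (\<kappa> i). \<pi> (incl i x) j = c i j *\<^sub>C x) \<and> (\<kappa> i \<noteq> \<kappa> j \<longrightarrow> c i j = 0)"
  proof -
    have "\<forall>i j. \<exists>c. i \<in> I \<longrightarrow> j \<in> I \<longrightarrow> (\<forall>x\<in>U (\<kappa> i). \<pi> (incl i x) j = c *\<^sub>C x) \<and> (\<kappa> i \<noteq> \<kappa> j \<longrightarrow> c = 0)"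
      using schur hom by meson
    then show ?thesis by metis
  qed
  then obtain c where c: "\<And>i j x. i \<in> I \<Longrightarrow> j \<in> I \<Longrightarrow> x \<in> U (\<kappa> i) \<Longrightarrow> \<pi> (incl i x) j = c i j *\<^sub>C x"
    and c0: "\<And>i j. i \<in> I \<Longrightarrow> j \<in> I \<Longrightarrow> \<kappa> i \<noteq> \<kappa> j \<Longrightarrow> c i j = 0" by blast
  have \<pi>j: "\<pi> z j = (\<Sum>i\<in>{i \<in> I. \<kappa> i = \<kappa> j}. c i j *\<^sub>C z i)" if z: "z \<in> ?D" and j: "j \<in> I" for z j
  proof -
    have "\<pi> z = \<pi> (\<Sum>i\<in>I. incl i (z i))" using sum_incl[OF fin z] by simp
    also have "\<dots> = (\<Sum>i\<in>I. \<pi> (incl i (z i)))"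
      using z incD by (intro lin_map_sum[OF l\<pi> subD]) (auto intro: dU)
    finally have "\<pi> z j = (\<Sum>i\<in>I. \<pi> (incl i (z i)) j)" by (simp add: sum_apply)
    also have "\<dots> = (\<Sum>i\<in>I. c i j *\<^sub>C z i)"
      using z j by (intro sum.cong) (auto simp: c dU)
    also have "\<dots> = (\<Sum>i\<in>{i \<in> I. \<kappa> i = \<kappa> j}. c i j *\<^sub>C z i)"
      by (rule sum.mono_neutral_right) (use fin c0 j in auto)
    finally show ?thesis .
  qed
  have "\<pi> w = 0" using N(2) w cvec.subspace_0[OF subP] by (intro \<pi>I) auto
  then have "\<pi> y j = 0" if "j \<in> I" for j
    using \<pi>j[of w j] \<pi>j[of y j] rel[where c = "\<lambda>i. c i j" and k = "\<kappa> j"] that w y N(2) by (auto simp: subset_iff)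
  moreover have "\<pi> y j = 0" if "j \<notin> I" for j
    using that lin_map_in[OF l\<pi> y] by (rule dsum_out[rotated])
  ultimately have "\<pi> y = 0" by (auto simp: fun_eq_iff)
  then show ?thesis using \<pi>(2)[OF y] by simp
qed

section \<open>Products of modes\<close>

text \<open>In generating functions: the left side is the coefficient of \<open>z^t\<close> in
  \<open>z^s (1+z)^b\<close>, and expanding the power of \<open>z = (1+z) - 1\<close> writes this
  series through the \<open>(1+z)^(b+i)\<close> with \<open>i \<le> s\<close>.\<close>

lemma shifted_binomial_combination:
  "\<exists>a. \<forall>t. (if t < s then 0 else (b :: complex) gchoose (t - s)) =
    (\<Sum>i\<le>s. a i * ((b + of_nat i) gchoose t))"
proof (induction s arbitrary: b)
  case 0
  show ?case by (rule exI[of _ "\<lambda>_. 1"]) simp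
next
  case (Suc s)
  obtain a1 where a1: "\<And>t. (if t < s then 0 else (b + 1) gchoose (t - s)) =
      (\<Sum>i\<le>s. a1 i * ((b + 1 + of_nat i) gchoose t))" using Suc[of "b + 1"] by blast
  obtain a2 where a2: "\<And>t. (if t < s then 0 else b gchoose (t - s)) =
      (\<Sum>i\<le>s. a2 i * ((b + of_nat i) gchoose t))" using Suc[of b] by blast
  define a where "a i = (if i = 0 then 0 else a1 (i - 1)) - (if i \<le> s then a2 i else 0)" for i
  have "(if t < Suc s then 0 else b gchoose (t - Suc s)) = (\<Sum>i\<le>Suc s. a i * ((b + of_nat i) gchoose t))" for t
  proof -
    \<comment> \<open>Pascal's rule, that is,
      \<open>z^(s+1) (1+z)^b = z^s (1+z)^(b+1) - z^s (1+z)^b\<close>.\<close>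
    have "(if t < Suc s then 0 else b gchoose (t - Suc s)) =
        (if t < s then 0 else (b + 1) gchoose (t - s)) - (if t < s then 0 else b gchoose (t - s))"
    proof (cases "t \<le> s")
      case True
      then show ?thesis by (cases "t = s") auto
    next
      case False
      then have "t - s = Suc (t - Suc s)" by simp
      then show ?thesis using False gbinomial_Suc_Suc[of b "t - Suc s"] by simp
    qed
    also have "\<dots> = (\<Sum>i\<le>s. a1 i * ((b + of_nat (Suc i)) gchoose t)) - (\<Sum>i\<le>s. a2 i * ((b + of_nat i) gchoose t))"
      using a1[of t] a2[of t] by (simp add: add_ac)
    also have "(\<Sum>i\<le>s. a1 i * ((b + of_nat (Suc i)) gchoose t)) =
        (\<Sum>i\<le>Suc s. (if i = 0 then 0 else a1 (i - 1)) * ((b + of_nat i) gchoose t))"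
      by (subst sum.atMost_Suc_shift) simp
    also have "(\<Sum>i\<le>s. a2 i * ((b + of_nat i) gchoose t)) =
        (\<Sum>i\<le>Suc s. (if i \<le> s then a2 i else 0) * ((b + of_nat i) gchoose t))"
      by simp
    finally show ?thesis by (simp only: a_def left_diff_distrib sum_subtractf)
  qed
  then show ?case by blast
qed

text \<open>In terms of generating functions: if \<open>(1 + z)\<^sup>m \<zeta>(z)\<close> is a polynomial of degree less than \<open>D\<close>,
  then it is also a polynomial of that degree in \<open>1 + z\<close>.\<close>

lemma binomial_recurrence:
  fixes \<zeta> :: "nat \<Rightarrow> 'a::complex_vector"
  assumes "\<And>t. t \<ge> D \<Longrightarrow> (\<Sum>i\<le>t. (m gchoose i) *\<^sub>C \<zeta> (t - i)) = 0"
  shows "\<exists>x. \<forall>t. \<zeta> t = (\<Sum>i<D. ((of_nat i - m) gchoose t) *\<^sub>C x i)"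
  using assms
proof (induction D arbitrary: \<zeta>)
  case 0
  have "\<zeta> t = 0" for t
  proof (induction t rule: less_induct)
    case (less t)
    have "(\<Sum>i\<le>t. (m gchoose i) *\<^sub>C \<zeta> (t - i)) = (\<Sum>i\<in>{0}. (m gchoose i) *\<^sub>C \<zeta> (t - i))"
      by (rule sum.mono_neutral_right) (use less in auto)
    then show ?case using 0[of t] by simp
  qed
  then show ?case by simp
next
  case (Suc D)
  \<comment> \<open>The coefficients of \<open>z^D (1+z)^(-m)\<close>. Its product with
    \<open>(1+z)^m\<close> is the monomial \<open>z^D\<close>, so subtracting \<open>c\<close> times
    this series removes the leading term and leaves degree less than \<open>D\<close>.\<close>
  define \<delta> where "\<delta> t = (if t < D then 0 else (- m) gchoose (t - D))" for t
  define c where "c = (\<Sum>i\<le>D. (m gchoose i) *\<^sub>C \<zeta> (D - i))"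
  have conv: "(\<Sum>i\<le>t. (m gchoose i) * \<delta> (t - i)) = (if t = D then 1 else 0)" if "t \<ge> D" for t
  proof -
    have "(\<Sum>i\<le>t. (m gchoose i) * \<delta> (t - i)) = (\<Sum>i\<in>{0..t - D}. (m gchoose i) * \<delta> (t - i))"
      by (rule sum.mono_neutral_right) (auto simp: \<delta>_def)
    also have "\<dots> = (\<Sum>i=0..t - D. (m gchoose i) * ((- m) gchoose (t - D - i)))"
      using that by (intro sum.cong) (auto simp: \<delta>_def add.commute)
    also have "\<dots> = (m + - m) gchoose (t - D)" by (rule gbinomial_Vandermonde)
    finally show ?thesis using that by (cases "t - D") auto
  qed
  have "(\<Sum>i\<le>t. (m gchoose i) *\<^sub>C (\<zeta> (t - i) - \<delta> (t - i) *\<^sub>C c)) = 0" if "t \<ge> D" for t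
  proof -
    have "(\<Sum>i\<le>t. (m gchoose i) *\<^sub>C (\<zeta> (t - i) - \<delta> (t - i) *\<^sub>C c)) =
        (\<Sum>i\<le>t. (m gchoose i) *\<^sub>C \<zeta> (t - i)) - (\<Sum>i\<le>t. (m gchoose i) * \<delta> (t - i)) *\<^sub>C c"
      by (simp add: cvec.scale_right_diff_distrib sum_subtractf cvec.scale_sum_left)
    then show ?thesis using conv[OF that] Suc.prems[of t] that by (cases "t = D") (auto simp: c_def)
  qed
  from Suc.IH[of "\<lambda>t. \<zeta> t - \<delta> t *\<^sub>C c", OF this]
  obtain x where x: "\<And>t. \<zeta> t - \<delta> t *\<^sub>C c = (\<Sum>i<D. ((of_nat i - m) gchoose t) *\<^sub>C x i)" by blast
  obtain a where a: "\<And>t. \<delta> t = (\<Sum>i\<le>D. a i * ((- m + of_nat i) gchoose t))"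
    using shifted_binomial_combination[of D "- m"] by (auto simp: \<delta>_def)
  have "\<zeta> t = (\<Sum>i<Suc D. ((of_nat i - m) gchoose t) *\<^sub>C ((if i < D then x i else 0) + a i *\<^sub>C c))" for t
  proof -
    have "\<zeta> t = (\<Sum>i<D. ((of_nat i - m) gchoose t) *\<^sub>C x i) + \<delta> t *\<^sub>C c"
      using x[of t] by (simp add: algebra_simps)
    moreover have "\<delta> t *\<^sub>C c = (\<Sum>i<Suc D. ((of_nat i - m) gchoose t) *\<^sub>C (a i *\<^sub>C c))"
      by (simp add: a cvec.scale_sum_left lessThan_Suc_atMost mult.commute add.commute del: sum.lessThan_Suc sum.atMost_Suc)
    ultimately show ?thesis
      by (simp add: scaleC_add_right sum.distrib)
  qed
  then show ?case by (intro exI[of _ "\<lambda>i. (if i < D then x i else 0) + a i *\<^sub>C c"] allI)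
qed

text \<open>For distinct \<open>\<beta> k\<close> the series \<open>(1+z)^(\<beta> k)\<close> are
  linearly independent, so each \<open>x k\<close> can be recovered from the coefficients
  \<open>Z t\<close>. Multiplying by \<open>\<beta> k\<close> is the operator
  \<open>(1+z) d/dz\<close>, which on coefficients combines the indices \<open>t\<close> and
  \<open>t + 1\<close>; this makes \<open>lagrange_extraction\<close> applicable.\<close>

lemma binomial_coefficients_in_span:
  fixes x :: "'k \<Rightarrow> 'a::complex_vector" and \<beta> :: "'k \<Rightarrow> complex"
  assumes Z: "\<And>t. Z t = (\<Sum>k\<in>Q. (\<beta> k gchoose t) *\<^sub>C x k)" and Q: "finite Q" "inj_on \<beta> Q" "k0 \<in> Q"
  shows "x k0 \<in> cvec.span (range Z)"
proof (rule lagrange_extraction[OF _ Q(1,3,2),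
    of _ "\<lambda>g. \<forall>t. (\<Sum>k\<in>Q. (g k * (\<beta> k gchoose t)) *\<^sub>C x k) \<in> cvec.span (range Z)"])
  show "\<forall>t. (\<Sum>k\<in>Q. (1 * (\<beta> k gchoose t)) *\<^sub>C x k) \<in> cvec.span (range Z)"
    using Z by (auto intro!: cvec.span_base simp: image_iff)
next
  fix g b assume g: "\<forall>t. (\<Sum>k\<in>Q. (g k * (\<beta> k gchoose t)) *\<^sub>C x k) \<in> cvec.span (range Z)"
  show "\<forall>t. (\<Sum>k\<in>Q. ((\<beta> k - b) * g k * (\<beta> k gchoose t)) *\<^sub>C x k) \<in> cvec.span (range Z)"
  proof
    fix t
    have "(\<beta> k - b) * g k * (\<beta> k gchoose t) =
        of_nat (Suc t) * (g k * (\<beta> k gchoose Suc t)) + (of_nat t - b) * (g k * (\<beta> k gchoose t))" for k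
    proof -
      have "(\<beta> k - b) * g k * (\<beta> k gchoose t) = g k * (\<beta> k * (\<beta> k gchoose t)) - b * (g k * (\<beta> k gchoose t))"
        by (simp add: algebra_simps)
      also have "\<dots> = g k * (of_nat t * (\<beta> k gchoose t) + of_nat (Suc t) * (\<beta> k gchoose Suc t)) - b * (g k * (\<beta> k gchoose t))"
        by (simp only: gbinomial_mult_1)
      finally show ?thesis by (simp add: algebra_simps)
    qed
    then have "(\<Sum>k\<in>Q. ((\<beta> k - b) * g k * (\<beta> k gchoose t)) *\<^sub>C x k) =
        of_nat (Suc t) *\<^sub>C (\<Sum>k\<in>Q. (g k * (\<beta> k gchoose Suc t)) *\<^sub>C x k) +
        (of_nat t - b) *\<^sub>C (\<Sum>k\<in>Q. (g k * (\<beta> k gchoose t)) *\<^sub>C x k)"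
      by (simp only: cvec.scale_sum_right scaleC_scaleC scaleC_add_left sum.distrib)
    then show "(\<Sum>k\<in>Q. ((\<beta> k - b) * g k * (\<beta> k gchoose t)) *\<^sub>C x k) \<in> cvec.span (range Z)"
      using g by (auto intro!: cvec.span_add cvec.span_scale)
  qed
next
  fix g assume "\<forall>t. (\<Sum>k\<in>Q. (g k * (\<beta> k gchoose t)) *\<^sub>C x k) \<in> cvec.span (range Z)"
  from this[rule_format, of 0] show "(\<Sum>k\<in>Q. g k *\<^sub>C x k) \<in> cvec.span (range Z)" by simp
qed auto

text \<open>The shape of the Jacobi identity at a fixed total index: \<open>\<zeta>\<close> stands
  for single modes of \<open>u\<^sub>l v\<close>, and \<open>a\<close> for products of modes.
  Vanishing of the right side for \<open>t \<ge> D\<close> makes all \<open>\<zeta> t\<close>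
  combinations of \<open>D\<close> vectors \<open>x i\<close>; the unit leading coefficient
  \<open>c t 0\<close> then lets one solve for \<open>a t\<close>, going down from
  \<open>t = D\<close>.\<close>

lemma triangular_recurrence:
  fixes \<zeta> :: "nat \<Rightarrow> 'a::complex_vector" and a :: "int \<Rightarrow> 'a"
  assumes a0: "\<And>t. t \<ge> int D \<Longrightarrow> a t = 0"
    and c0: "\<And>t. c t 0 = 1"
    and rec: "\<And>t. (if t < 0 then 0 else \<Sum>i\<le>nat t. (m gchoose i) *\<^sub>C \<zeta> (nat t - i)) =
      (\<Sum>i<nat (int D - t). c t i *\<^sub>C a (t + int i))"
  shows "\<exists>x. (\<forall>t. \<zeta> t = (\<Sum>i<D. ((of_nat i - m) gchoose t) *\<^sub>C x i)) \<and> (\<forall>t. a t \<in> cvec.span (x ` {..<D}))"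
proof -
  have "(\<Sum>i\<le>t. (m gchoose i) *\<^sub>C \<zeta> (t - i)) = 0" if "t \<ge> D" for t
    using rec[of "int t"] that by simp
  from binomial_recurrence[of D m \<zeta>, OF this]
  obtain x where x: "\<And>t. \<zeta> t = (\<Sum>i<D. ((of_nat i - m) gchoose t) *\<^sub>C x i)" by blast
  let ?S = "cvec.span (x ` {..<D})"
  have \<zeta>: "\<zeta> t \<in> ?S" for t
    unfolding x by (intro cvec.span_sum cvec.span_scale cvec.span_base) auto
  have "a t \<in> ?S" for t
  proof (induction "nat (int D - t)" arbitrary: t rule: less_induct)
    case less
    show ?case
    proof (cases "t \<ge> int D")
      case True
      then show ?thesis using a0 cvec.span_zero by simp
    next
      case False
      then obtain k where k: "nat (int D - t) = Suc k" by (cases "nat (int D - t)") auto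
      have "(\<Sum>i<Suc k. c t i *\<^sub>C a (t + int i)) = a t + (\<Sum>i<k. c t (Suc i) *\<^sub>C a (t + int (Suc i)))"
        by (subst sum.lessThan_Suc_shift) (simp add: c0)
      then have "a t = (\<Sum>i<Suc k. c t i *\<^sub>C a (t + int i)) - (\<Sum>i<k. c t (Suc i) *\<^sub>C a (t + int (Suc i)))"
        by simp
      moreover have "(\<Sum>i<Suc k. c t i *\<^sub>C a (t + int i)) \<in> ?S"
        using rec[of t, symmetric] k
        by (auto intro!: cvec.span_sum cvec.span_scale \<zeta> cvec.span_zero simp del: sum.lessThan_Suc)
      moreover have "(\<Sum>i<k. c t (Suc i) *\<^sub>C a (t + int (Suc i))) \<in> ?S"
        by (intro cvec.span_sum cvec.span_scale less) (use k in auto)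
      ultimately show ?thesis by (metis cvec.span_diff)
    qed
  qed
  then show ?thesis using x by blast
qed

lemma uniform_bound:
  assumes "finite A" "\<And>x. x \<in> A \<Longrightarrow> \<exists>N::int. \<forall>n\<ge>N. P x n"
  shows "\<exists>N::int. \<forall>x\<in>A. \<forall>n\<ge>N. P x n"
  using assms
proof (induction A rule: finite_induct)
  case (insert x A)
  then obtain N1 N2 :: int where "\<forall>y\<in>A. \<forall>n\<ge>N1. P y n" "\<forall>n\<ge>N2. P x n" by blast
  then show ?case by (intro exI[of _ "max N1 N2"]) auto
qed auto

lemma Sum_any_eq_sum: "(\<And>i. i \<ge> K \<Longrightarrow> f i = 0) \<Longrightarrow> Sum_any f = (\<Sum>i<K. f (i::nat))"
  by (rule Sum_any.expand_superset) (auto simp: not_le[symmetric])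

text \<open>The twisted Jacobi identity and the restriction on exponents speak about eigenvectors of
  \<open>g\<close>; the decomposition extends their consequences to all of \<open>V\<close> by
  linearity. It is supplied by \<open>eigenspace_decomposition\<close> when \<open>g ^^ T\<close> is
  the identity on \<open>V\<close>.\<close>

locale twisted_decomposed =
  V: vertex_operator_algebra V + M: twisted_module V g T M
  for V :: "'v::complex_vector voa" and g T and M :: "('v, 'm::complex_vector) tmod" +
  assumes T_pos: "T > 0"
    and decomposition: "u \<in> vspace V \<Longrightarrow> \<exists>p. (\<forall>r<T. p r \<in> eigenspace_aut V g T r) \<and> u = (\<Sum>r<T. p r)"
begin

lemma eigen_in: "u \<in> eigenspace_aut V g T r \<Longrightarrow> u \<in> vspace V"
  by (auto simp: eigenspace_aut_def)

lemma mmode_in: "u \<in> vspace V \<Longrightarrow> w \<in> mspace M \<Longrightarrow> mmode M u k w \<in> mspace M"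
  using M.mode_linear lin_map_in by blast

lemma vmode_in: "u \<in> vspace V \<Longrightarrow> v \<in> vspace V \<Longrightarrow> vmode V u n v \<in> vspace V"
  using V.mode_linear lin_map_in by blast

lemma mmode_zero_right: "u \<in> vspace V \<Longrightarrow> mmode M u k 0 = 0"
  using M.mode_linear M.subspace lin_map_zero by blast

lemma mmode_zero_left: "w \<in> mspace M \<Longrightarrow> mmode M 0 k w = 0"
  using lin_map_zero[OF M.field_linear V.subspace] by blast

text \<open>The doubled bound, over an integer \<open>n\<close> and the rational indices above it,
  has the form that \<open>uniform_bound\<close> combines over finitely many vectors.\<close>

lemma truncation_int: "u \<in> vspace V \<Longrightarrow> w \<in> mspace M \<Longrightarrow> \<exists>N::int. \<forall>n\<ge>N. \<forall>k. of_int n \<le> k \<longrightarrow> mmode M u k w = 0"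
proof -
  assume "u \<in> vspace V" "w \<in> mspace M"
  then obtain N where N: "\<forall>k\<ge>N. mmode M u k w = 0" using M.truncation by blast
  have "mmode M u k w = 0" if "n \<ge> \<lceil>N\<rceil>" "of_int n \<le> k" for n k
    using N that by (meson ceiling_le_iff order_trans)
  then show ?thesis by blast
qed

text \<open>Starting \<open>m\<close> above the truncation index of \<open>u\<close> on
  \<open>w\<close> removes the terms in which \<open>u\<close> is applied first, so only products
  with \<open>u\<close> on the left remain. The index of the second field is written as
  \<open>k - m - l\<close>, which keeps the total index \<open>k\<close> fixed.\<close>

lemma jacobi_truncated:
  assumes r: "r < T" and u: "u \<in> eigenspace_aut V g T r" and v: "v \<in> vspace V" and w: "w \<in> mspace M"
    and m: "m - of_nat r / of_nat T \<in> \<int>" and um: "\<And>k. k \<ge> m \<Longrightarrow> mmode M u k w = 0"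
    and K1: "\<And>j. j \<ge> l + int K1 \<Longrightarrow> vmode V u j v = 0"
    and K2: "\<And>j. j \<ge> k - m - of_int l + of_nat K2 \<Longrightarrow> mmode M v j w = 0"
  shows "(\<Sum>i<K1. (of_rat m gchoose i) *\<^sub>C mmode M (vmode V u (l + int i) v) (k - of_int l - of_nat i) w) =
    (\<Sum>i<K2. ((-1) ^ i * (of_int l gchoose i)) *\<^sub>C mmode M u (m + of_int l - of_nat i) (mmode M v (k - m - of_int l + of_nat i) w))"
proof -
  have uV: "u \<in> vspace V" using u by (rule eigen_in)
  have "Sum_any (\<lambda>i::nat. (of_rat m gchoose i) *\<^sub>C mmode M (vmode V u (l + int i) v) (m + (k - m - of_int l) - of_nat i) w) =
      Sum_any (\<lambda>i::nat. ((-1) ^ i * (of_int l gchoose i)) *\<^sub>C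
        (mmode M u (m + of_int l - of_nat i) (mmode M v (k - m - of_int l + of_nat i) w) -
         ((-1) powi l) *\<^sub>C mmode M v (k - m - of_int l + of_int l - of_nat i) (mmode M u (m + of_nat i) w)))"
    by (rule M.jacobi[OF r u v w m])
  also have "\<dots> = Sum_any (\<lambda>i::nat. ((-1) ^ i * (of_int l gchoose i)) *\<^sub>C
        mmode M u (m + of_int l - of_nat i) (mmode M v (k - m - of_int l + of_nat i) w))"
    using um mmode_zero_right[OF v] by simp
  also have "\<dots> = (\<Sum>i<K2. ((-1) ^ i * (of_int l gchoose i)) *\<^sub>C
        mmode M u (m + of_int l - of_nat i) (mmode M v (k - m - of_int l + of_nat i) w))"
    by (rule Sum_any_eq_sum) (simp add: K2 mmode_zero_right[OF uV])
  also have "Sum_any (\<lambda>i::nat. (of_rat m gchoose i) *\<^sub>C mmode M (vmode V u (l + int i) v) (m + (k - m - of_int l) - of_nat i) w) =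
      (\<Sum>i<K1. (of_rat m gchoose i) *\<^sub>C mmode M (vmode V u (l + int i) v) (m + (k - m - of_int l) - of_nat i) w)"
    by (rule Sum_any_eq_sum) (simp add: K1 mmode_zero_left[OF w])
  finally show ?thesis by simp
qed

lemma mmode_sum_left:
  assumes "\<And>r. r \<in> R \<Longrightarrow> p r \<in> vspace V" "w \<in> mspace M"
  shows "mmode M (\<Sum>r\<in>R. p r) k w = (\<Sum>r\<in>R. mmode M (p r) k w)"
  using lin_map_sum[OF M.field_linear[OF assms(2), of k] V.subspace, of R p] assms(1) by blast

lemma vmode_sum_left:
  assumes "\<And>r. r \<in> R \<Longrightarrow> p r \<in> vspace V" "v \<in> vspace V"
  shows "vmode V (\<Sum>r\<in>R. p r) k v = (\<Sum>r\<in>R. vmode V (p r) k v)"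
  using lin_map_sum[OF V.field_linear[OF assms(2), of k] V.subspace, of R p] assms(1) by blast

end

text \<open>The modules may be twisted by different automorphisms: the generating functions of the
  eigencomponents of \<open>u\<close> involve powers of \<open>1 + z\<close> with exponents in different cosets of the
  integers, and these are linearly independent.\<close>

theorem product_of_modes_in_span:
  fixes M :: "'i \<Rightarrow> ('v::complex_vector, 'm::complex_vector) tmod" and w :: "'i \<Rightarrow> 'm" and q n :: rat
  assumes I: "finite I" and tw: "\<And>i. i \<in> I \<Longrightarrow> twisted_decomposed V (g i) T (M i)"
    and w: "\<And>i. i \<in> I \<Longrightarrow> w i \<in> mspace (M i)" and u: "u \<in> vspace V" and v: "v \<in> vspace V"
  shows "(\<lambda>i. if i \<in> I then mmode (M i) u q (mmode (M i) v n (w i)) else 0) \<in>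
    cvec.span {\<lambda>i. if i \<in> I then mmode (M i) x k (w i) else 0 |x k. x \<in> vspace V}"
    (is "?goal \<in> cvec.span ?G")
proof (cases "I = {}")
  case True
  then have "?goal = 0" by (auto simp: fun_eq_iff)
  then show ?thesis by (simp add: cvec.span_zero)
next
  case False
  then obtain i0 where i0: "i0 \<in> I" by blast
  interpret t0: twisted_decomposed V "g i0" T "M i0" by (rule tw[OF i0])
  define k where "k = q + n"
  have "\<forall>i\<in>I. \<exists>p. (\<forall>r<T. p r \<in> eigenspace_aut V (g i) T r) \<and> u = (\<Sum>r<T. p r)"
    using twisted_decomposed.decomposition[OF tw u] by blast
  then obtain p where p: "\<And>i r. i \<in> I \<Longrightarrow> r < T \<Longrightarrow> p i r \<in> eigenspace_aut V (g i) T r"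
    and up: "\<And>i. i \<in> I \<Longrightarrow> u = (\<Sum>r<T. p i r)" by metis
  have pV: "p i r \<in> vspace V" if "i \<in> I" "r < T" for i r
    using p[OF that] by (auto simp: eigenspace_aut_def)
  obtain L :: int where L: "\<And>i r n k. i \<in> I \<Longrightarrow> r < T \<Longrightarrow> of_int L \<le> k \<Longrightarrow> mmode (M i) (p i r) k (w i) = 0"
    using uniform_bound[of "I \<times> {..<T}" "\<lambda>(i,r) n. \<forall>k. of_int n \<le> k \<longrightarrow> mmode (M i) (p i r) k (w i) = 0"]
      twisted_decomposed.truncation_int[OF tw pV w] I by fastforce
  obtain L' :: int where L': "\<And>i k. i \<in> I \<Longrightarrow> of_int L' \<le> k \<Longrightarrow> mmode (M i) v k (w i) = 0"
    using uniform_bound[of "I" "\<lambda>i n. \<forall>k. of_int n \<le> k \<longrightarrow> mmode (M i) v k (w i) = 0"]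
      twisted_decomposed.truncation_int[OF tw v w] I by fastforce
  obtain N :: int where N: "\<And>i r j. i \<in> I \<Longrightarrow> r < T \<Longrightarrow> N \<le> j \<Longrightarrow> vmode V (p i r) j v = 0"
    using uniform_bound[of "I \<times> {..<T}" "\<lambda>(i,r) n. vmode V (p i r) n v = 0"]
      t0.V.truncation[OF pV v] I by fastforce
  \<comment> \<open>An index in the coset of \<open>r/T\<close> above the truncation bound
    \<open>L\<close>: from here on the component \<open>p i r\<close> kills \<open>w i\<close>, for
    all \<open>i\<close> at once.\<close>
  define m where "m r = of_nat r / of_nat T + (of_int L :: rat)" for r
  have mL: "m r \<ge> of_int L" for r by (simp add: m_def)
  \<comment> \<open>On the right side \<open>v\<close> is applied at index
    \<open>k - m r - (N - 1 - t)\<close>, which is at least \<open>L'\<close> once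
    \<open>t \<ge> D\<close>. As \<open>r/T < 1\<close>, replacing \<open>m r\<close> by
    \<open>L + 1\<close> makes one \<open>D\<close> serve every \<open>r\<close>.\<close>
  define D where "D = nat \<lceil>of_int L' - k + (of_int L + 1) + of_int N - 1\<rceil>"
  have D: "of_nat D \<ge> of_int L' - k + m r + of_int N - 1" if "r < T" for r
  proof -
    have "m r \<le> of_int L + 1" using that t0.T_pos by (simp add: m_def)
    moreover have "of_int L' - k + (of_int L + 1) + of_int N - 1 \<le> (of_nat D :: rat)"
      unfolding D_def by (rule order_trans[OF le_of_int_ceiling]) simp
    ultimately show ?thesis by linarith
  qed
  \<comment> \<open>The parameter \<open>t\<close> runs against the mode
    \<open>l = N - 1 - t\<close> of \<open>u\<close> on \<open>v\<close>: negative \<open>t\<close>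
    give \<open>l \<ge> N\<close>, where truncation makes the product vanish, so
    \<open>\<zeta>\<close> and \<open>Z\<close> are indexed by natural numbers.\<close>
  define a where "a r t = (\<lambda>i. if i \<in> I then mmode (M i) (p i r) (m r + of_int (N - 1 - t))
      (mmode (M i) v (k - (m r + of_int (N - 1 - t))) (w i)) else 0)" for r and t :: int
  define \<zeta> where "\<zeta> r t = (\<lambda>i. if i \<in> I then mmode (M i) (vmode V (p i r) (N - 1 - int t) v)
      (k - of_int (N - 1 - int t)) (w i) else 0)" for r and t :: nat
  define Z where "Z t = (\<lambda>i. if i \<in> I then mmode (M i) (vmode V u (N - 1 - int t) v)
      (k - of_int (N - 1 - int t)) (w i) else 0)" for t :: nat
  have "\<exists>x. (\<forall>t. \<zeta> r t = (\<Sum>i<D. ((of_nat i - of_rat (m r)) gchoose t) *\<^sub>C x i)) \<and> (\<forall>t. a r t \<in> cvec.span (x ` {..<D}))"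
    if r: "r < T" for r
  proof (rule triangular_recurrence[of D "a r" "\<lambda>t i. (-1) ^ i * (of_int (N - 1 - t) gchoose i)"])
    show "a r t = 0" if "t \<ge> int D" for t
    proof -
      have "of_int t \<ge> (of_nat D :: rat)" using that by (metis of_int_le_iff of_int_of_nat_eq)
      then have "of_int L' \<le> k - (m r + of_int (N - 1 - t))" using D[OF r] by simp
      then have "mmode (M i) v (k - (m r + of_int (N - 1 - t))) (w i) = 0" if "i \<in> I" for i
        using L' that by blast
      then show ?thesis using twisted_decomposed.mmode_zero_right[OF tw pV[OF _ r]]
        by (auto simp: a_def fun_eq_iff)
    qed
    show "(if t < 0 then 0 else \<Sum>i\<le>nat t. (of_rat (m r) gchoose i) *\<^sub>C \<zeta> r (nat t - i)) =
        (\<Sum>i<nat (int D - t). ((-1) ^ i * (of_int (N - 1 - t) gchoose i)) *\<^sub>C a r (t + int i))" (is "?l = ?r") for t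
    proof (rule ext)
      fix i
      show "?l i = ?r i"
      proof (cases "i \<in> I")
        case False
        then show ?thesis by (simp add: sum_apply a_def \<zeta>_def)
      next
        case i: True
        interpret ti: twisted_decomposed V "g i" T "M i" by (rule tw[OF i])
        have "(\<Sum>s<nat (t + 1). (of_rat (m r) gchoose s) *\<^sub>C mmode (M i) (vmode V (p i r) ((N - 1 - t) + int s) v)
            (k - of_int (N - 1 - t) - of_nat s) (w i)) =
          (\<Sum>s<nat (int D - t). ((-1) ^ s * (of_int (N - 1 - t) gchoose s)) *\<^sub>C
            mmode (M i) (p i r) (m r + of_int (N - 1 - t) - of_nat s) (mmode (M i) v (k - m r - of_int (N - 1 - t) + of_nat s) (w i)))"
        proof (rule ti.jacobi_truncated[OF r p[OF i r] v w[OF i]])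
          show "m r - of_nat r / of_nat T \<in> \<int>" by (simp add: m_def)
          show "mmode (M i) (p i r) k (w i) = 0" if "k \<ge> m r" for k
            using L[OF i r] mL[of r] that by simp
          show "vmode V (p i r) j v = 0" if "j \<ge> N - 1 - t + int (nat (t + 1))" for j
          proof -
            have "N \<le> j" using that by (cases "t + 1 \<ge> 0") auto
            then show ?thesis by (rule N[OF i r])
          qed
          show "mmode (M i) v j (w i) = 0" if "k - m r - of_int (N - 1 - t) + of_nat (nat (int D - t)) \<le> j" for j
          proof -
            have "(of_nat (nat (int D - t)) :: rat) \<ge> of_nat D - of_int t"
              by (smt (verit) of_int_diff of_int_le_iff of_int_of_nat_eq of_nat_nat nat_eq_iff2 of_nat_0 int_nat_eq)
            then have "of_int L' \<le> j" using D[OF r] that by simp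
            then show ?thesis using L'[OF i] by simp
          qed
        qed
        moreover have "?l i = (\<Sum>s<nat (t + 1). (of_rat (m r) gchoose s) *\<^sub>C mmode (M i) (vmode V (p i r) ((N - 1 - t) + int s) v)
            (k - of_int (N - 1 - t) - of_nat s) (w i))"
        proof (cases "t < 0")
          case False
          then have "{..<nat (t + 1)} = {..nat t}" by auto
          then show ?thesis using False i
            by (auto simp: sum_apply \<zeta>_def of_nat_diff algebra_simps intro!: sum.cong)
        qed auto
        moreover have "?r i = (\<Sum>s<nat (int D - t). ((-1) ^ s * (of_int (N - 1 - t) gchoose s)) *\<^sub>C
            mmode (M i) (p i r) (m r + of_int (N - 1 - t) - of_nat s) (mmode (M i) v (k - m r - of_int (N - 1 - t) + of_nat s) (w i)))"
          using i by (auto simp: sum_apply a_def algebra_simps intro!: sum.cong)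
        ultimately show ?thesis by simp
      qed
    qed
  qed simp
  then obtain x where x: "\<And>r t. r < T \<Longrightarrow> \<zeta> r t = (\<Sum>i<D. ((of_nat i - of_rat (m r)) gchoose t) *\<^sub>C x r i)"
    and ax: "\<And>r t. r < T \<Longrightarrow> a r t \<in> cvec.span (x r ` {..<D})" by metis
  let ?Q = "{..<T} \<times> {..<D}"
  have Z: "Z t = (\<Sum>(r, i)\<in>?Q. ((of_nat i - of_rat (m r)) gchoose t) *\<^sub>C x r i)" for t
  proof -
    have "Z t = (\<Sum>r<T. \<zeta> r t)"
    proof (rule ext)
      fix i show "Z t i = (\<Sum>r<T. \<zeta> r t) i"
      proof (cases "i \<in> I")
        case i: True
        interpret ti: twisted_decomposed V "g i" T "M i" by (rule tw[OF i])
        have "vmode V (\<Sum>r<T. p i r) j v = (\<Sum>r<T. vmode V (p i r) j v)" for j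
          using pV i v by (intro ti.vmode_sum_left) auto
        moreover have "mmode (M i) (\<Sum>r<T. vmode V (p i r) j v) h (w i) = (\<Sum>r<T. mmode (M i) (vmode V (p i r) j v) h (w i))" for j h
          using pV i v w by (intro ti.mmode_sum_left ti.vmode_in) auto
        ultimately show ?thesis using i
          by (simp add: Z_def \<zeta>_def sum_apply up[OF i, symmetric] del: of_int_diff)
      qed (simp add: Z_def \<zeta>_def sum_apply)
    qed
    also have "\<dots> = (\<Sum>r<T. \<Sum>i<D. ((of_nat i - of_rat (m r)) gchoose t) *\<^sub>C x r i)"
      using x by simp
    finally show ?thesis by (simp add: sum.cartesian_product)
  qed
  \<comment> \<open>The fractional part of \<open>i - m r\<close> determines \<open>r < T\<close>,
    so distinct pairs give distinct exponents. This separates the eigencomponents: the tuples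
    \<open>\<zeta> r t\<close> need not lie in the target span, because \<open>p i r\<close> depends
    on \<open>i\<close>; their sums \<open>Z t\<close> do, being modes of one vector.\<close>
  have inj: "inj_on (\<lambda>(r, i). of_nat i - (of_rat (m r) :: complex)) ?Q"
  proof (rule inj_onI, clarsimp)
    fix r i r' i' assume r: "r < T" "r' < T" and eq: "of_nat i - (of_rat (m r) :: complex) = of_nat i' - of_rat (m r')"
    have "(of_rat (of_nat i - m r) :: complex) = of_rat (of_nat i' - m r')" using eq by (simp add: of_rat_diff)
    then have "of_nat i - m r = of_nat i' - m r'" using of_rat_eq_iff by blast
    then have "of_nat i * of_nat T - of_nat r = of_nat i' * (of_nat T :: rat) - of_nat r'"
      using t0.T_pos by (simp add: m_def field_simps)
    then have "of_int (int i * int T - int r) = (of_int (int i' * int T - int r') :: rat)" by simp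
    then have *: "int i * int T - int r = int i' * int T - int r'" by (simp only: of_int_eq_iff)
    then have "int T * (int i - int i') = int r - int r'" by (simp add: algebra_simps)
    moreover have "\<bar>int r - int r'\<bar> < int T" using r by auto
    ultimately have "int i = int i'"
      by (metis abs_mult mult_cancel_left2 mult_less_cancel_left2 abs_of_nat zero_less_abs_iff right_minus_eq
          int_one_le_iff_zero_less linorder_not_less mult.right_neutral mult_left_mono of_nat_0_le_iff)
    then show "r = r' \<and> i = i'" using * by simp
  qed
  have xZ: "x r i \<in> cvec.span (range Z)" if "r < T" "i < D" for r i
    using binomial_coefficients_in_span[where Z = Z and Q = ?Q and x = "\<lambda>(r, i). x r i" and ?k0.0 = "(r, i)"
        and \<beta> = "\<lambda>(r, i). of_nat i - (of_rat (m r) :: complex)"] Z inj that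
    by (simp add: case_prod_unfold)
  have aZ: "a r t \<in> cvec.span (range Z)" if "r < T" for r t
  proof -
    have "cvec.span (x r ` {..<D}) \<subseteq> cvec.span (range Z)"
      using xZ[OF that] by (intro cvec.span_minimal) auto
    then show ?thesis using ax[OF that] by blast
  qed
  have "cvec.span (range Z) \<subseteq> cvec.span ?G"
  proof (rule cvec.span_mono)
    show "range Z \<subseteq> ?G" using t0.vmode_in[OF u v] unfolding Z_def by blast
  qed
  moreover have "?goal \<in> cvec.span (range Z)"
  proof -
    define b where "b r = (\<lambda>i. if i \<in> I then mmode (M i) (p i r) q (mmode (M i) v n (w i)) else 0)" for r
    have "?goal = (\<Sum>r<T. b r)"
    proof (rule ext)
      fix i show "?goal i = (\<Sum>r<T. b r) i"
      proof (cases "i \<in> I")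
        case i: True
        interpret ti: twisted_decomposed V "g i" T "M i" by (rule tw[OF i])
        have "mmode (M i) (\<Sum>r<T. p i r) q (mmode (M i) v n (w i)) = (\<Sum>r<T. mmode (M i) (p i r) q (mmode (M i) v n (w i)))"
          using pV i by (intro ti.mmode_sum_left ti.mmode_in v w) auto
        then show ?thesis using i by (simp add: b_def sum_apply up[OF i, symmetric])
      qed (simp add: b_def sum_apply)
    qed
    moreover have "b r \<in> cvec.span (range Z)" if r: "r < T" for r
    proof (cases "q - of_nat r / of_nat T \<in> \<int>")
      case True
      then obtain z where "q - of_nat r / of_nat T = of_int z" by (auto elim: Ints_cases)
      then have q: "q = m r + of_int (N - 1 - (L + N - 1 - z))" by (simp add: m_def algebra_simps)
      have "b r = a r (L + N - 1 - z)"
        unfolding b_def a_def q[symmetric] k_def add_diff_cancel_left' ..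
      then show ?thesis using aZ[OF r] by simp
    next
      case False
      have "mmode (M i) (p i r) q (mmode (M i) v n (w i)) = 0" if i: "i \<in> I" for i
      proof -
        interpret ti: twisted_decomposed V "g i" T "M i" by (rule tw[OF i])
        show ?thesis by (rule ti.M.exponents[OF r p[OF i r] ti.mmode_in[OF v w[OF i]] False])
      qed
      then have "b r = 0" by (auto simp: b_def)
      then show ?thesis by (simp add: cvec.span_zero)
    qed
    ultimately show ?thesis by (auto intro: cvec.span_sum)
  qed
  ultimately show ?thesis by blast
qed

section \<open>Faithfulness of twisted modules\<close>

context twisted_decomposed
begin

definition annihilator :: "'v set"
  where "annihilator = {v \<in> vspace V. \<forall>k. \<forall>w\<in>mspace M. mmode M v k w = 0}"

lemma subspace_annihilator: "cvec.subspace annihilator"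
proof (rule cvec.subspaceI)
  show "0 \<in> annihilator"
    by (auto simp: annihilator_def cvec.subspace_0[OF V.subspace] mmode_zero_left)
qed (auto simp: annihilator_def cvec.subspace_add[OF V.subspace] cvec.subspace_scale[OF V.subspace]
    lin_map_add[OF M.field_linear] lin_map_scale[OF M.field_linear])

text \<open>Descending induction on \<open>l\<close>, starting where truncation gives zero. In the
  Jacobi identity with \<open>m = r/T\<close> every term on the right contains a mode of
  \<open>v\<close> acting on \<open>M\<close>, and on the left the terms with \<open>i > 0\<close>
  vanish by induction, which leaves the mode of \<open>u\<^sub>l v\<close>.\<close>

lemma annihilator_eigen_closed:
  assumes r: "r < T" and u: "u \<in> eigenspace_aut V g T r" and v: "v \<in> annihilator"
  shows "vmode V u l v \<in> annihilator"
proof -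
  have uV: "u \<in> vspace V" and vV: "v \<in> vspace V" using u v by (auto simp: eigenspace_aut_def annihilator_def)
  have v0: "mmode M v k w = 0" if "w \<in> mspace M" for k w using v that by (auto simp: annihilator_def)
  obtain N where N: "\<And>n. n \<ge> N \<Longrightarrow> vmode V u n v = 0" using V.truncation[OF uV vV] by blast
  let ?m = "of_nat r / of_nat T :: rat"
  have "\<forall>k. \<forall>w\<in>mspace M. mmode M (vmode V u l v) k w = 0"
  proof (induction "nat (N - l)" arbitrary: l rule: less_induct)
    case less
    show ?case
    proof (cases "l \<ge> N")
      case True
      then show ?thesis using N mmode_zero_left by simp
    next
      case False
      show ?thesis
      proof (intro allI ballI)
        fix k w assume w: "w \<in> mspace M"
        have "Sum_any (\<lambda>i::nat. (of_rat ?m gchoose i) *\<^sub>C mmode M (vmode V u (l + int i) v) (?m + (k - ?m) - of_nat i) w) =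
          Sum_any (\<lambda>i::nat. ((-1) ^ i * (of_int l gchoose i)) *\<^sub>C
            (mmode M u (?m + of_int l - of_nat i) (mmode M v ((k - ?m) + of_nat i) w) -
             ((-1) powi l) *\<^sub>C mmode M v ((k - ?m) + of_int l - of_nat i) (mmode M u (?m + of_nat i) w)))"
          by (rule M.jacobi[OF r u vV w]) simp
        also have "\<dots> = 0"
          using v0[OF w] v0[OF mmode_in[OF uV w]] mmode_zero_right[OF uV] by simp
        also have "Sum_any (\<lambda>i::nat. (of_rat ?m gchoose i) *\<^sub>C mmode M (vmode V u (l + int i) v) (?m + (k - ?m) - of_nat i) w) =
            Sum_any (\<lambda>i::nat. if i = 0 then mmode M (vmode V u l v) k w else 0)"
        proof (rule arg_cong[where f = Sum_any], rule ext)
          fix i :: nat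
          show "(of_rat ?m gchoose i) *\<^sub>C mmode M (vmode V u (l + int i) v) (?m + (k - ?m) - of_nat i) w =
            (if i = 0 then mmode M (vmode V u l v) k w else 0)"
            using less[of "l + int i"] False w by (cases i) auto
        qed
        also have "\<dots> = mmode M (vmode V u l v) k w"
          by (subst Sum_any_eq_sum[of 1]) auto
        finally show "mmode M (vmode V u l v) k w = 0" .
      qed
    qed
  qed
  then show ?thesis using vmode_in[OF uV vV] by (simp add: annihilator_def)
qed

text \<open>The annihilator is an ideal, so simplicity leaves two cases; the whole of
  \<open>V\<close> is excluded by the vacuum, which acts as the identity at index
  \<open>-1\<close>.\<close>

lemma annihilator_trivial:
  assumes simple: "simple_voa V" and M: "mspace M \<noteq> {0}"
  shows "annihilator = {0}"
proof -
  have "vmode V u n v \<in> annihilator" if u: "u \<in> vspace V" and v: "v \<in> annihilator" for u n v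
  proof -
    have vV: "v \<in> vspace V" using v by (auto simp: annihilator_def)
    obtain p where p: "\<forall>r<T. p r \<in> eigenspace_aut V g T r" "u = (\<Sum>r<T. p r)"
      using decomposition[OF u] by blast
    have "vmode V u n v = (\<Sum>r<T. vmode V (p r) n v)"
      unfolding p(2) using p(1) vV eigen_in by (intro vmode_sum_left) auto
    also have "\<dots> \<in> annihilator"
      using p(1) v by (intro cvec.subspace_sum[OF subspace_annihilator] annihilator_eigen_closed) auto
    finally show ?thesis .
  qed
  then have "annihilator = {0} \<or> annihilator = vspace V"
    using simple subspace_annihilator unfolding simple_voa_def by (auto simp: annihilator_def)
  moreover have "annihilator \<noteq> vspace V"
  proof
    assume "annihilator = vspace V"
    then have "vac V \<in> annihilator" using V.vac_in by simp
    then have "w = 0" if "w \<in> mspace M" for w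
      using that M.vacuum[of w "-1"] by (auto simp: annihilator_def)
    then show False using M cvec.subspace_0[OF M.subspace] by auto
  qed
  ultimately show ?thesis by simp
qed

text \<open>A form of weak commutativity: for \<open>l\<close> beyond the truncation of
  \<open>u\<close> on all \<open>v t\<close>, the Jacobi identity loses its left side and says that
  \<open>u\<close> and \<open>v t\<close> commute up to the factor \<open>(z1 - z2)^l\<close>.
  Summing over \<open>t\<close> kills the terms with \<open>v t\<close> applied first, and the
  remaining relation is solved by descending induction on \<open>m\<close>.\<close>

lemma mmode_kernel_closed_eigen:
  assumes A: "finite A" and v: "\<And>t. t \<in> A \<Longrightarrow> v t \<in> vspace V" and w: "\<And>t. t \<in> A \<Longrightarrow> w t \<in> mspace M"
    and 0: "\<And>k. (\<Sum>t\<in>A. mmode M (v t) k (w t)) = 0"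
    and r: "r < T" and u: "u \<in> eigenspace_aut V g T r"
  shows "(\<Sum>t\<in>A. mmode M (v t) k (mmode M u m (w t))) = 0"
proof (cases "m - of_nat r / of_nat T \<in> \<int>")
  case False
  then have "mmode M u m (w t) = 0" if "t \<in> A" for t using M.exponents[OF r u w[OF that]] by simp
  then show ?thesis using mmode_zero_right v by simp
next
  case True
  have uV: "u \<in> vspace V" using u by (rule eigen_in)
  define Y where "Y a b = (\<Sum>t\<in>A. mmode M (v t) a (mmode M u b (w t)))" for a b
  obtain l0 :: int where l0: "\<And>t n. t \<in> A \<Longrightarrow> n \<ge> l0 \<Longrightarrow> vmode V u n (v t) = 0"
    using uniform_bound[OF A, of "\<lambda>t n. vmode V u n (v t) = 0"] V.truncation[OF uV v] by blast
  \<comment> \<open>Beyond \<open>l0\<close>, so that the products of \<open>u\<close> with the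
    \<open>v t\<close> vanish; nonnegative, so that \<open>l gchoose i\<close> vanishes for
    \<open>i > l\<close> and the other side is a finite sum.\<close>
  define l where "l = nat (max l0 0)"
  have l: "vmode V u (int l + int i) (v t) = 0" if "t \<in> A" for t i
    by (rule l0[OF that]) (auto simp: l_def)
  obtain L :: int where L: "\<And>t n k. t \<in> A \<Longrightarrow> n \<ge> L \<Longrightarrow> of_int n \<le> k \<Longrightarrow> mmode M u k (w t) = 0"
    using uniform_bound[OF A, of "\<lambda>t n. \<forall>k. of_int n \<le> k \<longrightarrow> mmode M u k (w t) = 0"]
      truncation_int[OF uV w] by blast
  have rel: "(\<Sum>i\<le>l. ((-1) ^ i * (of_nat l gchoose i)) *\<^sub>C Y (n + of_nat l - of_nat i) (m + of_nat i)) = 0"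
    if m: "m - of_nat r / of_nat T \<in> \<int>" for m n
  proof -
    have each: "(\<Sum>i\<le>l. ((-1) ^ i * (of_nat l gchoose i)) *\<^sub>C
        (mmode M u (m + of_nat l - of_nat i) (mmode M (v t) (n + of_nat i) (w t)) -
         ((-1) ^ l) *\<^sub>C mmode M (v t) (n + of_nat l - of_nat i) (mmode M u (m + of_nat i) (w t)))) = 0"
      if t: "t \<in> A" for t
    proof -
      have "Sum_any (\<lambda>i::nat. (of_rat m gchoose i) *\<^sub>C mmode M (vmode V u (int l + int i) (v t)) (m + n - of_nat i) (w t)) =
          Sum_any (\<lambda>i::nat. ((-1) ^ i * (of_int (int l) gchoose i)) *\<^sub>C
            (mmode M u (m + of_int (int l) - of_nat i) (mmode M (v t) (n + of_nat i) (w t)) -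
             ((-1) powi (int l)) *\<^sub>C mmode M (v t) (n + of_int (int l) - of_nat i) (mmode M u (m + of_nat i) (w t))))"
        by (rule M.jacobi[OF r u v[OF t] w[OF t] m])
      also have "\<dots> = (\<Sum>i<Suc l. ((-1) ^ i * (of_int (int l) gchoose i)) *\<^sub>C
            (mmode M u (m + of_int (int l) - of_nat i) (mmode M (v t) (n + of_nat i) (w t)) -
             ((-1) powi (int l)) *\<^sub>C mmode M (v t) (n + of_int (int l) - of_nat i) (mmode M u (m + of_nat i) (w t))))"
        by (rule Sum_any_eq_sum) (simp add: binomial_gbinomial[symmetric] binomial_eq_0)
      also have "Sum_any (\<lambda>i::nat. (of_rat m gchoose i) *\<^sub>C mmode M (vmode V u (int l + int i) (v t)) (m + n - of_nat i) (w t)) = 0"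
        using l[OF t] mmode_zero_left[OF w[OF t]] by simp
      finally show ?thesis by (simp add: lessThan_Suc_atMost del: sum.lessThan_Suc sum.atMost_Suc)
    qed
    have "0 = (\<Sum>t\<in>A. \<Sum>i\<le>l. ((-1) ^ i * (of_nat l gchoose i)) *\<^sub>C
        (mmode M u (m + of_nat l - of_nat i) (mmode M (v t) (n + of_nat i) (w t)) -
         ((-1) ^ l) *\<^sub>C mmode M (v t) (n + of_nat l - of_nat i) (mmode M u (m + of_nat i) (w t))))"
      using each by simp
    also have "\<dots> = (\<Sum>i\<le>l. ((-1) ^ i * (of_nat l gchoose i)) *\<^sub>C
        ((\<Sum>t\<in>A. mmode M u (m + of_nat l - of_nat i) (mmode M (v t) (n + of_nat i) (w t))) -
         ((-1) ^ l) *\<^sub>C Y (n + of_nat l - of_nat i) (m + of_nat i)))"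
      by (subst sum.swap) (simp add: Y_def cvec.scale_sum_right[symmetric] sum_subtractf del: sum.atMost_Suc)
    also have "\<dots> = (\<Sum>i\<le>l. ((-1) ^ i * (of_nat l gchoose i)) *\<^sub>C
        (- (((-1) ^ l) *\<^sub>C Y (n + of_nat l - of_nat i) (m + of_nat i))))"
    proof (rule sum.cong[OF refl])
      fix i
      have "(\<Sum>t\<in>A. mmode M u (m + of_nat l - of_nat i) (mmode M (v t) (n + of_nat i) (w t))) =
          mmode M u (m + of_nat l - of_nat i) (\<Sum>t\<in>A. mmode M (v t) (n + of_nat i) (w t))"
        using v w by (intro lin_map_sum[OF M.mode_linear[OF uV] M.subspace, symmetric] mmode_in)
      then show "((-1) ^ i * (of_nat l gchoose i)) *\<^sub>C
        ((\<Sum>t\<in>A. mmode M u (m + of_nat l - of_nat i) (mmode M (v t) (n + of_nat i) (w t))) -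
         ((-1) ^ l) *\<^sub>C Y (n + of_nat l - of_nat i) (m + of_nat i)) =
        ((-1) ^ i * (of_nat l gchoose i)) *\<^sub>C (- (((-1) ^ l) *\<^sub>C Y (n + of_nat l - of_nat i) (m + of_nat i)))"
        using 0 mmode_zero_right[OF uV] by simp
    qed
    also have "\<dots> = (- ((-1) ^ l)) *\<^sub>C (\<Sum>i\<le>l. ((-1) ^ i * (of_nat l gchoose i)) *\<^sub>C Y (n + of_nat l - of_nat i) (m + of_nat i))"
      by (simp add: cvec.scale_sum_right mult_ac sum_negf del: sum.atMost_Suc)
    finally show ?thesis by simp
  qed
  have "\<forall>a. Y a m = 0" using True
  proof (induction "nat (L - \<lfloor>m\<rfloor>)" arbitrary: m rule: less_induct)
    case less
    show ?case
    proof (cases "\<lfloor>m\<rfloor> \<ge> L")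
      case True
      then have "mmode M u m (w t) = 0" if "t \<in> A" for t using L[OF that, of "\<lfloor>m\<rfloor>" m] by simp
      then show ?thesis using mmode_zero_right v by (simp add: Y_def)
    next
      case False
      show ?thesis
      proof
        fix a
        have Y0: "Y b (m + of_nat i) = 0" if "i > 0" for b i
        proof -
          have "(m - of_nat r / of_nat T) + of_nat i \<in> \<int>" using less.prems by (rule Ints_add) simp
          then have "m + of_nat i - of_nat r / of_nat T \<in> \<int>" unfolding diff_add_eq .
          moreover have "\<lfloor>m + of_nat i\<rfloor> = \<lfloor>m\<rfloor> + int i" by (metis floor_add_int of_int_of_nat_eq)
          ultimately show ?thesis using less.hyps[of "m + of_nat i"] False that by simp
        qed
        \<comment> \<open>The terms with \<open>i > 0\<close> involve the higher indices
          \<open>m + i\<close>, where the induction hypothesis applies; the shift by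
          \<open>of_nat l\<close> makes the surviving term equal to \<open>Y a m\<close>.\<close>
        have "(\<Sum>i\<le>l. ((-1) ^ i * (of_nat l gchoose i)) *\<^sub>C Y ((a - of_nat l) + of_nat l - of_nat i) (m + of_nat i)) =
            (\<Sum>i\<in>{0}. ((-1) ^ i * (of_nat l gchoose i)) *\<^sub>C Y ((a - of_nat l) + of_nat l - of_nat i) (m + of_nat i))"
          by (rule sum.mono_neutral_right) (auto simp: Y0)
        then show "Y a m = 0" using rel[OF less.prems, of "a - of_nat l"] by simp
      qed
    qed
  qed
  then show ?thesis by (simp add: Y_def)
qed

lemma mmode_kernel_closed:
  assumes A: "finite A" and v: "\<And>t. t \<in> A \<Longrightarrow> v t \<in> vspace V" and w: "\<And>t. t \<in> A \<Longrightarrow> w t \<in> mspace M"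
    and 0: "\<And>k. (\<Sum>t\<in>A. mmode M (v t) k (w t)) = 0" and u: "u \<in> vspace V"
  shows "(\<Sum>t\<in>A. mmode M (v t) k (mmode M u m (w t))) = 0"
proof -
  obtain p where p: "\<forall>r<T. p r \<in> eigenspace_aut V g T r" "u = (\<Sum>r<T. p r)"
    using decomposition[OF u] by blast
  have pV: "p r \<in> vspace V" if "r \<in> {..<T}" for r using p(1) that eigen_in by auto
  have "(\<Sum>t\<in>A. mmode M (v t) k (mmode M u m (w t))) = (\<Sum>t\<in>A. \<Sum>r<T. mmode M (v t) k (mmode M (p r) m (w t)))"
  proof (rule sum.cong[OF refl])
    fix t assume t: "t \<in> A"
    have "mmode M u m (w t) = (\<Sum>r<T. mmode M (p r) m (w t))"
      unfolding p(2) using pV w[OF t] by (intro mmode_sum_left) auto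
    then show "mmode M (v t) k (mmode M u m (w t)) = (\<Sum>r<T. mmode M (v t) k (mmode M (p r) m (w t)))"
      using lin_map_sum[OF M.mode_linear[OF v[OF t]] M.subspace, of "{..<T}"] mmode_in[OF pV w[OF t]] by simp
  qed
  also have "\<dots> = (\<Sum>r<T. \<Sum>t\<in>A. mmode M (v t) k (mmode M (p r) m (w t)))" by (rule sum.swap)
  also have "\<dots> = 0" using mmode_kernel_closed_eigen[OF A v w 0] p(1) by simp
  finally show ?thesis .
qed

end

text \<open>The automorphism can be read off the module. A \<open>g\<close>-eigenvector of index
  \<open>r\<close> acts through modes in \<open>r/T + \<int>\<close> only. Its
  \<open>h\<close>-components of index \<open>s \<noteq> r\<close> act through
  \<open>s/T + \<int>\<close>, where the vector itself acts as zero, so they annihilate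
  \<open>N\<close> and vanish. Hence it is an \<open>h\<close>-eigenvector with the same
  eigenvalue.\<close>

lemma twisted_automorphism_unique:
  assumes M: "twisted_decomposed V g T M" and N: "twisted_decomposed V h T N"
    and simple: "simple_voa V" and N0: "mspace N \<noteq> {0}"
    and f: "f ` mspace M = mspace N"
    and hom: "\<And>u k w. u \<in> vspace V \<Longrightarrow> w \<in> mspace M \<Longrightarrow> f (mmode M u k w) = mmode N u k (f w)"
    and f0: "f 0 = 0" and u: "u \<in> vspace V"
    and g: "lin_map (vspace V) (vspace V) g" and h: "lin_map (vspace V) (vspace V) h"
  shows "g u = h u"
proof -
  interpret M: twisted_decomposed V g T M by (rule M)
  interpret N: twisted_decomposed V h T N by (rule N)
  have eigen: "g v = h v" if r: "r < T" and v: "v \<in> eigenspace_aut V g T r" for r v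
  proof -
    have vV: "v \<in> vspace V" using v by (rule M.eigen_in)
    obtain p where p: "\<forall>s<T. p s \<in> eigenspace_aut V h T s" "v = (\<Sum>s<T. p s)"
      using N.decomposition[OF vV] by blast
    have pV: "p s \<in> vspace V" if "s < T" for s using p(1) that N.eigen_in by auto
    have "p s = 0" if s: "s < T" "s \<noteq> r" for s
    proof -
      have "mmode N (p s) k w = 0" if w: "w \<in> mspace N" for k w
      proof (cases "k - of_nat s / of_nat T \<in> \<int>")
        case False
        then show ?thesis using N.M.exponents p(1) s(1) w by blast
      next
        case True
        have sep: "k - of_nat s' / of_nat T \<notin> (\<int> :: rat set)" if s': "s' < T" "s' \<noteq> s" for s'
        proof
          assume "k - of_nat s' / of_nat T \<in> (\<int> :: rat set)"
          then have "(k - of_nat s' / of_nat T) - (k - of_nat s / of_nat T) \<in> (\<int> :: rat set)"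
            using True by (rule Ints_diff)
          then obtain z where "(k - of_nat s' / of_nat T) - (k - of_nat s / of_nat T) = (of_int z :: rat)"
            by (auto elim: Ints_cases)
          then have "of_nat s / of_nat T - of_nat s' / of_nat T = (of_int z :: rat)" by simp
          then have "(of_nat s / of_nat T - of_nat s' / of_nat T) * of_nat T = of_int z * (of_nat T :: rat)" by simp
          then have "of_nat s - of_nat s' = of_int z * (of_nat T :: rat)"
            using M.T_pos by (simp add: left_diff_distrib)
          then have "of_int (int s - int s') = (of_int (z * int T) :: rat)" by simp
          then have eq: "int s - int s' = z * int T" by (simp only: of_int_eq_iff)
          have "\<bar>int s - int s'\<bar> < int T" using s(1) s'(1) by auto
          then have "z = 0" unfolding eq abs_mult
            by (smt (verit) mult_less_cancel_right2 abs_of_nat)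
          then show False using eq s' by simp
        qed
        have "mmode N v k w = (\<Sum>s'<T. mmode N (p s') k w)"
          unfolding p(2) using pV w by (intro N.mmode_sum_left) auto
        also have "\<dots> = (\<Sum>s'\<in>{s}. mmode N (p s') k w)"
        proof (rule sum.mono_neutral_right)
          show "\<forall>i\<in>{..<T} - {s}. mmode N (p i) k w = 0"
            using N.M.exponents[OF _ _ w sep] p(1) by auto
        qed (use s in auto)
        finally have "mmode N v k w = mmode N (p s) k w" by simp
        moreover have "mmode N v k w = 0"
        proof -
          obtain x where x: "x \<in> mspace M" "w = f x" using w f by auto
          have "mmode M v k x = 0" using M.M.exponents[OF r v x(1) sep[OF r]] s(2) by simp
          then show ?thesis using hom[OF vV x(1), of k] f0 x(2) by simp
        qed
        ultimately show ?thesis by simp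
      qed
      then have "p s \<in> N.annihilator" using pV s by (auto simp: N.annihilator_def)
      then show ?thesis using N.annihilator_trivial[OF simple N0] by simp
    qed
    then have "v = (\<Sum>s\<in>{r}. p s)" unfolding p(2) using r by (intro sum.mono_neutral_right) auto
    then have "v \<in> eigenspace_aut V h T r" using p(1) r by simp
    then show ?thesis using v by (simp add: eigenspace_aut_def)
  qed
  obtain p where p: "\<forall>r<T. p r \<in> eigenspace_aut V g T r" "u = (\<Sum>r<T. p r)"
    using M.decomposition[OF u] by blast
  have pV: "p r \<in> vspace V" if "r \<in> {..<T}" for r using p(1) that M.eigen_in by auto
  have "g u = (\<Sum>r<T. g (p r))"
    unfolding p(2) using pV by (rule lin_map_sum[OF g M.V.subspace])
  also have "\<dots> = (\<Sum>r<T. h (p r))" using eigen p(1) by (intro sum.cong) auto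
  also have "\<dots> = h u"
    unfolding p(2) using pV by (rule lin_map_sum[OF h M.V.subspace, symmetric])
  finally show ?thesis .
qed

section \<open>Irreducible twisted modules as simple modules over the set of modes\<close>

abbreviation mode_ops :: "'v::complex_vector voa \<Rightarrow> ('v \<times> rat) set"
  where "mode_ops V \<equiv> vspace V \<times> UNIV"

definition mode_act :: "('v, 'm) tmod \<Rightarrow> 'v \<times> rat \<Rightarrow> 'm \<Rightarrow> 'm"
  where "mode_act M x = mmode M (fst x) (snd x)"

lemma submod_opsub: "submod V M N \<longleftrightarrow> opsub (mode_ops V) (mspace M) (mode_act M) N"
  by (auto simp: submod_def opsub_def mode_act_def)

lemma irreducible_opsimple:
  assumes "irreducible_twisted V g T M"
  shows "opsimple (mode_ops V) (mspace M) (mode_act M)"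
proof -
  interpret twisted_module V g T M using assms by (simp add: irreducible_twisted_def)
  have "\<forall>x\<in>mode_ops V. lin_map (mspace M) (mspace M) (mode_act M x)"
    using mode_linear by (auto simp: mode_act_def)
  then show ?thesis using assms subspace
    by (simp add: opsimple_def opmod_def irreducible_twisted_def submod_opsub)
qed

text \<open>An endomorphism commutes with the mode \<open>L(0)\<close> of the conformal vector,
  hence preserves its eigenspaces. For an ordinary module these are finite dimensional, and they
  cannot all be zero since they span; one of them is the subspace asked for by
  \<open>schur_scalar\<close>.\<close>

lemma mode_schur_scalar:
  assumes M: "irreducible_twisted V g T M" and conf: "conf V \<in> vspace V"
    and f: "ophom (mode_ops V) (mspace M) (mode_act M) (mspace M) (mode_act M) f"
  shows "\<exists>c. \<forall>x\<in>mspace M. f x = c *\<^sub>C x"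
proof -
  interpret twisted_module V g T M using M by (simp add: irreducible_twisted_def)
  have L: "lin_map (mspace M) (mspace M) (mmode M (conf V) 1)" using conf by (rule mode_linear)
  have sub: "cvec.subspace (L0_eigenspace V M c)" for c
    unfolding L0_eigenspace_def using lin_map_zero[OF L subspace]
    by (auto intro!: cvec.subspaceI simp: cvec.subspace_0[OF subspace] cvec.subspace_add[OF subspace]
        cvec.subspace_scale[OF subspace] lin_map_add[OF L] lin_map_scale[OF L] scaleC_add_right mult.commute)
  have "\<exists>c. L0_eigenspace V M c \<noteq> {0}"
  proof (rule ccontr)
    assume "\<nexists>c. L0_eigenspace V M c \<noteq> {0}"
    then have "cvec.span (\<Union>c. L0_eigenspace V M c) = {0}" by simp
    then show False using M by (auto simp: irreducible_twisted_def ordinary_def)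
  qed
  then obtain c where c: "L0_eigenspace V M c \<noteq> {0}" by blast
  show ?thesis
  proof (rule schur_scalar[OF irreducible_opsimple[OF M] f _ sub c])
    show "fin_dim (L0_eigenspace V M c)" using M by (simp add: irreducible_twisted_def ordinary_def)
    show "f x \<in> L0_eigenspace V M c" if "x \<in> L0_eigenspace V M c" for x
    proof -
      have x: "x \<in> mspace M" "mmode M (conf V) 1 x = c *\<^sub>C x" using that by (auto simp: L0_eigenspace_def)
      have "f (mode_act M (conf V, 1) x) = mode_act M (conf V, 1) (f x)"
        using f x(1) conf by (auto simp: ophom_def)
      then show ?thesis using x f lin_map_in[of "mspace M" "mspace M" f] lin_map_scale[of "mspace M" "mspace M" f]
        by (auto simp: mode_act_def L0_eigenspace_def ophom_def)
    qed
  qed (auto simp: L0_eigenspace_def)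
qed

text \<open>The kernel of \<open>V \<otimes> M \<rightarrow> M((z))\<close> is stable under the modes acting on \<open>M\<close>, so if it were nonzero
  it would contain \<open>v \<otimes> M\<close> for some nonzero \<open>v\<close>, which therefore annihilates \<open>M\<close>.\<close>

lemma mode_tensor_injective:
  assumes M: "irreducible_twisted V g T M" and D: "twisted_decomposed V g T M" and simple: "simple_voa V"
    and A: "finite A" and v: "\<And>t. t \<in> A \<Longrightarrow> v t \<in> vspace V" and w: "\<And>t. t \<in> A \<Longrightarrow> w t \<in> mspace M"
    and 0: "\<And>k. (\<Sum>t\<in>A. mmode M (v t) k (w t)) = 0"
    and l: "lin_map UNIV (UNIV :: complex set) l"
  shows "(\<Sum>t\<in>A. l (w t) *\<^sub>C v t) = 0"
proof -
  interpret twisted_decomposed V g T M by (rule D)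
  define Q where "Q = {y \<in> dsum A (\<lambda>_. mspace M). \<forall>k. (\<Sum>t\<in>A. mmode M (v t) k (y t)) = 0}"
  have yM: "y t \<in> mspace M" if "y \<in> dsum A (\<lambda>_. mspace M)" "t \<in> A" for y t
    using that by (rule dsum_in)
  have subD: "cvec.subspace (dsum A (\<lambda>_. mspace M))" using M.subspace by (intro subspace_dsum)
  define w' where "w' = (\<lambda>t. if t \<in> A then w t else 0)"
  have w'Q: "w' \<in> Q" unfolding Q_def using w 0 by (auto simp: w'_def intro!: dsumI cong: sum.cong_simp)
  \<comment> \<open>Density with all coordinates in the one simple module \<open>M\<close>: a linear
    relation among the \<open>w t\<close> is carried by \<open>l\<close> to the scalars
    \<open>l (w t)\<close>, hence holds for the tuple of the \<open>l (w t) *\<^sub>C x\<close>,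
    which therefore lies in the kernel \<open>Q\<close> too.\<close>
  have "(\<lambda>t. if t \<in> A then l (w t) *\<^sub>C x else 0) \<in> Q" if x: "x \<in> mspace M" for x
  proof (rule density[where I = A and \<Omega> = "mode_ops V" and U = "\<lambda>_::unit. mspace M" and r = "\<lambda>_. mode_act M" and \<kappa> = "\<lambda>_. ()" and w = w'])
    show "\<exists>c. (\<forall>x\<in>mspace M. f x = c *\<^sub>C x) \<and> (() \<noteq> () \<longrightarrow> c = 0)"
      if "ophom (mode_ops V) (mspace M) (mode_act M) (mspace M) (mode_act M) f" for f
      using mode_schur_scalar[OF M V.conf_in that] by blast
    show "cvec.subspace Q"
      unfolding Q_def
      using cvec.subspace_0[OF subD] cvec.subspace_add[OF subD] cvec.subspace_scale[OF subD]
      by (auto intro!: cvec.subspaceI simp: mmode_zero_right v lin_map_add[OF M.mode_linear[OF v] yM yM]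
          lin_map_scale[OF M.mode_linear[OF v] yM] sum.distrib cvec.scale_sum_right[symmetric] cong: sum.cong_simp)
    show "(\<lambda>i. if i \<in> A then mode_act M x (y i) else 0) \<in> Q" if "x \<in> mode_ops V" "y \<in> Q" for x y
    proof -
      have y: "y \<in> dsum A (\<lambda>_. mspace M)" "\<And>k. (\<Sum>t\<in>A. mmode M (v t) k (y t)) = 0"
        using that by (auto simp: Q_def)
      have "(\<Sum>t\<in>A. mmode M (v t) k (mmode M (fst x) (snd x) (y t))) = 0" for k
        using that(1) by (intro mmode_kernel_closed[OF A v yM[OF y(1)] y(2)]) auto
      then show ?thesis using that(1) y yM[OF y(1)]
        by (auto simp: Q_def mode_act_def intro!: dsumI mmode_in cong: sum.cong_simp)
    qed
    show "(\<lambda>t. if t \<in> A then l (w t) *\<^sub>C x else 0) \<in> dsum A (\<lambda>i. mspace M)"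
      using x M.subspace by (auto intro!: dsumI simp: cvec.subspace_scale)
    show "(\<Sum>i\<in>{i \<in> A. () = k}. c i *\<^sub>C (if i \<in> A then l (w i) *\<^sub>C x else 0)) = 0"
      if "(\<Sum>i\<in>{i \<in> A. () = k}. c i *\<^sub>C w' i) = 0" for c k
    proof -
      have "(\<Sum>i\<in>A. c i *\<^sub>C w i) = 0" using that by (simp add: w'_def cong: sum.cong_simp)
      then have "l (\<Sum>i\<in>A. c i *\<^sub>C w i) = 0" using lin_map_zero[OF l] by simp
      then have "(\<Sum>i\<in>A. c i * l (w i)) = 0" by (simp add: lin_map_lincomb[OF l])
      then have "(\<Sum>i\<in>A. c i * l (w i)) *\<^sub>C x = 0" by simp
      then show ?thesis by (simp add: cvec.scale_sum_left cong: sum.cong_simp)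
    qed
  qed (use A w'Q irreducible_opsimple[OF M] in \<open>auto simp: Q_def\<close>)
  then have "(\<Sum>t\<in>A. mmode M (v t) k (l (w t) *\<^sub>C x)) = 0" if "x \<in> mspace M" for x k
    using that by (auto simp: Q_def cong: sum.cong_simp)
  moreover have "mmode M (\<Sum>t\<in>A. l (w t) *\<^sub>C v t) k x = (\<Sum>t\<in>A. mmode M (v t) k (l (w t) *\<^sub>C x))"
    if "x \<in> mspace M" for x k
  proof -
    have "mmode M (\<Sum>t\<in>A. l (w t) *\<^sub>C v t) k x = (\<Sum>t\<in>A. l (w t) *\<^sub>C mmode M (v t) k x)"
      using v by (rule lin_map_lincomb[OF M.field_linear[OF that] V.subspace])
    also have "\<dots> = (\<Sum>t\<in>A. mmode M (v t) k (l (w t) *\<^sub>C x))"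
      by (intro sum.cong refl) (simp add: lin_map_scale[OF M.mode_linear[OF v] that])
    finally show ?thesis .
  qed
  ultimately have "mmode M (\<Sum>t\<in>A. l (w t) *\<^sub>C v t) k x = 0" if "x \<in> mspace M" for x k
    using that by simp
  moreover have "(\<Sum>t\<in>A. l (w t) *\<^sub>C v t) \<in> vspace V"
    using v by (intro cvec.subspace_sum[OF V.subspace] cvec.subspace_scale[OF V.subspace])
  ultimately have "(\<Sum>t\<in>A. l (w t) *\<^sub>C v t) \<in> annihilator" by (auto simp: annihilator_def)
  then show ?thesis using annihilator_trivial[OF simple] M by (auto simp: irreducible_twisted_def)
qed

section \<open>Twisted group algebras\<close>

lemma fspace_eq_span: "finite I \<Longrightarrow> fspace I = cvec.span (bvec ` I)"
proof (rule antisym)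
  assume I: "finite I"
  show "fspace I \<subseteq> cvec.span (bvec ` I)"
  proof
    fix x :: "'a \<Rightarrow> complex" assume "x \<in> fspace I"
    then have "x = (\<Sum>i\<in>I. x i *\<^sub>C bvec i)"
      using I by (auto simp: fspace_def bvec_def fun_eq_iff sum_apply if_distrib[where f = "\<lambda>y. _ * y"] sum.delta cong: if_cong)
    also have "\<dots> \<in> cvec.span (bvec ` I)" by (intro cvec.span_sum cvec.span_scale cvec.span_base) auto
    finally show "x \<in> cvec.span (bvec ` I)" .
  qed
  show "cvec.span (bvec ` I) \<subseteq> fspace I"
    by (rule cvec.span_minimal) (auto simp: fspace_def bvec_def intro!: cvec.subspaceI)
qed

lemma subspace_fspace: "cvec.subspace (fspace I)"
  by (auto simp: fspace_def intro!: cvec.subspaceI)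

lemma bvec_in_fspace: "i \<in> I \<Longrightarrow> bvec i \<in> fspace I"
  by (auto simp: fspace_def bvec_def)

lemma fspace_expand: "finite I \<Longrightarrow> x \<in> fspace I \<Longrightarrow> x = (\<Sum>i\<in>I. x i *\<^sub>C bvec i)"
  by (auto simp: fspace_def bvec_def fun_eq_iff sum_apply if_distrib[where f = "\<lambda>y. _ * y"] sum.delta cong: if_cong)

lemma sum_bvec_scale: "finite I \<Longrightarrow> i \<in> I \<Longrightarrow> (\<Sum>j\<in>I. bvec i j *\<^sub>C f j) = f i"
  by (simp add: bvec_def if_distrib[where f = "\<lambda>y. y *\<^sub>C _"] sum.delta cong: if_cong)

section \<open>Finite groups of bijections and their projective representations\<close>

locale perm_group =
  fixes H :: "('v \<Rightarrow> 'v) set"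
  assumes finite_H: "finite H" and id_in: "id \<in> H"
    and comp_in: "a \<in> H \<Longrightarrow> b \<in> H \<Longrightarrow> a \<circ> b \<in> H"
    and inv_in: "a \<in> H \<Longrightarrow> inv a \<in> H"
    and bij: "a \<in> H \<Longrightarrow> bij a"
begin

lemma comp_inv: "a \<in> H \<Longrightarrow> a \<circ> inv a = id"
  using bij by (metis bij_is_surj surj_iff)

lemma inv_comp: "a \<in> H \<Longrightarrow> inv a \<circ> a = id"
  using bij by (metis bij_is_inj inj_iff)

lemma inv_inv: "a \<in> H \<Longrightarrow> inv (inv a) = a"
  using bij by (rule inv_inv_eq)

lemma inv_comp_distrib: "a \<in> H \<Longrightarrow> b \<in> H \<Longrightarrow> inv (a \<circ> b) = inv b \<circ> inv a"
  using bij by (intro o_inv_distrib)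

lemma comp_cancel: "a \<in> H \<Longrightarrow> a \<circ> (inv a \<circ> f) = f" "a \<in> H \<Longrightarrow> inv a \<circ> (a \<circ> f) = f"
  by (simp_all add: comp_assoc[symmetric] comp_inv inv_comp)

lemma comp_cancel_right: "a \<in> H \<Longrightarrow> (f \<circ> a) \<circ> inv a = f" "a \<in> H \<Longrightarrow> (f \<circ> inv a) \<circ> a = f"
  by (simp_all add: comp_assoc comp_inv inv_comp)

lemma left_translation_bij: "b \<in> H \<Longrightarrow> bij_betw (\<lambda>c. b \<circ> c) H H"
  by (rule bij_betw_byWitness[where f' = "\<lambda>c. inv b \<circ> c"])
    (auto simp: comp_cancel comp_in inv_in)

lemma sum_left_translation: "b \<in> H \<Longrightarrow> (\<Sum>a\<in>H. f a) = (\<Sum>c\<in>H. f (b \<circ> c))"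
  using sum.reindex_bij_betw[OF left_translation_bij, of b f] by simp

lemma inverse_bij: "bij_betw inv H H"
  by (rule bij_betw_byWitness[where f' = inv]) (auto simp: inv_inv inv_in)

end

locale twisted_group = perm_group H for H :: "('v \<Rightarrow> 'v) set" +
  fixes \<alpha> :: "('v \<Rightarrow> 'v) \<Rightarrow> ('v \<Rightarrow> 'v) \<Rightarrow> complex"
  assumes alpha_nonzero: "a \<in> H \<Longrightarrow> b \<in> H \<Longrightarrow> \<alpha> a b \<noteq> 0"
begin

text \<open>Modules of the twisted group algebra in terms of its basis: the operators are indexed by
  the group \<open>H\<close> itself, so that \<open>density\<close> and Schur's lemma apply with
  \<open>H\<close> as the set of operators.\<close>

definition proj_rep :: "'w::complex_vector set \<Rightarrow> (('v \<Rightarrow> 'v) \<Rightarrow> 'w \<Rightarrow> 'w) \<Rightarrow> bool"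
  where "proj_rep X r \<longleftrightarrow> opmod H X r \<and> (\<forall>x\<in>X. r id x = x) \<and>
    (\<forall>a\<in>H. \<forall>b\<in>H. \<forall>x\<in>X. r a (r b x) = \<alpha> a b *\<^sub>C r (a \<circ> b) x)"

lemma proj_repD:
  assumes "proj_rep X r"
  shows "cvec.subspace X" "opmod H X r" "a \<in> H \<Longrightarrow> lin_map X X (r a)" "a \<in> H \<Longrightarrow> x \<in> X \<Longrightarrow> r a x \<in> X"
    "x \<in> X \<Longrightarrow> r id x = x"
    "a \<in> H \<Longrightarrow> b \<in> H \<Longrightarrow> x \<in> X \<Longrightarrow> r a (r b x) = \<alpha> a b *\<^sub>C r (a \<circ> b) x"
  using assms by (auto simp: proj_rep_def opmod_def lin_map_in)

lemma proj_rep_sub: "proj_rep X r \<Longrightarrow> opsub H X r N \<Longrightarrow> proj_rep N r"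
  using opmod_sub[of H X r N] by (auto simp: proj_rep_def opsub_def subset_iff)

text \<open>The inverse of \<open>r a\<close>. As \<open>r (inv a)\<close> after \<open>r a\<close>
  is \<open>\<alpha> (inv a) a\<close> times the identity, this scalar has to be divided
  out.\<close>

definition rep_inv :: "(('v \<Rightarrow> 'v) \<Rightarrow> 'w::complex_vector \<Rightarrow> 'w) \<Rightarrow> ('v \<Rightarrow> 'v) \<Rightarrow> 'w \<Rightarrow> 'w"
  where "rep_inv r a x = inverse (\<alpha> (inv a) a) *\<^sub>C r (inv a) x"

lemma rep_inv_left:
  assumes "proj_rep X r" "a \<in> H" "x \<in> X"
  shows "rep_inv r a (r a x) = x"
  using assms proj_repD[OF assms(1)] alpha_nonzero[of "inv a" a]
  by (simp add: rep_inv_def inv_in inv_comp)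

lemma rep_inv_in:
  assumes "proj_rep X r" "a \<in> H" "x \<in> X"
  shows "rep_inv r a x \<in> X"
  unfolding rep_inv_def
  using assms by (intro cvec.subspace_scale proj_repD(1)[OF assms(1)] proj_repD(4)[OF assms(1)] inv_in)

lemma rep_surj:
  assumes "proj_rep X r" "a \<in> H" "x \<in> X"
  obtains y where "y \<in> X" "x = r a y"
proof -
  have "r a (inverse (\<alpha> a (inv a)) *\<^sub>C r (inv a) x) = x"
    using assms proj_repD[OF assms(1)] alpha_nonzero[of a "inv a"]
    by (simp add: lin_map_scale[of X X] inv_in comp_inv)
  moreover have "inverse (\<alpha> a (inv a)) *\<^sub>C r (inv a) x \<in> X"
    using assms proj_repD[OF assms(1)] by (intro cvec.subspace_scale) (auto simp: inv_in)
  ultimately show ?thesis using that by metis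
qed

lemma rep_inv_right:
  assumes "proj_rep X r" "a \<in> H" "x \<in> X"
  shows "r a (rep_inv r a x) = x"
  using rep_surj[OF assms] rep_inv_left[OF assms(1,2)] by metis

lemma lin_map_rep_inv:
  assumes X: "proj_rep X r" and a: "a \<in> H"
  shows "lin_map X X (rep_inv r a)"
proof -
  note l = proj_repD(3)[OF X inv_in[OF a]]
  show ?thesis
    by (intro lin_mapI rep_inv_in[OF X a])
      (simp_all add: rep_inv_def lin_map_add[OF l] lin_map_scale[OF l] scaleC_add_right mult.commute)
qed

text \<open>The sum over the group without division by its order; averaging a projection onto a
  submodule gives \<open>card H\<close> times the identity there.\<close>

definition average :: "(('v \<Rightarrow> 'v) \<Rightarrow> 'w::complex_vector \<Rightarrow> 'w) \<Rightarrow> (('v \<Rightarrow> 'v) \<Rightarrow> 'x::complex_vector \<Rightarrow> 'x) \<Rightarrow>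
    ('w \<Rightarrow> 'x) \<Rightarrow> 'w \<Rightarrow> 'x"
  where "average r s f x = (\<Sum>a\<in>H. s a (f (rep_inv r a x)))"

lemma average_hom:
  assumes X: "proj_rep X r" and Y: "proj_rep Y s" and f: "lin_map X Y f"
  shows "ophom H X r Y s (average r s f)"
  unfolding ophom_def
proof (intro conjI ballI)
  note lr = lin_map_rep_inv[OF X] and ls = proj_repD(3)[OF Y]
  have sf: "s a (f (rep_inv r a x)) \<in> Y" if "a \<in> H" "x \<in> X" for a x
    using that X Y f by (blast intro: lin_map_in[OF ls] lin_map_in[OF f] rep_inv_in)
  have lm: "lin_map X Y (\<lambda>x. s a (f (rep_inv r a x)))" if "a \<in> H" for a
    by (rule lin_map_comp[OF lin_map_comp[OF lr[OF that] f] ls[OF that]])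
  show "lin_map X Y (average r s f)"
    by (intro lin_mapI)
      (auto simp: average_def sf cvec.subspace_sum[OF proj_repD(1)[OF Y]] lin_map_add[OF lm] lin_map_scale[OF lm]
        sum.distrib cvec.scale_sum_right cong: sum.cong_simp)
  show "average r s f (r b x) = s b (average r s f x)" if b: "b \<in> H" and x: "x \<in> X" for b x
  proof -
    have "average r s f (r b x) = (\<Sum>c\<in>H. s (b \<circ> c) (f (rep_inv r (b \<circ> c) (r b x))))"
      unfolding average_def by (rule sum_left_translation[OF b])
    also have "\<dots> = (\<Sum>c\<in>H. s b (s c (f (rep_inv r c x))))"
    proof (rule sum.cong[OF refl])
      fix c assume c: "c \<in> H"
      obtain y where y: "y \<in> X" "x = r c y" using rep_surj[OF X c x] .
      have bc: "b \<circ> c \<in> H" using b c by (rule comp_in)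
      \<comment> \<open>The factor \<open>\<alpha> b c\<close> produced in \<open>X\<close> is
        exactly the one that turns \<open>s (b \<circ> c)\<close> into \<open>s b\<close> after
        \<open>s c\<close> in \<open>Y\<close>, since both representations have the same
        cocycle.\<close>
      have "r b x = r (b \<circ> c) (\<alpha> b c *\<^sub>C y)"
        using proj_repD[OF X] b c y bc lin_map_scale[of X X "r (b \<circ> c)" y "\<alpha> b c"] by simp
      then have "rep_inv r (b \<circ> c) (r b x) = \<alpha> b c *\<^sub>C y"
        using rep_inv_left[OF X bc, of "\<alpha> b c *\<^sub>C y"] y(1) proj_repD(1)[OF X] by (simp add: cvec.subspace_scale)
      moreover have "rep_inv r c x = y" using rep_inv_left[OF X c y(1)] y(2) by simp
      moreover have "f y \<in> Y" using f y(1) by (rule lin_map_in)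
      ultimately show "s (b \<circ> c) (f (rep_inv r (b \<circ> c) (r b x))) = s b (s c (f (rep_inv r c x)))"
        using proj_repD(6)[OF Y b c] lin_map_scale[OF f y(1)] lin_map_scale[OF ls[OF bc]] by simp
    qed
    also have "\<dots> = s b (average r s f x)"
      unfolding average_def using sf x by (intro lin_map_sum[OF ls[OF b] proj_repD(1)[OF Y], symmetric])
    finally show ?thesis .
  qed
qed

definition alg_act :: "(('v \<Rightarrow> 'v) \<Rightarrow> 'w::complex_vector \<Rightarrow> 'w) \<Rightarrow> (('v \<Rightarrow> 'v) \<Rightarrow> complex) \<Rightarrow> 'w \<Rightarrow> 'w"
  where "alg_act r x w = (\<Sum>a\<in>H. x a *\<^sub>C r a w)"

lemma alg_act_add: "alg_act r (x + y) w = alg_act r x w + alg_act r y w"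
  by (simp add: alg_act_def scaleC_add_left sum.distrib)

lemma alg_act_scale: "alg_act r (c *\<^sub>C x) w = c *\<^sub>C alg_act r x w"
  by (simp add: alg_act_def cvec.scale_sum_right)

lemma alg_act_sum: "alg_act r (\<Sum>i\<in>I. c i *\<^sub>C x i) w = (\<Sum>i\<in>I. c i *\<^sub>C alg_act r (x i) w)"
proof (induction I rule: infinite_finite_induct)
  case (insert i I)
  then show ?case by (simp only: sum.insert not_False_eq_True alg_act_add alg_act_scale)
qed (simp_all add: alg_act_def)

lemma alg_act_bvec: "a \<in> H \<Longrightarrow> alg_act r (bvec a) w = r a w"
  by (simp add: alg_act_def sum_bvec_scale finite_H)

lemma lin_map_alg_act:
  assumes "opmod H X r"
  shows "lin_map X X (alg_act r x)"
proof -
  have X: "cvec.subspace X" and l: "\<And>a. a \<in> H \<Longrightarrow> lin_map X X (r a)" using assms by (auto simp: opmod_def)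
  show ?thesis
  proof (rule lin_mapI)
    show "alg_act r x w \<in> X" if "w \<in> X" for w
      unfolding alg_act_def by (intro cvec.subspace_sum[OF X] cvec.subspace_scale[OF X] lin_map_in[OF l] that)
  qed (simp_all add: alg_act_def lin_map_add[OF l] lin_map_scale[OF l] scaleC_add_right sum.distrib
      cvec.scale_sum_right mult.commute cong: sum.cong_simp)
qed

lemma opsub_alg_act:
  assumes "opsub H X r N" "w \<in> N"
  shows "alg_act r x w \<in> N"
proof -
  have N: "cvec.subspace N" "\<And>a. a \<in> H \<Longrightarrow> r a w \<in> N" using assms by (auto simp: opsub_def)
  show ?thesis unfolding alg_act_def by (intro cvec.subspace_sum[OF N(1)] cvec.subspace_scale[OF N(1)] N(2))
qed

lemma ophom_alg_act:
  assumes "ophom H X r Y s f" "opmod H X r" "w \<in> X"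
  shows "f (alg_act r x w) = alg_act s x (f w)"
proof -
  have f: "lin_map X Y f" and X: "cvec.subspace X" using assms by (auto simp: ophom_def opmod_def)
  have "f (alg_act r x w) = (\<Sum>a\<in>H. x a *\<^sub>C f (r a w))"
    unfolding alg_act_def using assms
    by (intro lin_map_lincomb[OF f X]) (auto simp: opmod_def lin_map_in)
  then show ?thesis using assms by (simp add: alg_act_def ophom_def)
qed

section \<open>Modules and characters of the twisted group algebra\<close>

abbreviation A where "A \<equiv> twisted_group_algebra H \<alpha>"

lemma A_simps: "acarrier A = fspace H" "aone A = bvec id"
  "amult A = (\<lambda>x y. \<Sum>a\<in>H. \<Sum>b\<in>H. (x a * y b * \<alpha> a b) *\<^sub>C bvec (a \<circ> b))"
  by (simp_all add: twisted_group_algebra_def)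

lemma amult_bvec: "a \<in> H \<Longrightarrow> b \<in> H \<Longrightarrow> amult A (bvec a) (bvec b) = \<alpha> a b *\<^sub>C bvec (a \<circ> b)"
proof -
  assume a: "a \<in> H" and b: "b \<in> H"
  have "amult A (bvec a) (bvec b) = (\<Sum>a'\<in>H. bvec a a' *\<^sub>C (\<Sum>b'\<in>H. bvec b b' *\<^sub>C (\<alpha> a' b' *\<^sub>C bvec (a' \<circ> b'))))"
    by (simp add: A_simps cvec.scale_sum_right mult.assoc)
  then show ?thesis unfolding sum_bvec_scale[OF finite_H a] sum_bvec_scale[OF finite_H b] .
qed

lemma alg_module_proj_rep:
  assumes W: "alg_module A W \<rho>"
  shows "proj_rep W (\<lambda>a. \<rho> (bvec a))"
    and "x \<in> fspace H \<Longrightarrow> w \<in> W \<Longrightarrow> \<rho> x w = alg_act (\<lambda>a. \<rho> (bvec a)) x w"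
proof -
  have sub: "cvec.subspace W" and l1: "\<And>x. x \<in> fspace H \<Longrightarrow> lin_map W W (\<rho> x)"
    and l2: "\<And>w. w \<in> W \<Longrightarrow> lin_map (fspace H) W (\<lambda>x. \<rho> x w)"
    and mult: "\<And>x y w. x \<in> fspace H \<Longrightarrow> y \<in> fspace H \<Longrightarrow> w \<in> W \<Longrightarrow> \<rho> (amult A x y) w = \<rho> x (\<rho> y w)"
    and one: "\<And>w. w \<in> W \<Longrightarrow> \<rho> (bvec id) w = w"
    using W by (auto simp: alg_module_def A_simps)
  have bv: "bvec a \<in> fspace H" if "a \<in> H" for a using that by (rule bvec_in_fspace)
  show "proj_rep W (\<lambda>a. \<rho> (bvec a))"
    unfolding proj_rep_def opmod_def
  proof (intro conjI ballI)
    show "\<rho> (bvec a) (\<rho> (bvec b) x) = \<alpha> a b *\<^sub>C \<rho> (bvec (a \<circ> b)) x" if "a \<in> H" "b \<in> H" "x \<in> W" for a b x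
    proof -
      have "\<rho> (bvec a) (\<rho> (bvec b) x) = \<rho> (\<alpha> a b *\<^sub>C bvec (a \<circ> b)) x"
        using mult[OF bv[OF that(1)] bv[OF that(2)] that(3)] amult_bvec[OF that(1,2)] by simp
      then show ?thesis using lin_map_scale[OF l2[OF that(3)] bv[OF comp_in[OF that(1,2)]]] by simp
    qed
  qed (use sub l1 bv one in auto)
  show "\<rho> x w = alg_act (\<lambda>a. \<rho> (bvec a)) x w" if "x \<in> fspace H" "w \<in> W"
  proof -
    have "\<rho> x w = \<rho> (\<Sum>a\<in>H. x a *\<^sub>C bvec a) w" using fspace_expand[OF finite_H that(1)] by simp
    also have "\<dots> = (\<Sum>a\<in>H. x a *\<^sub>C \<rho> (bvec a) w)"
      using bv by (rule lin_map_lincomb[OF l2[OF that(2)] subspace_fspace])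
    finally show ?thesis by (simp add: alg_act_def)
  qed
qed

lemma proj_rep_alg_module:
  assumes X: "proj_rep X r"
  shows "alg_module A X (alg_act r)"
  unfolding alg_module_def
proof (intro conjI ballI)
  show "lin_map (acarrier A) X (\<lambda>x. alg_act r x w)" if "w \<in> X" for w
    using that lin_map_in[OF lin_map_alg_act[OF proj_repD(2)[OF X]]]
    by (auto intro!: lin_mapI simp: alg_act_add alg_act_scale)
  show "alg_act r (amult A x y) w = alg_act r x (alg_act r y w)"
    if "x \<in> acarrier A" "y \<in> acarrier A" "w \<in> X" for x y w
  proof -
    have "alg_act r (amult A x y) w = (\<Sum>a\<in>H. alg_act r (\<Sum>b\<in>H. (x a * y b * \<alpha> a b) *\<^sub>C bvec (a \<circ> b)) w)"
      using alg_act_sum[of r "\<lambda>_. 1" "\<lambda>a. \<Sum>b\<in>H. (x a * y b * \<alpha> a b) *\<^sub>C bvec (a \<circ> b)" H w] by (simp add: A_simps)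
    also have "\<dots> = (\<Sum>a\<in>H. \<Sum>b\<in>H. (x a * y b * \<alpha> a b) *\<^sub>C r (a \<circ> b) w)"
      by (simp add: alg_act_sum alg_act_bvec comp_in)
    also have "\<dots> = (\<Sum>a\<in>H. x a *\<^sub>C r a (\<Sum>b\<in>H. y b *\<^sub>C r b w))"
    proof (rule sum.cong[OF refl])
      fix a assume a: "a \<in> H"
      have "r a (\<Sum>b\<in>H. y b *\<^sub>C r b w) = (\<Sum>b\<in>H. y b *\<^sub>C r a (r b w))"
        using proj_repD(4)[OF X] that by (intro lin_map_lincomb[OF proj_repD(3)[OF X a] proj_repD(1)[OF X]]) auto
      then show "(\<Sum>b\<in>H. (x a * y b * \<alpha> a b) *\<^sub>C r (a \<circ> b) w) = x a *\<^sub>C r a (\<Sum>b\<in>H. y b *\<^sub>C r b w)"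
        using proj_repD(6)[OF X a _ that(3)] by (simp add: cvec.scale_sum_right mult.assoc)
    qed
    finally show ?thesis by (simp add: alg_act_def)
  qed
  show "alg_act r (aone A) w = w" if "w \<in> X" for w
    using that proj_repD(5)[OF X] by (simp add: A_simps alg_act_bvec id_in)
qed (use proj_repD[OF X] lin_map_alg_act in auto)

lemma simple_alg_module_opsimple:
  assumes W: "simple_alg_module A W \<rho>"
  shows "opsimple H W (\<lambda>a. \<rho> (bvec a))"
proof -
  have m: "alg_module A W \<rho>" using W by (simp add: simple_alg_module_def)
  note pr = alg_module_proj_rep[OF m]
  have "N = {0} \<or> N = W" if N: "opsub H W (\<lambda>a. \<rho> (bvec a)) N" for N
  proof -
    have "\<rho> x w \<in> N" if "x \<in> acarrier A" "w \<in> N" for x w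
      using pr(2)[of x w] opsub_alg_act[OF N that(2), of x] that N by (auto simp: A_simps opsub_def)
    then show ?thesis using W N by (auto simp: simple_alg_module_def opsub_def)
  qed
  then show ?thesis using W pr(1) by (auto simp: opsimple_def simple_alg_module_def proj_rep_def)
qed

lemma opsimple_simple_alg_module:
  assumes X: "proj_rep X r" and s: "opsimple H X r"
  shows "simple_alg_module A X (alg_act r)"
proof -
  have "N = {0} \<or> N = X" if N: "cvec.subspace N" "N \<subseteq> X" "\<forall>x\<in>acarrier A. \<forall>w\<in>N. alg_act r x w \<in> N" for N
  proof -
    have "r a w \<in> N" if "a \<in> H" "w \<in> N" for a w
    proof -
      have "alg_act r (bvec a) w \<in> N" using N(3) that(2) bvec_in_fspace[OF that(1)] by (simp add: A_simps(1))
      then show ?thesis unfolding alg_act_bvec[OF that(1), of r w] .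
    qed
    then have "opsub H X r N" using N by (auto simp: opsub_def)
    then show ?thesis using s by (auto simp: opsimple_def)
  qed
  then show ?thesis using s proj_rep_alg_module[OF X] by (auto simp: simple_alg_module_def opsimple_def)
qed

text \<open>Applying \<open>r b\<close> to \<open>r a x\<close> gives a scalar multiple of
  \<open>r (b \<circ> a) x\<close>, so the span of the translates is stable. A simple module is thus
  spanned by finitely many vectors.\<close>

lemma opsub_generated:
  assumes X: "proj_rep X r" and x: "x \<in> X"
  shows "opsub H X r (cvec.span ((\<lambda>a. r a x) ` H))" "x \<in> cvec.span ((\<lambda>a. r a x) ` H)"
proof -
  let ?S = "cvec.span ((\<lambda>a. r a x) ` H)"
  have sub: "?S \<subseteq> X" using proj_repD[OF X] x by (intro cvec.span_minimal) auto
  have "r b y \<in> ?S" if b: "b \<in> H" and y: "y \<in> ?S" for b y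
  proof (rule lin_map_span_image[OF proj_repD(3)[OF X b] proj_repD(1)[OF X] y])
    show "r b z \<in> ?S" if z: "z \<in> (\<lambda>a. r a x) ` H" for z
    proof -
      obtain a where a: "a \<in> H" "z = r a x" using z by blast
      have "r (b \<circ> a) x \<in> ?S" by (intro cvec.span_base imageI comp_in a b)
      then show ?thesis using proj_repD(6)[OF X b a(1) x] a(2) by (auto intro: cvec.span_scale)
    qed
  qed (use proj_repD[OF X] x in auto)
  then show "opsub H X r ?S" using sub by (auto simp: opsub_def)
  have "r id x \<in> ?S" by (intro cvec.span_base imageI id_in)
  then show "x \<in> ?S" using proj_repD(5)[OF X x] by simp
qed

lemma opsimple_fin_dim:
  assumes X: "proj_rep X r" and s: "opsimple H X r"
  shows "fin_dim X"
proof -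
  obtain x where x: "x \<in> X" "x \<noteq> 0"
    using s proj_repD(1)[OF X] cvec.subspace_0 by (auto simp: opsimple_def)
  have "cvec.span ((\<lambda>a. r a x) ` H) = X"
    using opsub_generated[OF X x(1)] s x(2) by (auto simp: opsimple_def)
  then show ?thesis using fin_dim_span[of "(\<lambda>a. r a x) ` H"] finite_H by simp
qed

text \<open>Among the nonzero submodules with a finite basis one of least dimension is simple; the
  submodule generated by \<open>x\<close> shows that there are any.\<close>

lemma simple_sub_exists:
  assumes X: "proj_rep X r" and x: "x \<in> X" "x \<noteq> 0"
  obtains N where "opsub H X r N" "opsimple H N r"
proof -
  let ?P = "\<lambda>B. finite B \<and> cvec.independent B \<and> opsub H X r (cvec.span B) \<and> cvec.span B \<noteq> {0}"
  have gen: "opsub H X r (cvec.span ((\<lambda>a. r a x) ` H))" "x \<in> cvec.span ((\<lambda>a. r a x) ` H)"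
    using opsub_generated[OF X x(1)] by blast+
  obtain B0 where "finite B0" "cvec.independent B0" "cvec.span B0 = cvec.span ((\<lambda>a. r a x) ` H)"
    using obtain_finite_basis[OF fin_dim_span[of "(\<lambda>a. r a x) ` H"]] finite_H by (metis cvec.subspace_span finite_imageI order_refl)
  then have "?P B0" using gen x(2) by auto
  then obtain B where B: "?P B" and min: "\<And>C. ?P C \<Longrightarrow> card B \<le> card C"
    using ex_has_least_nat[of ?P B0 card] by blast
  have "N = {0} \<or> N = cvec.span B" if N: "opsub H (cvec.span B) r N" for N
  proof (rule ccontr)
    assume c: "\<not> (N = {0} \<or> N = cvec.span B)"
    have NB: "N \<subseteq> cvec.span B" and Ns: "cvec.subspace N" using N by (auto simp: opsub_def)
    obtain C where C: "finite C" "cvec.independent C" "cvec.span C = N"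
      using obtain_finite_basis[OF fin_dim_span Ns NB] B by blast
    have "opsub H X r N" using N B by (auto simp: opsub_def subset_iff)
    then have "card B \<le> card C" using min[of C] C c by auto
    obtain y where y: "y \<in> cvec.span B" "y \<notin> N" using NB c by blast
    have "cvec.independent (insert y C)" using y C by (intro cvec.independent_insertI) auto
    moreover have "insert y C \<subseteq> cvec.span B" using y C NB cvec.span_superset by blast
    ultimately have "card (insert y C) \<le> card B"
      using cvec.independent_span_bound[of B] B by blast
    moreover have "y \<notin> C" using y(2) C(3) cvec.span_base by blast
    ultimately show False using C(1) \<open>card B \<le> card C\<close> by simp
  qed
  then have "opsimple H (cvec.span B) r"
    using B opmod_sub[OF proj_repD(2)[OF X]] by (auto simp: opsimple_def)
  then show ?thesis using that B by blast
qed

lemma proj_rep_simple_scalar: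
  assumes "proj_rep X r" "opsimple H X r" "ophom H X r X r f"
  shows "\<exists>c. \<forall>x\<in>X. f x = c *\<^sub>C x"
  using assms by (intro schur_scalar[OF assms(2,3) opsimple_fin_dim[OF assms(1,2)] proj_repD(1)[OF assms(1)]])
    (auto simp: opsimple_def ophom_def lin_map_in)

text \<open>Linear maps on the simple modules are determined by the images of basis vectors, so the
  claim is density for the single tuple of all basis vectors, with the image of the algebra on that
  tuple as the submodule. A relation among the basis vectors of one module is carried over by the
  linear map \<open>T k\<close>.\<close>

lemma burnside:
  fixes U :: "'k \<Rightarrow> 'w::complex_vector set"
  assumes K: "finite K" and U: "\<And>k. k \<in> K \<Longrightarrow> proj_rep (U k) (r k)" and simple: "\<And>k. k \<in> K \<Longrightarrow> opsimple H (U k) (r k)"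
    and noniso: "\<And>k l f. k \<in> K \<Longrightarrow> l \<in> K \<Longrightarrow> k \<noteq> l \<Longrightarrow> ophom H (U k) (r k) (U l) (r l) f \<Longrightarrow> \<forall>x\<in>U k. f x = 0"
    and T: "\<And>k. k \<in> K \<Longrightarrow> lin_map (U k) (U k) (T k)"
  shows "\<exists>x\<in>fspace H. \<forall>k\<in>K. \<forall>u\<in>U k. alg_act (r k) x u = T k u"
proof -
  have "\<forall>k\<in>K. \<exists>B. finite B \<and> cvec.span B = U k" using opsimple_fin_dim[OF U simple] by (auto simp: fin_dim_def)
  then obtain B where B: "\<And>k. k \<in> K \<Longrightarrow> finite (B k)" "\<And>k. k \<in> K \<Longrightarrow> cvec.span (B k) = U k" by metis
  have BU: "b \<in> U k" if "k \<in> K" "b \<in> B k" for k b using B that cvec.span_base by blast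
  let ?I = "SIGMA k:K. B k"
  define F where "F x = (\<lambda>i. if i \<in> ?I then alg_act (r (fst i)) x (snd i) else 0)" for x
  have Flin: "lin_map (fspace H) UNIV F"
    by (auto intro!: lin_mapI simp: F_def fun_eq_iff alg_act_add alg_act_scale)
  let ?y = "\<lambda>i. if i \<in> ?I then T (fst i) (snd i) else 0"
  have "?y \<in> F ` fspace H"
  proof (rule density[where I = ?I and \<Omega> = H and U = U and r = r and \<kappa> = fst and w = "F (bvec id)"])
    show "finite ?I" using K B by auto
    show "opsimple H (U (fst i)) (r (fst i))" if "i \<in> ?I" for i using that simple by auto
    show "\<exists>c. (\<forall>x\<in>U (fst i). f x = c *\<^sub>C x) \<and> (fst i \<noteq> fst j \<longrightarrow> c = 0)"
      if ij: "i \<in> ?I" "j \<in> ?I" and f: "ophom H (U (fst i)) (r (fst i)) (U (fst j)) (r (fst j)) f" for i j f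
    proof (cases "fst i = fst j")
      case True
      then show ?thesis using proj_rep_simple_scalar[of "U (fst i)" "r (fst i)" f] U simple ij f by auto
    next
      case False
      then show ?thesis using noniso[OF _ _ False f] ij by (intro exI[of _ 0]) auto
    qed
    show "cvec.subspace (F ` fspace H)" by (rule lin_map_image[OF Flin subspace_fspace])
    show "F ` fspace H \<subseteq> dsum ?I (\<lambda>i. U (fst i))"
      using BU lin_map_in[OF lin_map_alg_act[OF proj_repD(2)[OF U]]]
      by (auto intro!: dsumI simp: F_def split: if_splits)
    show "(\<lambda>i. if i \<in> ?I then r (fst i) a (y i) else 0) \<in> F ` fspace H" if a: "a \<in> H" and y: "y \<in> F ` fspace H" for a y
    proof -
      obtain x where x: "x \<in> fspace H" "y = F x" using y by blast
      let ?x = "amult A (bvec a) x"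
      have "?x \<in> fspace H"
        by (auto simp: A_simps intro!: cvec.subspace_sum[OF subspace_fspace] cvec.subspace_scale[OF subspace_fspace]
            bvec_in_fspace comp_in)
      moreover have "(\<lambda>i. if i \<in> ?I then r (fst i) a (y i) else 0) = F ?x"
      proof (rule ext)
        fix i
        have "r k a (alg_act (r k) x b) = alg_act (r k) ?x b" if "k \<in> K" "b \<in> B k" for k b
          using proj_rep_alg_module[OF U[OF that(1)]] BU[OF that] x(1) bvec_in_fspace[OF a] alg_act_bvec[OF a, of "r k"]
          by (simp add: alg_module_def A_simps(1))
        then show "(if i \<in> ?I then r (fst i) a (y i) else 0) = F ?x i"
          by (auto simp: F_def x(2))
      qed
      ultimately show ?thesis by blast
    qed
    show "F (bvec id) \<in> F ` fspace H" using bvec_in_fspace[OF id_in] by blast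
    show "?y \<in> dsum ?I (\<lambda>i. U (fst i))"
      using lin_map_in[OF T] BU by (auto intro!: dsumI split: if_splits)
    show "(\<Sum>i\<in>{i \<in> ?I. fst i = k}. c i *\<^sub>C (if i \<in> ?I then T (fst i) (snd i) else 0)) = 0"
      if s: "(\<Sum>i\<in>{i \<in> ?I. fst i = k}. c i *\<^sub>C F (bvec id) i) = 0" for c k
    proof (cases "k \<in> K")
      case True
      have "F (bvec id) i = snd i" if "i \<in> ?I" for i
        using that BU[of "fst i" "snd i"] proj_repD(5)[OF U] by (auto simp: F_def alg_act_bvec id_in)
      then have s': "(\<Sum>i\<in>{i \<in> ?I. fst i = k}. c i *\<^sub>C snd i) = 0" using s by (simp cong: sum.cong_simp)
      have "(\<Sum>i\<in>{i \<in> ?I. fst i = k}. c i *\<^sub>C (if i \<in> ?I then T (fst i) (snd i) else 0)) =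
          (\<Sum>i\<in>{i \<in> ?I. fst i = k}. c i *\<^sub>C T k (snd i))"
        by (intro sum.cong) auto
      also have "\<dots> = T k (\<Sum>i\<in>{i \<in> ?I. fst i = k}. c i *\<^sub>C snd i)"
        using BU by (intro lin_map_lincomb[OF T[OF True] proj_repD(1)[OF U[OF True]], symmetric]) auto
      finally show ?thesis using s' lin_map_zero[OF T[OF True] proj_repD(1)[OF U[OF True]]] by simp
    next
      case False
      then have e: "{i \<in> ?I. fst i = k} = {}" by auto
      show ?thesis unfolding e by (rule sum.empty)
    qed
  qed
  then obtain x where x: "?y = F x" "x \<in> fspace H" by (rule imageE)
  have "alg_act (r k) x u = T k u" if k: "k \<in> K" and u: "u \<in> U k" for k u
  proof (rule lin_map_eq_on_span[where U = "U k" and X = "U k" and B = "B k" and f = "alg_act (r k) x" and g = "T k"])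
    show "alg_act (r k) x b = T k b" if "b \<in> B k" for b
      using fun_cong[OF x(1), of "(k, b)"] k that by (simp add: F_def)
  qed (use lin_map_alg_act[OF proj_repD(2)[OF U[OF k]]] T[OF k] proj_repD(1)[OF U[OF k]] B(2)[OF k] u BU[OF k] in auto)
  then show ?thesis using x(2) by blast
qed

lemma proj_rep_iso:
  assumes X: "proj_rep X r" and h: "lin_iso X Y h" and Y: "cvec.subspace Y"
    and s: "\<And>a x. a \<in> H \<Longrightarrow> x \<in> X \<Longrightarrow> s a (h x) = h (r a x)"
  shows "proj_rep Y s" "ophom H X r Y s h" "opsimple H X r \<Longrightarrow> opsimple H Y s"
proof -
  have hl: "lin_map X Y h" and hb: "bij_betw h X Y" using h by (auto simp: lin_iso_def)
  have Yx: "y \<in> Y \<longleftrightarrow> (\<exists>x\<in>X. y = h x)" for y using hb by (auto simp: bij_betw_def)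
  have X0: "cvec.subspace X" using proj_repD(1)[OF X] .
  have "lin_map Y Y (s a)" if a: "a \<in> H" for a
  proof -
    note ra = proj_repD(3)[OF X a]
    have "s a (h x + h y) = s a (h x) + s a (h y)" if "x \<in> X" "y \<in> X" for x y
    proof -
      have "s a (h x + h y) = s a (h (x + y))" using lin_map_add[OF hl] that by simp
      also have "\<dots> = h (r a x + r a y)" using s[OF a] that cvec.subspace_add[OF X0] lin_map_add[OF ra] by simp
      finally show ?thesis using that lin_map_add[OF hl] lin_map_in[OF ra] s[OF a] by simp
    qed
    moreover have "s a (c *\<^sub>C h x) = c *\<^sub>C s a (h x)" if "x \<in> X" for c x
    proof -
      have "s a (c *\<^sub>C h x) = s a (h (c *\<^sub>C x))" using lin_map_scale[OF hl] that by simp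
      also have "\<dots> = h (c *\<^sub>C r a x)" using s[OF a] that cvec.subspace_scale[OF X0] lin_map_scale[OF ra] by simp
      finally show ?thesis using that lin_map_scale[OF hl] lin_map_in[OF ra] s[OF a] by simp
    qed
    ultimately show ?thesis using s[OF a] lin_map_in[OF hl] lin_map_in[OF ra] by (auto simp: lin_map_def Yx)
  qed
  then show pY: "proj_rep Y s" using Y s proj_repD[OF X]
    by (auto simp: proj_rep_def opmod_def Yx id_in comp_in lin_map_scale[OF hl])
  show hom: "ophom H X r Y s h" using hl s by (auto simp: ophom_def)
  show "opsimple H Y s" if sX: "opsimple H X r"
  proof -
    have inv: "lin_iso Y X (inv_into X h)" by (rule lin_iso_inv[OF h X0])
    have ih: "ophom H Y s X r (inv_into X h)" by (rule ophom_inv[OF hom h proj_repD(2)[OF X]])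
    have "N = {0} \<or> N = Y" if N: "opsub H Y s N" for N
    proof -
      have "ophom H N s X r (inv_into X h)" using ih N by (auto simp: ophom_def opsub_def subset_iff lin_map_def)
      then have "opsub H X r (inv_into X h ` N)" using ophom_image opmod_sub[OF proj_repD(2)[OF pY] N] by blast
      then have "inv_into X h ` N = {0} \<or> inv_into X h ` N = X" using sX by (auto simp: opsimple_def)
      moreover have "h ` inv_into X h ` N = N"
        using N hb by (intro image_inv_into_cancel) (auto simp: opsub_def bij_betw_def)
      ultimately show ?thesis using hb lin_map_zero[OF hl X0] by (auto simp: bij_betw_def)
    qed
    moreover have "Y \<noteq> {0}"
    proof
      assume "Y = {0}"
      have "x = 0" if x: "x \<in> X" for x
      proof -
        have "h x = h 0" using lin_map_in[OF hl x] \<open>Y = {0}\<close> lin_map_zero[OF hl X0] by simp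
        then show ?thesis using bij_betw_imp_inj_on[OF hb] x cvec.subspace_0[OF X0] by (simp add: inj_on_def)
      qed
      then have "X = {0}" using cvec.subspace_0[OF X0] by auto
      then show False using sX by (simp add: opsimple_def)
    qed
    ultimately show ?thesis using proj_repD(2)[OF pY] by (auto simp: opsimple_def)
  qed
qed

lemma embed_in_nat_fun:
  assumes X: "proj_rep X r" and s: "opsimple H X r"
  shows "\<exists>(Y :: (nat \<Rightarrow> complex) set) t h. proj_rep Y t \<and> opsimple H Y t \<and> lin_iso X Y h \<and> ophom H X r Y t h"
proof -
  obtain Y :: "(nat \<Rightarrow> complex) set" and h where Y: "lin_iso X Y h" "cvec.subspace Y"
    using fin_dim_embedding[OF opsimple_fin_dim[OF X s] proj_repD(1)[OF X]] by blast
  define t where "t a y = h (r a (inv_into X h y))" for a y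
  have "t a (h x) = h (r a x)" if "x \<in> X" for a x
    using that Y(1) by (simp add: t_def lin_iso_def bij_betw_def)
  from proj_rep_iso[OF X Y, of t, OF this] s Y(1) show ?thesis by blast
qed

lemma alg_character_iso:
  assumes X: "alg_module A X \<rho>" and fd: "fin_dim X" and Y: "alg_module A Y \<sigma>" and h: "lin_iso X Y h"
    and hom: "ophom H X (\<lambda>a. \<rho> (bvec a)) Y (\<lambda>a. \<sigma> (bvec a)) h"
  shows "alg_character A X \<rho> = alg_character A Y \<sigma>"
proof -
  note pX = alg_module_proj_rep[OF X] and pY = alg_module_proj_rep[OF Y]
  have "trace_on X (\<rho> x) = trace_on Y (\<sigma> x)" if x: "x \<in> fspace H" for x
  proof (rule trace_on_iso[OF h _ fd])
    show "h (\<rho> x w) = \<sigma> x (h w)" if w: "w \<in> X" for w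
      using ophom_alg_act[OF hom proj_repD(2)[OF pX(1)] w] pX(2)[OF x w] pY(2)[OF x, of "h w"] h w
      by (auto simp: lin_iso_def lin_map_in)
  qed (use X Y x in \<open>auto simp: alg_module_def A_simps\<close>)
  then show ?thesis by (simp add: alg_character_def A_simps fun_eq_iff)
qed

lemma alg_character_alg_act:
  assumes W: "alg_module A W \<rho>" and fd: "fin_dim W"
  shows "alg_character A W (alg_act (\<lambda>a. \<rho> (bvec a))) = alg_character A W \<rho>"
proof -
  have sub: "cvec.subspace W" using W by (simp add: alg_module_def)
  have "trace_on W (\<rho> x) = trace_on W (alg_act (\<lambda>a. \<rho> (bvec a)) x)" if "x \<in> fspace H" for x
    using that W by (intro trace_on_cong[OF fd _ sub]) (auto simp: alg_module_proj_rep(2)[OF W] alg_module_def A_simps)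
  then show ?thesis by (simp add: alg_character_def A_simps fun_eq_iff)
qed

text \<open>If there were no isomorphism, \<open>burnside\<close> would give an algebra element
  acting as the identity on \<open>X\<close> and as zero on \<open>Y\<close>, and the characters
  would differ at it. Both carriers have one type here because \<open>burnside\<close> treats a
  single family; \<open>same_character_iso\<close> removes this restriction.\<close>

lemma same_character_iso_nat:
  fixes X Y :: "(nat \<Rightarrow> complex) set"
  assumes X: "proj_rep X r" "opsimple H X r" and Y: "proj_rep Y s" "opsimple H Y s"
    and ch: "alg_character A X (alg_act r) = alg_character A Y (alg_act s)"
  shows "\<exists>f. lin_iso X Y f \<and> ophom H X r Y s f"
proof (rule ccontr)
  assume no: "\<not> ?thesis"
  define U where "U k = (if k then X else Y)" for k
  define t where "t k = (if k then r else s)" for k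
  have XY: "\<forall>x\<in>X. f x = 0" if "ophom H X r Y s f" for f
    using schur_iso[OF X(2) Y(2) that] that no by blast
  have YX: "\<forall>y\<in>Y. f y = 0" if f: "ophom H Y s X r f" for f
  proof (rule ccontr)
    assume "\<not> ?thesis"
    then have "lin_iso Y X f" using schur_iso[OF Y(2) X(2) f] by blast
    then have "lin_iso X Y (inv_into Y f)" "ophom H X r Y s (inv_into Y f)"
      using lin_iso_inv proj_repD[OF Y(1)] ophom_inv[OF f] by blast+
    then show False using no by blast
  qed
  have "\<exists>x\<in>fspace H. \<forall>k\<in>UNIV. \<forall>u\<in>U k. alg_act (t k) x u = (if k then u else 0)"
  proof (rule burnside)
    show "lin_map (U k) (U k) (\<lambda>u. if k then u else 0)" for k
      using proj_repD(1)[OF X(1)] proj_repD(1)[OF Y(1)]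
      by (auto intro!: lin_mapI simp: U_def cvec.subspace_0)
    show "\<forall>x\<in>U k. f x = 0" if "k \<noteq> l" "ophom H (U k) (t k) (U l) (t l) f" for k l f
      using that XY YX by (auto simp: U_def t_def split: if_splits)
  qed (use X Y in \<open>auto simp: U_def t_def\<close>)
  then obtain x where x: "x \<in> fspace H" "\<And>u. u \<in> X \<Longrightarrow> alg_act r x u = u" "\<And>u. u \<in> Y \<Longrightarrow> alg_act s x u = 0"
    by (auto simp: U_def t_def split: if_splits)
  have "trace_on X (alg_act r x) \<noteq> 0"
    using x X by (intro trace_on_id opsimple_fin_dim[OF X]) (auto simp: proj_repD opsimple_def)
  moreover have "trace_on Y (alg_act s x) = 0"
    using x Y by (intro trace_on_zero opsimple_fin_dim[OF Y]) (auto simp: proj_repD)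
  moreover have "trace_on X (alg_act r x) = trace_on Y (alg_act s x)"
    using fun_cong[OF ch, of x] x(1) by (simp add: alg_character_def A_simps)
  ultimately show False by simp
qed

lemma character_transport:
  fixes X :: "'w::complex_vector set"
  assumes X: "proj_rep X r" "opsimple H X r"
  obtains Y :: "(nat \<Rightarrow> complex) set" and t h where "proj_rep Y t" "opsimple H Y t" "lin_iso X Y h" "ophom H X r Y t h"
    "alg_character A Y (alg_act t) = alg_character A X (alg_act r)"
proof -
  obtain Y :: "(nat \<Rightarrow> complex) set" and t h where Y: "proj_rep Y t" "opsimple H Y t" "lin_iso X Y h" "ophom H X r Y t h"
    using embed_in_nat_fun[OF X] by blast
  have "ophom H X (\<lambda>a. alg_act r (bvec a)) Y (\<lambda>a. alg_act t (bvec a)) h"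
    using Y(4) by (simp add: ophom_def alg_act_bvec)
  then have "alg_character A X (alg_act r) = alg_character A Y (alg_act t)"
    using Y X by (intro alg_character_iso[of X _ Y _ h] proj_rep_alg_module opsimple_fin_dim)
  then show ?thesis using that Y by simp
qed

lemma alg_character_in_irr:
  assumes "proj_rep X r" "opsimple H X r"
  shows "alg_character A X (alg_act r) \<in> irr_characters A"
proof -
  obtain Y :: "(nat \<Rightarrow> complex) set" and t h where Y: "proj_rep Y t" "opsimple H Y t"
    "alg_character A Y (alg_act t) = alg_character A X (alg_act r)"
    using character_transport[OF assms] by metis
  then show ?thesis using opsimple_simple_alg_module[OF Y(1,2)] unfolding irr_characters_def by (metis (mono_tags, lifting) mem_Collect_eq)
qed

lemma same_character_iso:
  fixes X :: "'w::complex_vector set" and Y :: "'x::complex_vector set"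
  assumes X: "proj_rep X r" "opsimple H X r" and Y: "proj_rep Y s" "opsimple H Y s"
    and ch: "alg_character A X (alg_act r) = alg_character A Y (alg_act s)"
  shows "\<exists>f. lin_iso X Y f \<and> ophom H X r Y s f"
proof -
  obtain X' :: "(nat \<Rightarrow> complex) set" and r' f where X': "proj_rep X' r'" "opsimple H X' r'" "lin_iso X X' f" "ophom H X r X' r' f"
    "alg_character A X' (alg_act r') = alg_character A X (alg_act r)" using character_transport[OF X] .
  obtain Y' :: "(nat \<Rightarrow> complex) set" and s' g where Y': "proj_rep Y' s'" "opsimple H Y' s'" "lin_iso Y Y' g" "ophom H Y s Y' s' g"
    "alg_character A Y' (alg_act s') = alg_character A Y (alg_act s)" using character_transport[OF Y] .
  obtain k where k: "lin_iso X' Y' k" "ophom H X' r' Y' s' k"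
    using same_character_iso_nat[OF X'(1,2) Y'(1,2)] X'(5) Y'(5) ch by auto
  have g': "lin_iso Y' Y (inv_into Y g)" "ophom H Y' s' Y s (inv_into Y g)"
    using lin_iso_inv[OF Y'(3)] ophom_inv[OF Y'(4,3)] proj_repD[OF Y(1)] by blast+
  have "lin_iso X Y (\<lambda>x. inv_into Y g (k (f x)))"
    using X'(3) k(1) g'(1) lin_map_comp[OF lin_map_comp, of X X' f Y' k Y "inv_into Y g"]
      bij_betw_trans[OF bij_betw_trans, of f X X' k Y' "inv_into Y g" Y]
    by (simp add: lin_iso_def comp_def)
  moreover have "ophom H X r Y s (\<lambda>x. inv_into Y g (k (f x)))"
    by (rule ophom_comp[OF ophom_comp[OF X'(4) k(2)] g'(2)])
  ultimately show ?thesis by blast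
qed

text \<open>Modules with distinct characters are not isomorphic, so for finitely many of them
  \<open>burnside\<close> yields algebra elements each acting as the identity on one module and as
  zero on the others. Such elements are linearly independent, while the algebra is spanned by
  \<open>card H\<close> vectors.\<close>

lemma finite_irr_characters: "finite (irr_characters A)"
proof (rule ccontr)
  assume "infinite (irr_characters A)"
  then obtain F where F: "F \<subseteq> irr_characters A" "finite F" "card F = Suc (card H)"
    using infinite_arbitrarily_large by blast
  have "\<forall>\<mu>\<in>F. \<exists>(W :: (nat \<Rightarrow> complex) set) \<rho>. simple_alg_module A W \<rho> \<and> alg_character A W \<rho> = \<mu>"
    using F(1) by (auto simp: irr_characters_def subset_iff) blast
  then obtain W :: "_ \<Rightarrow> (nat \<Rightarrow> complex) set" and \<rho> where W: "\<And>\<mu>. \<mu> \<in> F \<Longrightarrow> simple_alg_module A (W \<mu>) (\<rho> \<mu>)"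
    "\<And>\<mu>. \<mu> \<in> F \<Longrightarrow> alg_character A (W \<mu>) (\<rho> \<mu>) = \<mu>" by metis
  define r where "r \<mu> a = \<rho> \<mu> (bvec a)" for \<mu> a
  have m: "alg_module A (W \<mu>) (\<rho> \<mu>)" if "\<mu> \<in> F" for \<mu> using W that by (simp add: simple_alg_module_def)
  have pr: "proj_rep (W \<mu>) (r \<mu>)" and si: "opsimple H (W \<mu>) (r \<mu>)" if "\<mu> \<in> F" for \<mu>
    using alg_module_proj_rep(1)[OF m[OF that]] simple_alg_module_opsimple[OF W(1)[OF that]]
    by (simp_all add: r_def[abs_def])
  have "\<exists>x\<in>fspace H. \<forall>\<nu>\<in>F. \<forall>u\<in>W \<nu>. alg_act (r \<nu>) x u = (if \<nu> = \<mu> then u else 0)" if "\<mu> \<in> F" for \<mu>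
  proof (rule burnside[OF F(2) pr si])
    show "lin_map (W \<nu>) (W \<nu>) (\<lambda>u. if \<nu> = \<mu> then u else 0)" if "\<nu> \<in> F" for \<nu>
      using proj_repD(1)[OF pr[OF that]] by (auto intro!: lin_mapI simp: cvec.subspace_0)
    show "\<forall>x\<in>W k. f x = 0" if "k \<in> F" "l \<in> F" "k \<noteq> l" "ophom H (W k) (r k) (W l) (r l) f" for k l f
    proof (rule ccontr)
      assume "\<not> ?thesis"
      then have "lin_iso (W k) (W l) f" using schur_iso[OF si[OF that(1)] si[OF that(2)] that(4)] by blast
      then have "alg_character A (W k) (\<rho> k) = alg_character A (W l) (\<rho> l)"
        using that by (intro alg_character_iso[OF m opsimple_fin_dim[OF pr si] m]) (auto simp: r_def[abs_def])
      then show False using W that by simp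
    qed
  qed auto
  then obtain x where x: "\<And>\<mu>. \<mu> \<in> F \<Longrightarrow> x \<mu> \<in> fspace H"
    "\<And>\<mu> \<nu> u. \<mu> \<in> F \<Longrightarrow> \<nu> \<in> F \<Longrightarrow> u \<in> W \<nu> \<Longrightarrow> alg_act (r \<nu>) (x \<mu>) u = (if \<nu> = \<mu> then u else 0)"
    by metis
  have "card (bvec ` H) < card F"
    using F(3) card_image_le[OF finite_H, of bvec] by simp
  moreover have "x \<mu> \<in> cvec.span (bvec ` H)" if "\<mu> \<in> F" for \<mu>
    using x(1)[OF that] fspace_eq_span[OF finite_H] by simp
  ultimately have "\<exists>c. (\<exists>\<mu>\<in>F. c \<mu> \<noteq> 0) \<and> (\<Sum>\<mu>\<in>F. c \<mu> *\<^sub>C x \<mu>) = 0"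
    by (rule family_dependent[OF F(2) finite_imageI[OF finite_H]])
  then obtain c where c: "\<exists>\<mu>\<in>F. c \<mu> \<noteq> 0" "(\<Sum>\<mu>\<in>F. c \<mu> *\<^sub>C x \<mu>) = 0"
    by (elim exE conjE)
  then obtain \<nu> where \<nu>: "\<nu> \<in> F" "c \<nu> \<noteq> 0" by blast
  obtain u where u: "u \<in> W \<nu>" "u \<noteq> 0"
    using si[OF \<nu>(1)] proj_repD(1)[OF pr[OF \<nu>(1)]] cvec.subspace_0 by (auto simp: opsimple_def)
  have "0 = alg_act (r \<nu>) (\<Sum>\<mu>\<in>F. c \<mu> *\<^sub>C x \<mu>) u" unfolding c(2) by (simp add: alg_act_def)
  also have "\<dots> = (\<Sum>\<mu>\<in>F. c \<mu> *\<^sub>C (if \<nu> = \<mu> then u else 0))"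
    unfolding alg_act_sum using x(2) \<nu>(1) u(1) by (intro sum.cong) auto
  also have "\<dots> = (\<Sum>\<mu>\<in>F. if \<nu> = \<mu> then c \<nu> *\<^sub>C u else 0)" by (intro sum.cong) auto
  also have "\<dots> = c \<nu> *\<^sub>C u" using F(2) \<nu>(1) by simp
  finally show False using \<nu>(2) u(2) by simp
qed

text \<open>Choose by \<open>burnside\<close> an algebra element acting on \<open>U k0\<close> as
  the map that sends \<open>b0\<close> to \<open>u\<close> and the other basis vectors to zero, and
  as zero on the other modules. Applied to the relation it leaves the single term
  \<open>f k0 b0 u\<close>.\<close>

lemma isotypic_independent:
  assumes K: "finite K" and U: "\<And>k. k \<in> K \<Longrightarrow> proj_rep (U k) (r k)" and simple: "\<And>k. k \<in> K \<Longrightarrow> opsimple H (U k) (r k)"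
    and noniso: "\<And>k l f. k \<in> K \<Longrightarrow> l \<in> K \<Longrightarrow> k \<noteq> l \<Longrightarrow> ophom H (U k) (r k) (U l) (r l) f \<Longrightarrow> \<forall>x\<in>U k. f x = 0"
    and B: "\<And>k. k \<in> K \<Longrightarrow> finite (B k) \<and> cvec.independent (B k) \<and> cvec.span (B k) = U k"
    and X: "proj_rep X s" and f: "\<And>k b. k \<in> K \<Longrightarrow> b \<in> B k \<Longrightarrow> ophom H (U k) (r k) X s (f k b)"
    and 0: "(\<Sum>k\<in>K. \<Sum>b\<in>B k. f k b b) = 0" and k0: "k0 \<in> K" "b0 \<in> B k0" "u \<in> U k0"
  shows "f k0 b0 u = 0"
proof -
  have BU: "b \<in> U k" if "k \<in> K" "b \<in> B k" for k b using B that cvec.span_base by blast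
  let ?T = "\<lambda>k v. if k = k0 then cvec.representation (B k0) v b0 *\<^sub>C u else 0"
  have "\<exists>x\<in>fspace H. \<forall>k\<in>K. \<forall>v\<in>U k. alg_act (r k) x v = ?T k v"
  proof (rule burnside[OF K U simple noniso])
    show "lin_map (U k) (U k) (?T k)" if "k \<in> K" for k
      using B[OF k0(1)] k0 proj_repD(1)[OF U[OF that]]
      by (auto intro!: lin_mapI cvec.subspace_scale simp: cvec.subspace_0 cvec.representation_add cvec.representation_scale
          scaleC_add_left)
  qed
  then obtain x where x: "x \<in> fspace H" "\<And>k v. k \<in> K \<Longrightarrow> v \<in> U k \<Longrightarrow> alg_act (r k) x v = ?T k v" by blast
  have ls: "lin_map X X (alg_act s x)" by (rule lin_map_alg_act[OF proj_repD(2)[OF X]])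
  note X0 = proj_repD(1)[OF X]
  have fX: "f k b b \<in> X" if "k \<in> K" "b \<in> B k" for k b
    using f[OF that] BU[OF that] by (auto simp: ophom_def lin_map_in)
  have inner: "(\<Sum>b\<in>B k. f k b b) \<in> X" if "k \<in> K" for k
    using fX[OF that] by (rule cvec.subspace_sum[OF X0])
  have "0 = alg_act s x (\<Sum>k\<in>K. \<Sum>b\<in>B k. f k b b)" using 0 lin_map_zero[OF ls X0] by simp
  also have "\<dots> = (\<Sum>k\<in>K. alg_act s x (\<Sum>b\<in>B k. f k b b))" using inner by (rule lin_map_sum[OF ls X0])
  also have "\<dots> = (\<Sum>k\<in>K. \<Sum>b\<in>B k. if k = k0 \<and> b = b0 then f k0 b0 u else 0)"
  proof (rule sum.cong[OF refl])
    fix k assume k: "k \<in> K"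
    have "alg_act s x (\<Sum>b\<in>B k. f k b b) = (\<Sum>b\<in>B k. alg_act s x (f k b b))"
      using fX[OF k] by (rule lin_map_sum[OF ls X0])
    also have "\<dots> = (\<Sum>b\<in>B k. if k = k0 \<and> b = b0 then f k0 b0 u else 0)"
    proof (rule sum.cong[OF refl])
      fix b assume b: "b \<in> B k"
      have "alg_act s x (f k b b) = f k b (?T k b)"
        using ophom_alg_act[OF f[OF k b] proj_repD(2)[OF U[OF k]] BU[OF k b], of x] x(2)[OF k BU[OF k b]] by simp
      also have "\<dots> = (if k = k0 \<and> b = b0 then f k0 b0 u else 0)"
      proof -
        have fl: "lin_map (U k) X (f k b)" using f[OF k b] by (simp add: ophom_def)
        show ?thesis using B[OF k0(1)] b k0(3) lin_map_zero[OF fl proj_repD(1)[OF U[OF k]]]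
          by (auto simp: cvec.representation_basis)
      qed
      finally show "alg_act s x (f k b b) = (if k = k0 \<and> b = b0 then f k0 b0 u else 0)" .
    qed
    finally show "alg_act s x (\<Sum>b\<in>B k. f k b b) = (\<Sum>b\<in>B k. if k = k0 \<and> b = b0 then f k0 b0 u else 0)" .
  qed
  also have "\<dots> = (\<Sum>k\<in>K. if k = k0 then f k0 b0 u else 0)"
    using B k0(2) by (intro sum.cong) auto
  also have "\<dots> = f k0 b0 u" using K k0(1) by simp
  finally show ?thesis by simp
qed

text \<open>Maschke's argument by contradiction. Averaging a linear projection onto
  \<open>?Q\<close> gives a homomorphism whose kernel is a complement. A vector outside
  \<open>?Q\<close> makes this kernel nonzero, so it contains a simple submodule, which by
  \<open>all\<close> is the image of some \<open>U k\<close> and hence lies in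
  \<open>?Q\<close>.\<close>

lemma isotypic_span:
  assumes X: "proj_rep X s"
    and all: "\<And>N. opsub H X s N \<Longrightarrow> opsimple H N s \<Longrightarrow> \<exists>k\<in>K. \<exists>f. lin_iso (U k) N f \<and> ophom H (U k) (r k) N s f"
    and U: "\<And>k. k \<in> K \<Longrightarrow> proj_rep (U k) (r k)" and x: "x \<in> X"
  shows "x \<in> cvec.span {f u |k f u. k \<in> K \<and> u \<in> U k \<and> ophom H (U k) (r k) X s f}"
    (is "x \<in> cvec.span ?G")
proof (rule ccontr)
  let ?Q = "cvec.span ?G"
  assume xQ: "x \<notin> ?Q"
  note X0 = proj_repD(1)[OF X]
  have QX: "?Q \<subseteq> X" by (rule cvec.span_minimal[OF _ X0]) (auto simp: ophom_def lin_map_in)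
  have "s a y \<in> ?Q" if a: "a \<in> H" and y: "y \<in> ?Q" for a y
  proof (rule lin_map_span_image[OF proj_repD(3)[OF X a] X0 y])
    fix b assume "b \<in> ?G"
    then obtain k f u where b: "b = f u" "k \<in> K" "u \<in> U k" "ophom H (U k) (r k) X s f" by blast
    then have "s a b = f (r k a u)" using a by (auto simp: ophom_def)
    then show "s a b \<in> ?Q" using b proj_repD(4)[OF U[OF b(2)] a b(3)] by (auto intro!: cvec.span_base)
  qed (auto simp: ophom_def lin_map_in)
  then have Qsub: "opsub H X s ?Q" using QX by (auto simp: opsub_def)
  have pQ: "proj_rep ?Q s" by (rule proj_rep_sub[OF X Qsub])
  obtain \<pi> where \<pi>: "lin_map UNIV ?Q \<pi>" "\<And>y. y \<in> ?Q \<Longrightarrow> \<pi> y = y"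
    using linear_extension[of ?Q] by auto
  define G where "G = average s s \<pi>"
  have hG: "ophom H X s ?Q s G" unfolding G_def
    by (rule average_hom[OF X pQ]) (use \<pi>(1) in \<open>auto simp: lin_map_def\<close>)
  have Gq: "G q = of_nat (card H) *\<^sub>C q" if q: "q \<in> ?Q" for q
  proof -
    have "G q = (\<Sum>a\<in>H. s a (rep_inv s a q))"
      unfolding G_def average_def using rep_inv_in[OF pQ _ q] \<pi>(2) by (intro sum.cong) auto
    also have "\<dots> = (\<Sum>a\<in>H. q)" using rep_inv_right[OF pQ _ q] by (intro sum.cong) auto
    finally show ?thesis by (simp add: cvec.sum_constant_scale)
  qed
  have cH: "of_nat (card H) \<noteq> (0::complex)" using finite_H id_in by auto
  have lG: "lin_map X ?Q G" using hG by (simp add: ophom_def)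
  \<comment> \<open>The component of \<open>x\<close> in the complement: \<open>G\<close> multiplies
    \<open>?Q\<close> by \<open>card H\<close>, so dividing by this number makes \<open>G c\<close>
    vanish.\<close>
  define c where "c = x - inverse (of_nat (card H)) *\<^sub>C G x"
  have GxQ: "G x \<in> ?Q" using lin_map_in[OF lG x] .
  have cX: "c \<in> X" unfolding c_def using x GxQ QX by (intro cvec.subspace_diff[OF X0] cvec.subspace_scale[OF X0]) auto
  have "G c = G x - inverse (of_nat (card H)) *\<^sub>C G (G x)"
    unfolding c_def using x GxQ QX
    by (subst lin_map_diff[OF lG X0]) (auto simp: lin_map_scale[OF lG] intro: cvec.subspace_scale[OF X0])
  also have "\<dots> = 0" using Gq[OF GxQ] cH by simp
  finally have Gc: "G c = 0" .
  have c0: "c \<noteq> 0"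
  proof
    assume "c = 0"
    then have e: "x = inverse (of_nat (card H)) *\<^sub>C G x" by (simp add: c_def)
    have "inverse (of_nat (card H)) *\<^sub>C G x \<in> ?Q" by (rule cvec.span_scale[OF GxQ])
    then have "x \<in> ?Q" unfolding e[symmetric] .
    then show False using xQ by contradiction
  qed
  let ?C = "{y \<in> X. G y = 0}"
  have Csub: "opsub H X s ?C" by (rule ophom_kernel[OF hG proj_repD(2)[OF X] proj_repD(2)[OF pQ]])
  have pC: "proj_rep ?C s" by (rule proj_rep_sub[OF X Csub])
  obtain N where N: "opsub H ?C s N" "opsimple H N s"
    using simple_sub_exists[OF pC, of c] cX Gc c0 by blast
  have NX: "opsub H X s N" using N(1) by (auto simp: opsub_def)
  obtain k f where kf: "k \<in> K" "lin_iso (U k) N f" "ophom H (U k) (r k) N s f" using all[OF NX N(2)] by blast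
  have fX: "ophom H (U k) (r k) X s f" using kf(3) NX by (auto simp: ophom_def opsub_def lin_map_def)
  have "n = 0" if n: "n \<in> N" for n
  proof -
    have "n \<in> f ` U k" using n kf(2) by (auto simp: lin_iso_def bij_betw_def)
    then obtain u where u: "n = f u" "u \<in> U k" by (rule imageE)
    have "f u \<in> ?Q" using kf(1) fX u(2) by (intro cvec.span_base) blast
    then have "n \<in> ?Q" unfolding u(1) .
    then have "G n = of_nat (card H) *\<^sub>C n" by (rule Gq)
    moreover have "G n = 0" using n N(1) by (auto simp: opsub_def)
    ultimately show ?thesis using cH by simp
  qed
  then have "N = {0}" using N(1) cvec.subspace_0 by (auto simp: opsub_def)
  then show False using N(2) by (simp add: opsimple_def)
qed

text \<open>Average the rank one map \<open>w \<mapsto> l w *\<^sub>C x\<close> for a functional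
  \<open>l\<close> that does not vanish at the given vector. The value there is a combination of the
  \<open>s a x\<close> with coefficient \<open>l w\<close> at the identity, so by \<open>ind\<close>
  it cannot be zero for every choice of \<open>x\<close>.\<close>

lemma nonzero_hom_exists:
  assumes W: "proj_rep W r" and w: "w \<in> W" "w \<noteq> 0" and X: "proj_rep X s"
    and ind: "\<And>c. (\<And>x. x \<in> X \<Longrightarrow> (\<Sum>a\<in>H. c a *\<^sub>C s a x) = 0) \<Longrightarrow> c id = 0"
  shows "\<exists>f. ophom H W r X s f \<and> f w \<noteq> 0"
proof -
  obtain l where l: "lin_map UNIV (UNIV :: complex set) l" "l w \<noteq> 0" using functional_separates[OF w(2)] by blast
  have "rep_inv r id w = w" using rep_inv_left[OF W id_in w(1)] proj_repD(5)[OF W w(1)] by simp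
  then have "\<not> (\<forall>x\<in>X. (\<Sum>a\<in>H. l (rep_inv r a w) *\<^sub>C s a x) = 0)"
    using ind[of "\<lambda>a. l (rep_inv r a w)"] l(2) by auto
  then obtain x where x: "x \<in> X" "(\<Sum>a\<in>H. l (rep_inv r a w) *\<^sub>C s a x) \<noteq> 0" by blast
  have f: "lin_map W X (\<lambda>w. l w *\<^sub>C x)"
    using x(1) proj_repD(1)[OF X]
    by (auto intro!: lin_mapI cvec.subspace_scale simp: lin_map_add[OF l(1)] lin_map_scale[OF l(1)] scaleC_add_left)
  have "average r s (\<lambda>w. l w *\<^sub>C x) w = (\<Sum>a\<in>H. l (rep_inv r a w) *\<^sub>C s a x)"
    unfolding average_def
    by (intro sum.cong refl lin_map_scale[OF proj_repD(3)[OF X] x(1)])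
  then show ?thesis using average_hom[OF W X f] x(2) by metis
qed

end

section \<open>Stable sets of twisted modules\<close>

text \<open>Lagrange's theorem for the cyclic group generated by \<open>g\<close>: the orbits of
  \<open>H\<close> under left multiplication by powers of \<open>g\<close> partition
  \<open>H\<close> and all have \<open>n\<close> elements, where \<open>n\<close> is the order of
  \<open>g\<close>.\<close>

lemma (in perm_group) power_card_eq_id:
  assumes g: "g \<in> H"
  shows "g ^^ card H = id"
proof -
  have gk: "g ^^ k \<in> H" for k by (induction k) (simp_all only: funpow.simps id_in comp_in g)
  have cancel: "g ^^ (j - i) = id" if "i < j" "g ^^ i = g ^^ j" for i j
  proof -
    have "g ^^ i \<circ> g ^^ (j - i) = g ^^ (i + (j - i))" by (rule funpow_add[symmetric])
    also have "\<dots> = g ^^ j" using that(1) by simp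
    also have "\<dots> = g ^^ i \<circ> id" using that(2) by simp
    finally have "inv (g ^^ i) \<circ> (g ^^ i \<circ> g ^^ (j - i)) = inv (g ^^ i) \<circ> (g ^^ i \<circ> id)" by simp
    then show ?thesis by (simp only: comp_cancel(2)[OF gk])
  qed
  have "\<not> inj_on (\<lambda>k. g ^^ k) {..card H}"
  proof
    assume "inj_on (\<lambda>k. g ^^ k) {..card H}"
    then have "card {..card H} \<le> card H" by (rule card_inj_on_le) (use gk finite_H in auto)
    then show False by simp
  qed
  then obtain i j where ij: "i < j" "g ^^ i = g ^^ j" unfolding inj_on_def by (metis linorder_neqE_nat)
  have "g ^^ (j - i) = id" using ij by (rule cancel)
  then have ex: "\<exists>n>0. g ^^ n = id" using ij(1) by (intro exI[of _ "j - i"]) simp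
  define n where "n = (LEAST n. n > 0 \<and> g ^^ n = id)"
  have n: "n > 0" "g ^^ n = id" using LeastI_ex[OF ex] by (auto simp: n_def)
  have min: "g ^^ k \<noteq> id" if "0 < k" "k < n" for k using not_less_Least[of k] that by (auto simp: n_def)
  have mod: "g ^^ k = g ^^ (k mod n)" for k
  proof -
    have "g ^^ k = g ^^ (n * (k div n)) \<circ> g ^^ (k mod n)" by (simp add: funpow_add[symmetric])
    also have "g ^^ (n * (k div n)) = id" by (simp add: funpow_mult[symmetric] n)
    finally show ?thesis by simp
  qed
  have inj: "inj_on (\<lambda>k. g ^^ k) {..<n}"
  proof (rule linorder_inj_onI)
    fix i j assume "i < j" "i \<in> {..<n}" "j \<in> {..<n}"
    show "g ^^ i \<noteq> g ^^ j"
    proof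
      assume e: "g ^^ i = g ^^ j"
      have "g ^^ (j - i) = id" using \<open>i < j\<close> e by (rule cancel)
      moreover have "0 < j - i" "j - i < n"
        using \<open>i < j\<close> \<open>j \<in> {..<n}\<close> by (simp_all add: less_imp_diff_less)
      ultimately show False using min[of "j - i"] by blast
    qed
  qed auto
  define R where "R = {(a, b) \<in> H \<times> H. \<exists>k. b = g ^^ k \<circ> a}"
  have cl: "R `` {a} = (\<lambda>k. g ^^ k \<circ> a) ` {..<n}" if a: "a \<in> H" for a
  proof -
    have "g ^^ k \<circ> a \<in> (\<lambda>k. g ^^ k \<circ> a) ` {..<n}" for k
      by (rule image_eqI[of _ _ "k mod n"]) (use mod[of k] n(1) in auto)
    then show ?thesis using a gk comp_in by (auto simp: R_def)
  qed
  have "equiv H R"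
  proof (rule equivI)
    show "refl_on H R" by (auto simp: refl_on_def R_def intro!: exI[of _ 0])
    show "sym R"
    proof (rule symI)
      fix a b assume "(a, b) \<in> R"
      then obtain k where k: "a \<in> H" "b \<in> H" "b = g ^^ k \<circ> a" by (auto simp: R_def)
      \<comment> \<open>The inverse of \<open>g ^^ k\<close> as a nonnegative power: composing it
        with \<open>g ^^ ((n - 1) * k)\<close> gives \<open>g ^^ (n * k)\<close>, the
        identity.\<close>
      have "g ^^ ((n - 1) * k) \<circ> b = g ^^ (n * k) \<circ> a"
        using n(1) by (simp add: k(3) comp_assoc[symmetric] funpow_add[symmetric] algebra_simps diff_mult_distrib)
      also have "\<dots> = a" by (simp add: funpow_mult[symmetric] n)
      finally show "(b, a) \<in> R" using k unfolding R_def by (auto intro!: exI[of _ "(n - 1) * k"])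
    qed
    show "trans R"
    proof (rule transI)
      fix a b c assume "(a, b) \<in> R" "(b, c) \<in> R"
      then obtain k l where "a \<in> H" "c \<in> H" "b = g ^^ k \<circ> a" "c = g ^^ l \<circ> b" by (auto simp: R_def)
      then show "(a, c) \<in> R" by (auto simp: R_def comp_assoc[symmetric] funpow_add[symmetric])
    qed
  qed (auto simp: R_def)
  moreover have "n dvd card X" if X: "X \<in> H // R" for X
  proof -
    obtain a where a: "a \<in> H" "X = R `` {a}" using X by (auto simp: quotient_def)
    have "inj_on (\<lambda>k. g ^^ k \<circ> a) {..<n}"
    proof (rule inj_onI)
      fix x y assume xy: "x \<in> {..<n}" "y \<in> {..<n}" "g ^^ x \<circ> a = g ^^ y \<circ> a"
      then have "(g ^^ x \<circ> a) \<circ> inv a = (g ^^ y \<circ> a) \<circ> inv a" by simp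
      then have "g ^^ x = g ^^ y" by (simp only: comp_cancel_right(1)[OF a(1)])
      then show "x = y" using inj xy by (auto simp: inj_on_def)
    qed
    then have "card X = n" using cl[OF a(1)] a(2) by (simp add: card_image)
    then show ?thesis by simp
  qed
  ultimately have "n dvd card H" using equiv_imp_dvd_card[OF finite_H] by blast
  then obtain q where "card H = n * q" by (auto simp: dvd_def)
  then show ?thesis by (simp add: funpow_mult[symmetric] n)
qed

text \<open>Discrete Fourier inversion on the cyclic group of order \<open>T\<close>:
  \<open>p r\<close> is the projection of \<open>u\<close> to the eigenvalue
  \<open>inverse (\<omega> ^ r)\<close>, which is the sign convention of
  \<open>eigenspace_aut\<close>.\<close>

lemma eigenspace_decomposition:
  assumes lin: "lin_map (vspace V) (vspace V) g" and sub: "cvec.subspace (vspace V)" and T: "T > 0"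
    and gT: "\<And>u. u \<in> vspace V \<Longrightarrow> (g ^^ T) u = u" and u: "u \<in> vspace V"
  shows "\<exists>p. (\<forall>r<T. p r \<in> eigenspace_aut V g T r) \<and> u = (\<Sum>r<T. p r)"
proof -
  define \<omega> where "\<omega> = cis (2 * pi / real T)"
  have \<omega>0: "\<omega> \<noteq> 0" by (simp add: \<omega>_def)
  have \<omega>k: "\<omega> ^ k = cis (2 * pi * real k / real T)" for k by (simp add: \<omega>_def Complex.DeMoivre mult_ac)
  have \<omega>T: "\<omega> ^ T = 1" using T by (simp add: \<omega>k)
  have \<omega>1: "\<omega> ^ j \<noteq> 1" if j: "0 < j" "j < T" for j
  proof
    assume "\<omega> ^ j = 1"
    then have "cis (2 * pi * real j / real T) = cis (2 * pi * real 0 / real T)" by (simp add: \<omega>k)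
    moreover have "inj_on (\<lambda>k. cis (2 * pi * real k / real T)) {..<T}"
      using bij_betw_roots_unity[OF T] by (simp add: bij_betw_def)
    ultimately have "j = 0" using j by (intro inj_onD[of "\<lambda>k. cis (2 * pi * real k / real T)" "{..<T}"]) auto
    then show False using j by simp
  qed
  have gk: "(g ^^ k) u \<in> vspace V" for k by (induction k) (use u lin_map_in[OF lin] in auto)
  define F where "F r j = \<omega> ^ (r * j) *\<^sub>C (g ^^ j) u" for r j
  have FV: "F r j \<in> vspace V" for r j unfolding F_def by (intro cvec.subspace_scale[OF sub] gk)
  define p where "p r = inverse (of_nat T) *\<^sub>C (\<Sum>j<T. F r j)" for r
  have pV: "p r \<in> vspace V" for r
    unfolding p_def by (intro cvec.subspace_scale[OF sub] cvec.subspace_sum[OF sub] FV)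
  have "g (p r) = exp (- (2 * of_real pi * \<i> * of_nat r / of_nat T)) *\<^sub>C p r" for r
  proof -
    have gF: "g (F r j) = inverse (\<omega> ^ r) *\<^sub>C F r (Suc j)" for j
    proof -
      have "g (F r j) = \<omega> ^ (r * j) *\<^sub>C (g ^^ Suc j) u"
        unfolding F_def using lin_map_scale[OF lin gk] by simp
      then show ?thesis using \<omega>0 by (simp add: F_def power_add)
    qed
    \<comment> \<open>The shift of the summation index is cyclic: the term \<open>j = T\<close>
      equals the term \<open>j = 0\<close>, since \<open>\<omega> ^ T = 1\<close> and
      \<open>g ^^ T\<close> fixes \<open>u\<close>.\<close>
    have "(\<Sum>j<T. F r (Suc j)) = (\<Sum>j<Suc T. F r j) - F r 0"
      by (subst sum.lessThan_Suc_shift) simp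
    also have "\<dots> = (\<Sum>j<T. F r j)"
    proof -
      have "\<omega> ^ (r * T) = 1" by (metis \<omega>T mult.commute power_mult power_one)
      then show ?thesis using gT[OF u] by (simp add: F_def)
    qed
    finally have sh: "(\<Sum>j<T. F r (Suc j)) = (\<Sum>j<T. F r j)" .
    have "g (p r) = inverse (of_nat T) *\<^sub>C g (\<Sum>j<T. F r j)"
      unfolding p_def by (intro lin_map_scale[OF lin] cvec.subspace_sum[OF sub] FV)
    also have "g (\<Sum>j<T. F r j) = (\<Sum>j<T. g (F r j))" using FV by (intro lin_map_sum[OF lin sub])
    also have "\<dots> = inverse (\<omega> ^ r) *\<^sub>C (\<Sum>j<T. F r j)"
      by (simp add: gF cvec.scale_sum_right[symmetric] sh)
    finally have "g (p r) = inverse (\<omega> ^ r) *\<^sub>C p r" by (simp add: p_def mult.commute)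
    moreover have "inverse (\<omega> ^ r) = exp (- (2 * of_real pi * \<i> * of_nat r / of_nat T))"
      by (simp add: \<omega>k cis_conv_exp exp_minus mult_ac)
    ultimately show ?thesis by simp
  qed
  then have "\<forall>r<T. p r \<in> eigenspace_aut V g T r" using pV by (simp add: eigenspace_aut_def)
  moreover have "u = (\<Sum>r<T. p r)"
  proof -
    \<comment> \<open>Orthogonality of the roots of unity: after exchanging the sums only
      \<open>j = 0\<close> survives, which contributes \<open>u\<close> with multiplicity
      \<open>T\<close>.\<close>
    have geo: "(\<Sum>r<T. \<omega> ^ (r * j)) = (if j = 0 then of_nat T else 0)" if "j < T" for j
    proof (cases "j = 0")
      case False
      have "(\<Sum>r<T. (\<omega> ^ j) ^ r) = (1 - (\<omega> ^ j) ^ T) / (1 - \<omega> ^ j)"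
        using \<omega>1[of j] that False by (intro sum_gp_strict[THEN trans]) auto
      also have "(\<omega> ^ j) ^ T = 1" by (metis \<omega>T mult.commute power_mult power_one)
      finally show ?thesis using False by (simp add: power_mult[symmetric] mult.commute)
    qed simp
    have "(\<Sum>r<T. p r) = inverse (of_nat T) *\<^sub>C (\<Sum>j<T. (\<Sum>r<T. \<omega> ^ (r * j)) *\<^sub>C (g ^^ j) u)"
      unfolding p_def F_def cvec.scale_sum_right[symmetric] cvec.scale_sum_left by (subst sum.swap) simp
    also have "(\<Sum>j<T. (\<Sum>r<T. \<omega> ^ (r * j)) *\<^sub>C (g ^^ j) u) = (\<Sum>j<T. if j = 0 then of_nat T *\<^sub>C u else 0)"
      using geo by (intro sum.cong) auto
    also have "\<dots> = of_nat T *\<^sub>C u" using T by simp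
    finally show ?thesis using T by simp
  qed
  ultimately show ?thesis by blast
qed

section \<open>Isomorphism and twisting of modules\<close>

lemma tmod_iso_refl: "tmod_iso V M M"
  by (auto simp: tmod_iso_def lin_iso_def lin_map_def intro!: exI[of _ "\<lambda>x. x"] bij_betwI[where g = "\<lambda>x. x"])

lemma tmod_iso_trans:
  assumes "tmod_iso V M N" "tmod_iso V N K"
  shows "tmod_iso V M K"
proof -
  obtain f g where f: "lin_iso (mspace M) (mspace N) f" "\<forall>u\<in>vspace V. \<forall>k. \<forall>w\<in>mspace M. f (mmode M u k w) = mmode N u k (f w)"
    and g: "lin_iso (mspace N) (mspace K) g" "\<forall>u\<in>vspace V. \<forall>k. \<forall>w\<in>mspace N. g (mmode N u k w) = mmode K u k (g w)"
    using assms by (auto simp: tmod_iso_def)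
  have "lin_iso (mspace M) (mspace K) (g \<circ> f)"
    using f(1) g(1) bij_betw_trans by (auto simp: lin_iso_def lin_map_def)
  moreover have "\<forall>u\<in>vspace V. \<forall>k. \<forall>w\<in>mspace M. (g \<circ> f) (mmode M u k w) = mmode K u k ((g \<circ> f) w)"
    using f g by (auto simp: lin_iso_def lin_map_def)
  ultimately show ?thesis by (auto simp: tmod_iso_def)
qed

lemma tmod_iso_sym:
  assumes iso: "tmod_iso V M N" and sub: "cvec.subspace (mspace M)"
    and cl: "\<And>u k w. u \<in> vspace V \<Longrightarrow> w \<in> mspace M \<Longrightarrow> mmode M u k w \<in> mspace M"
  shows "tmod_iso V N M"
proof -
  obtain f where f: "lin_iso (mspace M) (mspace N) f" "\<And>u k w. u \<in> vspace V \<Longrightarrow> w \<in> mspace M \<Longrightarrow> f (mmode M u k w) = mmode N u k (f w)"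
    using iso by (auto simp: tmod_iso_def)
  have b: "bij_betw f (mspace M) (mspace N)" using f(1) by (simp add: lin_iso_def)
  let ?g = "inv_into (mspace M) f"
  have "?g (mmode N u k y) = mmode M u k (?g y)" if u: "u \<in> vspace V" and y: "y \<in> mspace N" for u k y
  proof (rule inv_into_f_eq)
    have gy: "?g y \<in> mspace M" "f (?g y) = y" using b y by (auto simp: bij_betw_def inv_into_into f_inv_into_f)
    show "mmode M u k (?g y) \<in> mspace M" using cl[OF u gy(1)] .
    show "f (mmode M u k (?g y)) = mmode N u k y" using f(2)[OF u gy(1)] gy(2) by simp
  qed (use b in \<open>simp add: bij_betw_def\<close>)
  then show ?thesis using lin_iso_inv[OF f(1) sub] by (auto simp: tmod_iso_def)
qed

lemma twist_simps [simp]: "mspace (twist M a) = mspace M" "mmode (twist M a) u = mmode M (a u)"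
  by (simp_all add: twist_def)

lemma twist_twist: "twist (twist M a) b = twist M (a \<circ> b)"
  by (simp add: twist_def comp_def)

lemma twist_id: "twist M id = M"
  by (simp add: twist_def)

lemma tmod_iso_twist:
  assumes "tmod_iso V M N" "\<And>u. u \<in> vspace V \<Longrightarrow> a u \<in> vspace V"
  shows "tmod_iso V (twist M a) (twist N a)"
  using assms by (auto simp: tmod_iso_def)

lemma fixed_voa_simps [simp]: "vspace (fixed_voa V G) = {v \<in> vspace V. \<forall>a\<in>G. a v = v}"
  "vmode (fixed_voa V G) = vmode V" "vac (fixed_voa V G) = vac V" "conf (fixed_voa V G) = conf V"
  by (simp_all add: fixed_voa_def)

locale automorphism_group =
  fixes V :: "'v::complex_vector voa" and G :: "('v \<Rightarrow> 'v) set"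
  assumes voa: "vertex_operator_algebra V" and simple: "simple_voa V" and group: "finite_aut_group V G"
begin

lemma autD:
  assumes "a \<in> G"
  shows "a permutes vspace V" "lin_map (vspace V) (vspace V) a" "a (vac V) = vac V" "a (conf V) = conf V"
    "u \<in> vspace V \<Longrightarrow> a u \<in> vspace V"
  using group assms by (auto simp: finite_aut_group_def voa_aut_def lin_map_in)

sublocale perm_group G
  using group by unfold_locales (auto simp: finite_aut_group_def voa_aut_def permutes_bij)

lemma subspace_V: "cvec.subspace (vspace V)"
  using voa by (simp add: vertex_operator_algebra_def)

lemma vac_V: "vac V \<in> vspace V" and conf_V: "conf V \<in> vspace V"
  using voa by (simp_all add: vertex_operator_algebra_def)

lemma aut_eqI:
  assumes "a \<in> G" "b \<in> G" "\<And>u. u \<in> vspace V \<Longrightarrow> a u = b u"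
  shows "a = b"
proof
  fix u show "a u = b u"
    using assms(3)[of u] permutes_not_in[OF autD(1)[OF assms(1)], of u] permutes_not_in[OF autD(1)[OF assms(2)], of u]
    by (cases "u \<in> vspace V") auto
qed

lemma twisted_decomposedI:
  assumes g: "g \<in> G" and M: "irreducible_twisted V g (card G) M"
  shows "twisted_decomposed V g (card G) M"
proof -
  have tm: "twisted_module V g (card G) M" using M by (simp add: irreducible_twisted_def)
  have T: "card G > 0" using finite_H id_in by (auto simp: card_gt_0_iff)
  have "\<exists>p. (\<forall>r<card G. p r \<in> eigenspace_aut V g (card G) r) \<and> u = (\<Sum>r<card G. p r)" if "u \<in> vspace V" for u
    by (rule eigenspace_decomposition[OF autD(2)[OF g] subspace_V T _ that]) (simp add: power_card_eq_id[OF g])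
  then show ?thesis using voa tm T by (simp add: twisted_decomposed_def twisted_decomposed_axioms_def)
qed

lemma irreducibleD:
  assumes "irreducible_twisted V g T M"
  shows "cvec.subspace (mspace M)" "mspace M \<noteq> {0}"
    "u \<in> vspace V \<Longrightarrow> w \<in> mspace M \<Longrightarrow> mmode M u k w \<in> mspace M"
    "u \<in> vspace V \<Longrightarrow> lin_map (mspace M) (mspace M) (mmode M u k)"
  using assms twisted_module.mode_linear[of V g T M u k] twisted_module.subspace[of V g T M]
  by (auto simp: irreducible_twisted_def lin_map_in)

end

section \<open>The action of the group on a stable set\<close>

locale stable_modules = automorphism_group V G for V :: "'v::complex_vector voa" and G +
  fixes S :: "('v, 'm::complex_vector) tpair set"
  assumes stable: "stable_set V G S"
begin

abbreviation Msp :: "('v, 'm) tpair \<Rightarrow> 'm set" where "Msp p \<equiv> mspace (snd p)"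
abbreviation Mm :: "('v, 'm) tpair \<Rightarrow> 'v \<Rightarrow> rat \<Rightarrow> 'm \<Rightarrow> 'm" where "Mm p \<equiv> mmode (snd p)"
abbreviation lact :: "('v \<Rightarrow> 'v) \<Rightarrow> ('v, 'm) tpair \<Rightarrow> ('v, 'm) tpair" where "lact a p \<equiv> pact V S p (inv a)"

lemma finite_S: "finite S"
  using stable by (simp add: stable_set_def)

lemma S_D:
  assumes "p \<in> S"
  shows "fst p \<in> G" "irreducible_twisted V (fst p) (card G) (snd p)"
proof -
  obtain g M where p: "p = (g, M)" by (cases p)
  have "\<forall>(g, M)\<in>S. g \<in> G \<and> irreducible_twisted V g (card G) M" using stable unfolding stable_set_def by (elim conjE)
  then show "fst p \<in> G" "irreducible_twisted V (fst p) (card G) (snd p)" using assms p by auto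
qed

lemma S_eqI:
  assumes "p \<in> S" "q \<in> S" "fst p = fst q" "tmod_iso V (snd p) (snd q)"
  shows "p = q"
proof -
  obtain g M where p: "p = (g, M)" by (cases p)
  obtain h N where q: "q = (h, N)" by (cases q)
  show ?thesis using stable assms unfolding stable_set_def p q by auto
qed

lemma Msp_facts:
  assumes "p \<in> S"
  shows "cvec.subspace (Msp p)" "Msp p \<noteq> {0}" "u \<in> vspace V \<Longrightarrow> w \<in> Msp p \<Longrightarrow> Mm p u k w \<in> Msp p"
    "u \<in> vspace V \<Longrightarrow> lin_map (Msp p) (Msp p) (Mm p u k)"
  using irreducibleD[OF S_D(2)[OF assms]] by auto

lemma Msp_nonzero: "p \<in> S \<Longrightarrow> \<exists>w\<in>Msp p. w \<noteq> 0"
  using Msp_facts[of p] cvec.subspace_0 by blast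

lemma tmod_iso_sym_V:
  assumes "tmod_iso V M N" "irreducible_twisted V g T M'" "M = twist M' a" "\<And>u. u \<in> vspace V \<Longrightarrow> a u \<in> vspace V"
  shows "tmod_iso V N M"
  using assms(1) by (rule tmod_iso_sym) (use irreducibleD[OF assms(2)] assms(3,4) in auto)

text \<open>\<open>pact\<close> is a definite description. As \<open>S\<close> contains one member
  of each isomorphism class, exhibiting any member with the right automorphism and module identifies
  it.\<close>

lemma pactI:
  assumes p: "p \<in> S" and a: "a \<in> G" and q: "q \<in> S" "fst q = inv a \<circ> fst p \<circ> a" "tmod_iso V (twist (snd p) a) (snd q)"
  shows "pact V S p a = q"
  unfolding pact_def
proof (rule the_equality)
  fix q' assume q': "q' \<in> S \<and> fst q' = inv a \<circ> fst p \<circ> a \<and> tmod_iso V (twist (snd p) a) (snd q')"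
  have "tmod_iso V (snd q') (twist (snd p) a)"
    by (rule tmod_iso_sym_V[OF _ S_D(2)[OF p] refl]) (use q' autD(5)[OF a] in auto)
  then have "tmod_iso V (snd q') (snd q)" using q(3) by (rule tmod_iso_trans)
  then show "q' = q" using q q' by (intro S_eqI) auto
qed (use q in auto)

lemma pact:
  assumes p: "p \<in> S" and a: "a \<in> G"
  shows "pact V S p a \<in> S" "fst (pact V S p a) = inv a \<circ> fst p \<circ> a"
    "tmod_iso V (twist (snd p) a) (snd (pact V S p a))"
proof -
  obtain g M where gM: "p = (g, M)" by (cases p)
  obtain N where N: "(inv a \<circ> g \<circ> a, N) \<in> S" "tmod_iso V (twist M a) N"
    using stable p a unfolding gM stable_set_def by blast
  then have "pact V S p a = (inv a \<circ> g \<circ> a, N)" using p a gM by (intro pactI) auto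
  then show "pact V S p a \<in> S" "fst (pact V S p a) = inv a \<circ> fst p \<circ> a"
    "tmod_iso V (twist (snd p) a) (snd (pact V S p a))" using N gM by auto
qed

lemma pact_pact:
  assumes p: "p \<in> S" and a: "a \<in> G" and b: "b \<in> G"
  shows "pact V S (pact V S p a) b = pact V S p (a \<circ> b)"
proof (rule sym, rule pactI[OF p comp_in[OF a b]])
  note pa = pact[OF p a] and pb = pact[OF pact(1)[OF p a] b]
  show "pact V S (pact V S p a) b \<in> S" by (rule pb(1))
  show "fst (pact V S (pact V S p a) b) = inv (a \<circ> b) \<circ> fst p \<circ> (a \<circ> b)"
    unfolding pb(2) pa(2) inv_comp_distrib[OF a b] by (simp add: comp_assoc)
  have "tmod_iso V (twist (twist (snd p) a) b) (twist (snd (pact V S p a)) b)"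
    using pa(3) autD(5)[OF b] by (rule tmod_iso_twist)
  then show "tmod_iso V (twist (snd p) (a \<circ> b)) (snd (pact V S (pact V S p a) b))"
    unfolding twist_twist using pb(3) by (rule tmod_iso_trans)
qed

lemma pact_id: "p \<in> S \<Longrightarrow> pact V S p id = p"
  by (rule pactI) (auto simp: id_in twist_id tmod_iso_refl)

lemma lact_in: "p \<in> S \<Longrightarrow> a \<in> G \<Longrightarrow> lact a p \<in> S"
  using pact(1) inv_in by blast

lemma lact_lact: "p \<in> S \<Longrightarrow> a \<in> G \<Longrightarrow> b \<in> G \<Longrightarrow> lact a (lact b p) = lact (a \<circ> b) p"
  by (simp add: pact_pact inv_in inv_comp_distrib)

lemma lact_id: "p \<in> S \<Longrightarrow> lact id p = p"
  by (simp add: pact_id)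

lemma lact_inv_cancel: "p \<in> S \<Longrightarrow> a \<in> G \<Longrightarrow> lact (inv a) (lact a p) = p" "p \<in> S \<Longrightarrow> a \<in> G \<Longrightarrow> lact a (lact (inv a) p) = p"
  by (simp_all only: lact_lact inv_in inv_comp comp_inv lact_id)

abbreviation stab where "stab p \<equiv> stabilizer V G p"

text \<open>Conjugation by \<open>a\<close> fixes the automorphism of \<open>p\<close> exactly when
  \<open>a\<close> commutes with it, so the two conditions in \<open>stabilizer\<close> are those
  that characterise \<open>p\<close> as its own translate.\<close>

lemma stab_iff_pact:
  assumes p: "p \<in> S"
  shows "a \<in> stab p \<longleftrightarrow> a \<in> G \<and> pact V S p a = p"
proof
  assume a: "a \<in> stab p"
  then have aG: "a \<in> G" and com: "a \<circ> fst p = fst p \<circ> a" and iso: "tmod_iso V (twist (snd p) a) (snd p)"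
    by (auto simp: stabilizer_def)
  have "inv a \<circ> fst p \<circ> a = fst p"
    using com comp_cancel(2)[OF aG, of "fst p"] by (simp add: comp_assoc)
  then show "a \<in> G \<and> pact V S p a = p" using pactI[OF p aG p _ iso] aG by simp
next
  assume a: "a \<in> G \<and> pact V S p a = p"
  then have "fst p = inv a \<circ> fst p \<circ> a" "tmod_iso V (twist (snd p) a) (snd p)" using pact(2,3)[OF p, of a] by auto
  moreover from this(1) have "a \<circ> fst p = a \<circ> (inv a \<circ> (fst p \<circ> a))" by (metis comp_assoc)
  ultimately show "a \<in> stab p" using a comp_cancel(1)[of a "fst p \<circ> a"] by (auto simp: stabilizer_def)
qed

lemma stab_iff:
  assumes p: "p \<in> S"
  shows "a \<in> stab p \<longleftrightarrow> a \<in> G \<and> lact a p = p"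
proof -
  have "lact a p = p \<longleftrightarrow> pact V S p a = p" if a: "a \<in> G"
    using pact_pact[OF p a inv_in[OF a]] pact_pact[OF p inv_in[OF a] a] pact_id[OF p]
    by (auto simp: comp_inv[OF a] inv_comp[OF a])
  then show ?thesis using stab_iff_pact[OF p] by blast
qed

lemma stab_G: "a \<in> stab p \<Longrightarrow> a \<in> G"
  by (simp add: stabilizer_def)

lemma perm_group_stab:
  assumes p: "p \<in> S"
  shows "perm_group (stab p)"
proof
  show "finite (stab p)" using finite_H by (rule rev_finite_subset) (auto simp: stabilizer_def)
  show "id \<in> stab p" using p id_in by (simp add: stab_iff pact_id)
  show "a \<circ> b \<in> stab p" if "a \<in> stab p" "b \<in> stab p" for a b
    using that p comp_in lact_lact[OF p, of a b] by (auto simp: stab_iff)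
  show "inv a \<in> stab p" if "a \<in> stab p" for a
  proof -
    have a: "a \<in> G" "lact a p = p" using that p by (auto simp: stab_iff)
    have "lact (inv a) (lact a p) = p" using lact_inv_cancel(1)[OF p a(1)] .
    then have "lact (inv a) p = p" unfolding a(2) .
    then show ?thesis using p a(1) inv_in by (simp add: stab_iff)
  qed
  show "bij a" if "a \<in> stab p" for a using that bij by (auto simp: stabilizer_def)
qed

text \<open>The concluding statement about a single twisted module comes without chosen maps
  \<open>\<phi>\<close>, so they have to be produced. At the identity the normalisation forces the
  choice; elsewhere an isomorphism from the twist by \<open>inv a\<close> becomes, after
  substituting \<open>a u\<close>, a map intertwining along \<open>a\<close>.\<close>

lemma intertwiners_exist: "\<exists>\<phi>. intertwiners V G S \<phi>"
proof -
  define Q where "Q a p f \<longleftrightarrow> lin_iso (Msp p) (Msp (lact a p)) f \<and>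
    (\<forall>u\<in>vspace V. \<forall>k. \<forall>w\<in>Msp p. f (Mm p u k w) = Mm (lact a p) (a u) k (f w)) \<and> (a = id \<longrightarrow> (\<forall>w\<in>Msp p. f w = w))" for a p f
  have ex: "\<exists>f. Q a p f" if p: "p \<in> S" and a: "a \<in> G" for a p
  proof (cases "a = id")
    case True
    have "Q a p id" using lact_id[OF p] by (simp add: Q_def True lin_iso_def lin_map_def)
    then show ?thesis by (rule exI[of "Q a p"])
  next
    case False
    obtain f where f: "lin_iso (Msp p) (Msp (lact a p)) f"
      and fm: "\<And>u k w. u \<in> vspace V \<Longrightarrow> w \<in> Msp p \<Longrightarrow> f (Mm p (inv a u) k w) = Mm (lact a p) u k (f w)"
      using pact(3)[OF p inv_in[OF a]] by (auto simp: tmod_iso_def)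
    have "f (Mm p u k w) = Mm (lact a p) (a u) k (f w)" if "u \<in> vspace V" "w \<in> Msp p" for u k w
      using fm[OF autD(5)[OF a that(1)] that(2), of k] bij_is_inj[OF bij[OF a]] by simp
    then have "Q a p f" using f False by (simp add: Q_def)
    then show ?thesis by (rule exI[of "Q a p"])
  qed
  define \<psi> where "\<psi> a p = (SOME f. Q a p f)" for a p
  have "Q a p (\<psi> a p)" if "p \<in> S" "a \<in> G" for a p
    unfolding \<psi>_def using ex[OF that] by (rule someI_ex)
  then have \<psi>: "lin_iso (Msp p) (Msp (lact a p)) (\<psi> a p)"
      "\<forall>u\<in>vspace V. \<forall>k. \<forall>w\<in>Msp p. \<psi> a p (Mm p u k w) = Mm (lact a p) (a u) k (\<psi> a p w)"
      "a = id \<Longrightarrow> \<forall>w\<in>Msp p. \<psi> a p w = w" if "p \<in> S" "a \<in> G" for a p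
    unfolding Q_def using that by blast+
  have "intertwiners V G S \<psi>"
    unfolding intertwiners_def by (intro ballI conjI) (use \<psi> id_in in blast)+
  then show ?thesis by (rule exI[of "intertwiners V G S"])
qed

end

section \<open>Intertwining maps, their cocycle, and density for fixed-point modes\<close>

locale orbifold = stable_modules V G S
  for V :: "'v::complex_vector voa" and G and S :: "('v, 'm::complex_vector) tpair set" +
  fixes \<phi> :: "('v \<Rightarrow> 'v) \<Rightarrow> ('v, 'm) tpair \<Rightarrow> 'm \<Rightarrow> 'm"
  assumes inter: "intertwiners V G S \<phi>"
begin

lemma phi:
  assumes "p \<in> S" "a \<in> G"
  shows "lin_iso (Msp p) (Msp (lact a p)) (\<phi> a p)" "lin_map (Msp p) (Msp (lact a p)) (\<phi> a p)"
    "bij_betw (\<phi> a p) (Msp p) (Msp (lact a p))" "w \<in> Msp p \<Longrightarrow> \<phi> a p w \<in> Msp (lact a p)"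
    "u \<in> vspace V \<Longrightarrow> w \<in> Msp p \<Longrightarrow> \<phi> a p (Mm p u k w) = Mm (lact a p) (a u) k (\<phi> a p w)"
proof -
  show iso: "lin_iso (Msp p) (Msp (lact a p)) (\<phi> a p)"
    and "u \<in> vspace V \<Longrightarrow> w \<in> Msp p \<Longrightarrow> \<phi> a p (Mm p u k w) = Mm (lact a p) (a u) k (\<phi> a p w)"
    using inter assms unfolding intertwiners_def by blast+
  then show l: "lin_map (Msp p) (Msp (lact a p)) (\<phi> a p)" and "bij_betw (\<phi> a p) (Msp p) (Msp (lact a p))"
    by (simp_all add: lin_iso_def)
  show "w \<in> Msp p \<Longrightarrow> \<phi> a p w \<in> Msp (lact a p)" by (rule lin_map_in[OF l])
qed

lemma phi_id: "p \<in> S \<Longrightarrow> w \<in> Msp p \<Longrightarrow> \<phi> id p w = w"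
  using inter by (auto simp: intertwiners_def)

lemma phi_zero_iff:
  assumes "p \<in> S" "a \<in> G" "w \<in> Msp p"
  shows "\<phi> a p w = 0 \<longleftrightarrow> w = 0"
proof -
  have "\<phi> a p 0 = 0" by (rule lin_map_zero[OF phi(2)[OF assms(1,2)] Msp_facts(1)[OF assms(1)]])
  then show ?thesis using phi(3)[OF assms(1,2)] assms(3) cvec.subspace_0[OF Msp_facts(1)[OF assms(1)]]
    by (metis bij_betw_inv_into_left)
qed

text \<open>A nonzero homomorphism is an isomorphism; \<open>twisted_automorphism_unique\<close>
  then makes the two automorphisms equal, and \<open>S\<close> has one member in each isomorphism
  class. So distinct members of \<open>S\<close> have no nonzero maps between them even as modules
  over the bare modes.\<close>

lemma mode_schur:
  assumes p: "p \<in> S" and q: "q \<in> S"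
    and f: "ophom (mode_ops V) (Msp p) (mode_act (snd p)) (Msp q) (mode_act (snd q)) f"
  shows "\<exists>c. (\<forall>x\<in>Msp p. f x = c *\<^sub>C x) \<and> (p \<noteq> q \<longrightarrow> c = 0)"
proof (cases "p = q")
  case True
  then show ?thesis using mode_schur_scalar[OF S_D(2)[OF p] conf_V] f by auto
next
  case False
  have "f x = 0" if x: "x \<in> Msp p" for x
  proof (rule ccontr)
    assume "f x \<noteq> 0"
    then have iso: "lin_iso (Msp p) (Msp q) f"
      using schur_iso[OF irreducible_opsimple[OF S_D(2)[OF p]] irreducible_opsimple[OF S_D(2)[OF q]] f x] by blast
    have com: "f (Mm p u k w) = Mm q u k (f w)" if "u \<in> vspace V" "w \<in> Msp p" for u k w
      using f that unfolding ophom_def mode_act_def by (metis SigmaI UNIV_I fst_conv snd_conv)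
    have "fst p = fst q"
    proof (rule aut_eqI)
      show "fst p u = fst q u" if "u \<in> vspace V" for u
      proof (rule twisted_automorphism_unique[OF twisted_decomposedI[OF S_D[OF p]] twisted_decomposedI[OF S_D[OF q]] simple])
        show "f ` Msp p = Msp q" using iso by (simp add: lin_iso_def bij_betw_def)
        show "f 0 = 0" using lin_map_zero[OF _ Msp_facts(1)[OF p]] iso by (auto simp: lin_iso_def)
      qed (use com that Msp_facts[OF q] autD(2) S_D(1) p q in auto)
    qed (use S_D p q in auto)
    moreover have "tmod_iso V (snd p) (snd q)" using iso com by (auto simp: tmod_iso_def)
    ultimately show False using S_eqI[OF p q] False by blast
  qed
  then show ?thesis by (intro exI[of _ 0]) auto
qed

abbreviation coc where "coc \<equiv> cocycle V S \<phi>"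

text \<open>The composite of \<open>\<phi> b\<close>, \<open>\<phi> a\<close> and the inverse of
  \<open>\<phi> (a \<circ> b)\<close> commutes with all modes, hence is a scalar by Schur's lemma; a
  nonzero vector shows this scalar to be unique and nonzero. This justifies the definite description
  in \<open>cocycle\<close>.\<close>

lemma cocycle_rel:
  assumes p: "p \<in> S" and a: "a \<in> G" and b: "b \<in> G"
  shows "coc p a b \<noteq> 0" "w \<in> Msp p \<Longrightarrow> \<phi> a (lact b p) (\<phi> b p w) = coc p a b *\<^sub>C \<phi> (a \<circ> b) p w"
proof -
  let ?P = "\<lambda>c. c \<noteq> 0 \<and> (\<forall>w\<in>Msp p. \<phi> a (lact b p) (\<phi> b p w) = c *\<^sub>C \<phi> (a \<circ> b) p w)"
  note bp = lact_in[OF p b] and ab = comp_in[OF a b]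
  have abp: "lact a (lact b p) = lact (a \<circ> b) p" by (rule lact_lact[OF p a b])
  note phiab = phi[OF p ab] and phia = phi[OF bp a] and phib = phi[OF p b]
  let ?i = "inv_into (Msp p) (\<phi> (a \<circ> b) p)"
  let ?f = "\<lambda>w. ?i (\<phi> a (lact b p) (\<phi> b p w))"
  have ff: "\<phi> a (lact b p) (\<phi> b p w) \<in> Msp (lact (a \<circ> b) p)" if "w \<in> Msp p" for w
    using phia(4)[OF phib(4)[OF that]] abp by simp
  have i: "?i y \<in> Msp p" "\<phi> (a \<circ> b) p (?i y) = y" if "y \<in> Msp (lact (a \<circ> b) p)" for y
    using phiab(3) that by (auto simp: bij_betw_def inv_into_into f_inv_into_f)
  have "ophom (mode_ops V) (Msp p) (mode_act (snd p)) (Msp p) (mode_act (snd p)) ?f"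
    unfolding ophom_def
  proof (intro conjI ballI)
    have "lin_map (Msp p) (Msp (lact (a \<circ> b) p)) (\<lambda>w. \<phi> a (lact b p) (\<phi> b p w))"
      using lin_map_comp[OF phib(2) phia(2)] abp by simp
    moreover have "lin_map (Msp (lact (a \<circ> b) p)) (Msp p) ?i"
      using lin_iso_inv[OF phiab(1) Msp_facts(1)[OF p]] by (simp add: lin_iso_def)
    ultimately show "lin_map (Msp p) (Msp p) ?f" by (rule lin_map_comp)
    show "?f (mode_act (snd p) x w) = mode_act (snd p) x (?f w)" if x: "x \<in> mode_ops V" and w: "w \<in> Msp p" for x w
    proof -
      obtain u k where x: "x = (u, k)" "u \<in> vspace V" using x by auto
      have "\<phi> a (lact b p) (\<phi> b p (Mm p u k w)) = Mm (lact (a \<circ> b) p) ((a \<circ> b) u) k (\<phi> a (lact b p) (\<phi> b p w))"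
        using phib(5)[OF x(2) w] phia(5)[OF autD(5)[OF b x(2)] phib(4)[OF w]] abp by simp
      also have "\<dots> = Mm (lact (a \<circ> b) p) ((a \<circ> b) u) k (\<phi> (a \<circ> b) p (?f w))" using i(2)[OF ff[OF w]] by simp
      also have "\<dots> = \<phi> (a \<circ> b) p (Mm p u k (?f w))" using phiab(5)[OF x(2) i(1)[OF ff[OF w]]] by simp
      finally show ?thesis
        using bij_betw_inv_into_left[OF phiab(3) Msp_facts(3)[OF p x(2) i(1)[OF ff[OF w]]]]
        by (simp add: mode_act_def x(1))
    qed
  qed
  then obtain c where c: "\<And>w. w \<in> Msp p \<Longrightarrow> ?f w = c *\<^sub>C w" using mode_schur[OF p p] by blast
  have rel: "\<phi> a (lact b p) (\<phi> b p w) = c *\<^sub>C \<phi> (a \<circ> b) p w" if w: "w \<in> Msp p" for w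
    using i(2)[OF ff[OF w]] c[OF w] lin_map_scale[OF phiab(2) w, of c] by simp
  obtain w0 where w0: "w0 \<in> Msp p" "w0 \<noteq> 0" using Msp_nonzero[OF p] by blast
  have nz: "\<phi> a (lact b p) (\<phi> b p w0) \<noteq> 0" "\<phi> (a \<circ> b) p w0 \<noteq> 0"
    using w0 phib(4)[OF w0(1)] by (simp_all add: phi_zero_iff p a b ab bp)
  have "?P c" using rel nz(1) rel[OF w0(1)] by auto
  moreover have "d = c" if "?P d" for d
  proof -
    have "d *\<^sub>C \<phi> (a \<circ> b) p w0 = c *\<^sub>C \<phi> (a \<circ> b) p w0" using that rel[OF w0(1)] w0(1) by auto
    then show ?thesis using nz(2) by simp
  qed
  ultimately have "?P (coc p a b)" unfolding cocycle_def by (rule theI)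
  then show "coc p a b \<noteq> 0" "w \<in> Msp p \<Longrightarrow> \<phi> a (lact b p) (\<phi> b p w) = coc p a b *\<^sub>C \<phi> (a \<circ> b) p w"
    by auto
qed

text \<open>Both sides are the scalar by which the threefold composite differs from
  \<open>\<phi> (a \<circ> (b \<circ> c))\<close>, bracketed in two ways. For the pair
  \<open>(a, b)\<close> the base point is \<open>lact c p\<close>, because \<open>\<phi> c p\<close>
  has been applied before.\<close>

lemma cocycle_identity:
  assumes p: "p \<in> S" and a: "a \<in> G" and b: "b \<in> G" and c: "c \<in> G"
  shows "coc p a (b \<circ> c) * coc p b c = coc (lact c p) a b * coc p (a \<circ> b) c"
proof -
  obtain w where w: "w \<in> Msp p" "w \<noteq> 0" using Msp_nonzero[OF p] by blast
  note cp = lact_in[OF p c] and bc = comp_in[OF b c] and ab = comp_in[OF a b]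
  note bcp = lact_in[OF p bc]
  have w': "\<phi> c p w \<in> Msp (lact c p)" "\<phi> (b \<circ> c) p w \<in> Msp (lact (b \<circ> c) p)"
    using phi(4)[OF p] c bc w by auto
  have "\<phi> a (lact b (lact c p)) (\<phi> b (lact c p) (\<phi> c p w)) = (coc p b c * coc p a (b \<circ> c)) *\<^sub>C \<phi> (a \<circ> (b \<circ> c)) p w"
    unfolding cocycle_rel(2)[OF p b c w(1)] lact_lact[OF p b c]
    by (simp add: lin_map_scale[OF phi(2)[OF bcp a] w'(2)] cocycle_rel(2)[OF p a bc w(1)])
  moreover have "\<phi> a (lact b (lact c p)) (\<phi> b (lact c p) (\<phi> c p w)) =
      (coc (lact c p) a b * coc p (a \<circ> b) c) *\<^sub>C \<phi> (a \<circ> (b \<circ> c)) p w"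
    unfolding cocycle_rel(2)[OF cp a b w'(1)] by (simp add: cocycle_rel(2)[OF p ab c w(1)] comp_assoc)
  moreover have "\<phi> (a \<circ> (b \<circ> c)) p w \<noteq> 0" using w by (simp add: phi_zero_iff p comp_in a bc)
  ultimately show ?thesis by (simp add: mult.commute)
qed

lemma twisted_group_stab:
  assumes p: "p \<in> S"
  shows "twisted_group (stab p) (coc p)"
proof -
  interpret P: perm_group "stab p" by (rule perm_group_stab[OF p])
  show ?thesis by unfold_locales (use cocycle_rel(1)[OF p] stab_G in blast)
qed

lemma proj_rep_phi:
  assumes p: "p \<in> S"
  shows "twisted_group.proj_rep (stab p) (coc p) (Msp p) (\<lambda>a. \<phi> a p)"
proof -
  interpret P: twisted_group "stab p" "coc p" by (rule twisted_group_stab[OF p])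
  have st: "a \<in> G" "lact a p = p" if "a \<in> stab p" for a using that p by (auto simp: stab_iff)
  show ?thesis
    unfolding P.proj_rep_def opmod_def
  proof (intro conjI ballI)
    show "lin_map (Msp p) (Msp p) (\<phi> a p)" if "a \<in> stab p" for a
      using phi(2)[OF p st(1)[OF that]] st(2)[OF that] by simp
    show "\<phi> a p (\<phi> b p x) = coc p a b *\<^sub>C \<phi> (a \<circ> b) p x" if "a \<in> stab p" "b \<in> stab p" "x \<in> Msp p" for a b x
      using cocycle_rel(2)[OF p st(1)[OF that(1)] st(1)[OF that(2)] that(3)] st(2)[OF that(2)] by simp
  qed (use phi_id[OF p] Msp_facts(1)[OF p] in auto)
qed

text \<open>The span is stable under all modes by \<open>product_of_modes_in_span\<close>, and it
  contains \<open>w\<close> through the mode \<open>-1\<close> of the vacuum. So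
  \<open>density\<close> applies to it, with \<open>\<kappa>\<close> telling to which member of
  \<open>S\<close> a coordinate belongs.\<close>

lemma density_V:
  assumes I: "finite I" and \<kappa>: "\<And>i. i \<in> I \<Longrightarrow> \<kappa> i \<in> S"
    and w: "\<And>i. i \<in> I \<Longrightarrow> w i \<in> Msp (\<kappa> i)" and y: "y \<in> dsum I (\<lambda>i. Msp (\<kappa> i))"
    and rel: "\<And>c q. (\<Sum>i\<in>{i \<in> I. \<kappa> i = q}. c i *\<^sub>C w i) = 0 \<Longrightarrow> (\<Sum>i\<in>{i \<in> I. \<kappa> i = q}. c i *\<^sub>C y i) = 0"
  shows "y \<in> cvec.span {\<lambda>i. if i \<in> I then Mm (\<kappa> i) x k (w i) else 0 |x k. x \<in> vspace V}"
    (is "y \<in> cvec.span ?G")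
proof -
  let ?N = "cvec.span ?G" and ?D = "dsum I (\<lambda>i. Msp (\<kappa> i))"
  have tw: "twisted_decomposed V (fst (\<kappa> i)) (card G) (snd (\<kappa> i))" if "i \<in> I" for i
    by (rule twisted_decomposedI[OF S_D[OF \<kappa>[OF that]]])
  have subD: "cvec.subspace ?D" by (rule subspace_dsum) (rule Msp_facts(1)[OF \<kappa>])
  have GD: "?G \<subseteq> ?D" using Msp_facts(3)[OF \<kappa>] w by (auto intro!: dsumI)
  have ND: "?N \<subseteq> ?D" using GD subD by (rule cvec.span_minimal)
  let ?w = "\<lambda>i. if i \<in> I then w i else 0"
  show ?thesis
  proof (rule density[where \<Omega> = "mode_ops V" and U = Msp and r = "\<lambda>p. mode_act (snd p)" and \<kappa> = \<kappa> and I = I and w = ?w])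
    show "opsimple (mode_ops V) (Msp (\<kappa> i)) (mode_act (snd (\<kappa> i)))" if "i \<in> I" for i
      by (rule irreducible_opsimple[OF S_D(2)[OF \<kappa>[OF that]]])
    show "\<exists>c. (\<forall>x\<in>Msp (\<kappa> i). f x = c *\<^sub>C x) \<and> (\<kappa> i \<noteq> \<kappa> j \<longrightarrow> c = 0)"
      if "i \<in> I" "j \<in> I" "ophom (mode_ops V) (Msp (\<kappa> i)) (mode_act (snd (\<kappa> i))) (Msp (\<kappa> j)) (mode_act (snd (\<kappa> j))) f" for i j f
      by (rule mode_schur[OF \<kappa>[OF that(1)] \<kappa>[OF that(2)] that(3)])
    show "(\<lambda>i. if i \<in> I then mode_act (snd (\<kappa> i)) x (z i) else 0) \<in> ?N" if x: "x \<in> mode_ops V" and z: "z \<in> ?N" for x z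
    proof -
      obtain u q where uq: "x = (u, q)" "u \<in> vspace V" using x by auto
      let ?A = "\<lambda>z i. if i \<in> I then Mm (\<kappa> i) u q (z i) else 0"
      have lA: "lin_map ?D ?D ?A"
      proof (intro lin_mapI dsumI)
        fix z i assume "z \<in> ?D" "i \<in> I"
        then show "?A z i \<in> Msp (\<kappa> i)"
          using Msp_facts(3)[OF \<kappa>[OF \<open>i \<in> I\<close>] uq(2) dsum_in[OF \<open>z \<in> ?D\<close> \<open>i \<in> I\<close>]] by simp
      next
        fix z z' assume "z \<in> ?D" "z' \<in> ?D"
        then show "?A (z + z') = ?A z + ?A z'"
          using dsum_in[of z I "\<lambda>i. Msp (\<kappa> i)"] dsum_in[of z' I "\<lambda>i. Msp (\<kappa> i)"] lin_map_add[OF Msp_facts(4)[OF \<kappa> uq(2)]]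
          by (auto simp: fun_eq_iff)
      next
        fix c z assume "z \<in> ?D"
        then show "?A (c *\<^sub>C z) = c *\<^sub>C ?A z"
          using dsum_in[of z I "\<lambda>i. Msp (\<kappa> i)"] lin_map_scale[OF Msp_facts(4)[OF \<kappa> uq(2)]]
          by (auto simp: fun_eq_iff)
      qed auto
      have "?A z \<in> ?N"
      proof (rule lin_map_span_image[OF lA subD z GD])
        fix b assume "b \<in> ?G"
        then obtain v n where b: "b = (\<lambda>i. if i \<in> I then Mm (\<kappa> i) v n (w i) else 0)" "v \<in> vspace V" by blast
        have "?A b = (\<lambda>i. if i \<in> I then Mm (\<kappa> i) u q (Mm (\<kappa> i) v n (w i)) else 0)"
          by (auto simp: b(1) fun_eq_iff)
        then show "?A b \<in> ?N" using product_of_modes_in_span[OF I tw w uq(2) b(2)] by simp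
      qed auto
      moreover have "(\<lambda>i. if i \<in> I then mode_act (snd (\<kappa> i)) x (z i) else 0) = ?A z"
        by (auto simp: uq(1) mode_act_def fun_eq_iff)
      ultimately show ?thesis by (simp only:)
    qed
    show "?w \<in> ?N"
    proof (rule cvec.span_base)
      have "?w = (\<lambda>i. if i \<in> I then Mm (\<kappa> i) (vac V) (-1) (w i) else 0)"
      proof (rule ext)
        fix i show "?w i = (if i \<in> I then Mm (\<kappa> i) (vac V) (-1) (w i) else 0)"
        proof (cases "i \<in> I")
          case True
          have "twisted_module V (fst (\<kappa> i)) (card G) (snd (\<kappa> i))"
            using S_D(2)[OF \<kappa>[OF True]] by (simp add: irreducible_twisted_def)
          then show ?thesis using twisted_module.vacuum[of V _ _ "snd (\<kappa> i)" "w i" "-1"] w[OF True] True by simp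
        qed simp
      qed
      then show "?w \<in> ?G" using vac_V by blast
    qed
    show "(\<Sum>i\<in>{i \<in> I. \<kappa> i = q}. c i *\<^sub>C y i) = 0" if "(\<Sum>i\<in>{i \<in> I. \<kappa> i = q}. c i *\<^sub>C ?w i) = 0" for c q
      using that rel[of c q] by (simp cong: sum.cong_simp)
  qed (use I ND y in auto)
qed

text \<open>The sum over inverses is the form in which the average appears after pulling back along
  the \<open>\<phi> a\<close>; reindexing by inversion reduces invariance to left
  translation.\<close>

lemma orbit_sum_fixed:
  assumes "x \<in> vspace V"
  shows "(\<Sum>a\<in>G. inv a x) \<in> vspace (fixed_voa V G)"
proof -
  have V: "inv a x \<in> vspace V" if "a \<in> G" for a using autD(5)[OF inv_in[OF that] assms] .
  have "b (\<Sum>a\<in>G. inv a x) = (\<Sum>a\<in>G. inv a x)" if b: "b \<in> G" for b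
  proof -
    have "b (\<Sum>a\<in>G. inv a x) = (\<Sum>a\<in>G. b (inv a x))" using V by (rule lin_map_sum[OF autD(2)[OF b] subspace_V])
    also have "\<dots> = (\<Sum>a\<in>G. (b \<circ> a) x)" using sum.reindex_bij_betw[OF inverse_bij, of "\<lambda>a. b (a x)"] by simp
    also have "\<dots> = (\<Sum>a\<in>G. a x)" using sum_left_translation[OF b, of "\<lambda>a. a x"] by simp
    also have "\<dots> = (\<Sum>a\<in>G. inv a x)" using sum.reindex_bij_betw[OF inverse_bij, of "\<lambda>a. a x"] by simp
    finally show ?thesis .
  qed
  moreover have "(\<Sum>a\<in>G. inv a x) \<in> vspace V" using V by (rule cvec.subspace_sum[OF subspace_V])
  ultimately show ?thesis by simp
qed

text \<open>Density for \<open>V\<close> applied to the translates \<open>\<phi>(a) w\<^sub>i\<close>, followed by averaging over \<open>G\<close>, which turns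
  the modes of elements of \<open>V\<close> into modes of elements of the fixed-point subalgebra.\<close>

lemma density_fixed:
  assumes I: "finite I" and \<kappa>: "\<And>i. i \<in> I \<Longrightarrow> \<kappa> i \<in> S"
    and w: "\<And>i. i \<in> I \<Longrightarrow> w i \<in> Msp (\<kappa> i)" and y: "y \<in> dsum I (\<lambda>i. Msp (\<kappa> i))"
    and rel: "\<And>c q. (\<Sum>(i, a)\<in>{(i, a) \<in> I \<times> G. lact a (\<kappa> i) = q}. c (i, a) *\<^sub>C \<phi> a (\<kappa> i) (w i)) = 0 \<Longrightarrow>
      (\<Sum>(i, a)\<in>{(i, a) \<in> I \<times> G. lact a (\<kappa> i) = q}. c (i, a) *\<^sub>C \<phi> a (\<kappa> i) (y i)) = 0"
  shows "y \<in> cvec.span {\<lambda>i. if i \<in> I then Mm (\<kappa> i) x k (w i) else 0 |x k. x \<in> vspace (fixed_voa V G)}"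
    (is "y \<in> cvec.span ?G")
proof -
  let ?I = "I \<times> G"
  define \<kappa>' where "\<kappa>' j = lact (snd j) (\<kappa> (fst j))" for j
  define w' where "w' j = \<phi> (snd j) (\<kappa> (fst j)) (w (fst j))" for j
  define y' where "y' j = (if j \<in> ?I then \<phi> (snd j) (\<kappa> (fst j)) (y (fst j)) else 0)" for j
  let ?D = "dsum ?I (\<lambda>j. Msp (\<kappa>' j))"
  have \<kappa>': "\<kappa>' j \<in> S" if "j \<in> ?I" for j
    using lact_in[OF \<kappa>, of "fst j" "snd j"] that by (simp add: \<kappa>'_def mem_Times_iff)
  have w': "w' j \<in> Msp (\<kappa>' j)" if "j \<in> ?I" for j
    using phi(4)[OF \<kappa> _ w, of "fst j" "snd j"] that by (simp add: \<kappa>'_def w'_def mem_Times_iff)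
  have yM: "y i \<in> Msp (\<kappa> i)" if "i \<in> I" for i using dsum_in[OF y that] .
  have y': "y' \<in> ?D" using phi(4)[OF \<kappa> _ yM] by (auto intro!: dsumI simp: y'_def \<kappa>'_def split: if_splits)
  have set_eq: "{j \<in> ?I. \<kappa>' j = q} = {(i, a) \<in> I \<times> G. lact a (\<kappa> i) = q}" for q by (auto simp: \<kappa>'_def)
  let ?G' = "{\<lambda>j. if j \<in> ?I then Mm (\<kappa>' j) x k (w' j) else 0 |x k. x \<in> vspace V}"
  have mem: "y' \<in> cvec.span ?G'"
  proof (rule density_V[OF _ \<kappa>' w' y'])
    show "finite ?I" using I finite_H by simp
    show "(\<Sum>i\<in>{j \<in> ?I. \<kappa>' j = q}. c i *\<^sub>C y' i) = 0" if "(\<Sum>i\<in>{j \<in> ?I. \<kappa>' j = q}. c i *\<^sub>C w' i) = 0" for c q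
    proof -
      have "(\<Sum>i\<in>{j \<in> ?I. \<kappa>' j = q}. c i *\<^sub>C w' i) =
          (\<Sum>(i, a)\<in>{(i, a) \<in> I \<times> G. lact a (\<kappa> i) = q}. c (i, a) *\<^sub>C \<phi> a (\<kappa> i) (w i))"
        unfolding set_eq by (intro sum.cong) (auto simp: w'_def)
      moreover have "(\<Sum>i\<in>{j \<in> ?I. \<kappa>' j = q}. c i *\<^sub>C y' i) =
          (\<Sum>(i, a)\<in>{(i, a) \<in> I \<times> G. lact a (\<kappa> i) = q}. c (i, a) *\<^sub>C \<phi> a (\<kappa> i) (y i))"
        unfolding set_eq by (intro sum.cong) (auto simp: y'_def)
      ultimately show ?thesis using rel[of c q] that by simp
    qed
  qed
  define J where "J i a = inv_into (Msp (\<kappa> i)) (\<phi> a (\<kappa> i))" for i a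
  have Jl: "lin_map (Msp (lact a (\<kappa> i))) (Msp (\<kappa> i)) (J i a)" if "i \<in> I" "a \<in> G" for i a
    using lin_iso_inv[OF phi(1)[OF \<kappa>[OF that(1)] that(2)] Msp_facts(1)[OF \<kappa>[OF that(1)]]]
    by (simp add: lin_iso_def J_def)
  have Jphi: "J i a (\<phi> a (\<kappa> i) z) = z" if "i \<in> I" "a \<in> G" "z \<in> Msp (\<kappa> i)" for i a z
    unfolding J_def by (rule bij_betw_inv_into_left[OF phi(3)[OF \<kappa>[OF that(1)] that(2)] that(3)])
  \<comment> \<open>Carry every coordinate back by the inverse of \<open>\<phi> a\<close> and add up
    over \<open>a\<close>. A mode of \<open>x\<close> on the translate becomes the mode of
    \<open>inv a x\<close> on \<open>w i\<close>, so the total is a mode of the invariant vector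
    that is the sum of the \<open>inv a x\<close>.\<close>
  define av where "av z = (\<lambda>i. if i \<in> I then \<Sum>a\<in>G. J i a (z (i, a)) else 0)" for z
  have zM: "z (i, a) \<in> Msp (lact a (\<kappa> i))" if "z \<in> ?D" "i \<in> I" "a \<in> G" for z i a
    using dsum_in[OF that(1), of "(i, a)"] that by (simp add: \<kappa>'_def)
  have lav: "lin_map ?D UNIV av"
  proof (intro lin_mapI)
    fix z z' assume z: "z \<in> ?D" "z' \<in> ?D"
    have "(\<Sum>a\<in>G. J i a (z (i, a) + z' (i, a))) = (\<Sum>a\<in>G. J i a (z (i, a))) + (\<Sum>a\<in>G. J i a (z' (i, a)))" if "i \<in> I" for i
      unfolding sum.distrib[symmetric] using that z
      by (intro sum.cong refl lin_map_add[OF Jl] zM)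
    then show "av (z + z') = av z + av z'" by (auto simp: av_def fun_eq_iff)
  next
    fix c z assume z: "z \<in> ?D"
    have "(\<Sum>a\<in>G. J i a (c *\<^sub>C z (i, a))) = c *\<^sub>C (\<Sum>a\<in>G. J i a (z (i, a)))" if "i \<in> I" for i
      unfolding cvec.scale_sum_right using that z
      by (intro sum.cong refl lin_map_scale[OF Jl] zM)
    then show "av (c *\<^sub>C z) = c *\<^sub>C av z" by (auto simp: av_def fun_eq_iff)
  qed auto
  have subD: "cvec.subspace ?D" by (rule subspace_dsum) (rule Msp_facts(1)[OF \<kappa>'])
  have "av y' \<in> cvec.span ?G"
  proof (rule lin_map_span_image[OF lav subD mem])
    show "?G' \<subseteq> ?D"
    proof
      fix z assume "z \<in> ?G'"
      then obtain x k where z: "z = (\<lambda>j. if j \<in> ?I then Mm (\<kappa>' j) x k (w' j) else 0)" "x \<in> vspace V" by blast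
      show "z \<in> ?D" unfolding z(1) by (rule dsumI) (simp_all only: if_True if_False Msp_facts(3)[OF \<kappa>' z(2) w'])
    qed
    fix b assume "b \<in> ?G'"
    then obtain x k where b: "b = (\<lambda>j. if j \<in> ?I then Mm (\<kappa>' j) x k (w' j) else 0)" "x \<in> vspace V" by blast
    have invx: "inv a x \<in> vspace V" if "a \<in> G" for a using autD(5)[OF inv_in[OF that] b(2)] .
    have "av b = (\<lambda>i. if i \<in> I then Mm (\<kappa> i) (\<Sum>a\<in>G. inv a x) k (w i) else 0)"
    proof (rule ext)
      fix i
      show "av b i = (if i \<in> I then Mm (\<kappa> i) (\<Sum>a\<in>G. inv a x) k (w i) else 0)"
      proof (cases "i \<in> I")
        case i: True
        have "J i a (b (i, a)) = Mm (\<kappa> i) (inv a x) k (w i)" if a: "a \<in> G" for a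
        proof -
          have ax: "a (inv a x) = x" using fun_cong[OF comp_inv[OF a], of x] by simp
          have "b (i, a) = \<phi> a (\<kappa> i) (Mm (\<kappa> i) (inv a x) k (w i))"
            using phi(5)[OF \<kappa>[OF i] a invx[OF a] w[OF i], of k] i a by (simp add: b(1) \<kappa>'_def w'_def ax)
          then show ?thesis using Jphi[OF i a Msp_facts(3)[OF \<kappa>[OF i] invx[OF a] w[OF i]]] by simp
        qed
        moreover have "Mm (\<kappa> i) (\<Sum>a\<in>G. inv a x) k (w i) = (\<Sum>a\<in>G. Mm (\<kappa> i) (inv a x) k (w i))"
        proof -
          have "twisted_module V (fst (\<kappa> i)) (card G) (snd (\<kappa> i))"
            using S_D(2)[OF \<kappa>[OF i]] by (simp add: irreducible_twisted_def)
          then have "lin_map (vspace V) (Msp (\<kappa> i)) (\<lambda>u. Mm (\<kappa> i) u k (w i))"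
            using twisted_module.field_linear w[OF i] by blast
          then show ?thesis using invx by (rule lin_map_sum[OF _ subspace_V])
        qed
        ultimately show ?thesis using i by (simp add: av_def)
      qed (simp add: av_def)
    qed
    then show "av b \<in> cvec.span ?G" using orbit_sum_fixed[OF b(2)] by (intro cvec.span_base) blast
  qed auto
  \<comment> \<open>The target tuple was translated by the same maps, so pulling back returns
    \<open>y\<close> once for each group element; the factor is divided out at the end.\<close>
  moreover have "av y' = of_nat (card G) *\<^sub>C y"
  proof (rule ext)
    fix i
    show "av y' i = (of_nat (card G) *\<^sub>C y) i"
    proof (cases "i \<in> I")
      case True
      have "(\<Sum>a\<in>G. J i a (y' (i, a))) = (\<Sum>a\<in>G. y i)"
        using True by (intro sum.cong refl) (simp add: y'_def Jphi[OF True _ yM[OF True]])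
      then show ?thesis using True by (simp add: av_def cvec.sum_constant_scale)
    qed (simp add: av_def dsum_out[OF y])
  qed
  ultimately have "of_nat (card G) *\<^sub>C y \<in> cvec.span ?G" by simp
  then have "inverse (of_nat (card G)) *\<^sub>C (of_nat (card G) *\<^sub>C y) \<in> cvec.span ?G" by (rule cvec.span_scale)
  moreover have "of_nat (card G) \<noteq> (0 :: complex)" using finite_H id_in by auto
  ultimately show ?thesis by simp
qed

text \<open>A relation in the module \<open>q\<close> involves the pairs \<open>(i, a)\<close> with
  \<open>lact a (\<kappa> i) = q\<close>. By \<open>orb\<close> these share one value
  \<open>\<kappa> i = p\<close>, and \<open>a\<close> runs through one coset
  \<open>a0 \<circ> b\<close> of the stabilizer; so the relation is the image under the injective
  \<open>\<phi> a0 p\<close> of a relation inside \<open>p\<close>.\<close>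

lemma density_fixed_stab:
  assumes I: "finite I" and \<kappa>: "\<And>i. i \<in> I \<Longrightarrow> \<kappa> i \<in> S"
    and orb: "\<And>i j a. i \<in> I \<Longrightarrow> j \<in> I \<Longrightarrow> a \<in> G \<Longrightarrow> lact a (\<kappa> i) = \<kappa> j \<Longrightarrow> \<kappa> i = \<kappa> j"
    and w: "\<And>i. i \<in> I \<Longrightarrow> w i \<in> Msp (\<kappa> i)" and y: "y \<in> dsum I (\<lambda>i. Msp (\<kappa> i))"
    and rel: "\<And>c p. p \<in> S \<Longrightarrow> (\<Sum>i\<in>{i \<in> I. \<kappa> i = p}. \<Sum>b\<in>stab p. c i b *\<^sub>C \<phi> b p (w i)) = 0 \<Longrightarrow>
      (\<Sum>i\<in>{i \<in> I. \<kappa> i = p}. \<Sum>b\<in>stab p. c i b *\<^sub>C \<phi> b p (y i)) = 0"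
  shows "y \<in> cvec.span {\<lambda>i. if i \<in> I then Mm (\<kappa> i) x k (w i) else 0 |x k. x \<in> vspace (fixed_voa V G)}"
proof (rule density_fixed[OF I \<kappa> w y])
  fix c q
  let ?A = "{(i, a) \<in> I \<times> G. lact a (\<kappa> i) = q}"
  assume 0: "(\<Sum>(i, a)\<in>?A. c (i, a) *\<^sub>C \<phi> a (\<kappa> i) (w i)) = 0"
  show "(\<Sum>(i, a)\<in>?A. c (i, a) *\<^sub>C \<phi> a (\<kappa> i) (y i)) = 0"
  proof (cases "?A = {}")
    case True
    show ?thesis unfolding True by (rule sum.empty)
  next
    case False
    then obtain i0 a0 where i0: "i0 \<in> I" "a0 \<in> G" "lact a0 (\<kappa> i0) = q" by blast
    define p where "p = \<kappa> i0"
    have p: "p \<in> S" using \<kappa>[OF i0(1)] by (simp add: p_def)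
    have q: "q = lact a0 p" using i0(3) by (simp add: p_def)
    let ?B = "{i \<in> I. \<kappa> i = p} \<times> stab p"
    have bij: "bij_betw (\<lambda>(i, b). (i, a0 \<circ> b)) ?B ?A"
    proof (rule bij_betw_byWitness[where f' = "\<lambda>(i, a). (i, inv a0 \<circ> a)"])
      show "\<forall>x\<in>?B. (case case x of (i, b) \<Rightarrow> (i, a0 \<circ> b) of (i, a) \<Rightarrow> (i, inv a0 \<circ> a)) = x"
        using i0(2) by (auto simp: comp_cancel(2))
      show "\<forall>x\<in>?A. (case case x of (i, a) \<Rightarrow> (i, inv a0 \<circ> a) of (i, b) \<Rightarrow> (i, a0 \<circ> b)) = x"
        using i0(2) by (auto simp: comp_cancel(1))
      show "(\<lambda>(i, b). (i, a0 \<circ> b)) ` ?B \<subseteq> ?A"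
      proof clarsimp
        fix i b assume "i \<in> I" "b \<in> stab (\<kappa> i)" "p = \<kappa> i"
        then have "b \<in> G" "lact b p = p" using stab_iff[OF p] by auto
        then show "a0 \<circ> b \<in> G \<and> lact (a0 \<circ> b) (\<kappa> i) = q"
          using comp_in[OF i0(2)] lact_lact[OF p i0(2), of b] q \<open>p = \<kappa> i\<close> by simp
      qed
      show "(\<lambda>(i, a). (i, inv a0 \<circ> a)) ` ?A \<subseteq> ?B"
      proof clarsimp
        fix i a assume ia: "i \<in> I" "a \<in> G" "q = lact a (\<kappa> i)"
        have ki: "\<kappa> i \<in> S" using \<kappa>[OF ia(1)] .
        have "lact (inv a0) (lact a (\<kappa> i)) = p" using ia(3) q lact_inv_cancel(1)[OF p i0(2)] by simp
        then have e: "lact (inv a0 \<circ> a) (\<kappa> i) = p" using lact_lact[OF ki inv_in[OF i0(2)] ia(2)] by simp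
        have m: "inv a0 \<circ> a \<in> G" using comp_in inv_in i0(2) ia(2) by blast
        have "\<kappa> i = p" using orb[OF ia(1) i0(1) m] e by (simp add: p_def)
        then show "\<kappa> i = p \<and> inv a0 \<circ> a \<in> stab p" using e m stab_iff[OF p] by simp
      qed
    qed
    \<comment> \<open>Since \<open>\<phi> a0\<close> after \<open>\<phi> b\<close> is
      \<open>coc p a0 b\<close> times \<open>\<phi> (a0 \<circ> b)\<close>, the coefficients have to
      be divided by this scalar.\<close>
    have sum: "(\<Sum>(i, a)\<in>?A. c (i, a) *\<^sub>C \<phi> a (\<kappa> i) (z i)) =
        \<phi> a0 p (\<Sum>i\<in>{i \<in> I. \<kappa> i = p}. \<Sum>b\<in>stab p. (c (i, a0 \<circ> b) * inverse (coc p a0 b)) *\<^sub>C \<phi> b p (z i))"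
      "(\<Sum>i\<in>{i \<in> I. \<kappa> i = p}. \<Sum>b\<in>stab p. (c (i, a0 \<circ> b) * inverse (coc p a0 b)) *\<^sub>C \<phi> b p (z i)) \<in> Msp p"
      if z: "\<And>i. i \<in> I \<Longrightarrow> z i \<in> Msp (\<kappa> i)" for z
    proof -
      let ?f = "\<lambda>(i, b). \<phi> b p (z i)" and ?c = "\<lambda>(i, b). c (i, a0 \<circ> b) * inverse (coc p a0 b)"
      have fM: "?f x \<in> Msp p" if "x \<in> ?B" for x
        using that z phi(4)[OF p] stab_iff[OF p] by fastforce
      have cart: "(\<Sum>i\<in>{i \<in> I. \<kappa> i = p}. \<Sum>b\<in>stab p. (c (i, a0 \<circ> b) * inverse (coc p a0 b)) *\<^sub>C \<phi> b p (z i)) =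
          (\<Sum>x\<in>?B. ?c x *\<^sub>C ?f x)"
        unfolding sum.cartesian_product by (intro sum.cong) auto
      show "(\<Sum>i\<in>{i \<in> I. \<kappa> i = p}. \<Sum>b\<in>stab p. (c (i, a0 \<circ> b) * inverse (coc p a0 b)) *\<^sub>C \<phi> b p (z i)) \<in> Msp p"
        unfolding cart using fM by (intro cvec.subspace_sum[OF Msp_facts(1)[OF p]] cvec.subspace_scale[OF Msp_facts(1)[OF p]])
      have "(\<Sum>(i, a)\<in>?A. c (i, a) *\<^sub>C \<phi> a (\<kappa> i) (z i)) = (\<Sum>x\<in>?B. ?c x *\<^sub>C \<phi> a0 p (?f x))"
        unfolding sum.reindex_bij_betw[OF bij, symmetric]
      proof (rule sum.cong[OF refl])
        fix x assume x: "x \<in> ?B"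
        obtain i b where ib: "x = (i, b)" by (cases x)
        have i: "i \<in> I" "\<kappa> i = p" and b: "b \<in> G" "lact b p = p" using x ib stab_iff[OF p] by auto
        have zi: "z i \<in> Msp p" using z[OF i(1)] i(2) by simp
        have "\<phi> a0 p (\<phi> b p (z i)) = coc p a0 b *\<^sub>C \<phi> (a0 \<circ> b) p (z i)"
          using cocycle_rel(2)[OF p i0(2) b(1) zi] b(2) by simp
        then show "(case case x of (i, b) \<Rightarrow> (i, a0 \<circ> b) of (i, a) \<Rightarrow> c (i, a) *\<^sub>C \<phi> a (\<kappa> i) (z i)) =
            ?c x *\<^sub>C \<phi> a0 p (?f x)"
          using cocycle_rel(1)[OF p i0(2) b(1)] i(2) by (simp add: ib)
      qed
      also have "\<dots> = \<phi> a0 p (\<Sum>x\<in>?B. ?c x *\<^sub>C ?f x)"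
        using fM by (rule lin_map_lincomb[OF phi(2)[OF p i0(2)] Msp_facts(1)[OF p], symmetric])
      finally show "(\<Sum>(i, a)\<in>?A. c (i, a) *\<^sub>C \<phi> a (\<kappa> i) (z i)) =
        \<phi> a0 p (\<Sum>i\<in>{i \<in> I. \<kappa> i = p}. \<Sum>b\<in>stab p. (c (i, a0 \<circ> b) * inverse (coc p a0 b)) *\<^sub>C \<phi> b p (z i))"
        unfolding cart .
    qed
    have yM: "y i \<in> Msp (\<kappa> i)" if "i \<in> I" for i using dsum_in[OF y that] .
    have "(\<Sum>i\<in>{i \<in> I. \<kappa> i = p}. \<Sum>b\<in>stab p. (c (i, a0 \<circ> b) * inverse (coc p a0 b)) *\<^sub>C \<phi> b p (w i)) = 0"
      using 0 sum[OF w] phi_zero_iff[OF p i0(2)] by simp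
    then have "(\<Sum>i\<in>{i \<in> I. \<kappa> i = p}. \<Sum>b\<in>stab p. (c (i, a0 \<circ> b) * inverse (coc p a0 b)) *\<^sub>C \<phi> b p (y i)) = 0"
      by (rule rel[OF p])
    then show ?thesis using sum(1)[OF yM] lin_map_zero[OF phi(2)[OF p i0(2)] Msp_facts(1)[OF p]] by simp
  qed
qed

text \<open>In the style of Artin's proof of the independence of characters, by induction on the
  size of the support: a relation is combined with one whose coefficients are multiplied by
  \<open>l (a u)\<close>, so that one term cancels. Elements of the support must then agree on all
  of \<open>V\<close>, so a single term remains, and \<open>\<phi> b p\<close> is injective.\<close>

lemma phi_independent:
  assumes p: "p \<in> S" and rel: "\<And>m. m \<in> Msp p \<Longrightarrow> (\<Sum>a\<in>stab p. c a *\<^sub>C \<phi> a p m) = 0"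
  shows "\<forall>a\<in>stab p. c a = 0"
  using rel
proof (induction "card {a \<in> stab p. c a \<noteq> 0}" arbitrary: c rule: less_induct)
  case less
  interpret P: perm_group "stab p" by (rule perm_group_stab[OF p])
  have st: "a \<in> G" "lact a p = p" if "a \<in> stab p" for a using that p by (auto simp: stab_iff)
  have irr: "irreducible_twisted V (fst p) (card G) (snd p)" and dec: "twisted_decomposed V (fst p) (card G) (snd p)"
    using S_D[OF p] twisted_decomposedI by auto
  have phM: "\<phi> a p m \<in> Msp p" if "a \<in> stab p" "m \<in> Msp p" for a m
    using phi(4)[OF p st(1)[OF that(1)] that(2)] st(2)[OF that(1)] by simp
  \<comment> \<open>Apply the relation to \<open>u\<^sub>k m\<close>: as \<open>\<phi> a\<close>
    carries this to the mode of \<open>a u\<close> on \<open>\<phi> a p m\<close>, the tensor built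
    from the \<open>a u\<close> and the \<open>c a *\<^sub>C \<phi> a p m\<close> lies in the kernel
    treated by \<open>mode_tensor_injective\<close>. The functionals \<open>l\<close> and
    \<open>l'\<close> extract scalars from its vanishing.\<close>
  have new: "(\<Sum>a\<in>stab p. (c a * l (a u)) *\<^sub>C \<phi> a p m) = 0"
    if l: "lin_map UNIV (UNIV :: complex set) l" and u: "u \<in> vspace V" and m: "m \<in> Msp p" for l u m
  proof (rule ccontr)
    assume "(\<Sum>a\<in>stab p. (c a * l (a u)) *\<^sub>C \<phi> a p m) \<noteq> 0"
    then obtain l' where l': "lin_map UNIV (UNIV :: complex set) l'" "l' (\<Sum>a\<in>stab p. (c a * l (a u)) *\<^sub>C \<phi> a p m) \<noteq> 0"
      using functional_separates by blast
    have "(\<Sum>a\<in>stab p. l' (c a *\<^sub>C \<phi> a p m) *\<^sub>C a u) = 0"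
    proof (rule mode_tensor_injective[OF irr dec simple P.finite_H _ _ _ l'(1)])
      show "a u \<in> vspace V" if "a \<in> stab p" for a using autD(5)[OF st(1)[OF that] u] .
      show "c a *\<^sub>C \<phi> a p m \<in> Msp p" if "a \<in> stab p" for a
        using phM[OF that m] by (rule cvec.subspace_scale[OF Msp_facts(1)[OF p]])
      show "(\<Sum>a\<in>stab p. Mm p (a u) k (c a *\<^sub>C \<phi> a p m)) = 0" for k
      proof -
        have "(\<Sum>a\<in>stab p. Mm p (a u) k (c a *\<^sub>C \<phi> a p m)) = (\<Sum>a\<in>stab p. c a *\<^sub>C \<phi> a p (Mm p u k m))"
        proof (rule sum.cong[OF refl])
          fix a assume a: "a \<in> stab p"
          show "Mm p (a u) k (c a *\<^sub>C \<phi> a p m) = c a *\<^sub>C \<phi> a p (Mm p u k m)"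
            using lin_map_scale[OF Msp_facts(4)[OF p autD(5)[OF st(1)[OF a] u]] phM[OF a m]]
              phi(5)[OF p st(1)[OF a] u m, of k] st(2)[OF a] by simp
        qed
        then show ?thesis using less.prems[OF Msp_facts(3)[OF p u m]] by simp
      qed
    qed
    then have "l (\<Sum>a\<in>stab p. l' (c a *\<^sub>C \<phi> a p m) *\<^sub>C a u) = 0" using lin_map_zero[OF l] by simp
    then have "(\<Sum>a\<in>stab p. l' (c a *\<^sub>C \<phi> a p m) * l (a u)) = 0"
      by (simp add: lin_map_lincomb[OF l])
    moreover have "l' (\<Sum>a\<in>stab p. (c a * l (a u)) *\<^sub>C \<phi> a p m) = (\<Sum>a\<in>stab p. l' (c a *\<^sub>C \<phi> a p m) * l (a u))"
      by (simp add: lin_map_lincomb[OF l'(1)] lin_map_scale[OF l'(1)] mult_ac)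
    ultimately show False using l'(2) by simp
  qed
  show ?case
  proof (rule ccontr)
    assume "\<not> ?case"
    then obtain b where b: "b \<in> stab p" "c b \<noteq> 0" by blast
    have eq: "a = b" if a: "a \<in> stab p" "c a \<noteq> 0" for a
    proof (rule aut_eqI[OF st(1)[OF a(1)] st(1)[OF b(1)]])
      fix u assume u: "u \<in> vspace V"
      show "a u = b u"
      proof (rule ccontr)
        assume "a u \<noteq> b u"
        then obtain l where l: "lin_map UNIV (UNIV :: complex set) l" "l (a u - b u) \<noteq> 0"
          using functional_separates[of "a u - b u"] by auto
        \<comment> \<open>The coefficient at \<open>b\<close> cancels, so the support shrinks and
          the induction hypothesis applies; but the coefficient at \<open>a\<close> survives, as
          \<open>l\<close> separates \<open>a u\<close> from \<open>b u\<close>.\<close>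
        let ?e = "\<lambda>a. c a * l (a u) - l (b u) * c a"
        have "card {a \<in> stab p. ?e a \<noteq> 0} < card {a \<in> stab p. c a \<noteq> 0}"
        proof (rule psubset_card_mono)
          show "{a \<in> stab p. ?e a \<noteq> 0} \<subset> {a \<in> stab p. c a \<noteq> 0}" using b by auto
        qed (use P.finite_H in auto)
        then have "\<forall>a\<in>stab p. ?e a = 0"
        proof (rule less.hyps)
          fix m assume m: "m \<in> Msp p"
          have "(\<Sum>a\<in>stab p. ?e a *\<^sub>C \<phi> a p m) =
              (\<Sum>a\<in>stab p. (c a * l (a u)) *\<^sub>C \<phi> a p m) - l (b u) *\<^sub>C (\<Sum>a\<in>stab p. c a *\<^sub>C \<phi> a p m)"
            by (simp add: cvec.scale_left_diff_distrib sum_subtractf cvec.scale_sum_right)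
          then show "(\<Sum>a\<in>stab p. ?e a *\<^sub>C \<phi> a p m) = 0" using new[OF l(1) u m] less.prems[OF m] by simp
        qed
        then have "c a * (l (a u) - l (b u)) = 0" using a(1) by (simp add: algebra_simps)
        then show False using a(2) l(2) lin_map_diff[OF l(1), of "a u" "b u"] by simp
      qed
    qed
    obtain m where m: "m \<in> Msp p" "m \<noteq> 0" using Msp_nonzero[OF p] by blast
    have "0 = (\<Sum>a\<in>stab p. c a *\<^sub>C \<phi> a p m)" using less.prems[OF m(1)] by simp
    also have "\<dots> = (\<Sum>a\<in>{b}. c a *\<^sub>C \<phi> a p m)"
    proof (rule sum.mono_neutral_right)
      show "\<forall>a\<in>stab p - {b}. c a *\<^sub>C \<phi> a p m = 0"
      proof
        fix a assume "a \<in> stab p - {b}"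
        then have "c a = 0" using eq[of a] by blast
        then show "c a *\<^sub>C \<phi> a p m = 0" by simp
      qed
    qed (use P.finite_H b(1) in simp_all)
    finally have "c b *\<^sub>C \<phi> b p m = 0" by simp
    then have "\<phi> b p m = 0" using b(2) by simp
    then show False using m(2) phi_zero_iff[OF p st(1)[OF b(1)] m(1)] by simp
  qed
qed

end

section \<open>Homomorphism spaces as modules for the fixed-point algebra\<close>

text \<open>An injective linear map preserves the support, so both sums run over the same indices
  and no finiteness has to be checked: over an infinite support both are zero.\<close>

lemma lin_iso_Sum_any:
  assumes f: "lin_iso M N f" and M: "cvec.subspace M" and a: "\<And>i. a i \<in> M"
  shows "Sum_any a \<in> M" "f (Sum_any a) = Sum_any (\<lambda>i. f (a i))"
proof -
  have fl: "lin_map M N f" and inj: "inj_on f M" using f by (auto simp: lin_iso_def bij_betw_def)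
  have f0: "f 0 = 0" by (rule lin_map_zero[OF fl M])
  have "f (a i) = 0 \<longleftrightarrow> a i = 0" for i
    using inj_on_eq_iff[OF inj a cvec.subspace_0[OF M], of i] f0 by simp
  then have s: "{i. f (a i) \<noteq> 0} = {i. a i \<noteq> 0}" by simp
  show "Sum_any a \<in> M" unfolding Sum_any.expand_set using a by (intro cvec.subspace_sum[OF M])
  show "f (Sum_any a) = Sum_any (\<lambda>i. f (a i))"
    unfolding Sum_any.expand_set s using a by (rule lin_map_sum[OF fl M])
qed

text \<open>Every axiom for \<open>M\<close> is an equation or a statement about subspaces, so it
  can be pulled back along the bijection \<open>f\<close> commuting with the modes. In the
  application \<open>f\<close> is evaluation at a vector, and the axioms for a space of
  homomorphisms come from those of a submodule.\<close>

lemma irreducible_twisted_transport: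
  assumes N: "irreducible_twisted V g T N" and f: "lin_iso (mspace M) (mspace N) f"
    and sub: "cvec.subspace (mspace M)"
    and cl: "\<And>u k w. u \<in> vspace V \<Longrightarrow> w \<in> mspace M \<Longrightarrow> mmode M u k w \<in> mspace M"
    and hom: "\<And>u k w. u \<in> vspace V \<Longrightarrow> w \<in> mspace M \<Longrightarrow> f (mmode M u k w) = mmode N u k (f w)"
    and V: "cvec.subspace (vspace V)" "vac V \<in> vspace V" "conf V \<in> vspace V"
      "\<And>u v n. u \<in> vspace V \<Longrightarrow> v \<in> vspace V \<Longrightarrow> vmode V u n v \<in> vspace V"
  shows "irreducible_twisted V g T M"
proof -
  interpret N: twisted_module V g T N using N by (simp add: irreducible_twisted_def)
  have fl: "lin_map (mspace M) (mspace N) f" and bij: "bij_betw f (mspace M) (mspace N)" using f by (auto simp: lin_iso_def)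
  have eqI: "x = y" if "x \<in> mspace M" "y \<in> mspace M" "f x = f y" for x y
    using bij that by (auto simp: bij_betw_def inj_on_def)
  have fN: "f x \<in> mspace N" if "x \<in> mspace M" for x by (rule lin_map_in[OF fl that])
  have f0: "f 0 = 0" by (rule lin_map_zero[OF fl sub])
  note add = cvec.subspace_add[OF sub] and scale = cvec.subspace_scale[OF sub] and zero = cvec.subspace_0[OF sub]
  note fadd = lin_map_add[OF fl] and fscale = lin_map_scale[OF fl]
  have tw: "twisted_module V g T M"
  proof
    show "lin_map (mspace M) (mspace M) (mmode M u k)" if u: "u \<in> vspace V" for u k
    proof (rule lin_mapI)
      fix x y c assume x: "x \<in> mspace M"
      show "mmode M u k (c *\<^sub>C x) = c *\<^sub>C mmode M u k x"
        by (rule eqI) (use x u in \<open>simp_all add: cl scale hom fscale lin_map_scale[OF N.mode_linear] fN\<close>)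
      assume y: "y \<in> mspace M"
      show "mmode M u k (x + y) = mmode M u k x + mmode M u k y"
        by (rule eqI) (use x y u in \<open>simp_all add: cl add hom fadd lin_map_add[OF N.mode_linear] fN\<close>)
    qed (rule cl[OF u])
    show "lin_map (vspace V) (mspace M) (\<lambda>u. mmode M u k w)" if w: "w \<in> mspace M" for w k
    proof (rule lin_mapI)
      fix x y c assume x: "x \<in> vspace V"
      show "mmode M (c *\<^sub>C x) k w = c *\<^sub>C mmode M x k w"
        by (rule eqI) (use x w in \<open>simp_all add: cl scale hom fscale lin_map_scale[OF N.field_linear] fN cvec.subspace_scale[OF V(1)]\<close>)
      assume y: "y \<in> vspace V"
      show "mmode M (x + y) k w = mmode M x k w + mmode M y k w"
        by (rule eqI) (use x y w in \<open>simp_all add: cl add hom fadd lin_map_add[OF N.field_linear] fN cvec.subspace_add[OF V(1)]\<close>)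
    qed (rule cl[OF _ w])
    show "\<exists>n. \<forall>k\<ge>n. mmode M u k w = 0" if u: "u \<in> vspace V" and w: "w \<in> mspace M" for u w
    proof -
      obtain n where n: "\<forall>k\<ge>n. mmode N u k (f w) = 0" using N.truncation[OF u fN[OF w]] by blast
      have "mmode M u k w = 0" if "k \<ge> n" for k
        by (rule eqI) (use u w n that in \<open>simp_all add: cl zero hom f0\<close>)
      then show ?thesis by blast
    qed
    show "mmode M u k w = 0" if "r < T" "u \<in> eigenspace_aut V g T r" "w \<in> mspace M" "k - of_nat r / of_nat T \<notin> \<int>" for r u w k
    proof (rule eqI)
      have u: "u \<in> vspace V" using that by (simp add: eigenspace_aut_def)
      show "mmode M u k w \<in> mspace M" using cl[OF u that(3)] .
      show "f (mmode M u k w) = f 0" using hom[OF u that(3)] N.exponents[OF that(1,2) fN[OF that(3)] that(4)] f0 by simp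
    qed (rule zero)
    show "mmode M (vac V) k w = (if k = -1 then w else 0)" if w: "w \<in> mspace M" for w k
      by (rule eqI) (use w V(2) in \<open>simp_all add: cl zero hom f0 N.vacuum fN\<close>)
    show "Sum_any (\<lambda>i::nat. (of_rat m gchoose i) *\<^sub>C mmode M (vmode V u (l + int i) v) (m + n - of_nat i) w) =
      Sum_any (\<lambda>i::nat. ((-1) ^ i * (of_int l gchoose i)) *\<^sub>C
        (mmode M u (m + of_int l - of_nat i) (mmode M v (n + of_nat i) w) -
         ((-1) powi l) *\<^sub>C mmode M v (n + of_int l - of_nat i) (mmode M u (m + of_nat i) w)))"
      (is "Sum_any ?a = Sum_any ?b")
      if r: "r < T" and u: "u \<in> eigenspace_aut V g T r" and v: "v \<in> vspace V" and w: "w \<in> mspace M"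
        and m: "m - of_nat r / of_nat T \<in> \<int>" for r u v w m n l
    proof -
      have uV: "u \<in> vspace V" using u by (simp add: eigenspace_aut_def)
      have a: "?a i \<in> mspace M" for i by (intro scale cl V(4) uV v w)
      have b: "?b i \<in> mspace M" for i by (intro scale cl uV v w cvec.subspace_diff[OF sub])
      have fa: "f (?a i) = (of_rat m gchoose i) *\<^sub>C mmode N (vmode V u (l + int i) v) (m + n - of_nat i) (f w)" for i
        using uV v w by (simp add: fscale cl V(4) hom)
      have fb: "f (?b i) = ((-1) ^ i * (of_int l gchoose i)) *\<^sub>C
        (mmode N u (m + of_int l - of_nat i) (mmode N v (n + of_nat i) (f w)) -
         ((-1) powi l) *\<^sub>C mmode N v (n + of_int l - of_nat i) (mmode N u (m + of_nat i) (f w)))" for i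
        using uV v w by (simp add: fscale cl hom lin_map_diff[OF fl sub] scale cvec.subspace_diff[OF sub])
      note A = lin_iso_Sum_any[OF f sub, of ?a, OF a] and B = lin_iso_Sum_any[OF f sub, of ?b, OF b]
      show ?thesis
      proof (rule eqI[OF A(1) B(1)])
        show "f (Sum_any ?a) = f (Sum_any ?b)"
          unfolding A(2) B(2) fa fb by (rule N.jacobi[OF r u v fN[OF w] m])
      qed
    qed
  qed (rule sub)
  let ?g = "inv_into (mspace M) f"
  have g: "lin_map (mspace N) (mspace M) ?g" using lin_iso_inv[OF f sub] by (simp add: lin_iso_def)
  have gf: "?g (f x) = x" if "x \<in> mspace M" for x using bij that by (simp add: bij_betw_def)
  have fg: "f (?g y) = y" "?g y \<in> mspace M" if "y \<in> mspace N" for y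
    using bij that by (auto simp: bij_betw_def f_inv_into_f inv_into_into)
  have E: "?g y \<in> L0_eigenspace V M c" if y: "y \<in> L0_eigenspace V N c" for y c
  proof -
    have yN: "y \<in> mspace N" "mmode N (conf V) 1 y = c *\<^sub>C y" using y by (auto simp: L0_eigenspace_def)
    have "mmode M (conf V) 1 (?g y) = c *\<^sub>C ?g y"
      by (rule eqI) (use yN V(3) fg[OF yN(1)] in \<open>simp_all add: cl scale hom fscale\<close>)
    then show ?thesis using fg[OF yN(1)] by (simp add: L0_eigenspace_def)
  qed
  have E2: "f x \<in> L0_eigenspace V N c" if x: "x \<in> L0_eigenspace V M c" for x c
    using x fN fscale hom[OF V(3)] by (auto simp: L0_eigenspace_def) metis
  have sp: "cvec.span (\<Union>c. L0_eigenspace V N c) = mspace N" and fd: "\<And>c. fin_dim (L0_eigenspace V N c)"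
    using N by (auto simp: irreducible_twisted_def ordinary_def)
  have "ordinary V M"
    unfolding ordinary_def
  proof (intro conjI allI)
    have "x \<in> cvec.span (\<Union>c. L0_eigenspace V M c)" if x: "x \<in> mspace M" for x
    proof -
      have "?g (f x) \<in> cvec.span (\<Union>c. L0_eigenspace V M c)"
      proof (rule lin_map_span_image[OF g N.subspace])
        show "f x \<in> cvec.span (\<Union>c. L0_eigenspace V N c)" using fN[OF x] sp by simp
        show "(\<Union>c. L0_eigenspace V N c) \<subseteq> mspace N" by (auto simp: L0_eigenspace_def)
        show "?g b \<in> cvec.span (\<Union>c. L0_eigenspace V M c)" if "b \<in> (\<Union>c. L0_eigenspace V N c)" for b
          using that E by (intro cvec.span_base) blast
      qed auto
      then show ?thesis using gf[OF x] by simp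
    qed
    moreover have "cvec.span (\<Union>c. L0_eigenspace V M c) \<subseteq> mspace M"
      using sub by (intro cvec.span_minimal) (auto simp: L0_eigenspace_def)
    ultimately show "cvec.span (\<Union>c. L0_eigenspace V M c) = mspace M" by blast
    fix c
    have LN: "cvec.subspace (L0_eigenspace V N c)"
      unfolding L0_eigenspace_def using lin_map_zero[OF N.mode_linear[OF V(3)] N.subspace]
      by (auto intro!: cvec.subspaceI simp: cvec.subspace_0[OF N.subspace] cvec.subspace_add[OF N.subspace]
        cvec.subspace_scale[OF N.subspace] lin_map_add[OF N.mode_linear[OF V(3)]] lin_map_scale[OF N.mode_linear[OF V(3)]]
        scaleC_add_right mult.commute)
    have "lin_map (L0_eigenspace V N c) UNIV ?g" by (rule lin_map_mono[OF g]) (auto simp: L0_eigenspace_def)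
    then have "fin_dim (?g ` L0_eigenspace V N c)" by (rule fin_dim_image[OF fd _ LN])
    moreover have "?g ` L0_eigenspace V N c = L0_eigenspace V M c"
    proof
      show "?g ` L0_eigenspace V N c \<subseteq> L0_eigenspace V M c" using E by blast
      show "L0_eigenspace V M c \<subseteq> ?g ` L0_eigenspace V N c"
      proof
        fix x assume x: "x \<in> L0_eigenspace V M c"
        then have "x = ?g (f x)" using gf by (simp add: L0_eigenspace_def)
        then show "x \<in> ?g ` L0_eigenspace V N c" using E2[OF x] by (rule image_eqI)
      qed
    qed
    ultimately show "fin_dim (L0_eigenspace V M c)" by simp
  qed
  moreover have "mspace M \<noteq> {0}"
  proof
    assume M0: "mspace M = {0}"
    have "mspace N = f ` mspace M" using bij by (simp add: bij_betw_def)
    then have "mspace N = {0}" using M0 f0 by simp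
    then show False using N by (simp add: irreducible_twisted_def)
  qed
  moreover have "K = {0} \<or> K = mspace M" if K: "submod V M K" for K
  proof -
    have KM: "K \<subseteq> mspace M" and Ks: "cvec.subspace K" using K by (auto simp: submod_def)
    have "submod V N (f ` K)"
      unfolding submod_def
    proof (intro conjI ballI allI)
      show "cvec.subspace (f ` K)" using lin_map_mono[OF fl KM order_refl] Ks by (rule lin_map_image)
      show "f ` K \<subseteq> mspace N" using KM fN by blast
      fix u k w assume u: "u \<in> vspace V" and "w \<in> f ` K"
      then obtain x where x: "x \<in> K" "w = f x" by blast
      have "mmode N u k w = f (mmode M u k x)" using hom[OF u, of x] x KM by auto
      then show "mmode N u k w \<in> f ` K" using K u x(1) by (auto simp: submod_def)
    qed
    then have "f ` K = {0} \<or> f ` K = mspace N" using N by (simp add: irreducible_twisted_def)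
    moreover have "?g ` f ` K = K" using gf KM by (force simp: image_iff)
    moreover have "?g ` mspace N = mspace M" using bij_betw_inv_into[OF bij] by (simp add: bij_betw_def)
    moreover have "?g ` {0} = {0}" using lin_map_zero[OF g N.subspace] by simp
    ultimately show ?thesis by metis
  qed
  ultimately show ?thesis using tw by (simp add: irreducible_twisted_def)
qed

section \<open>Restriction to the fixed-point subalgebra\<close>

context automorphism_group
begin

abbreviation VG where "VG \<equiv> fixed_voa V G"

lemma VG_facts: "cvec.subspace (vspace VG)" "vac VG \<in> vspace VG" "conf VG \<in> vspace VG"
  "u \<in> vspace VG \<Longrightarrow> v \<in> vspace VG \<Longrightarrow> vmode VG u n v \<in> vspace VG"
proof -
  interpret vertex_operator_algebra V by (rule voa)
  have a0: "a 0 = 0" if "a \<in> G" for a using lin_map_zero[OF autD(2)[OF that] subspace] .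
  show "cvec.subspace (vspace VG)"
    by (rule cvec.subspaceI)
      (auto simp: cvec.subspace_0[OF subspace] cvec.subspace_add[OF subspace] cvec.subspace_scale[OF subspace] a0
        lin_map_add[OF autD(2)] lin_map_scale[OF autD(2)])
  show "vac VG \<in> vspace VG" "conf VG \<in> vspace VG" using autD vac_in conf_in by auto
  have aut: "a (vmode V u n v) = vmode V (a u) n (a v)" if "a \<in> G" "u \<in> vspace V" "v \<in> vspace V" for a u v n
    using group that by (auto simp: finite_aut_group_def voa_aut_def)
  have "a (vmode V u n v) = vmode V u n v" if a: "a \<in> G" and u: "u \<in> vspace VG" and v: "v \<in> vspace VG" for a
  proof -
    have "a u = u" "a v = v" using a u v by simp_all
    then show ?thesis using aut[OF a, of u v n] u v by simp
  qed
  then show "u \<in> vspace VG \<Longrightarrow> v \<in> vspace VG \<Longrightarrow> vmode VG u n v \<in> vspace VG"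
    using lin_map_in[OF mode_linear] by simp
qed

text \<open>Vectors fixed by \<open>G\<close> are eigenvectors of index \<open>r = 0\<close> for
  every \<open>g\<close>, so their modes have integral indices and the twisted Jacobi identity
  becomes the untwisted one. The grading restricts because \<open>N\<close> is stable under
  \<open>L(0)\<close>, the conformal vector being fixed.\<close>

lemma fixed_submodule:
  assumes M: "irreducible_twisted V g (card G) M" and g: "g \<in> G" and N: "submod VG M N"
  shows "twisted_module VG id 1 (M\<lparr>mspace := N\<rparr>)" "ordinary VG (M\<lparr>mspace := N\<rparr>)"
proof -
  interpret M: twisted_module V g "card G" M using M by (simp add: irreducible_twisted_def)
  have T: "0 < card G" using finite_H id_in by (auto simp: card_gt_0_iff)
  have NM: "N \<subseteq> mspace M" and Ns: "cvec.subspace N" and Ncl: "\<And>u k w. u \<in> vspace VG \<Longrightarrow> w \<in> N \<Longrightarrow> mmode M u k w \<in> N"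
    using N by (auto simp: submod_def)
  have V: "u \<in> vspace V" if "u \<in> vspace VG" for u using that by simp
  have E: "u \<in> eigenspace_aut V g (card G) 0" if "u \<in> vspace VG" for u
    using that g by (auto simp: eigenspace_aut_def)
  have ml: "lin_map N N (mmode M u k)" if "u \<in> vspace VG" for u k
    using M.mode_linear[OF V[OF that], of k] NM Ncl[OF that] by (auto simp: lin_map_def subset_iff)
  show "twisted_module VG id 1 (M\<lparr>mspace := N\<rparr>)"
  proof
    show "lin_map (vspace VG) (mspace (M\<lparr>mspace := N\<rparr>)) (\<lambda>u. mmode (M\<lparr>mspace := N\<rparr>) u k w)"
      if "w \<in> mspace (M\<lparr>mspace := N\<rparr>)" for w k
      using M.field_linear[of w k] that NM Ncl by (auto simp: lin_map_def)
    show "\<exists>n. \<forall>k\<ge>n. mmode (M\<lparr>mspace := N\<rparr>) u k w = 0" if "u \<in> vspace VG" "w \<in> mspace (M\<lparr>mspace := N\<rparr>)" for u w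
      using M.truncation[of u w] that NM by auto
    show "mmode (M\<lparr>mspace := N\<rparr>) u k w = 0"
      if "r < 1" "u \<in> eigenspace_aut VG id 1 r" "w \<in> mspace (M\<lparr>mspace := N\<rparr>)" "k - of_nat r / of_nat 1 \<notin> \<int>" for r u w k
    proof -
      have "u \<in> vspace VG" using that(2) by (simp add: eigenspace_aut_def)
      then show ?thesis using M.exponents[OF T E, of u w k] that NM by auto
    qed
    show "mmode (M\<lparr>mspace := N\<rparr>) (vac VG) k w = (if k = -1 then w else 0)" if "w \<in> mspace (M\<lparr>mspace := N\<rparr>)" for w k
      using M.vacuum[of w k] that NM by auto
    show "Sum_any (\<lambda>i::nat. (of_rat m gchoose i) *\<^sub>C mmode (M\<lparr>mspace := N\<rparr>) (vmode VG u (l + int i) v) (m + n - of_nat i) w) =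
      Sum_any (\<lambda>i::nat. ((-1) ^ i * (of_int l gchoose i)) *\<^sub>C
        (mmode (M\<lparr>mspace := N\<rparr>) u (m + of_int l - of_nat i) (mmode (M\<lparr>mspace := N\<rparr>) v (n + of_nat i) w) -
         ((-1) powi l) *\<^sub>C mmode (M\<lparr>mspace := N\<rparr>) v (n + of_int l - of_nat i) (mmode (M\<lparr>mspace := N\<rparr>) u (m + of_nat i) w)))"
      if r: "r < 1" and u: "u \<in> eigenspace_aut VG id 1 r" and v: "v \<in> vspace VG" and w: "w \<in> mspace (M\<lparr>mspace := N\<rparr>)"
        and m: "m - of_nat r / of_nat 1 \<in> \<int>" for r u v w m n l
    proof -
      have uV: "u \<in> vspace VG" using u by (simp add: eigenspace_aut_def)
      have wM: "w \<in> mspace M" using w NM by auto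
      have "m - of_nat 0 / of_nat (card G) \<in> \<int>" using m r by simp
      from M.jacobi[OF T E[OF uV] V[OF v] wM this, of l n] show ?thesis by simp
    qed
  qed (use Ns ml in auto)
  have L: "lin_map (mspace M) (mspace M) (mmode M (conf V) 1)" using conf_V by (rule M.mode_linear)
  have eq: "L0_eigenspace VG (M\<lparr>mspace := N\<rparr>) c = N \<inter> L0_eigenspace V M c" for c
    using NM by (auto simp: L0_eigenspace_def)
  have sub: "cvec.subspace (L0_eigenspace V M c)" for c
    unfolding L0_eigenspace_def using lin_map_zero[OF L M.subspace]
    by (auto intro!: cvec.subspaceI simp: cvec.subspace_0[OF M.subspace] cvec.subspace_add[OF M.subspace]
        cvec.subspace_scale[OF M.subspace] lin_map_add[OF L] lin_map_scale[OF L] scaleC_add_right mult.commute)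
  have sp: "cvec.span (\<Union>c. L0_eigenspace V M c) = mspace M" and fd: "\<And>c. fin_dim (L0_eigenspace V M c)"
    using M by (auto simp: irreducible_twisted_def ordinary_def)
  show "ordinary VG (M\<lparr>mspace := N\<rparr>)"
    unfolding ordinary_def eq
  proof (intro conjI allI)
    show "fin_dim (N \<inter> L0_eigenspace V M c)" for c
      using fd cvec.subspace_inter[OF Ns sub] by (rule fin_dim_subset) auto
    have "x \<in> cvec.span (\<Union>c. N \<inter> L0_eigenspace V M c)" if x: "x \<in> N" for x
    proof -
      have "x \<in> cvec.span (\<Union>c. L0_eigenspace V M c)" using x NM sp by auto
      then obtain C y where C: "finite C" "\<And>c. c \<in> C \<Longrightarrow> y c \<in> L0_eigenspace V M c" "x = (\<Sum>c\<in>C. y c)"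
      proof (rule span_eigenspaces_decomp[OF _ sub])
        fix C y assume *: "finite C" "\<And>c. c \<in> C \<Longrightarrow> y c \<in> L0_eigenspace V M c" "x = (\<Sum>c\<in>C. y c)"
        show thesis by (rule that[OF *])
      qed
      have "y c \<in> N" if c: "c \<in> C" for c
      proof (rule eigen_components_in_subspace[OF Ns L M.subspace _ C(1) _ _ c])
        show "mmode M (conf V) 1 z \<in> N" if "z \<in> N" for z using Ncl[OF VG_facts(3) that] by simp
        show "y c \<in> mspace M \<and> mmode M (conf V) 1 (y c) = c *\<^sub>C y c" if "c \<in> C" for c
          using C(2)[OF that] by (simp add: L0_eigenspace_def)
        show "(\<Sum>c\<in>C. y c) \<in> N" using x C(3) by simp
      qed
      then have "y c \<in> (\<Union>c. N \<inter> L0_eigenspace V M c)" if "c \<in> C" for c using C(2)[OF that] that by blast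
      then show ?thesis unfolding C(3) by (intro cvec.span_sum cvec.span_base)
    qed
    moreover have "cvec.span (\<Union>c. N \<inter> L0_eigenspace V M c) \<subseteq> N" using Ns by (intro cvec.span_minimal) auto
    ultimately show "cvec.span (\<Union>c. N \<inter> L0_eigenspace V M c) = mspace (M\<lparr>mspace := N\<rparr>)" by auto
  qed
qed

end

context orbifold
begin

lemma stab_algebra_eq: "stab_algebra V G S \<phi> p = twisted_group_algebra (stab p) (coc p)"
  by (simp add: stab_algebra_def)

abbreviation hom_sp where "hom_sp p W \<rho> \<equiv> mspace (hom_mod V G S \<phi> p W \<rho>)"
abbreviation stab_hom where "stab_hom p W \<rho> f \<equiv> ophom (stab p) W (\<lambda>a. \<rho> (bvec a)) (Msp p) (\<lambda>a. \<phi> a p) f"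

text \<open>Compatibility with the whole algebra is reduced to the basis elements
  \<open>bvec a\<close>, the form in which the results on operators indexed by the stabilizer
  apply.\<close>

lemma hom_sp_iff:
  assumes p: "p \<in> S" and W: "alg_module (stab_algebra V G S \<phi> p) W \<rho>"
  shows "f \<in> hom_sp p W \<rho> \<longleftrightarrow> stab_hom p W \<rho> f \<and> (\<forall>w. w \<notin> W \<longrightarrow> f w = 0)"
proof -
  interpret P: twisted_group "stab p" "coc p" by (rule twisted_group_stab[OF p])
  have W': "alg_module P.A W \<rho>" using W by (simp add: stab_algebra_eq)
  note pr = P.alg_module_proj_rep[OF W']
  have "(\<forall>x\<in>fspace (stab p). \<forall>w\<in>W. f (\<rho> x w) = (\<Sum>a\<in>stab p. x a *\<^sub>C \<phi> a p (f w))) \<longleftrightarrow>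
      (\<forall>a\<in>stab p. \<forall>w\<in>W. f (\<rho> (bvec a) w) = \<phi> a p (f w))" (is "?l \<longleftrightarrow> ?r") if f: "lin_map W (Msp p) f"
  proof
    assume l: ?l
    show ?r
    proof (intro ballI)
      fix a w assume a: "a \<in> stab p" and w: "w \<in> W"
      have "f (\<rho> (bvec a) w) = (\<Sum>b\<in>stab p. bvec a b *\<^sub>C \<phi> b p (f w))" using l bvec_in_fspace[OF a] w by blast
      then show "f (\<rho> (bvec a) w) = \<phi> a p (f w)" unfolding sum_bvec_scale[OF P.finite_H a] .
    qed
  next
    assume r: ?r
    have h: "stab_hom p W \<rho> f" using f r by (simp add: ophom_def)
    show ?l
    proof (intro ballI)
      fix x w assume x: "x \<in> fspace (stab p)" and w: "w \<in> W"
      show "f (\<rho> x w) = (\<Sum>a\<in>stab p. x a *\<^sub>C \<phi> a p (f w))"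
        using P.ophom_alg_act[OF h P.proj_repD(2)[OF pr(1)] w, of x] pr(2)[OF x w]
        by (simp only: P.alg_act_def)
    qed
  qed
  then show ?thesis
    by (auto simp: hom_mod_def stab_algebra_eq P.A_simps ophom_def)
qed

lemma hom_mod_mode: "mmode (hom_mod V G S \<phi> p W \<rho>) u k f = (\<lambda>w. if w \<in> W then Mm p u k (f w) else 0)"
  by (simp add: hom_mod_def)

lemma subspace_hom_sp:
  assumes p: "p \<in> S" and W: "alg_module (stab_algebra V G S \<phi> p) W \<rho>"
  shows "cvec.subspace (hom_sp p W \<rho>)"
proof -
  interpret P: twisted_group "stab p" "coc p" by (rule twisted_group_stab[OF p])
  note M0 = Msp_facts(1)[OF p]
  have ph: "lin_map (Msp p) (Msp p) (\<phi> a p)" if "a \<in> stab p" for a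
    using phi(2)[OF p, of a] that by (simp add: stab_iff[OF p])
  note ph0 = lin_map_zero[OF ph M0]
  show ?thesis
  proof (rule cvec.subspaceI)
    show "0 \<in> hom_sp p W \<rho>"
      by (auto simp: hom_sp_iff[OF p W] ophom_def ph0 cvec.subspace_0[OF M0] intro!: lin_mapI)
    fix f h c assume f: "f \<in> hom_sp p W \<rho>"
    then have f': "lin_map W (Msp p) f" by (simp add: hom_sp_iff[OF p W] ophom_def)
    show "c *\<^sub>C f \<in> hom_sp p W \<rho>"
      using f lin_map_in[OF f'] lin_map_add[OF f'] lin_map_scale[OF f']
      by (auto simp: hom_sp_iff[OF p W] ophom_def lin_map_scale[OF ph] cvec.subspace_scale[OF M0] scaleC_add_right mult.commute
          intro!: lin_mapI)
    assume h: "h \<in> hom_sp p W \<rho>"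
    then have h': "lin_map W (Msp p) h" by (simp add: hom_sp_iff[OF p W] ophom_def)
    show "f + h \<in> hom_sp p W \<rho>"
      using f h lin_map_in[OF f'] lin_map_add[OF f'] lin_map_scale[OF f'] lin_map_in[OF h'] lin_map_add[OF h'] lin_map_scale[OF h']
      by (auto simp: hom_sp_iff[OF p W] ophom_def lin_map_add[OF ph] cvec.subspace_add[OF M0] scaleC_add_right
          intro!: lin_mapI)
  qed
qed

lemma hom_mode_in:
  assumes p: "p \<in> S" and W: "alg_module (stab_algebra V G S \<phi> p) W \<rho>" and f: "f \<in> hom_sp p W \<rho>" and u: "u \<in> vspace VG"
  shows "mmode (hom_mod V G S \<phi> p W \<rho>) u k f \<in> hom_sp p W \<rho>"
proof -
  interpret P: twisted_group "stab p" "coc p" by (rule twisted_group_stab[OF p])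
  have W': "alg_module P.A W \<rho>" using W by (simp add: stab_algebra_eq)
  note pr = P.alg_module_proj_rep[OF W']
  have uV: "u \<in> vspace V" and ua: "\<And>a. a \<in> G \<Longrightarrow> a u = u" using u by auto
  have f': "lin_map W (Msp p) f" "\<And>a w. a \<in> stab p \<Longrightarrow> w \<in> W \<Longrightarrow> f (\<rho> (bvec a) w) = \<phi> a p (f w)"
    using f by (auto simp: hom_sp_iff[OF p W] ophom_def)
  note l = lin_map_comp[OF f'(1) Msp_facts(4)[OF p uV, of k]]
  have "lin_map W (Msp p) (\<lambda>w. if w \<in> W then Mm p u k (f w) else 0)"
    by (rule lin_map_cong[OF l P.proj_repD(1)[OF pr(1)]]) simp
  moreover have "Mm p u k (f (\<rho> (bvec a) w)) = \<phi> a p (Mm p u k (f w))" if a: "a \<in> stab p" and w: "w \<in> W" for a w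
    using phi(5)[OF p _ uV lin_map_in[OF f'(1) w], of a k] a ua[of a] f'(2)[OF a w] by (simp add: stab_iff[OF p])
  ultimately show ?thesis
    using P.proj_repD(4)[OF pr(1)] by (auto simp: hom_sp_iff[OF p W] hom_mod_mode ophom_def)
qed

end

section \<open>Homomorphisms from one simple module of a stabilizer algebra\<close>

locale stab_simple = orbifold V G S \<phi>
  for V :: "'v::complex_vector voa" and G and S :: "('v, 'm::complex_vector) tpair set" and \<phi> +
  fixes p :: "('v, 'm) tpair" and W :: "'w::complex_vector set" and \<rho> :: "(('v \<Rightarrow> 'v) \<Rightarrow> complex) \<Rightarrow> 'w \<Rightarrow> 'w"
  assumes p: "p \<in> S" and simple_W: "simple_alg_module (stab_algebra V G S \<phi> p) W \<rho>"
begin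

sublocale P: twisted_group "stab p" "coc p"
  by (rule twisted_group_stab[OF p])

lemma alg_W: "alg_module (stab_algebra V G S \<phi> p) W \<rho>" and alg_W': "alg_module P.A W \<rho>"
  using simple_W by (simp_all add: simple_alg_module_def stab_algebra_eq)

abbreviation r where "r a \<equiv> \<rho> (bvec a)"

lemmas rep_W = P.alg_module_proj_rep[OF alg_W']
lemmas rep_M = proj_rep_phi[OF p]
lemmas sub_W = P.proj_repD(1)[OF rep_W(1)]

lemma opsimple_W: "opsimple (stab p) W (\<lambda>a. r a)"
  using simple_W P.simple_alg_module_opsimple by (simp add: stab_algebra_eq)

lemma fin_W: "fin_dim W"
  by (rule P.opsimple_fin_dim[OF rep_W(1) opsimple_W])

abbreviation Hom where "Hom \<equiv> hom_sp p W \<rho>"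

lemma HomD:
  assumes "f \<in> Hom"
  shows "stab_hom p W \<rho> f" "lin_map W (Msp p) f" "w \<in> W \<Longrightarrow> f w \<in> Msp p" "w \<notin> W \<Longrightarrow> f w = 0"
    "a \<in> stab p \<Longrightarrow> w \<in> W \<Longrightarrow> f (r a w) = \<phi> a p (f w)"
  using assms by (auto simp: hom_sp_iff[OF p alg_W] ophom_def lin_map_in)

text \<open>The kernel of a homomorphism on the simple module \<open>W\<close> is trivial or
  everything; evaluation at a nonzero vector therefore loses nothing.\<close>

lemma Hom_inj:
  assumes f: "f \<in> Hom" and w: "w \<in> W" "w \<noteq> 0" and fw: "f w = 0"
  shows "f = 0"
proof (rule ccontr)
  assume "f \<noteq> 0"
  then obtain x where "f x \<noteq> 0" by (auto simp: fun_eq_iff)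
  then have "x \<in> W" "f x \<noteq> 0" using HomD(4)[OF f] by auto
  then show False using schur_inj(2)[OF opsimple_W P.proj_repD(2)[OF rep_M] HomD(1)[OF f]] w fw by blast
qed

lemma Hom_sum:
  assumes f: "f \<in> Hom" and B: "finite B" "B \<subseteq> W"
  shows "(\<Sum>b\<in>B. \<Sum>a\<in>stab p. c b a *\<^sub>C \<phi> a p (f b)) = f (\<Sum>b\<in>B. \<Sum>a\<in>stab p. c b a *\<^sub>C r a b)"
    "(\<Sum>b\<in>B. \<Sum>a\<in>stab p. c b a *\<^sub>C r a b) \<in> W"
proof -
  have inner: "(\<Sum>a\<in>stab p. c b a *\<^sub>C r a b) \<in> W" if "b \<in> B" for b
    using P.proj_repD(4)[OF rep_W(1)] that B by (intro cvec.subspace_sum[OF sub_W] cvec.subspace_scale[OF sub_W]) auto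
  then show "(\<Sum>b\<in>B. \<Sum>a\<in>stab p. c b a *\<^sub>C r a b) \<in> W" by (rule cvec.subspace_sum[OF sub_W])
  have "f (\<Sum>b\<in>B. \<Sum>a\<in>stab p. c b a *\<^sub>C r a b) = (\<Sum>b\<in>B. f (\<Sum>a\<in>stab p. c b a *\<^sub>C r a b))"
    using inner by (rule lin_map_sum[OF HomD(2)[OF f] sub_W])
  also have "\<dots> = (\<Sum>b\<in>B. \<Sum>a\<in>stab p. c b a *\<^sub>C \<phi> a p (f b))"
  proof (rule sum.cong[OF refl])
    fix b assume b: "b \<in> B"
    have "f (\<Sum>a\<in>stab p. c b a *\<^sub>C r a b) = (\<Sum>a\<in>stab p. c b a *\<^sub>C f (r a b))"
      using P.proj_repD(4)[OF rep_W(1)] b B(2) by (intro lin_map_lincomb[OF HomD(2)[OF f] sub_W]) auto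
    also have "\<dots> = (\<Sum>a\<in>stab p. c b a *\<^sub>C \<phi> a p (f b))"
      using HomD(5)[OF f] b B(2) by (intro sum.cong) auto
    finally show "f (\<Sum>a\<in>stab p. c b a *\<^sub>C r a b) = (\<Sum>a\<in>stab p. c b a *\<^sub>C \<phi> a p (f b))" .
  qed
  finally show "(\<Sum>b\<in>B. \<Sum>a\<in>stab p. c b a *\<^sub>C \<phi> a p (f b)) = f (\<Sum>b\<in>B. \<Sum>a\<in>stab p. c b a *\<^sub>C r a b)" by simp
qed

text \<open>Evaluate \<open>f\<close> and \<open>f'\<close> on a basis of \<open>W\<close>. A
  relation among the \<open>\<phi> a p (f b)\<close> is \<open>f\<close> applied to an element of
  \<open>W\<close>; as \<open>f\<close> is injective this element is zero, so \<open>f'\<close>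
  satisfies the relation as well, and density for fixed-point modes applies.\<close>

lemma hom_density:
  assumes f: "f \<in> Hom" "f \<noteq> 0" and f': "f' \<in> Hom" and e: "e \<in> W"
  shows "f' e \<in> cvec.span {Mm p x k (f e) |x k. x \<in> vspace VG}"
proof -
  obtain B where B: "finite B" "cvec.independent B" "cvec.span B = W"
    using obtain_finite_basis[OF fin_W sub_W] by blast
  have BW: "B \<subseteq> W" using B(3) cvec.span_superset by blast
  let ?G = "{\<lambda>b. if b \<in> B then Mm p x k (f b) else 0 |x k. x \<in> vspace VG}"
  let ?y = "\<lambda>b. if b \<in> B then f' b else 0"
  let ?D = "dsum B (\<lambda>_. Msp p)"
  have mem: "?y \<in> cvec.span ?G"
  proof (rule density_fixed_stab[where \<kappa> = "\<lambda>_. p" and I = B])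
    show "f b \<in> Msp p" if "b \<in> B" for b using HomD(3)[OF f(1)] BW that by blast
    show "?y \<in> ?D" using HomD(3)[OF f'] BW by (auto intro!: dsumI)
    fix c q
    assume 0: "(\<Sum>i\<in>{i \<in> B. p = q}. \<Sum>b\<in>stab q. c i b *\<^sub>C \<phi> b q (f i)) = 0"
    show "(\<Sum>i\<in>{i \<in> B. p = q}. \<Sum>b\<in>stab q. c i b *\<^sub>C \<phi> b q (?y i)) = 0"
    proof (cases "p = q")
      case True
      have Bq: "{i \<in> B. p = q} = B" using True by simp
      let ?u = "\<Sum>b\<in>B. \<Sum>a\<in>stab p. c b a *\<^sub>C r a b"
      have "f ?u = 0" using 0 Hom_sum(1)[OF f(1) B(1) BW, of c] unfolding Bq True[symmetric] by simp
      then have "?u = 0" using Hom_inj[OF f(1) Hom_sum(2)[OF f(1) B(1) BW, of c]] f(2) by blast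
      then have "f' ?u = 0" using lin_map_zero[OF HomD(2)[OF f'] sub_W] by simp
      then have "(\<Sum>b\<in>B. \<Sum>a\<in>stab p. c b a *\<^sub>C \<phi> a p (f' b)) = 0" using Hom_sum(1)[OF f' B(1) BW, of c] by simp
      then show ?thesis unfolding Bq True[symmetric] by (simp cong: sum.cong_simp)
    qed simp
  qed (use B(1) p in auto)
  \<comment> \<open>The coordinates of \<open>e\<close> turn the tuple of values on the basis into
    the value at \<open>e\<close>; this linear map carries the span for the tuple into the span for
    the one vector \<open>f e\<close>.\<close>
  let ?ev = "\<lambda>z. \<Sum>b\<in>B. cvec.representation B e b *\<^sub>C z b"
  have lev: "lin_map ?D UNIV ?ev"
    by (intro lin_mapI) (auto simp: scaleC_add_right sum.distrib cvec.scale_sum_right mult.commute)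
  have ex: "(\<Sum>b\<in>B. cvec.representation B e b *\<^sub>C b) = e" using e B by (intro cvec.sum_representation_eq) auto
  have ev: "?ev (\<lambda>b. if b \<in> B then h b else 0) = h e" if h: "lin_map W (Msp p) h" for h
  proof -
    have "h e = h (\<Sum>b\<in>B. cvec.representation B e b *\<^sub>C b)" using ex by simp
    also have "\<dots> = (\<Sum>b\<in>B. cvec.representation B e b *\<^sub>C h b)" using BW by (intro lin_map_lincomb[OF h sub_W]) auto
    finally show ?thesis by (simp cong: sum.cong_simp)
  qed
  have "?ev ?y \<in> cvec.span {Mm p x k (f e) |x k. x \<in> vspace VG}"
  proof (rule lin_map_span_image[OF lev _ mem])
    show "cvec.subspace ?D" by (rule subspace_dsum) (rule Msp_facts(1)[OF p])
    show "?G \<subseteq> ?D"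
    proof
      fix z assume "z \<in> ?G"
      then obtain x k where z: "z = (\<lambda>b. if b \<in> B then Mm p x k (f b) else 0)" "x \<in> vspace VG" by blast
      show "z \<in> ?D" unfolding z(1) using Msp_facts(3)[OF p] HomD(3)[OF f(1)] BW z(2) by (auto intro!: dsumI)
    qed
    fix z assume "z \<in> ?G"
    then obtain x k where z: "z = (\<lambda>b. if b \<in> B then Mm p x k (f b) else 0)" "x \<in> vspace VG" by blast
    have xV: "x \<in> vspace V" using z(2) by simp
    have "lin_map W (Msp p) (\<lambda>b. Mm p x k (f b))"
      by (rule lin_map_comp[OF HomD(2)[OF f(1)] Msp_facts(4)[OF p xV]])
    then have "?ev z = Mm p x k (f e)" unfolding z(1) by (rule ev)
    then show "?ev z \<in> cvec.span {Mm p x k (f e) |x k. x \<in> vspace VG}" using z(2) by (intro cvec.span_base) blast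
  qed auto
  then show ?thesis unfolding ev[OF HomD(2)[OF f']] .
qed

text \<open>A copy of the space of homomorphisms inside the twisted module. For
  \<open>e \<noteq> 0\<close> it is a faithful copy by \<open>Hom_inj\<close>, and as a submodule
  for the fixed-point modes it inherits the module axioms.\<close>

definition ev_image :: "'w \<Rightarrow> 'm set"
  where "ev_image e = (\<lambda>f. f e) ` Hom"

lemma lin_map_ev: "e \<in> W \<Longrightarrow> lin_map Hom (Msp p) (\<lambda>f. f e)"
  by (intro lin_mapI) (auto simp: HomD(3))

lemma submod_ev_image:
  assumes e: "e \<in> W"
  shows "submod VG (snd p) (ev_image e)"
  unfolding submod_def ev_image_def
proof (intro conjI ballI allI)
  show "cvec.subspace ((\<lambda>f. f e) ` Hom)" by (rule lin_map_image[OF lin_map_ev[OF e] subspace_hom_sp[OF p alg_W]])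
  show "(\<lambda>f. f e) ` Hom \<subseteq> Msp p" using HomD(3) e by blast
  fix u k w assume u: "u \<in> vspace VG" and "w \<in> (\<lambda>f. f e) ` Hom"
  then obtain f where f: "f \<in> Hom" "w = f e" by blast
  have "Mm p u k w = mmode (hom_mod V G S \<phi> p W \<rho>) u k f e" using e f by (simp add: hom_mod_mode)
  then show "Mm p u k w \<in> (\<lambda>f. f e) ` Hom" using hom_mode_in[OF p alg_W f(1) u, of k] by blast
qed

text \<open>The independence of the operators \<open>\<phi> a p\<close> enters here through
  \<open>nonzero_hom_exists\<close>; the resulting map is cut off outside \<open>W\<close> to meet
  the normalisation.\<close>

lemma Hom_nonzero: "\<exists>f\<in>Hom. f \<noteq> 0"
proof -
  obtain w where w: "w \<in> W" "w \<noteq> 0"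
    using opsimple_W cvec.subspace_0[OF sub_W] by (auto simp: opsimple_def)
  have "\<exists>f. stab_hom p W \<rho> f \<and> f w \<noteq> 0"
  proof (rule P.nonzero_hom_exists[OF rep_W(1) w rep_M])
    fix c assume "\<And>x. x \<in> Msp p \<Longrightarrow> (\<Sum>a\<in>stab p. c a *\<^sub>C \<phi> a p x) = 0"
    then have "\<forall>a\<in>stab p. c a = 0" by (rule phi_independent[OF p])
    then show "c id = 0" using P.id_in by blast
  qed
  then obtain f where f: "stab_hom p W \<rho> f" "f w \<noteq> 0" by blast
  let ?f = "\<lambda>w. if w \<in> W then f w else 0"
  have fl: "lin_map W (Msp p) ?f" by (rule lin_map_cong[OF _ sub_W]) (use f in \<open>auto simp: ophom_def\<close>)
  have "?f \<in> Hom"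
    using fl f(1) P.proj_repD(4)[OF rep_W(1)] by (auto simp: hom_sp_iff[OF p alg_W] ophom_def)
  moreover have "?f \<noteq> 0" using f(2) w(1) by (auto simp: fun_eq_iff)
  ultimately show ?thesis by blast
qed

lemma lin_iso_ev:
  assumes e: "e \<in> W" "e \<noteq> 0"
  shows "lin_iso Hom (ev_image e) (\<lambda>f. f e)"
proof -
  have "inj_on (\<lambda>f. f e) Hom"
    using Hom_inj[OF _ e] by (intro lin_map_inj_on[OF lin_map_ev[OF e(1)] subspace_hom_sp[OF p alg_W]])
  then show ?thesis using lin_map_ev[OF e(1)] by (auto simp: lin_iso_def bij_betw_def ev_image_def lin_map_def)
qed

lemma irreducible_ev_image:
  assumes e: "e \<in> W" "e \<noteq> 0"
  shows "irreducible_mod VG ((snd p)\<lparr>mspace := ev_image e\<rparr>)"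
proof -
  note sub = submod_ev_image[OF e(1)]
  have "ev_image e \<noteq> {0}"
  proof -
    obtain f where f: "f \<in> Hom" "f \<noteq> 0" using Hom_nonzero by blast
    then have "f e \<noteq> 0" using Hom_inj[OF f(1) e] by blast
    then show ?thesis using f(1) by (auto simp: ev_image_def)
  qed
  moreover have "K = {0} \<or> K = ev_image e" if K: "submod VG ((snd p)\<lparr>mspace := ev_image e\<rparr>) K" for K
  proof (rule ccontr)
    assume c: "\<not> ?thesis"
    have KN: "K \<subseteq> ev_image e" and Ks: "cvec.subspace K" and Kc: "\<And>u k w. u \<in> vspace VG \<Longrightarrow> w \<in> K \<Longrightarrow> Mm p u k w \<in> K"
      using K by (auto simp: submod_def)
    obtain x where x: "x \<in> K" "x \<noteq> 0" using c cvec.subspace_0[OF Ks] by blast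
    then obtain f where f: "f \<in> Hom" "x = f e" using KN by (auto simp: ev_image_def)
    have f0: "f \<noteq> 0" using f x by auto
    have "ev_image e \<subseteq> K"
    proof
      fix y assume "y \<in> ev_image e"
      then obtain f' where f': "f' \<in> Hom" "y = f' e" by (auto simp: ev_image_def)
      have "cvec.span {Mm p u k (f e) |u k. u \<in> vspace VG} \<subseteq> K"
        using Kc x(1) f(2) by (intro cvec.span_minimal[OF _ Ks]) blast
      then show "y \<in> K" using hom_density[OF f(1) f0 f'(1) e(1)] f'(2) by blast
    qed
    then show False using c KN by blast
  qed
  ultimately show ?thesis
    using fixed_submodule[OF S_D(2)[OF p] S_D(1)[OF p] sub] by (auto simp: irreducible_twisted_def)
qed

lemma irreducible_hom_mod: "irreducible_mod VG (hom_mod V G S \<phi> p W \<rho>)"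
proof -
  obtain e where e: "e \<in> W" "e \<noteq> 0"
    using opsimple_W cvec.subspace_0[OF sub_W] by (auto simp: opsimple_def)
  show ?thesis
  proof (rule irreducible_twisted_transport[OF irreducible_ev_image[OF e], of _ "\<lambda>f. f e"])
    show "lin_iso Hom (mspace ((snd p)\<lparr>mspace := ev_image e\<rparr>)) (\<lambda>f. f e)" using lin_iso_ev[OF e] by simp
    show "mmode (hom_mod V G S \<phi> p W \<rho>) u k w e = mmode ((snd p)\<lparr>mspace := ev_image e\<rparr>) u k (w e)" for u k w
      using e(1) by (simp add: hom_mod_mode)
  qed (use subspace_hom_sp[OF p alg_W] hom_mode_in[OF p alg_W] VG_facts in blast)+
qed

end

section \<open>Inequivalence and complete reducibility\<close>

locale orbifold_decomposition = orbifold V G S \<phi>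
  for V :: "'v::complex_vector voa" and G and S :: "('v, 'm::complex_vector) tpair set" and \<phi> +
  fixes J :: "'j set" and rep :: "'j \<Rightarrow> ('v, 'm) tpair"
    and \<Lambda> :: "'j \<Rightarrow> ((('v \<Rightarrow> 'v) \<Rightarrow> complex) \<Rightarrow> complex) set"
    and W :: "'j \<Rightarrow> ((('v \<Rightarrow> 'v) \<Rightarrow> complex) \<Rightarrow> complex) \<Rightarrow> 'w::complex_vector set"
    and \<rho> :: "'j \<Rightarrow> ((('v \<Rightarrow> 'v) \<Rightarrow> complex) \<Rightarrow> complex) \<Rightarrow> (('v \<Rightarrow> 'v) \<Rightarrow> complex) \<Rightarrow> 'w \<Rightarrow> 'w"
  assumes reps: "orbit_representatives V G S J rep"
    and Lambda: "j \<in> J \<Longrightarrow> \<Lambda> j = irr_characters (stab_algebra V G S \<phi> (rep j))"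
    and modules: "j \<in> J \<Longrightarrow> \<mu> \<in> \<Lambda> j \<Longrightarrow> simple_alg_module (stab_algebra V G S \<phi> (rep j)) (W j \<mu>) (\<rho> j \<mu>) \<and>
      alg_character (stab_algebra V G S \<phi> (rep j)) (W j \<mu>) (\<rho> j \<mu>) = \<mu>"
begin

lemma rep_S: "j \<in> J \<Longrightarrow> rep j \<in> S"
  using reps by (simp add: orbit_representatives_def)

lemma orbit_index:
  assumes "q \<in> S"
  obtains j a where "j \<in> J" "a \<in> G" "lact a (rep j) = q"
proof -
  have "\<exists>!j. j \<in> J \<and> q \<in> pact V S (rep j) ` G" using reps assms by (simp add: orbit_representatives_def)
  then obtain j b where "j \<in> J" "b \<in> G" "q = pact V S (rep j) b" by blast
  then show ?thesis using that[of j "inv b"] inv_in inv_inv by simp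
qed

lemma orbit_index_unique:
  assumes j: "j \<in> J" "j' \<in> J" and a: "a \<in> G" "b \<in> G" and eq: "lact a (rep j) = lact b (rep j')"
  shows "j = j'"
proof -
  have "lact a (rep j) \<in> S" by (rule lact_in[OF rep_S[OF j(1)] a(1)])
  then have "\<exists>!i. i \<in> J \<and> lact a (rep j) \<in> pact V S (rep i) ` G" using reps by (simp add: orbit_representatives_def)
  moreover have "lact a (rep j) \<in> pact V S (rep j) ` G" using inv_in[OF a(1)] by blast
  moreover have "lact a (rep j) \<in> pact V S (rep j') ` G" unfolding eq using inv_in[OF a(2)] by blast
  ultimately show ?thesis using j by blast
qed

lemma rep_unique:
  assumes "j \<in> J" "j' \<in> J" "a \<in> G" "lact a (rep j) = rep j'"
  shows "j = j'"
  using orbit_index_unique[OF assms(1-3) id_in] assms(4) lact_id[OF rep_S[OF assms(2)]] by simp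

lemma finite_J: "finite J"
proof (rule finite_imageD[of rep])
  show "finite (rep ` J)" using finite_S rep_S by (blast intro: finite_subset)
  show "inj_on rep J"
  proof (rule inj_onI)
    fix i j assume ij: "i \<in> J" "j \<in> J" "rep i = rep j"
    show "i = j" using rep_unique[OF ij(1,2) id_in] ij(3) lact_id[OF rep_S[OF ij(1)]] by simp
  qed
qed

lemma stab_simpleI: "j \<in> J \<Longrightarrow> \<mu> \<in> \<Lambda> j \<Longrightarrow> stab_simple V G S \<phi> (rep j) (W j \<mu>) (\<rho> j \<mu>)"
  using modules rep_S by (simp add: stab_simple_def stab_simple_axioms_def orbifold_axioms)

lemma finite_Lambda: "j \<in> J \<Longrightarrow> finite (\<Lambda> j)"
  using twisted_group.finite_irr_characters[OF twisted_group_stab[OF rep_S]] Lambda by (simp add: stab_algebra_eq)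

abbreviation rr where "rr j \<mu> a \<equiv> \<rho> j \<mu> (bvec a)"

text \<open>A nonzero map between simple modules would be an isomorphism, and isomorphic modules
  have the same character, which is their label.\<close>

lemma character_distinct:
  assumes j: "j \<in> J" and \<mu>: "\<mu> \<in> \<Lambda> j" "\<nu> \<in> \<Lambda> j" "\<mu> \<noteq> \<nu>"
    and f: "ophom (stab (rep j)) (W j \<mu>) (rr j \<mu>) (W j \<nu>) (rr j \<nu>) f"
  shows "\<forall>x\<in>W j \<mu>. f x = 0"
proof (rule ccontr)
  assume "\<not> ?thesis"
  interpret A: stab_simple V G S \<phi> "rep j" "W j \<mu>" "\<rho> j \<mu>" by (rule stab_simpleI[OF j \<mu>(1)])
  interpret B: stab_simple V G S \<phi> "rep j" "W j \<nu>" "\<rho> j \<nu>" by (rule stab_simpleI[OF j \<mu>(2)])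
  from \<open>\<not> ?thesis\<close> have "lin_iso (W j \<mu>) (W j \<nu>) f" using schur_iso[OF A.opsimple_W B.opsimple_W f] by blast
  then have "alg_character A.P.A (W j \<mu>) (\<rho> j \<mu>) = alg_character A.P.A (W j \<nu>) (\<rho> j \<nu>)"
    by (rule A.P.alg_character_iso[OF A.alg_W' A.fin_W B.alg_W' _ f])
  then show False using modules[OF j \<mu>(1)] modules[OF j \<mu>(2)] \<mu>(3) by (simp add: stab_algebra_eq)
qed

text \<open>The character of \<open>N\<close> is one of the labels in \<open>\<Lambda> j\<close>,
  and simple modules with equal characters are isomorphic; so the chosen module with that label is a
  copy of \<open>N\<close>.\<close>

lemma simple_occurs:
  assumes j: "j \<in> J" and N: "opsub (stab (rep j)) (Msp (rep j)) (\<lambda>a. \<phi> a (rep j)) N"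
    and s: "opsimple (stab (rep j)) N (\<lambda>a. \<phi> a (rep j))"
  shows "\<exists>\<mu>\<in>\<Lambda> j. \<exists>f. lin_iso (W j \<mu>) N f \<and> ophom (stab (rep j)) (W j \<mu>) (rr j \<mu>) N (\<lambda>a. \<phi> a (rep j)) f"
proof -
  interpret P: twisted_group "stab (rep j)" "coc (rep j)" by (rule twisted_group_stab[OF rep_S[OF j]])
  have pN: "P.proj_rep N (\<lambda>a. \<phi> a (rep j))" by (rule P.proj_rep_sub[OF proj_rep_phi[OF rep_S[OF j]] N])
  define \<mu> where "\<mu> = alg_character P.A N (P.alg_act (\<lambda>a. \<phi> a (rep j)))"
  have \<mu>: "\<mu> \<in> \<Lambda> j" using P.alg_character_in_irr[OF pN s] by (simp add: Lambda[OF j] \<mu>_def stab_algebra_eq)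
  interpret A: stab_simple V G S \<phi> "rep j" "W j \<mu>" "\<rho> j \<mu>" by (rule stab_simpleI[OF j \<mu>])
  have "alg_character P.A (W j \<mu>) (P.alg_act (\<lambda>a. \<rho> j \<mu> (bvec a))) = alg_character P.A (W j \<mu>) (\<rho> j \<mu>)"
    by (rule P.alg_character_alg_act[OF A.alg_W' A.fin_W])
  also have "\<dots> = \<mu>" using modules[OF j \<mu>] by (simp add: stab_algebra_eq)
  finally have "alg_character P.A (W j \<mu>) (P.alg_act (\<lambda>a. \<rho> j \<mu> (bvec a))) = alg_character P.A N (P.alg_act (\<lambda>a. \<phi> a (rep j)))"
    by (simp add: \<mu>_def)
  then show ?thesis using P.same_character_iso[OF A.rep_W(1) A.opsimple_W pN s] \<mu> by blast
qed

abbreviation Hom where "Hom j \<mu> \<equiv> hom_sp (rep j) (W j \<mu>) (\<rho> j \<mu>)"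

text \<open>Complete reducibility over the stabilizer in the form of \<open>isotypic_span\<close>;
  homomorphisms are replaced by their extensions by zero, which are the elements of
  \<open>Hom j \<mu>\<close>.\<close>

lemma module_spanned:
  assumes j: "j \<in> J"
  shows "Msp (rep j) = cvec.span {f u |\<mu> f u. \<mu> \<in> \<Lambda> j \<and> f \<in> Hom j \<mu> \<and> u \<in> W j \<mu>}"
    (is "_ = cvec.span ?G")
proof
  interpret P: twisted_group "stab (rep j)" "coc (rep j)" by (rule twisted_group_stab[OF rep_S[OF j]])
  have pW: "P.proj_rep (W j \<mu>) (rr j \<mu>)" if "\<mu> \<in> \<Lambda> j" for \<mu>
    using stab_simple.rep_W(1)[OF stab_simpleI[OF j that]] .
  show "Msp (rep j) \<subseteq> cvec.span ?G"
  proof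
    fix x assume x: "x \<in> Msp (rep j)"
    have "x \<in> cvec.span {f u |\<mu> f u. \<mu> \<in> \<Lambda> j \<and> u \<in> W j \<mu> \<and> ophom (stab (rep j)) (W j \<mu>) (rr j \<mu>) (Msp (rep j)) (\<lambda>a. \<phi> a (rep j)) f}"
      by (rule P.isotypic_span[OF proj_rep_phi[OF rep_S[OF j]] simple_occurs[OF j] pW x])
    also have "\<dots> \<subseteq> cvec.span ?G"
    proof (rule cvec.span_mono, clarify)
      fix \<mu> f u assume \<mu>: "\<mu> \<in> \<Lambda> j" and u: "u \<in> W j \<mu>"
        and f: "ophom (stab (rep j)) (W j \<mu>) (rr j \<mu>) (Msp (rep j)) (\<lambda>a. \<phi> a (rep j)) f"
      interpret A: stab_simple V G S \<phi> "rep j" "W j \<mu>" "\<rho> j \<mu>" by (rule stab_simpleI[OF j \<mu>])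
      let ?f = "\<lambda>w. if w \<in> W j \<mu> then f w else 0"
      have "lin_map (W j \<mu>) (Msp (rep j)) ?f"
        by (rule lin_map_cong[OF _ A.sub_W]) (use f in \<open>auto simp: ophom_def\<close>)
      then have "?f \<in> Hom j \<mu>"
        using f P.proj_repD(4)[OF A.rep_W(1)] by (auto simp: hom_sp_iff[OF A.p A.alg_W] ophom_def)
      then show "\<exists>\<mu>' f' u'. f u = f' u' \<and> \<mu>' \<in> \<Lambda> j \<and> f' \<in> Hom j \<mu>' \<and> u' \<in> W j \<mu>'"
        using \<mu> u by (intro exI[of _ \<mu>] exI[of _ ?f] exI[of _ u]) simp
    qed
    finally show "x \<in> cvec.span ?G" .
  qed
  show "cvec.span ?G \<subseteq> Msp (rep j)"
  proof (rule cvec.span_minimal[OF _ Msp_facts(1)[OF rep_S[OF j]]], clarify)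
    fix \<mu> f u assume \<mu>: "\<mu> \<in> \<Lambda> j" and f: "f \<in> Hom j \<mu>" and u: "u \<in> W j \<mu>"
    show "f u \<in> Msp (rep j)" by (rule stab_simple.HomD(3)[OF stab_simpleI[OF j \<mu>] f u])
  qed
qed

definition basis where "basis j \<mu> = (SOME B. finite B \<and> cvec.independent B \<and> cvec.span B = W j \<mu>)"

lemma basis:
  assumes "j \<in> J" "\<mu> \<in> \<Lambda> j"
  shows "finite (basis j \<mu>)" "cvec.independent (basis j \<mu>)" "cvec.span (basis j \<mu>) = W j \<mu>" "basis j \<mu> \<subseteq> W j \<mu>"
    "b \<in> basis j \<mu> \<Longrightarrow> b \<noteq> 0"
proof -
  interpret A: stab_simple V G S \<phi> "rep j" "W j \<mu>" "\<rho> j \<mu>" by (rule stab_simpleI[OF assms])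
  obtain B where "finite B \<and> cvec.independent B \<and> cvec.span B = W j \<mu>"
    using obtain_finite_basis[OF A.fin_W A.sub_W order_refl] by metis
  then have "finite (basis j \<mu>) \<and> cvec.independent (basis j \<mu>) \<and> cvec.span (basis j \<mu>) = W j \<mu>"
    unfolding basis_def by (rule someI)
  then show b: "finite (basis j \<mu>)" "cvec.independent (basis j \<mu>)" "cvec.span (basis j \<mu>) = W j \<mu>" by auto
  show "basis j \<mu> \<subseteq> W j \<mu>" using b(3) cvec.span_superset by blast
  show "b \<in> basis j \<mu> \<Longrightarrow> b \<noteq> 0" using b(2) cvec.dependent_zero by blast
qed

lemma independent_images:
  assumes j: "j \<in> J" and f: "\<And>\<mu> b. \<mu> \<in> \<Lambda> j \<Longrightarrow> b \<in> basis j \<mu> \<Longrightarrow> f \<mu> b \<in> Hom j \<mu>"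
    and 0: "(\<Sum>\<mu>\<in>\<Lambda> j. \<Sum>b\<in>basis j \<mu>. f \<mu> b b) = 0"
    and \<mu>: "\<mu> \<in> \<Lambda> j" and b: "b \<in> basis j \<mu>"
  shows "f \<mu> b = 0"
proof -
  interpret P: twisted_group "stab (rep j)" "coc (rep j)" by (rule twisted_group_stab[OF rep_S[OF j]])
  have "f \<mu> b u = 0" if u: "u \<in> W j \<mu>" for u
  proof (rule P.isotypic_independent[where K = "\<Lambda> j" and U = "W j" and r = "rr j" and B = "basis j" and f = f
        and X = "Msp (rep j)" and s = "\<lambda>a. \<phi> a (rep j)"])
    show "P.proj_rep (W j \<nu>) (rr j \<nu>)" "opsimple (stab (rep j)) (W j \<nu>) (rr j \<nu>)" if "\<nu> \<in> \<Lambda> j" for \<nu>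
      using stab_simple.rep_W(1)[OF stab_simpleI[OF j that]] stab_simple.opsimple_W[OF stab_simpleI[OF j that]] .
    show "ophom (stab (rep j)) (W j \<nu>) (rr j \<nu>) (Msp (rep j)) (\<lambda>a. \<phi> a (rep j)) (f \<nu> c)" if "\<nu> \<in> \<Lambda> j" "c \<in> basis j \<nu>" for \<nu> c
      by (rule stab_simple.HomD(1)[OF stab_simpleI[OF j that(1)] f[OF that]])
    show "\<forall>x\<in>W j k. h x = 0" if "k \<in> \<Lambda> j" "l \<in> \<Lambda> j" "k \<noteq> l" "ophom (stab (rep j)) (W j k) (rr j k) (W j l) (rr j l) h" for k l h
      by (rule character_distinct[OF j that])
  qed (use finite_Lambda[OF j] basis[OF j] proj_rep_phi[OF rep_S[OF j]] 0 \<mu> b u in auto)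
  moreover have "f \<mu> b u = 0" if "u \<notin> W j \<mu>" for u
    by (rule stab_simple.HomD(4)[OF stab_simpleI[OF j \<mu>] f[OF \<mu> b] that])
  ultimately show ?thesis by (auto simp: fun_eq_iff)
qed

text \<open>Independence of two isotypic parts, for arbitrary vectors instead of basis vectors: an
  algebra element acting as the identity on \<open>W j \<mu>\<close> and as zero on
  \<open>W j \<nu>\<close> fixes \<open>f u\<close> and kills \<open>h v\<close>.\<close>

lemma distinct_images:
  assumes j: "j \<in> J" and \<mu>: "\<mu> \<in> \<Lambda> j" "\<nu> \<in> \<Lambda> j" "\<mu> \<noteq> \<nu>" and f: "f \<in> Hom j \<mu>" and h: "h \<in> Hom j \<nu>"
    and u: "u \<in> W j \<mu>" and v: "v \<in> W j \<nu>" and 0: "f u + h v = 0"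
  shows "f u = 0"
proof -
  interpret A: stab_simple V G S \<phi> "rep j" "W j \<mu>" "\<rho> j \<mu>" by (rule stab_simpleI[OF j \<mu>(1)])
  interpret B: stab_simple V G S \<phi> "rep j" "W j \<nu>" "\<rho> j \<nu>" by (rule stab_simpleI[OF j \<mu>(2)])
  have pW: "A.P.proj_rep (W j k) (rr j k)" and sW: "opsimple (stab (rep j)) (W j k) (rr j k)" if "k \<in> \<Lambda> j" for k
    using stab_simple.rep_W(1)[OF stab_simpleI[OF j that]] stab_simple.opsimple_W[OF stab_simpleI[OF j that]] .
  have "\<exists>x\<in>fspace (stab (rep j)). \<forall>k\<in>\<Lambda> j. \<forall>w\<in>W j k. A.P.alg_act (rr j k) x w = (if k = \<mu> then w else 0)"
  proof (rule A.P.burnside[OF finite_Lambda[OF j] pW sW])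
    show "lin_map (W j k) (W j k) (\<lambda>w. if k = \<mu> then w else 0)" if "k \<in> \<Lambda> j" for k
      using A.P.proj_repD(1)[OF pW[OF that]] by (intro lin_mapI) (auto simp: cvec.subspace_0)
    show "\<forall>x\<in>W j k. h x = 0" if "k \<in> \<Lambda> j" "l \<in> \<Lambda> j" "k \<noteq> l" "ophom (stab (rep j)) (W j k) (rr j k) (W j l) (rr j l) h" for k l h
      by (rule character_distinct[OF j that])
  qed
  then obtain x where x: "\<And>k w. k \<in> \<Lambda> j \<Longrightarrow> w \<in> W j k \<Longrightarrow> A.P.alg_act (rr j k) x w = (if k = \<mu> then w else 0)" by blast
  let ?s = "\<lambda>a. \<phi> a (rep j)"
  have l: "lin_map (Msp (rep j)) (Msp (rep j)) (A.P.alg_act ?s x)"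
    by (rule A.P.lin_map_alg_act[OF A.P.proj_repD(2)[OF A.rep_M]])
  have "A.P.alg_act ?s x (f u) = f u"
    using A.P.ophom_alg_act[OF A.HomD(1)[OF f] A.P.proj_repD(2)[OF A.rep_W(1)] u, of x] x[OF \<mu>(1) u] by simp
  moreover have "A.P.alg_act ?s x (h v) = 0"
    using A.P.ophom_alg_act[OF B.HomD(1)[OF h] A.P.proj_repD(2)[OF B.rep_W(1)] v, of x] x[OF \<mu>(2) v] \<mu>(3)
      lin_map_zero[OF B.HomD(2)[OF h] B.sub_W] by simp
  moreover have "A.P.alg_act ?s x (f u + h v) = A.P.alg_act ?s x (f u) + A.P.alg_act ?s x (h v)"
    by (rule lin_map_add[OF l A.HomD(3)[OF f u] B.HomD(3)[OF h v]])
  ultimately show ?thesis using 0 lin_map_zero[OF l Msp_facts(1)[OF A.p]] by simp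
qed

text \<open>For an isomorphism \<open>h\<close> the fixed-point modes keep the pair
  \<open>(f1, h f1)\<close> inside the graph of \<open>h\<close>. If the labels differ, the values
  of the two homomorphisms satisfy no mixed relation, so density moves the pair to
  \<open>(f1, 0)\<close>; hence \<open>h f1 = 0\<close>, against injectivity.\<close>

lemma hom_mod_inequivalent:
  assumes j1: "j1 \<in> J" "\<mu>1 \<in> \<Lambda> j1" and j2: "j2 \<in> J" "\<mu>2 \<in> \<Lambda> j2"
    and iso: "tmod_iso VG (hom_mod V G S \<phi> (rep j1) (W j1 \<mu>1) (\<rho> j1 \<mu>1)) (hom_mod V G S \<phi> (rep j2) (W j2 \<mu>2) (\<rho> j2 \<mu>2))"
  shows "j1 = j2 \<and> \<mu>1 = \<mu>2"
proof (rule ccontr)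
  assume ne: "\<not> ?thesis"
  interpret A: stab_simple V G S \<phi> "rep j1" "W j1 \<mu>1" "\<rho> j1 \<mu>1" by (rule stab_simpleI[OF j1])
  interpret B: stab_simple V G S \<phi> "rep j2" "W j2 \<mu>2" "\<rho> j2 \<mu>2" by (rule stab_simpleI[OF j2])
  let ?p1 = "rep j1" and ?p2 = "rep j2"
  note b1 = basis[OF j1] and b2 = basis[OF j2]
  obtain h where h: "lin_iso A.Hom B.Hom h"
    and hm: "\<And>u k f. u \<in> vspace VG \<Longrightarrow> f \<in> A.Hom \<Longrightarrow> h (mmode (hom_mod V G S \<phi> ?p1 (W j1 \<mu>1) (\<rho> j1 \<mu>1)) u k f) =
      mmode (hom_mod V G S \<phi> ?p2 (W j2 \<mu>2) (\<rho> j2 \<mu>2)) u k (h f)"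
    using iso unfolding tmod_iso_def by blast
  have hl: "lin_map A.Hom B.Hom h" and hinj: "inj_on h A.Hom" using h by (auto simp: lin_iso_def bij_betw_def)
  note subA = subspace_hom_sp[OF A.p A.alg_W]
  obtain f1 where f1: "f1 \<in> A.Hom" "f1 \<noteq> 0" using A.Hom_nonzero by blast
  define f2 where "f2 = h f1"
  have f2: "f2 \<in> B.Hom" unfolding f2_def using hl f1(1) by (rule lin_map_in)
  have f20: "f2 \<noteq> 0"
    using inj_onD[OF hinj _ f1(1) cvec.subspace_0[OF subA]] lin_map_zero[OF hl subA] f1(2) by (auto simp: f2_def)
  \<comment> \<open>Basis vectors of both modules, tagged by a truth value because the two bases may
    share elements.\<close>
  let ?I = "Pair True ` basis j1 \<mu>1 \<union> Pair False ` basis j2 \<mu>2"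
  let ?\<kappa> = "\<lambda>i. if fst i then ?p1 else ?p2"
  define pr where "pr F F' = (\<lambda>i. if i \<in> ?I then if fst i then F (snd i) else F' (snd i) else 0)" for F F' :: "'w \<Rightarrow> 'm"
  have sum_I: "(\<Sum>i\<in>{i \<in> ?I. ?\<kappa> i = q}. g i) =
      (if ?p1 = q then \<Sum>b\<in>basis j1 \<mu>1. g (True, b) else 0) + (if ?p2 = q then \<Sum>b\<in>basis j2 \<mu>2. g (False, b) else 0)" for g :: "_ \<Rightarrow> 'm" and q
  proof -
    have "(\<Sum>i\<in>{i \<in> ?I. ?\<kappa> i = q}. g i) = (\<Sum>i\<in>?I. if ?\<kappa> i = q then g i else 0)"
      by (rule sum.inter_filter) (use b1 b2 in auto)
    also have "\<dots> = (\<Sum>i\<in>Pair True ` basis j1 \<mu>1. if ?\<kappa> i = q then g i else 0) + (\<Sum>i\<in>Pair False ` basis j2 \<mu>2. if ?\<kappa> i = q then g i else 0)"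
      by (rule sum.union_disjoint) (use b1 b2 in auto)
    finally show ?thesis by (simp add: sum.reindex inj_on_def)
  qed
  let ?G = "{\<lambda>i. if i \<in> ?I then Mm (?\<kappa> i) x k (pr f1 f2 i) else 0 |x k. x \<in> vspace VG}"
  have mem: "pr f1 0 \<in> cvec.span ?G"
  proof (rule density_fixed_stab[where \<kappa> = ?\<kappa> and I = ?I])
    show "?\<kappa> i \<in> S" for i using A.p B.p by auto
    show "?\<kappa> i = ?\<kappa> j" if "i \<in> ?I" "j \<in> ?I" "a \<in> G" "lact a (?\<kappa> i) = ?\<kappa> j" for i j a
      using rep_unique[OF j1(1) j2(1) that(3)] rep_unique[OF j2(1) j1(1) that(3)] that(4) by (auto split: if_splits)
    show "pr f1 f2 i \<in> Msp (?\<kappa> i)" if "i \<in> ?I" for i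
      using that A.HomD(3)[OF f1(1)] B.HomD(3)[OF f2] b1(4) b2(4) by (auto simp: pr_def)
    show "pr f1 0 \<in> dsum ?I (\<lambda>i. Msp (?\<kappa> i))"
      using A.HomD(3)[OF f1(1)] b1(4) cvec.subspace_0[OF Msp_facts(1)[OF B.p]]
      by (auto intro!: dsumI simp: pr_def split: if_splits)
    fix c q
    have prT: "(\<Sum>b\<in>basis j1 \<mu>1. \<Sum>a\<in>stab q. c (True, b) a *\<^sub>C \<phi> a q (pr F F' (True, b))) =
        (\<Sum>b\<in>basis j1 \<mu>1. \<Sum>a\<in>stab q. c (True, b) a *\<^sub>C \<phi> a q (F b))"
      and prF: "(\<Sum>b\<in>basis j2 \<mu>2. \<Sum>a\<in>stab q. c (False, b) a *\<^sub>C \<phi> a q (pr F F' (False, b))) =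
        (\<Sum>b\<in>basis j2 \<mu>2. \<Sum>a\<in>stab q. c (False, b) a *\<^sub>C \<phi> a q (F' b))" for F F'
      by (auto simp: pr_def intro!: sum.cong)
    assume "(\<Sum>i\<in>{i \<in> ?I. ?\<kappa> i = q}. \<Sum>b\<in>stab q. c i b *\<^sub>C \<phi> b q (pr f1 f2 i)) = 0"
    then have 0: "(if ?p1 = q then \<Sum>b\<in>basis j1 \<mu>1. \<Sum>a\<in>stab q. c (True, b) a *\<^sub>C \<phi> a q (f1 b) else 0) +
        (if ?p2 = q then \<Sum>b\<in>basis j2 \<mu>2. \<Sum>a\<in>stab q. c (False, b) a *\<^sub>C \<phi> a q (f2 b) else 0) = 0"
      unfolding sum_I prT prF .
    note H1 = A.Hom_sum[OF f1(1) b1(1,4), of "\<lambda>b. c (True, b)"]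
    note H2 = B.Hom_sum[OF f2 b2(1,4), of "\<lambda>b. c (False, b)"]
    \<comment> \<open>The two parts of the relation can interact only when both representatives
      equal \<open>q\<close>. Then the orbits coincide, so the characters differ, and
      \<open>distinct_images\<close> makes the first part vanish by itself.\<close>
    have z: "(if ?p1 = q then \<Sum>b\<in>basis j1 \<mu>1. \<Sum>a\<in>stab q. c (True, b) a *\<^sub>C \<phi> a q (f1 b) else 0) = 0"
    proof (cases "?p1 = q \<and> ?p2 = q")
      case True
      then have "?p1 = ?p2" by simp
      then have jj: "j1 = j2" using rep_unique[OF j1(1) j2(1) id_in] lact_id[OF A.p] by simp
      have \<mu>: "\<mu>1 \<noteq> \<mu>2" using ne jj by simp
      show ?thesis
        using True 0 H1 H2 distinct_images[OF j1(1) j1(2) _ \<mu> f1(1) _ H1(2)] j2(2) f2 unfolding jj by auto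
    qed (use 0 in auto)
    have f0: "\<phi> a q 0 = 0" if "?p2 = q" "a \<in> stab q" for a
      using phi_zero_iff[OF B.p, of a 0] that cvec.subspace_0[OF Msp_facts(1)[OF B.p]] stab_G[of a q] by auto
    show "(\<Sum>i\<in>{i \<in> ?I. ?\<kappa> i = q}. \<Sum>b\<in>stab q. c i b *\<^sub>C \<phi> b q (pr f1 0 i)) = 0"
      unfolding sum_I prT prF using z f0 by (simp cong: sum.cong_simp)
  qed (use b1 b2 in auto)
  let ?Q = "{pr F (h F) |F. F \<in> A.Hom}"
  have "cvec.span ?G \<subseteq> ?Q"
  proof (rule cvec.span_minimal)
    show "?G \<subseteq> ?Q"
    proof clarify
      fix x k assume x: "x \<in> vspace VG"
      let ?F = "mmode (hom_mod V G S \<phi> ?p1 (W j1 \<mu>1) (\<rho> j1 \<mu>1)) x k f1"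
      have hF: "h ?F = mmode (hom_mod V G S \<phi> ?p2 (W j2 \<mu>2) (\<rho> j2 \<mu>2)) x k f2" using hm[OF x f1(1)] by (simp add: f2_def)
      have "(\<lambda>i. if i \<in> ?I then Mm (?\<kappa> i) x k (pr f1 f2 i) else 0) = pr ?F (h ?F)"
        unfolding hF using b1(4) b2(4) by (auto simp: fun_eq_iff pr_def hom_mod_mode)
      moreover have "?F \<in> A.Hom" by (rule hom_mode_in[OF A.p A.alg_W f1(1) x])
      ultimately show "\<exists>F. (\<lambda>i. if i \<in> ?I then Mm (?\<kappa> i) x k (pr f1 f2 i) else 0) = pr F (h F) \<and> F \<in> A.Hom" by blast
    qed
    have "lin_map A.Hom UNIV (\<lambda>F. pr F (h F))"
      by (intro lin_mapI) (auto simp: pr_def fun_eq_iff lin_map_add[OF hl] lin_map_scale[OF hl])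
    then have "cvec.subspace ((\<lambda>F. pr F (h F)) ` A.Hom)" using subA by (rule lin_map_image)
    then show "cvec.subspace ?Q" by (simp add: setcompr_eq_image)
  qed
  then obtain F where F: "F \<in> A.Hom" "pr f1 0 = pr F (h F)" using mem by blast
  have hF: "h F \<in> B.Hom" using hl F(1) by (rule lin_map_in)
  have "f1 b = F b" if "b \<in> basis j1 \<mu>1" for b
    using fun_cong[OF F(2), of "(True, b)"] that by (simp add: pr_def)
  then have "f1 w = F w" if "w \<in> W j1 \<mu>1" for w
    using lin_map_eq_on_span[OF A.HomD(2)[OF f1(1)] A.HomD(2)[OF F(1)] A.sub_W b1(4)] b1(3) that by blast
  then have "f1 = F" using A.HomD(4)[OF f1(1)] A.HomD(4)[OF F(1)] by (metis ext)
  have hb: "h F b = 0" if "b \<in> basis j2 \<mu>2" for b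
    using fun_cong[OF F(2), of "(False, b)"] that by (simp add: pr_def)
  have "h F w = 0" if "w \<in> W j2 \<mu>2" for w
  proof -
    have "lin_map (W j2 \<mu>2) (Msp ?p2) (\<lambda>_. 0)" using cvec.subspace_0[OF Msp_facts(1)[OF B.p]] by (intro lin_mapI) auto
    from lin_map_eq_on_span[OF B.HomD(2)[OF hF] this B.sub_W b2(4), of w] show ?thesis using b2(3) that hb by blast
  qed
  then have "h F = 0" using B.HomD(4)[OF hF] by (auto simp: fun_eq_iff)
  then show False using f20 \<open>f1 = F\<close> by (simp add: f2_def)
qed

text \<open>The summands are the spaces of values at the basis vectors of the
  \<open>W j \<mu>\<close>: each is irreducible, together they span by
  \<open>module_spanned\<close>, and their independence is
  \<open>independent_images\<close>.\<close>

lemma completely_reducible_rep: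
  assumes j: "j \<in> J"
  shows "completely_reducible VG (snd (rep j))"
proof -
  let ?I = "SIGMA \<mu>:\<Lambda> j. basis j \<mu>"
  define E where "E i = (\<lambda>f. f (snd i)) ` Hom j (fst i)" for i
  have iI: "fst i \<in> \<Lambda> j" "snd i \<in> basis j (fst i)" "snd i \<in> W j (fst i)" "snd i \<noteq> 0" if "i \<in> ?I" for i
    using that basis(4)[OF j, of "fst i"] basis(5)[OF j, of "fst i" "snd i"] by auto
  have Eev: "E i = stab_simple.ev_image V G S \<phi> (rep j) (W j (fst i)) (\<rho> j (fst i)) (snd i)" if "i \<in> ?I" for i
    unfolding E_def stab_simple.ev_image_def[OF stab_simpleI[OF j iI(1)[OF that]]] ..
  have Esub: "submod VG (snd (rep j)) (E i)" if i: "i \<in> ?I" for i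
    unfolding Eev[OF i] by (rule stab_simple.submod_ev_image[OF stab_simpleI[OF j iI(1)[OF i]] iI(3)[OF i]])
  have Eirr: "irreducible_mod VG ((snd (rep j))\<lparr>mspace := E i\<rparr>)" if i: "i \<in> ?I" for i
    unfolding Eev[OF i] by (rule stab_simple.irreducible_ev_image[OF stab_simpleI[OF j iI(1)[OF i]] iI(3,4)[OF i]])
  have Es: "cvec.subspace (E i)" if "i \<in> ?I" for i using Esub[OF that] by (simp add: submod_def)
  have sp: "cvec.span (\<Union>(E ` ?I)) = Msp (rep j)"
  proof
    show "cvec.span (\<Union>(E ` ?I)) \<subseteq> Msp (rep j)"
      using Esub by (intro cvec.span_minimal[OF _ Msp_facts(1)[OF rep_S[OF j]]]) (auto simp: submod_def)
    show "Msp (rep j) \<subseteq> cvec.span (\<Union>(E ` ?I))"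
      unfolding module_spanned[OF j]
    proof (rule cvec.span_minimal, clarify)
      fix \<mu> f u assume \<mu>: "\<mu> \<in> \<Lambda> j" and f: "f \<in> Hom j \<mu>" and u: "u \<in> W j \<mu>"
      interpret A: stab_simple V G S \<phi> "rep j" "W j \<mu>" "\<rho> j \<mu>" by (rule stab_simpleI[OF j \<mu>])
      show "f u \<in> cvec.span (\<Union>(E ` ?I))"
      proof (rule lin_map_span_image[OF A.HomD(2)[OF f] A.sub_W _ basis(4)[OF j \<mu>]])
        show "u \<in> cvec.span (basis j \<mu>)" using u basis(3)[OF j \<mu>] by simp
        fix b assume "b \<in> basis j \<mu>"
        then have "(\<mu>, b) \<in> ?I" "f b \<in> E (\<mu>, b)" using \<mu> f by (auto simp: E_def)
        then show "f b \<in> cvec.span (\<Union>(E ` ?I))" by (intro cvec.span_base) blast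
      qed auto
    qed auto
  qed
  have ind: "N \<inter> cvec.span (\<Union>(E ` ?I - {N})) = {0}" if N: "N \<in> E ` ?I" for N
  proof -
    obtain i0 where i0: "i0 \<in> ?I" "N = E i0" using N by blast
    \<comment> \<open>The sums of values in which the homomorphism at the position of
      \<open>N\<close> is zero. They form a subspace that contains every other summand, and
      uniqueness of the homomorphisms makes it meet \<open>N\<close> trivially.\<close>
    define Q where "Q = {\<Sum>\<mu>\<in>\<Lambda> j. \<Sum>b\<in>basis j \<mu>. f \<mu> b b |f. (\<forall>\<mu>\<in>\<Lambda> j. \<forall>b\<in>basis j \<mu>. f \<mu> b \<in> Hom j \<mu>) \<and> f (fst i0) (snd i0) = 0}"
    have subH: "cvec.subspace (Hom j \<mu>)" if "\<mu> \<in> \<Lambda> j" for \<mu>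
      by (rule subspace_hom_sp[OF rep_S[OF j] stab_simple.alg_W[OF stab_simpleI[OF j that]]])
    have subQ: "cvec.subspace Q"
    proof (rule cvec.subspaceI)
      show "0 \<in> Q" unfolding Q_def by (rule CollectI, rule exI[of _ "\<lambda>_ _. 0"]) (auto simp: cvec.subspace_0[OF subH])
      fix x y c assume x: "x \<in> Q"
      then obtain f where f: "x = (\<Sum>\<mu>\<in>\<Lambda> j. \<Sum>b\<in>basis j \<mu>. f \<mu> b b)" "\<forall>\<mu>\<in>\<Lambda> j. \<forall>b\<in>basis j \<mu>. f \<mu> b \<in> Hom j \<mu>" "f (fst i0) (snd i0) = 0"
        unfolding Q_def by blast
      show "c *\<^sub>C x \<in> Q" unfolding Q_def
        by (rule CollectI, rule exI[of _ "\<lambda>\<mu> b. c *\<^sub>C f \<mu> b"]) (use f in \<open>auto simp: cvec.scale_sum_right cvec.subspace_scale[OF subH]\<close>)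
      assume "y \<in> Q"
      then obtain h where h: "y = (\<Sum>\<mu>\<in>\<Lambda> j. \<Sum>b\<in>basis j \<mu>. h \<mu> b b)" "\<forall>\<mu>\<in>\<Lambda> j. \<forall>b\<in>basis j \<mu>. h \<mu> b \<in> Hom j \<mu>" "h (fst i0) (snd i0) = 0"
        unfolding Q_def by blast
      show "x + y \<in> Q" unfolding Q_def
        by (rule CollectI, rule exI[of _ "\<lambda>\<mu> b. f \<mu> b + h \<mu> b"]) (use f h in \<open>auto simp: sum.distrib cvec.subspace_add[OF subH]\<close>)
    qed
    have EQ: "E i \<subseteq> Q" if i: "i \<in> ?I" "i \<noteq> i0" for i
    proof
      fix x assume "x \<in> E i"
      then obtain f where f: "f \<in> Hom j (fst i)" "x = f (snd i)" by (auto simp: E_def)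
      define F where "F \<mu> b = (if (\<mu>, b) = i then f else 0)" for \<mu> b
      have "(\<Sum>\<mu>\<in>\<Lambda> j. \<Sum>b\<in>basis j \<mu>. F \<mu> b b) = (\<Sum>z\<in>?I. F (fst z) (snd z) (snd z))"
        using finite_Lambda[OF j] basis(1)[OF j] by (subst sum.Sigma) (auto simp: case_prod_unfold)
      also have "\<dots> = (\<Sum>z\<in>?I. if z = i then f (snd i) else 0)" by (intro sum.cong) (auto simp: F_def)
      also have "\<dots> = x" using i(1) f(2) finite_Lambda[OF j] basis(1)[OF j] by (simp add: finite_SigmaI)
      finally have e: "x = (\<Sum>\<mu>\<in>\<Lambda> j. \<Sum>b\<in>basis j \<mu>. F \<mu> b b)" by simp
      show "x \<in> Q" unfolding Q_def
        by (rule CollectI, rule exI[of _ F]) (use e i(2) f(1) in \<open>auto simp: F_def cvec.subspace_0[OF subH]\<close>)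
    qed
    have "\<Union>(E ` ?I - {N}) \<subseteq> Q"
    proof
      fix x assume "x \<in> \<Union>(E ` ?I - {N})"
      then obtain i where i: "i \<in> ?I" "E i \<noteq> N" "x \<in> E i" by blast
      then have "i \<noteq> i0" using i0(2) by blast
      then show "x \<in> Q" using EQ[OF i(1)] i(3) by blast
    qed
    then have spQ: "cvec.span (\<Union>(E ` ?I - {N})) \<subseteq> Q" using subQ by (rule cvec.span_minimal)
    have "z = 0" if z: "z \<in> N" "z \<in> Q" for z
    proof -
      obtain f0 where f0: "f0 \<in> Hom j (fst i0)" "z = f0 (snd i0)" using z(1) i0(2) by (auto simp: E_def)
      obtain f where f: "z = (\<Sum>\<mu>\<in>\<Lambda> j. \<Sum>b\<in>basis j \<mu>. f \<mu> b b)" "\<forall>\<mu>\<in>\<Lambda> j. \<forall>b\<in>basis j \<mu>. f \<mu> b \<in> Hom j \<mu>" "f (fst i0) (snd i0) = 0"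
        using z(2) unfolding Q_def by blast
      define F where "F \<mu> b = f \<mu> b - (if (\<mu>, b) = i0 then f0 else 0)" for \<mu> b
      have "(\<Sum>\<mu>\<in>\<Lambda> j. \<Sum>b\<in>basis j \<mu>. (if (\<mu>, b) = i0 then f0 else 0) b) = (\<Sum>y\<in>?I. (if y = i0 then f0 else 0) (snd y))"
        using finite_Lambda[OF j] basis(1)[OF j] by (subst sum.Sigma) (auto simp: case_prod_unfold)
      also have "\<dots> = (\<Sum>y\<in>?I. if y = i0 then z else 0)" using f0(2) by (intro sum.cong) auto
      also have "\<dots> = z" using i0(1) finite_Lambda[OF j] basis(1)[OF j] by (simp add: finite_SigmaI)
      finally have e: "(\<Sum>\<mu>\<in>\<Lambda> j. \<Sum>b\<in>basis j \<mu>. (if (\<mu>, b) = i0 then f0 else 0) b) = z" .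
      have "(\<Sum>\<mu>\<in>\<Lambda> j. \<Sum>b\<in>basis j \<mu>. F \<mu> b b) =
          (\<Sum>\<mu>\<in>\<Lambda> j. \<Sum>b\<in>basis j \<mu>. f \<mu> b b) - (\<Sum>\<mu>\<in>\<Lambda> j. \<Sum>b\<in>basis j \<mu>. (if (\<mu>, b) = i0 then f0 else 0) b)"
        unfolding F_def minus_apply sum_subtractf ..
      also have "\<dots> = 0" unfolding e f(1)[symmetric] by simp
      finally have s0: "(\<Sum>\<mu>\<in>\<Lambda> j. \<Sum>b\<in>basis j \<mu>. F \<mu> b b) = 0" .
      have FH: "F \<mu> b \<in> Hom j \<mu>" if "\<mu> \<in> \<Lambda> j" "b \<in> basis j \<mu>" for \<mu> b
      proof -
        have "(if (\<mu>, b) = i0 then f0 else 0) \<in> Hom j \<mu>" using f0(1) cvec.subspace_0[OF subH[OF that(1)]] by auto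
        then show ?thesis unfolding F_def using f(2) that by (intro cvec.subspace_diff[OF subH[OF that(1)]]) auto
      qed
      have "F (fst i0) (snd i0) = 0" by (rule independent_images[OF j FH s0 iI(1,2)[OF i0(1)]])
      then have "f0 = 0" using f(3) by (simp add: F_def)
      then show ?thesis using f0(2) by simp
    qed
    moreover have "0 \<in> N" using Es[OF i0(1)] i0(2) cvec.subspace_0 by blast
    ultimately show ?thesis using spQ cvec.span_zero by blast
  qed
  show ?thesis
    unfolding completely_reducible_def
    by (rule exI[of _ "E ` ?I"]) (use Esub Eirr sp ind in blast)
qed

end

section \<open>Induced modules and evaluation\<close>

lemma tens_in: "d \<in> U \<Longrightarrow> w \<in> W \<Longrightarrow> tens F d w \<in> tensor_space F U W"
  unfolding tensor_space_def by (rule cvec.span_base) blast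

lemma subspace_tensor_space: "cvec.subspace (tensor_space F U W)"
  by (simp add: tensor_space_def)

lemma tensor_space_image:
  assumes f: "lin_map (tensor_space F U W) X f" and Y: "cvec.subspace Y" and t: "t \<in> tensor_space F U W"
    and gen: "\<And>d w. d \<in> U \<Longrightarrow> w \<in> W \<Longrightarrow> f (tens F d w) \<in> Y"
  shows "f t \<in> Y"
proof (rule lin_map_span_image[OF f subspace_tensor_space _ _ Y])
  show "t \<in> cvec.span {tens F d w |d w. d \<in> U \<and> w \<in> W}" using t by (simp add: tensor_space_def)
  show "{tens F d w |d w. d \<in> U \<and> w \<in> W} \<subseteq> tensor_space F U W"
    unfolding tensor_space_def by (rule cvec.span_superset)
  fix b assume "b \<in> {tens F d w |d w. d \<in> U \<and> w \<in> W}"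
  then obtain d w where b: "b = tens F d w" "d \<in> U" "w \<in> W" by blast
  show "f b \<in> Y" unfolding b(1) using b(2,3) by (rule gen)
qed

lemma tensor_space_eq:
  assumes f: "lin_map (tensor_space F U W) X f" and g: "lin_map (tensor_space F U W) X g" and t: "t \<in> tensor_space F U W"
    and gen: "\<And>d w. d \<in> U \<Longrightarrow> w \<in> W \<Longrightarrow> f (tens F d w) = g (tens F d w)"
  shows "f t = g t"
proof (rule lin_map_eq_on_span[OF f g subspace_tensor_space])
  show "t \<in> cvec.span {tens F d w |d w. d \<in> U \<and> w \<in> W}" using t by (simp add: tensor_space_def)
  show "{tens F d w |d w. d \<in> U \<and> w \<in> W} \<subseteq> tensor_space F U W"
    unfolding tensor_space_def by (rule cvec.span_superset)
  fix b assume "b \<in> {tens F d w |d w. d \<in> U \<and> w \<in> W}"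
  then obtain d w where b: "b = tens F d w" "d \<in> U" "w \<in> W" by blast
  show "f b = g b" unfolding b(1) using b(2,3) by (rule gen)
qed

lemma fspace_out: "x \<in> fspace I \<Longrightarrow> i \<notin> I \<Longrightarrow> x i = 0"
  by (simp add: fspace_def)

lemma fspace_mono: "I \<subseteq> K \<Longrightarrow> fspace I \<subseteq> fspace K"
  by (auto simp: fspace_def)

lemma lin_map_tensor_map: "lin_map U UNIV (tensor_map F f g)"
  by (rule lin_mapI) (auto simp: tensor_map_def fun_eq_iff)

lemma tensor_map_in:
  assumes cl: "\<And>\<beta>. \<beta> \<in> F \<Longrightarrow> (\<lambda>d w. \<beta> (f d) (g w)) \<in> F" and f: "\<And>d. d \<in> U \<Longrightarrow> f d \<in> U" and g: "\<And>w. w \<in> W \<Longrightarrow> g w \<in> W"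
    and t: "t \<in> tensor_space F U W"
  shows "tensor_map F f g t \<in> tensor_space F U W"
proof (rule tensor_space_image[OF lin_map_tensor_map subspace_tensor_space t])
  fix d w assume "d \<in> U" "w \<in> W"
  then have "tens F (f d) (g w) \<in> tensor_space F U W" by (intro tens_in f g)
  moreover have "tensor_map F f g (tens F d w) = tens F (f d) (g w)" by (rule tensor_map_tens) (rule cl)
  ultimately show "tensor_map F f g (tens F d w) \<in> tensor_space F U W" by simp
qed

lemma lin_map_tensor_map_in:
  assumes "\<And>\<beta>. \<beta> \<in> F \<Longrightarrow> (\<lambda>d w. \<beta> (f d) (g w)) \<in> F" "\<And>d. d \<in> U \<Longrightarrow> f d \<in> U" "\<And>w. w \<in> W \<Longrightarrow> g w \<in> W"
  shows "lin_map (tensor_space F U W) (tensor_space F U W) (tensor_map F f g)"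
  using tensor_map_in[of F f g U W] assms lin_map_tensor_map[of UNIV F f g] by (auto simp: lin_map_def)

text \<open>With an empty set of scalars the balancing condition is void, so
  \<open>tensor_universal\<close>, stated for balanced forms, also covers the tensor product over
  the complex numbers.\<close>

lemma bilinear_forms_balanced: "bilinear_forms U W = balanced_forms {} r l U W"
  by (simp add: balanced_forms_def)

lemma bilinear_forms_comp:
  assumes \<beta>: "\<beta> \<in> bilinear_forms U W" and f: "lin_map U U f" and g: "lin_map W W g"
  shows "(\<lambda>d w. \<beta> (f d) (g w)) \<in> bilinear_forms U W"
  using assms by (auto simp: bilinear_forms_def intro: lin_map_comp[OF f] lin_map_comp[OF g] lin_map_in)

context orbifold
begin

abbreviation GS where "GS \<equiv> G \<times> S"

lemma finite_GS: "finite GS"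
  using finite_H finite_S by simp

abbreviation AM where "AM \<equiv> amult (stable_algebra V G S \<phi>)"

definition bprod :: "('v \<Rightarrow> 'v) \<times> ('v, 'm) tpair \<Rightarrow> ('v \<Rightarrow> 'v) \<times> ('v, 'm) tpair \<Rightarrow> ('v \<Rightarrow> 'v) \<times> ('v, 'm) tpair \<Rightarrow> complex"
  where "bprod i j = (if pact V S (snd i) (fst j) = snd j then coc (snd j) (fst i) (fst j) *\<^sub>C bvec (fst i \<circ> fst j, snd j) else 0)"

lemma AM_eq: "AM x y = (\<Sum>i\<in>GS. \<Sum>j\<in>GS. (x i * y j) *\<^sub>C bprod i j)"
  by (simp add: stable_algebra_def bprod_def case_prod_unfold)

lemma lin_map_AM_left: "lin_map U UNIV (\<lambda>x. AM x y)"
  by (rule lin_mapI) (simp_all add: AM_eq distrib_right scaleC_add_left sum.distrib cvec.scale_sum_right mult.assoc)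

lemma lin_map_AM_right: "lin_map U UNIV (AM x)"
  by (rule lin_mapI) (simp_all add: AM_eq distrib_left scaleC_add_left sum.distrib cvec.scale_sum_right mult_ac)

lemma AM_bvec: "i \<in> GS \<Longrightarrow> j \<in> GS \<Longrightarrow> AM (bvec i) (bvec j) = bprod i j"
proof -
  assume i: "i \<in> GS" and j: "j \<in> GS"
  have "AM (bvec i) (bvec j) = (\<Sum>i'\<in>GS. bvec i i' *\<^sub>C (\<Sum>j'\<in>GS. bvec j j' *\<^sub>C bprod i' j'))"
    by (simp add: AM_eq cvec.scale_sum_right)
  then show ?thesis unfolding sum_bvec_scale[OF finite_GS i] sum_bvec_scale[OF finite_GS j] .
qed

lemma bprod_in:
  assumes "i \<in> GS" "j \<in> G \<times> {p}"
  shows "bprod i j \<in> fspace (G \<times> {p})"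
proof -
  have "bvec (fst i \<circ> fst j, snd j) \<in> fspace (G \<times> {p})" using assms comp_in by (intro bvec_in_fspace) auto
  then show ?thesis
    by (auto simp: bprod_def intro: cvec.subspace_scale[OF subspace_fspace] cvec.subspace_0[OF subspace_fspace])
qed

text \<open>The vectors with a fixed second label \<open>p\<close> behave like a matrix column: a
  product takes its second label from the right factor. This is what makes \<open>D_span G p\<close>
  a left ideal.\<close>

lemma AM_in_col:
  assumes d: "d \<in> fspace (G \<times> {p})"
  shows "AM x d \<in> fspace (G \<times> {p})"
  unfolding AM_eq
proof (intro cvec.subspace_sum[OF subspace_fspace])
  fix i j assume i: "i \<in> GS" and j: "j \<in> GS"
  show "(x i * d j) *\<^sub>C bprod i j \<in> fspace (G \<times> {p})"
  proof (cases "j \<in> G \<times> {p}")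
    case True
    then show ?thesis using bprod_in[OF i] by (intro cvec.subspace_scale[OF subspace_fspace])
  next
    case False
    then have "d j = 0" by (rule fspace_out[OF d])
    then show ?thesis by (simp add: cvec.subspace_0[OF subspace_fspace])
  qed
qed

text \<open>The scalars agree by \<open>cocycle_identity\<close> at the base point
  \<open>q3\<close>, where the cocycle of \<open>q2\<close> occurs because
  \<open>lact c q3 = q2\<close>. The conditions for a nonzero product agree because acting by
  \<open>c\<close> is injective on \<open>S\<close>.\<close>

lemma bprod_assoc:
  assumes i: "i \<in> GS" and j: "j \<in> GS" and k: "k \<in> GS"
  shows "AM (bprod i j) (bvec k) = AM (bvec i) (bprod j k)"
proof -
  obtain a q1 where i': "i = (a, q1)" by (cases i)
  obtain b q2 where j': "j = (b, q2)" by (cases j)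
  obtain c q3 where k': "k = (c, q3)" by (cases k)
  have m: "a \<in> G" "q1 \<in> S" "b \<in> G" "q2 \<in> S" "c \<in> G" "q3 \<in> S" using assms i' j' k' by auto
  note l0 = lin_map_zero[OF lin_map_AM_left cvec.subspace_UNIV] and r0 = lin_map_zero[OF lin_map_AM_right cvec.subspace_UNIV]
  note ls = lin_map_scale[OF lin_map_AM_left UNIV_I] and rs = lin_map_scale[OF lin_map_AM_right UNIV_I]
  have ij: "bprod i j = (if pact V S q1 b = q2 then coc q2 a b *\<^sub>C bvec (a \<circ> b, q2) else 0)"
    and jk: "bprod j k = (if pact V S q2 c = q3 then coc q3 b c *\<^sub>C bvec (b \<circ> c, q3) else 0)"
    by (simp_all add: bprod_def i' j' k')
  have L: "AM (bprod i j) (bvec k) = (if pact V S q1 b = q2 then coc q2 a b *\<^sub>C bprod (a \<circ> b, q2) k else 0)"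
    using AM_bvec[of "(a \<circ> b, q2)" k] m k comp_in by (simp add: ij l0 ls)
  have R: "AM (bvec i) (bprod j k) = (if pact V S q2 c = q3 then coc q3 b c *\<^sub>C bprod i (b \<circ> c, q3) else 0)"
    using AM_bvec[of i "(b \<circ> c, q3)"] m i comp_in by (simp add: jk r0 rs)
  show ?thesis
  proof (cases "pact V S q2 c = q3")
    case False
    then show ?thesis unfolding L R by (simp add: bprod_def k')
  next
    case True
    have e: "pact V S q1 b = q2 \<longleftrightarrow> pact V S q1 (b \<circ> c) = q3"
    proof
      assume "pact V S q1 b = q2"
      then show "pact V S q1 (b \<circ> c) = q3" using pact_pact[OF m(2,3,5)] True by simp
    next
      assume h: "pact V S q1 (b \<circ> c) = q3"
      have "pact V S (pact V S (pact V S q1 b) c) (inv c) = pact V S (pact V S q2 c) (inv c)"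
        using h True pact_pact[OF m(2,3,5)] by simp
      then show "pact V S q1 b = q2"
        using pact_pact[OF pact(1)[OF m(2,3)] m(5) inv_in[OF m(5)]] pact_pact[OF m(4,5) inv_in[OF m(5)]]
        by (simp add: comp_inv[OF m(5)] pact_id m pact(1))
    qed
    have q2: "lact c q3 = q2"
      using True pact_pact[OF m(4,5) inv_in[OF m(5)]] by (simp add: comp_inv[OF m(5)] pact_id m)
    show ?thesis
      unfolding L R using e True cocycle_identity[OF m(6,1,3,5)] q2
      by (simp add: bprod_def i' k' comp_assoc mult.commute)
  qed
qed

lemma fspace_linear_eq:
  assumes "finite I" "lin_map UNIV UNIV f" "lin_map UNIV UNIV g" "x \<in> fspace I" "\<And>i. i \<in> I \<Longrightarrow> f (bvec i) = g (bvec i)"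
  shows "f x = g x"
  by (rule lin_map_eq_on_span[OF assms(2,3) cvec.subspace_UNIV, of "bvec ` I"])
    (use assms fspace_eq_span[OF assms(1)] in auto)

lemma AM_assoc:
  assumes x: "x \<in> fspace GS" and y: "y \<in> fspace GS" and z: "z \<in> fspace GS"
  shows "AM (AM x y) z = AM x (AM y z)"
proof -
  note lc = lin_map_comp[where X = UNIV and Y = UNIV and U = UNIV]
  have 1: "AM (AM x (bvec j)) (bvec k) = AM x (AM (bvec j) (bvec k))" if "j \<in> GS" "k \<in> GS" for j k
    by (rule fspace_linear_eq[OF finite_GS _ _ x, where f = "\<lambda>x. AM (AM x (bvec j)) (bvec k)" and g = "\<lambda>x. AM x (AM (bvec j) (bvec k))"])
      (use that in \<open>simp_all add: lin_map_AM_left lc[OF lin_map_AM_left lin_map_AM_left] AM_bvec bprod_assoc\<close>)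
  have 2: "AM (AM x y) (bvec k) = AM x (AM y (bvec k))" if "k \<in> GS" for k
    by (rule fspace_linear_eq[OF finite_GS _ _ y, where f = "\<lambda>y. AM (AM x y) (bvec k)" and g = "\<lambda>y. AM x (AM y (bvec k))"])
      (use that 1 in \<open>simp_all add: lc[OF lin_map_AM_right lin_map_AM_left] lc[OF lin_map_AM_left lin_map_AM_right]\<close>)
  show ?thesis
    by (rule fspace_linear_eq[OF finite_GS _ _ z, where f = "\<lambda>z. AM (AM x y) z" and g = "\<lambda>z. AM x (AM y z)"])
      (use 2 in \<open>simp_all add: lin_map_AM_right lc[OF lin_map_AM_right lin_map_AM_right]\<close>)
qed

section \<open>The two commuting actions on the total module\<close>

abbreviation Tot where "Tot \<equiv> dsum S Msp"

lemma subspace_Tot: "cvec.subspace Tot"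
  by (rule subspace_dsum) (rule Msp_facts(1))

lemma incl_in_Tot: "p \<in> S \<Longrightarrow> m \<in> Msp p \<Longrightarrow> incl p m \<in> Tot"
  by (rule incl_in_dsum) (auto simp: cvec.subspace_0[OF Msp_facts(1)])

definition tact :: "(('v \<Rightarrow> 'v) \<times> ('v, 'm) tpair \<Rightarrow> complex) \<Rightarrow> (('v, 'm) tpair \<Rightarrow> 'm) \<Rightarrow> ('v, 'm) tpair \<Rightarrow> 'm"
  where "tact x f = (\<Sum>i\<in>GS. x i *\<^sub>C incl (lact (fst i) (snd i)) (\<phi> (fst i) (snd i) (f (snd i))))"

lemma tact_bact: "bact (total_bimod V G S \<phi>) = tact"
  by (simp add: total_bimod_def tact_def[abs_def] case_prod_unfold)

lemma tact_component:
  assumes i: "i \<in> GS" and f: "f \<in> Tot"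
  shows "incl (lact (fst i) (snd i)) (\<phi> (fst i) (snd i) (f (snd i))) \<in> Tot"
  using i phi(4)[of "snd i" "fst i"] dsum_in[OF f, of "snd i"] lact_in[of "snd i" "fst i"]
  by (intro incl_in_Tot) auto

lemma lin_map_tact_left: "f \<in> Tot \<Longrightarrow> lin_map UNIV Tot (\<lambda>x. tact x f)"
  by (rule lin_mapI)
    (auto simp: tact_def scaleC_add_left sum.distrib cvec.scale_sum_right
      intro!: cvec.subspace_sum[OF subspace_Tot] cvec.subspace_scale[OF subspace_Tot] tact_component)

lemma lin_map_tact: "lin_map Tot Tot (tact x)"
proof (rule lin_mapI)
  show "tact x f \<in> Tot" if "f \<in> Tot" for f using lin_map_in[OF lin_map_tact_left[OF that]] by simp
  fix f g c assume f: "f \<in> Tot"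
  have f': "f (snd i) \<in> Msp (snd i)" if "i \<in> GS" for i using dsum_in[OF f, of "snd i"] that by auto
  have ph: "lin_map (Msp (snd i)) (Msp (lact (fst i) (snd i))) (\<phi> (fst i) (snd i))" if "i \<in> GS" for i
    using phi(2)[of "snd i" "fst i"] that by auto
  show "tact x (c *\<^sub>C f) = c *\<^sub>C tact x f"
    unfolding tact_def cvec.scale_sum_right
  proof (rule sum.cong[OF refl])
    fix i assume i: "i \<in> GS"
    show "x i *\<^sub>C incl (lact (fst i) (snd i)) (\<phi> (fst i) (snd i) ((c *\<^sub>C f) (snd i))) =
      c *\<^sub>C x i *\<^sub>C incl (lact (fst i) (snd i)) (\<phi> (fst i) (snd i) (f (snd i)))"
      using lin_map_scale[OF ph[OF i] f'[OF i], of c] by (simp add: incl_scale mult.commute)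
  qed
  assume g: "g \<in> Tot"
  have g': "g (snd i) \<in> Msp (snd i)" if "i \<in> GS" for i using dsum_in[OF g, of "snd i"] that by auto
  show "tact x (f + g) = tact x f + tact x g"
    unfolding tact_def sum.distrib[symmetric]
  proof (rule sum.cong[OF refl])
    fix i assume i: "i \<in> GS"
    show "x i *\<^sub>C incl (lact (fst i) (snd i)) (\<phi> (fst i) (snd i) ((f + g) (snd i))) =
      x i *\<^sub>C incl (lact (fst i) (snd i)) (\<phi> (fst i) (snd i) (f (snd i))) + x i *\<^sub>C incl (lact (fst i) (snd i)) (\<phi> (fst i) (snd i) (g (snd i)))"
      using lin_map_add[OF ph[OF i] f'[OF i] g'[OF i]] by (simp add: incl_add scaleC_add_right)
  qed
qed

lemma tact_bvec: "i \<in> GS \<Longrightarrow> tact (bvec i) f = incl (lact (fst i) (snd i)) (\<phi> (fst i) (snd i) (f (snd i)))"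
  unfolding tact_def by (rule sum_bvec_scale[OF finite_GS])

lemma phi_0: "p \<in> S \<Longrightarrow> a \<in> G \<Longrightarrow> \<phi> a p 0 = 0"
  by (simp add: phi_zero_iff cvec.subspace_0[OF Msp_facts(1)])

text \<open>The condition \<open>pact V S q b = p\<close> in the product means
  \<open>lact b p = q\<close>: the map \<open>\<phi> b\<close> lands in the component on which the
  left factor acts. Otherwise the intermediate vector has entry zero there, matching the zero
  product.\<close>

lemma tact_bprod:
  assumes i: "i \<in> GS" and j: "j \<in> GS" and f: "f \<in> Tot"
  shows "tact (bprod i j) f = tact (bvec i) (tact (bvec j) f)"
proof -
  obtain a q where i': "i = (a, q)" by (cases i)
  obtain b p where j': "j = (b, p)" by (cases j)
  have m: "a \<in> G" "q \<in> S" "b \<in> G" "p \<in> S" using assms i' j' by auto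
  have fp: "f p \<in> Msp p" using f m(4) by (rule dsum_in)
  have e: "pact V S q b = p \<longleftrightarrow> lact b p = q"
    using pact_pact[OF m(2,3) inv_in[OF m(3)]] pact_pact[OF m(4) inv_in[OF m(3)] m(3)]
    by (auto simp: comp_inv[OF m(3)] inv_comp[OF m(3)] pact_id m)
  have R: "tact (bvec i) (tact (bvec j) f) = incl (lact a q) (\<phi> a q (incl (lact b p) (\<phi> b p (f p)) q))"
    using i j by (simp add: tact_bvec i' j')
  show ?thesis
  proof (cases "lact b p = q")
    case True
    have "tact (bprod i j) f = coc p a b *\<^sub>C tact (bvec (a \<circ> b, p)) f"
      using True e lin_map_scale[OF lin_map_tact_left[OF f] UNIV_I] by (simp add: bprod_def i' j')
    also have "\<dots> = incl (lact (a \<circ> b) p) (coc p a b *\<^sub>C \<phi> (a \<circ> b) p (f p))"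
      using m comp_in by (simp add: tact_bvec incl_scale)
    also have "\<dots> = incl (lact a q) (\<phi> a q (\<phi> b p (f p)))"
      using cocycle_rel(2)[OF m(4,1,3) fp] lact_lact[OF m(4,1,3)] True by simp
    finally show ?thesis unfolding R using True by (simp add: incl_def)
  next
    case False
    then have "incl (lact b p) (\<phi> b p (f p)) q = 0" by (auto simp: incl_def)
    then show ?thesis unfolding R
      using False e lin_map_zero[OF lin_map_tact_left[OF f] cvec.subspace_UNIV] by (simp add: bprod_def i' j' phi_0 m)
  qed
qed

lemma tact_AM:
  assumes x: "x \<in> fspace GS" and y: "y \<in> fspace GS" and f: "f \<in> Tot"
  shows "tact (AM x y) f = tact x (tact y f)"
proof -
  have T: "lin_map UNIV UNIV (\<lambda>x. tact x g)" if "g \<in> Tot" for g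
    by (rule lin_map_mono[OF lin_map_tact_left[OF that]]) auto
  have tT: "tact z f \<in> Tot" for z using lin_map_in[OF lin_map_tact f] .
  have 1: "tact (AM x (bvec j)) f = tact x (tact (bvec j) f)" if "j \<in> GS" for j
    by (rule fspace_linear_eq[OF finite_GS _ _ x, where f = "\<lambda>x. tact (AM x (bvec j)) f" and g = "\<lambda>x. tact x (tact (bvec j) f)"])
      (use that f tT in \<open>simp_all add: T lin_map_comp[OF lin_map_AM_left T] AM_bvec tact_bprod\<close>)
  have l2: "lin_map UNIV UNIV (\<lambda>y. tact x (tact y f))"
    by (rule lin_map_mono[OF lin_map_comp[OF lin_map_tact_left[OF f] lin_map_tact]]) auto
  show ?thesis
    by (rule fspace_linear_eq[OF finite_GS _ l2 y, where f = "\<lambda>y. tact (AM x y) f"])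
      (use 1 in \<open>simp_all add: lin_map_comp[OF lin_map_AM_right T[OF f]]\<close>)
qed

definition tmode :: "'v \<Rightarrow> rat \<Rightarrow> (('v, 'm) tpair \<Rightarrow> 'm) \<Rightarrow> ('v, 'm) tpair \<Rightarrow> 'm"
  where "tmode u k f = (\<lambda>p. if p \<in> S then Mm p u k (f p) else 0)"

lemma tmode_bmode: "bmode (total_bimod V G S \<phi>) = tmode"
  by (simp add: total_bimod_def tmode_def[abs_def])

lemma lin_map_tmode:
  assumes u: "u \<in> vspace V"
  shows "lin_map Tot Tot (tmode u k)"
proof (rule lin_mapI)
  fix f g c assume f: "f \<in> Tot"
  have f': "f p \<in> Msp p" if "p \<in> S" for p using dsum_in[OF f that] .
  show "tmode u k f \<in> Tot" using Msp_facts(3)[OF _ u f'] by (auto simp: tmode_def intro!: dsumI)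
  show "tmode u k (c *\<^sub>C f) = c *\<^sub>C tmode u k f"
    using lin_map_scale[OF Msp_facts(4)[OF _ u] f'] by (auto simp: tmode_def fun_eq_iff)
  assume g: "g \<in> Tot"
  have g': "g p \<in> Msp p" if "p \<in> S" for p using dsum_in[OF g that] .
  show "tmode u k (f + g) = tmode u k f + tmode u k g"
    using lin_map_add[OF Msp_facts(4)[OF _ u] f' g'] by (auto simp: tmode_def fun_eq_iff)
qed

lemma tmode_incl:
  assumes u: "u \<in> vspace V" and p: "p \<in> S"
  shows "tmode u k (incl p m) = incl p (Mm p u k m)"
proof -
  have "Mm q u k 0 = 0" if "q \<in> S" for q using lin_map_zero[OF Msp_facts(4)[OF that u] Msp_facts(1)[OF that]] .
  then show ?thesis using p by (auto simp: tmode_def incl_def fun_eq_iff)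
qed

text \<open>Each \<open>\<phi> a\<close> turns the modes of \<open>u\<close> into those of
  \<open>a u\<close>, which is \<open>u\<close> itself for a fixed vector.\<close>

lemma tact_tmode:
  assumes u: "u \<in> vspace VG" and x: "x \<in> fspace GS" and f: "f \<in> Tot"
  shows "tact x (tmode u k f) = tmode u k (tact x f)"
proof -
  have uV: "u \<in> vspace V" and ua: "\<And>a. a \<in> G \<Longrightarrow> a u = u" using u by auto
  note lm = lin_map_tmode[OF uV, of k]
  have mf: "tmode u k f \<in> Tot" by (rule lin_map_in[OF lm f])
  have l1: "lin_map UNIV UNIV (\<lambda>x. tact x (tmode u k f))"
    by (rule lin_map_mono[OF lin_map_tact_left[OF mf]]) auto
  have l2: "lin_map UNIV UNIV (\<lambda>x. tmode u k (tact x f))"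
    by (rule lin_map_mono[OF lin_map_comp[OF lin_map_tact_left[OF f] lm]]) auto
  show ?thesis
  proof (rule fspace_linear_eq[OF finite_GS l1 l2 x])
    fix i assume i: "i \<in> GS"
    obtain a p where i': "i = (a, p)" and a: "a \<in> G" and p: "p \<in> S" using i by auto
    have fp: "f p \<in> Msp p" using f p by (rule dsum_in)
    show "tact (bvec i) (tmode u k f) = tmode u k (tact (bvec i) f)"
      unfolding tact_bvec[OF i] using phi(5)[OF p a uV fp, of k] ua[OF a] p
      by (simp add: i' tmode_incl[OF uV lact_in[OF p a]]) (simp add: tmode_def)
  qed
qed

lemma D_span_eq: "D_span G p = fspace (G \<times> {p})"
proof -
  have "{bvec (a, p) |a. a \<in> G} = bvec ` (G \<times> {p})" by auto
  then show ?thesis using finite_H by (simp add: D_span_def fspace_eq_span)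
qed

lemma S_span_eq:
  assumes p: "p \<in> S"
  shows "S_span V G p = fspace (stab p \<times> {p})"
proof -
  interpret P: perm_group "stab p" by (rule perm_group_stab[OF p])
  have "{bvec (a, p) |a. a \<in> stab p} = bvec ` (stab p \<times> {p})" by auto
  then show ?thesis using P.finite_H by (simp add: S_span_def fspace_eq_span)
qed

end

section \<open>Evaluation on the tensor product of an induced module with a space of
  homomorphisms\<close>

context stab_simple
begin

abbreviation Dp where "Dp \<equiv> D_span G p"
abbreviation Fi where "Fi \<equiv> induced_forms V G S \<phi> p W \<rho>"
abbreviation Ind where "Ind \<equiv> induced_space V G S \<phi> p W \<rho>"
abbreviation Ft where "Ft \<equiv> bilinear_forms Ind Hom"
abbreviation TT where "TT \<equiv> tensor_space Ft Ind Hom"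

lemma subspace_Dp: "cvec.subspace Dp"
  by (simp add: D_span_def)

lemma Dp_sub: "Dp \<subseteq> fspace GS"
  unfolding D_span_eq using p by (intro fspace_mono) auto

lemma Sp_sub: "S_span V G p \<subseteq> fspace GS" "S_span V G p \<subseteq> Dp"
  unfolding S_span_eq[OF p] D_span_eq using p stab_G by (auto intro!: fspace_mono)

lemma bvec_Dp: "a \<in> G \<Longrightarrow> bvec (a, p) \<in> Dp"
  unfolding D_span_eq by (rule bvec_in_fspace) simp

lemma AM_Dp: "d \<in> Dp \<Longrightarrow> AM x d \<in> Dp"
  unfolding D_span_eq by (rule AM_in_col)

lemma Fi_eq: "Fi = balanced_forms (S_span V G p) AM (\<lambda>s. \<rho> (\<lambda>a. s (a, p))) Dp W"
  by (simp add: induced_forms_def)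

lemma Ind_eq: "Ind = tensor_space Fi Dp W"
  by (simp add: induced_space_def)

lemma Fi_bilinear: "Fi \<subseteq> bilinear_forms Dp W"
  unfolding Fi_eq by (auto simp: balanced_forms_def)

lemma subspace_Ind: "cvec.subspace Ind"
  unfolding Ind_eq by (rule subspace_tensor_space)

lemma subspace_Hom: "cvec.subspace Hom"
  by (rule subspace_hom_sp[OF p alg_W])

lemmas tens_lin = tens_bilinear[OF Fi_bilinear subspace_Dp sub_W, folded Ind_eq]
lemmas tens_lin2 = tens_bilinear[OF order_refl subspace_Ind subspace_Hom]

lemma tens_Ind: "d \<in> Dp \<Longrightarrow> e \<in> W \<Longrightarrow> tens Fi d e \<in> Ind"
  unfolding Ind_eq by (rule tens_in)

lemma restrict_in: "s \<in> S_span V G p \<Longrightarrow> (\<lambda>a. s (a, p)) \<in> fspace (stab p)"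
  using fspace_out[of s "stab p \<times> {p}"] by (simp add: S_span_eq[OF p] fspace_def)

lemma \<rho>_in: "x \<in> fspace (stab p) \<Longrightarrow> e \<in> W \<Longrightarrow> \<rho> x e \<in> W"
  using alg_W' by (auto simp: alg_module_def P.A_simps lin_map_in)

text \<open>For stabilizer elements \<open>\<phi> a p\<close> stays in the component
  \<open>p\<close> and may be moved inside \<open>h\<close>. This is the balancing that lets
  evaluation factor through the tensor product over the stabilizer algebra.\<close>

lemma tact_stab:
  assumes s: "s \<in> S_span V G p" and h: "h \<in> Hom" and e: "e \<in> W"
  shows "tact s (incl p (h e)) = incl p (h (\<rho> (\<lambda>a. s (a, p)) e))"
proof -
  let ?s = "\<lambda>a. s (a, p)"
  have s0: "s i = 0" if "i \<notin> stab p \<times> {p}" for i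
    using fspace_out[OF s[unfolded S_span_eq[OF p]] that] .
  have "tact s (incl p (h e)) = (\<Sum>i\<in>stab p \<times> {p}. s i *\<^sub>C incl (lact (fst i) (snd i)) (\<phi> (fst i) (snd i) (incl p (h e) (snd i))))"
    unfolding tact_def by (rule sum.mono_neutral_right) (use finite_GS stab_G p s0 in auto)
  also have "\<dots> = (\<Sum>a\<in>stab p. s (a, p) *\<^sub>C incl (lact a p) (\<phi> a p (h e)))"
  proof -
    have e: "stab p \<times> {p} = (\<lambda>a. (a, p)) ` stab p" by auto
    have "incl p (h e) p = h e" by (simp add: incl_def)
    then show ?thesis unfolding e by (subst sum.reindex) (simp_all add: inj_on_def)
  qed
  also have "\<dots> = (\<Sum>a\<in>stab p. incl p (s (a, p) *\<^sub>C \<phi> a p (h e)))"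
    using stab_iff[OF p] by (intro sum.cong) (auto simp: incl_scale)
  also have "\<dots> = incl p (\<Sum>a\<in>stab p. s (a, p) *\<^sub>C \<phi> a p (h e))"
    by (auto simp: incl_def fun_eq_iff sum_apply)
  also have "(\<Sum>a\<in>stab p. s (a, p) *\<^sub>C \<phi> a p (h e)) = h (\<rho> ?s e)"
    using P.ophom_alg_act[OF HomD(1)[OF h] P.proj_repD(2)[OF rep_W(1)] e, of ?s] rep_W(2)[OF restrict_in[OF s] e]
    by (simp only: P.alg_act_def)
  finally show ?thesis .
qed

lemma incl_hom_in: "h \<in> Hom \<Longrightarrow> e \<in> W \<Longrightarrow> incl p (h e) \<in> Tot"
  by (rule incl_in_Tot[OF p HomD(3)])

lemma lin_map_incl_hom: "h \<in> Hom \<Longrightarrow> lin_map W Tot (\<lambda>e. incl p (h e))"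
  by (rule lin_mapI)
    (auto simp: incl_hom_in lin_map_add[OF HomD(2)] lin_map_scale[OF HomD(2)] incl_add incl_scale)

text \<open>Evaluation with the homomorphism \<open>h\<close> held fixed. Balance is associativity
  of the action, \<open>tact_AM\<close>, followed by \<open>tact_stab\<close>.\<close>

lemma theta_exists:
  assumes h: "h \<in> Hom"
  shows "\<exists>\<theta>. lin_map Ind UNIV \<theta> \<and> (\<forall>d\<in>Dp. \<forall>e\<in>W. \<theta> (tens Fi d e) = tact d (incl p (h e)))"
  unfolding Ind_eq Fi_eq
proof (rule tensor_universal)
  show "lin_map Dp UNIV (\<lambda>d. tact d (incl p (h e)))" if "e \<in> W" for e
    by (rule lin_map_mono[OF lin_map_tact_left[OF incl_hom_in[OF h that]]]) auto
  show "lin_map W UNIV (\<lambda>e. tact d (incl p (h e)))" for d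
    by (rule lin_map_mono[OF lin_map_comp[OF lin_map_incl_hom[OF h] lin_map_tact]]) auto
  show "tact (AM d s) (incl p (h e)) = tact d (incl p (h (\<rho> (\<lambda>a. s (a, p)) e)))"
    if "d \<in> Dp" "s \<in> S_span V G p" "e \<in> W" for d s e
    using tact_AM[of d s "incl p (h e)"] that Dp_sub Sp_sub(1) incl_hom_in[OF h that(3)] tact_stab[OF that(2) h that(3)] by auto
qed

definition theta where
  "theta h = (SOME \<theta>. lin_map Ind UNIV \<theta> \<and> (\<forall>d\<in>Dp. \<forall>e\<in>W. \<theta> (tens Fi d e) = tact d (incl p (h e))))"

lemma theta:
  assumes h: "h \<in> Hom"
  shows "lin_map Ind UNIV (theta h)" "d \<in> Dp \<Longrightarrow> e \<in> W \<Longrightarrow> theta h (tens Fi d e) = tact d (incl p (h e))"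
  using someI_ex[OF theta_exists[OF h]] by (auto simp: theta_def)

lemma theta_Tot:
  assumes h: "h \<in> Hom" and t: "t \<in> Ind"
  shows "theta h t \<in> Tot"
proof (rule tensor_space_image[OF theta(1)[OF h, unfolded Ind_eq] subspace_Tot t[unfolded Ind_eq]])
  show "theta h (tens Fi d e) \<in> Tot" if "d \<in> Dp" "e \<in> W" for d e
    unfolding theta(2)[OF h that] using lin_map_tact incl_hom_in[OF h that(2)] by (rule lin_map_in)
qed

text \<open>\<open>theta h\<close> is chosen for each \<open>h\<close> separately, so linearity in
  \<open>h\<close> is no part of the choice; it follows by comparing values on the generating
  tensors.\<close>

lemma lin_map_theta:
  assumes t: "t \<in> Ind"
  shows "lin_map Hom UNIV (\<lambda>h. theta h t)"
proof (rule lin_mapI)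
  fix h h' c assume h: "h \<in> Hom"
  have cs: "c *\<^sub>C h \<in> Hom" using h by (rule cvec.subspace_scale[OF subspace_Hom])
  have "lin_map Ind UNIV (\<lambda>t. c *\<^sub>C theta h t)"
    by (rule lin_mapI) (auto simp: lin_map_add[OF theta(1)[OF h]] lin_map_scale[OF theta(1)[OF h]] scaleC_add_right mult.commute)
  then show "theta (c *\<^sub>C h) t = c *\<^sub>C theta h t"
  proof (rule tensor_space_eq[OF theta(1)[OF cs, unfolded Ind_eq] _ t[unfolded Ind_eq], unfolded Ind_eq[symmetric]])
    fix d e assume d: "d \<in> Dp" and e: "e \<in> W"
    show "theta (c *\<^sub>C h) (tens Fi d e) = c *\<^sub>C theta h (tens Fi d e)"
      using theta(2)[OF cs d e] theta(2)[OF h d e] lin_map_scale[OF lin_map_tact incl_hom_in[OF h e], of d c] by (simp add: incl_scale)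
  qed
  assume h': "h' \<in> Hom"
  have hh: "h + h' \<in> Hom" using h h' by (rule cvec.subspace_add[OF subspace_Hom])
  have "lin_map Ind UNIV (\<lambda>t. theta h t + theta h' t)"
    by (rule lin_mapI) (auto simp: lin_map_add[OF theta(1)[OF h]] lin_map_scale[OF theta(1)[OF h]]
        lin_map_add[OF theta(1)[OF h']] lin_map_scale[OF theta(1)[OF h']] scaleC_add_right)
  then show "theta (h + h') t = theta h t + theta h' t"
  proof (rule tensor_space_eq[OF theta(1)[OF hh, unfolded Ind_eq] _ t[unfolded Ind_eq], unfolded Ind_eq[symmetric]])
    fix d e assume d: "d \<in> Dp" and e: "e \<in> W"
    show "theta (h + h') (tens Fi d e) = theta h (tens Fi d e) + theta h' (tens Fi d e)"
      using theta(2)[OF hh d e] theta(2)[OF h d e] theta(2)[OF h' d e]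
        lin_map_add[OF lin_map_tact incl_hom_in[OF h e] incl_hom_in[OF h' e], of d] by (simp add: incl_add)
  qed
qed auto

text \<open>A second use of the universal property, now over the complex numbers, combines the maps
  \<open>theta h\<close> into one linear map.\<close>

lemma psi_exists: "\<exists>\<psi>. lin_map TT UNIV \<psi> \<and> (\<forall>t\<in>Ind. \<forall>h\<in>Hom. \<psi> (tens Ft t h) = theta h t)"
  using tensor_universal[where K = "{}" and U = Ind and W = Hom and r = "\<lambda>d (s :: unit). d" and l = "\<lambda>s w. w"
      and \<beta> = "\<lambda>t h. theta h t"] theta(1) lin_map_theta
  by (simp add: bilinear_forms_balanced[of Ind Hom "\<lambda>d (s :: unit). d" "\<lambda>s w. w"])

definition psi where "psi = (SOME \<psi>. lin_map TT UNIV \<psi> \<and> (\<forall>t\<in>Ind. \<forall>h\<in>Hom. \<psi> (tens Ft t h) = theta h t))"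

lemma psi: "lin_map TT UNIV psi" "t \<in> Ind \<Longrightarrow> h \<in> Hom \<Longrightarrow> psi (tens Ft t h) = theta h t"
  using someI_ex[OF psi_exists] by (auto simp: psi_def)

lemma psi_Tot: "t \<in> TT \<Longrightarrow> psi t \<in> Tot"
  by (rule tensor_space_image[OF psi(1) subspace_Tot]) (simp_all add: psi(2) theta_Tot)

lemma lin_map_psi: "lin_map TT Tot psi"
  using psi(1) psi_Tot by (auto simp: lin_map_def)

lemma psi_generator:
  assumes c: "c \<in> G" and e: "e \<in> W" and h: "h \<in> Hom"
  shows "psi (tens Ft (tens Fi (bvec (c, p)) e) h) = incl (lact c p) (\<phi> c p (h e))"
  using psi(2)[OF tens_Ind[OF bvec_Dp[OF c] e] h] theta(2)[OF h bvec_Dp[OF c] e] tact_bvec[of "(c, p)" "incl p (h e)"] c p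
  by (simp add: incl_def)

text \<open>\<open>tensor_map_tens\<close> requires that composition with the operator preserve the
  forms. Left multiplication respects the balancing on the right by associativity of the algebra,
  which rests on the cocycle identity.\<close>

lemma Fi_closed:
  assumes x: "x \<in> fspace GS" and \<beta>: "\<beta> \<in> Fi"
  shows "(\<lambda>d w. \<beta> (AM x d) (id w)) \<in> Fi"
proof -
  have b: "\<beta> \<in> bilinear_forms Dp W" and bal: "\<And>d s w. d \<in> Dp \<Longrightarrow> s \<in> S_span V G p \<Longrightarrow> w \<in> W \<Longrightarrow> \<beta> (AM d s) w = \<beta> d (\<rho> (\<lambda>a. s (a, p)) w)"
    using \<beta> unfolding Fi_eq balanced_forms_def by auto
  have l: "lin_map Dp Dp (AM x)" using lin_map_AM_right[of Dp x] AM_Dp by (auto simp: lin_map_def)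
  have "(\<lambda>d w. \<beta> (AM x d) (id w)) \<in> bilinear_forms Dp W"
    by (rule bilinear_forms_comp[OF b l]) (auto simp: lin_map_def)
  moreover have "\<beta> (AM x (AM d s)) w = \<beta> (AM x d) (\<rho> (\<lambda>a. s (a, p)) w)" if "d \<in> Dp" "s \<in> S_span V G p" "w \<in> W" for d s w
  proof -
    have "AM x (AM d s) = AM (AM x d) s"
      by (rule AM_assoc[OF x subsetD[OF Dp_sub that(1)] subsetD[OF Sp_sub(1) that(2)], symmetric])
    then have "\<beta> (AM x (AM d s)) w = \<beta> (AM (AM x d) s) w" by (rule arg_cong)
    also have "\<dots> = \<beta> (AM x d) (\<rho> (\<lambda>a. s (a, p)) w)" by (rule bal[OF AM_Dp[OF that(1)] that(2,3)])
    finally show ?thesis .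
  qed
  ultimately show ?thesis unfolding Fi_eq balanced_forms_def by (simp only: mem_Collect_eq id_apply) blast
qed

abbreviation iact where "iact \<equiv> induced_act V G S \<phi> p W \<rho>"

lemma iact:
  assumes x: "x \<in> fspace GS"
  shows "d \<in> Dp \<Longrightarrow> e \<in> W \<Longrightarrow> iact x (tens Fi d e) = tens Fi (AM x d) e" "lin_map Ind Ind (iact x)"
proof -
  show "d \<in> Dp \<Longrightarrow> e \<in> W \<Longrightarrow> iact x (tens Fi d e) = tens Fi (AM x d) e"
    unfolding induced_act_def using tensor_map_tens[where F = Fi and f = "AM x" and g = id and d = d and w = e] Fi_closed[OF x] by simp
  show "lin_map Ind Ind (iact x)"
    unfolding induced_act_def Ind_eq
  proof (rule lin_map_tensor_map_in)
    show "(\<lambda>d w. \<beta> (AM x d) (id w)) \<in> Fi" if "\<beta> \<in> Fi" for \<beta> using x that by (rule Fi_closed)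
  qed (simp_all add: AM_Dp)
qed

lemma Ft_closed_act: "x \<in> fspace GS \<Longrightarrow> \<beta> \<in> Ft \<Longrightarrow> (\<lambda>d w. \<beta> (iact x d) (id w)) \<in> Ft"
  by (rule bilinear_forms_comp[OF _ iact(2)]) (auto simp: lin_map_def)

text \<open>There are two nested tensor products, so the identity is checked on generators of the
  outer one and, for each of them, on generators of the inner one.\<close>

lemma psi_act:
  assumes x: "x \<in> fspace GS" and t: "t \<in> TT"
  shows "tensor_map Ft (iact x) id t \<in> TT" "psi (tensor_map Ft (iact x) id t) = tact x (psi t)"
proof -
  note ii = lin_map_in[OF iact(2)[OF x]]
  have lt: "lin_map TT TT (tensor_map Ft (iact x) id)"
  proof (rule lin_map_tensor_map_in)
    show "(\<lambda>d w. \<beta> (iact x d) (id w)) \<in> Ft" if "\<beta> \<in> Ft" for \<beta> using x that by (rule Ft_closed_act)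
  qed (simp_all add: ii)
  then show "tensor_map Ft (iact x) id t \<in> TT" using t by (rule lin_map_in)
  show "psi (tensor_map Ft (iact x) id t) = tact x (psi t)"
  proof (rule tensor_space_eq[where F = Ft and U = Ind and W = Hom and X = Tot and t = t
        and f = "\<lambda>t. psi (tensor_map Ft (iact x) id t)" and g = "\<lambda>t. tact x (psi t)"])
    show "lin_map TT Tot (\<lambda>t. psi (tensor_map Ft (iact x) id t))" by (rule lin_map_comp[OF lt lin_map_psi])
    show "lin_map TT Tot (\<lambda>t. tact x (psi t))" by (rule lin_map_comp[OF lin_map_psi lin_map_tact])
    show "t \<in> TT" by (rule t)
    fix \<tau> h assume \<tau>: "\<tau> \<in> Ind" and h: "h \<in> Hom"
    have "theta h (iact x \<tau>) = tact x (theta h \<tau>)"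
    proof (rule tensor_space_eq[where F = Fi and U = Dp and W = W and X = UNIV and t = \<tau>
          and f = "\<lambda>\<tau>. theta h (iact x \<tau>)" and g = "\<lambda>\<tau>. tact x (theta h \<tau>)", folded Ind_eq])
      show "lin_map Ind UNIV (\<lambda>\<tau>. theta h (iact x \<tau>))" by (rule lin_map_comp[OF iact(2)[OF x] theta(1)[OF h]])
      show "lin_map Ind UNIV (\<lambda>\<tau>. tact x (theta h \<tau>))"
        by (rule lin_map_comp[where X = Tot]) (use theta(1)[OF h] theta_Tot[OF h] lin_map_tact in \<open>auto simp: lin_map_def\<close>)
      show "\<tau> \<in> Ind" by (rule \<tau>)
      fix d e assume d: "d \<in> Dp" and e: "e \<in> W"
      show "theta h (iact x (tens Fi d e)) = tact x (theta h (tens Fi d e))"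
        using iact(1)[OF x d e] theta(2)[OF h d e] theta(2)[OF h AM_Dp[OF d] e] tact_AM[OF x _ incl_hom_in[OF h e], of d] d Dp_sub by auto
    qed
    then show "psi (tensor_map Ft (iact x) id (tens Ft \<tau> h)) = tact x (psi (tens Ft \<tau> h))"
      using tensor_map_tens[where F = Ft and f = "iact x" and g = id and d = \<tau> and w = h, OF Ft_closed_act[OF x]]
        psi(2)[OF \<tau> h] psi(2)[OF ii[OF \<tau>] h] by simp
  qed
qed

lemma psi_mode:
  assumes u: "u \<in> vspace VG" and t: "t \<in> TT"
  shows "tensor_map Ft id (mmode (hom_mod V G S \<phi> p W \<rho>) u k) t \<in> TT"
    "psi (tensor_map Ft id (mmode (hom_mod V G S \<phi> p W \<rho>) u k) t) = tmode u k (psi t)"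
proof -
  let ?m = "mmode (hom_mod V G S \<phi> p W \<rho>) u k"
  have uV: "u \<in> vspace V" using u by simp
  have lm: "lin_map Hom Hom ?m"
    using irreducible_hom_mod u twisted_module.mode_linear[of VG id 1] by (auto simp: irreducible_twisted_def)
  have cl: "(\<lambda>d w. \<beta> (id d) (?m w)) \<in> Ft" if "\<beta> \<in> Ft" for \<beta>
    by (rule bilinear_forms_comp[OF that _ lm]) (auto simp: lin_map_def)
  have lt: "lin_map TT TT (tensor_map Ft id ?m)"
  proof (rule lin_map_tensor_map_in)
    show "(\<lambda>d w. \<beta> (id d) (?m w)) \<in> Ft" if "\<beta> \<in> Ft" for \<beta> using that by (rule cl)
  qed (simp_all add: lin_map_in[OF lm])
  then show "tensor_map Ft id ?m t \<in> TT" using t by (rule lin_map_in)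
  show "psi (tensor_map Ft id ?m t) = tmode u k (psi t)"
  proof (rule tensor_space_eq[where F = Ft and U = Ind and W = Hom and X = Tot and t = t
        and f = "\<lambda>t. psi (tensor_map Ft id ?m t)" and g = "\<lambda>t. tmode u k (psi t)"])
    show "lin_map TT Tot (\<lambda>t. psi (tensor_map Ft id ?m t))" by (rule lin_map_comp[OF lt lin_map_psi])
    show "lin_map TT Tot (\<lambda>t. tmode u k (psi t))" by (rule lin_map_comp[OF lin_map_psi lin_map_tmode[OF uV]])
    show "t \<in> TT" by (rule t)
    fix \<tau> h assume \<tau>: "\<tau> \<in> Ind" and h: "h \<in> Hom"
    have mh: "?m h \<in> Hom" using lm h by (rule lin_map_in)
    have "theta (?m h) \<tau> = tmode u k (theta h \<tau>)"
    proof (rule tensor_space_eq[where F = Fi and U = Dp and W = W and X = UNIV and t = \<tau>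
          and f = "theta (?m h)" and g = "\<lambda>\<tau>. tmode u k (theta h \<tau>)", folded Ind_eq])
      show "lin_map Ind UNIV (theta (?m h))" by (rule theta(1)[OF mh])
      show "lin_map Ind UNIV (\<lambda>\<tau>. tmode u k (theta h \<tau>))"
        by (rule lin_map_comp[where X = Tot]) (use theta(1)[OF h] theta_Tot[OF h] lin_map_tmode[OF uV, of k] in \<open>auto simp: lin_map_def\<close>)
      show "\<tau> \<in> Ind" by (rule \<tau>)
      fix d e assume d: "d \<in> Dp" and e: "e \<in> W"
      have "tact d (incl p (?m h e)) = tmode u k (tact d (incl p (h e)))"
        using tact_tmode[OF u _ incl_hom_in[OF h e], of d k] d Dp_sub e by (auto simp: tmode_incl[OF uV p] hom_mod_mode)
      then show "theta (?m h) (tens Fi d e) = tmode u k (theta h (tens Fi d e))"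
        using theta(2)[OF h d e] theta(2)[OF mh d e] by simp
    qed
    then show "psi (tensor_map Ft id ?m (tens Ft \<tau> h)) = tmode u k (psi (tens Ft \<tau> h))"
      using tensor_map_tens[where F = Ft and f = id and g = ?m and d = \<tau> and w = h, OF cl]
        psi(2)[OF \<tau> h] psi(2)[OF \<tau> mh] by simp
  qed
qed

definition orbit where "orbit = (\<lambda>a. lact a p) ` G"
text \<open>A choice of one group element over each point of the orbit, that is, of representatives
  for the cosets of the stabilizer.\<close>

definition coset_rep where "coset_rep q = (SOME a. a \<in> G \<and> lact a p = q)"

lemma coset_rep:
  assumes "q \<in> orbit"
  shows "coset_rep q \<in> G \<and> lact (coset_rep q) p = q"
proof -
  obtain a where "a \<in> G \<and> lact a p = q" using assms unfolding orbit_def by blast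
  then show ?thesis unfolding coset_rep_def by (rule someI[of "\<lambda>a. a \<in> G \<and> lact a p = q"])
qed

lemma finite_orbit: "finite orbit"
  using finite_H by (simp add: orbit_def)

text \<open>Every \<open>a\<close> is a coset representative times a stabilizer element, and the
  latter moves across the tensor sign into \<open>W\<close>; so only the coset representatives are
  left. Coordinates in \<open>W\<close> are then absorbed into \<open>Hom\<close>. That the
  coefficients are determined emerges only with the injectivity of evaluation.\<close>

lemma tensor_normal_form:
  assumes B: "finite B" "cvec.independent B" "cvec.span B = W" and t: "t \<in> TT"
  shows "\<exists>h. (\<forall>q\<in>orbit. \<forall>b\<in>B. h q b \<in> Hom) \<and>
    t = (\<Sum>q\<in>orbit. \<Sum>b\<in>B. tens Ft (tens Fi (bvec (coset_rep q, p)) b) (h q b))"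
proof -
  let ?g = "\<lambda>q b. tens Fi (bvec (coset_rep q, p)) b"
  define NF where "NF = {\<Sum>q\<in>orbit. \<Sum>b\<in>B. tens Ft (?g q b) (h q b) |h. \<forall>q\<in>orbit. \<forall>b\<in>B. h q b \<in> Hom}"
  have BW: "B \<subseteq> W" using B(3) cvec.span_superset by blast
  have gI: "?g q b \<in> Ind" if "q \<in> orbit" "b \<in> B" for q b
    using tens_Ind[OF bvec_Dp] coset_rep[OF that(1)] BW that(2) by blast
  note tl = tens_lin2(2)[OF gI]
  have NFI: "(\<Sum>q\<in>orbit. \<Sum>b\<in>B. tens Ft (?g q b) (h q b)) \<in> NF" if "\<And>q b. q \<in> orbit \<Longrightarrow> b \<in> B \<Longrightarrow> h q b \<in> Hom" for h
    unfolding NF_def using that by blast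
  have NFE: "\<exists>h. z = (\<Sum>q\<in>orbit. \<Sum>b\<in>B. tens Ft (?g q b) (h q b)) \<and> (\<forall>q\<in>orbit. \<forall>b\<in>B. h q b \<in> Hom)" if "z \<in> NF" for z
    using that unfolding NF_def by blast
  have subNF: "cvec.subspace NF"
  proof (rule cvec.subspaceI)
    have "(\<Sum>q\<in>orbit. \<Sum>b\<in>B. tens Ft (?g q b) 0) = 0"
      using lin_map_zero[OF tl subspace_Hom] by simp
    moreover have "(\<Sum>q\<in>orbit. \<Sum>b\<in>B. tens Ft (?g q b) 0) \<in> NF"
      by (rule NFI) (rule cvec.subspace_0[OF subspace_Hom])
    ultimately show "0 \<in> NF" by simp
    fix x y c assume "x \<in> NF"
    then obtain h where h: "x = (\<Sum>q\<in>orbit. \<Sum>b\<in>B. tens Ft (?g q b) (h q b))" "\<forall>q\<in>orbit. \<forall>b\<in>B. h q b \<in> Hom" using NFE by blast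
    have "c *\<^sub>C x = (\<Sum>q\<in>orbit. \<Sum>b\<in>B. tens Ft (?g q b) (c *\<^sub>C h q b))"
      unfolding h(1) cvec.scale_sum_right using h(2) by (intro sum.cong refl lin_map_scale[OF tl, symmetric]) auto
    then show "c *\<^sub>C x \<in> NF" using NFI[of "\<lambda>q b. c *\<^sub>C h q b"] h(2) cvec.subspace_scale[OF subspace_Hom] by auto
    assume "y \<in> NF"
    then obtain h' where h': "y = (\<Sum>q\<in>orbit. \<Sum>b\<in>B. tens Ft (?g q b) (h' q b))" "\<forall>q\<in>orbit. \<forall>b\<in>B. h' q b \<in> Hom" using NFE by blast
    have "x + y = (\<Sum>q\<in>orbit. \<Sum>b\<in>B. tens Ft (?g q b) (h q b + h' q b))"
      unfolding h(1) h'(1) sum.distrib[symmetric] using h(2) h'(2) by (intro sum.cong refl lin_map_add[OF tl, symmetric]) auto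
    then show "x + y \<in> NF" using NFI[of "\<lambda>q b. h q b + h' q b"] h(2) h'(2) cvec.subspace_add[OF subspace_Hom] by auto
  qed
  have gen: "tens Ft (tens Fi (bvec (a, p)) e) h \<in> NF" if a: "a \<in> G" and e: "e \<in> W" and h: "h \<in> Hom" for a e h
  proof -
    let ?q = "lact a p"
    have q: "?q \<in> orbit" using a by (auto simp: orbit_def)
    define c where "c = coset_rep ?q"
    have c: "c \<in> G" "lact c p = ?q" using coset_rep[OF q] by (auto simp: c_def)
    define b where "b = inv c \<circ> a"
    have bG: "b \<in> G" unfolding b_def using inv_in[OF c(1)] a by (rule comp_in)
    have ab: "c \<circ> b = a" unfolding b_def by (rule comp_cancel(1)[OF c(1)])
    have "lact b p = lact (inv c) (lact a p)" unfolding b_def by (rule lact_lact[OF p inv_in[OF c(1)] a, symmetric])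
    also have "\<dots> = p" unfolding c(2)[symmetric] by (rule lact_inv_cancel(1)[OF p c(1)])
    finally have bs: "b \<in> stab p" using bG by (simp add: stab_iff[OF p])
    have bp: "pact V S p b = p" using bs by (simp add: stab_iff_pact[OF p])
    \<comment> \<open>The scalar cancels the cocycle value in the product of
      \<open>bvec (c, p)\<close> and \<open>bvec (b, p)\<close>, so that the result is exactly
      \<open>bvec (a, p)\<close>.\<close>
    let ?s = "inverse (coc p c b) *\<^sub>C bvec (b, p)"
    have sS: "?s \<in> S_span V G p"
      unfolding S_span_eq[OF p] by (intro cvec.subspace_scale[OF subspace_fspace] bvec_in_fspace) (use bs in simp)
    have "AM (bvec (c, p)) ?s = inverse (coc p c b) *\<^sub>C AM (bvec (c, p)) (bvec (b, p))"
      by (rule lin_map_scale[OF lin_map_AM_right UNIV_I])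
    also have "AM (bvec (c, p)) (bvec (b, p)) = coc p c b *\<^sub>C bvec (a, p)"
      using AM_bvec[of "(c, p)" "(b, p)"] c bG p bp ab by (simp add: bprod_def)
    also have "inverse (coc p c b) *\<^sub>C coc p c b *\<^sub>C bvec (a, p) = (inverse (coc p c b) * coc p c b) *\<^sub>C bvec (a, p)"
      by (rule scaleC_scaleC)
    also have "inverse (coc p c b) * coc p c b = 1" by (rule left_inverse) (rule cocycle_rel(1)[OF p c(1) bG])
    also have "1 *\<^sub>C bvec (a, p) = bvec (a, p)" by (rule scaleC_one)
    finally have AMs: "AM (bvec (c, p)) ?s = bvec (a, p)" .
    define e' where "e' = \<rho> (\<lambda>x. ?s (x, p)) e"
    have e': "e' \<in> W" unfolding e'_def by (rule \<rho>_in[OF restrict_in[OF sS] e])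
    have t1: "tens Fi (bvec (a, p)) e = tens Fi (bvec (c, p)) e'"
      unfolding AMs[symmetric] e'_def Fi_eq by (rule tens_balanced[OF bvec_Dp[OF c(1)] sS e])
    let ?r = "cvec.representation B e'"
    have ex: "e' = (\<Sum>b\<in>B. ?r b *\<^sub>C b)" using cvec.sum_representation_eq[OF B(2), of e' B] e' B by simp
    have t2: "tens Fi (bvec (c, p)) e' = (\<Sum>b\<in>B. ?r b *\<^sub>C tens Fi (bvec (c, p)) b)"
      using lin_map_lincomb[OF tens_lin(2)[OF bvec_Dp[OF c(1)]] sub_W, of B "\<lambda>b. b" ?r] BW ex by auto
    have t3: "tens Ft (\<Sum>b\<in>B. ?r b *\<^sub>C tens Fi (bvec (c, p)) b) h = (\<Sum>b\<in>B. ?r b *\<^sub>C tens Ft (tens Fi (bvec (c, p)) b) h)"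
      using tens_Ind[OF bvec_Dp[OF c(1)]] BW by (intro lin_map_lincomb[OF tens_lin2(1)[OF h] subspace_Ind]) auto
    have t4: "?r b *\<^sub>C tens Ft (tens Fi (bvec (c, p)) b) h = tens Ft (tens Fi (bvec (c, p)) b) (?r b *\<^sub>C h)" if "b \<in> B" for b
      by (rule lin_map_scale[OF tens_lin2(2)[OF tens_Ind[OF bvec_Dp[OF c(1)]]] h, symmetric]) (use that BW in auto)
    define H where "H q b = (if q = ?q then ?r b *\<^sub>C h else 0)" for q b
    have HH: "H q b \<in> Hom" for q b
      using h cvec.subspace_scale[OF subspace_Hom] cvec.subspace_0[OF subspace_Hom] by (auto simp: H_def)
    have "(\<Sum>q\<in>orbit. \<Sum>b\<in>B. tens Ft (?g q b) (H q b)) = (\<Sum>q\<in>{?q}. \<Sum>b\<in>B. tens Ft (?g q b) (H q b))"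
    proof (rule sum.mono_neutral_right[OF finite_orbit])
      show "\<forall>i\<in>orbit - {?q}. (\<Sum>b\<in>B. tens Ft (?g i b) (H i b)) = 0"
        using lin_map_zero[OF tl subspace_Hom] by (auto simp: H_def intro!: sum.neutral)
    qed (use q in auto)
    also have "\<dots> = (\<Sum>b\<in>B. tens Ft (tens Fi (bvec (c, p)) b) (?r b *\<^sub>C h))" by (simp add: H_def c_def)
    also have "\<dots> = tens Ft (tens Fi (bvec (a, p)) e) h" unfolding t1 t2 t3 using t4 by (intro sum.cong) auto
    finally show ?thesis using NFI[of H, OF HH] by simp
  qed
  have TT_NF: "TT \<subseteq> NF"
  proof -
    have "tens Ft \<tau> h \<in> NF" if \<tau>: "\<tau> \<in> Ind" and h: "h \<in> Hom" for \<tau> h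
    proof (rule tensor_space_image[where F = Fi and U = Dp and W = W and f = "\<lambda>\<tau>. tens Ft \<tau> h", folded Ind_eq, OF tens_lin2(1)[OF h] subNF \<tau>])
      fix d e assume d: "d \<in> Dp" and e: "e \<in> W"
      show "tens Ft (tens Fi d e) h \<in> NF"
      proof (rule lin_map_span_image[where f = "\<lambda>d. tens Ft (tens Fi d e) h" and B = "{bvec (a, p) |a. a \<in> G}",
            OF lin_map_comp[OF tens_lin(1)[OF e] tens_lin2(1)[OF h]] subspace_Dp _ _ subNF])
        show "d \<in> cvec.span {bvec (a, p) |a. a \<in> G}" using d by (simp add: D_span_def)
        show "{bvec (a, p) |a. a \<in> G} \<subseteq> Dp" using bvec_Dp by blast
        show "tens Ft (tens Fi b e) h \<in> NF" if "b \<in> {bvec (a, p) |a. a \<in> G}" for b using that gen[OF _ e h] by blast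
      qed
    qed
    then show ?thesis unfolding tensor_space_def[of Ft] by (intro cvec.span_minimal[OF _ subNF]) blast
  qed
  then show ?thesis using NFE[of t] t by blast
qed

end

section \<open>The decomposition\<close>

lemma lin_map_dsum:
  assumes f: "\<And>i. i \<in> I \<Longrightarrow> lin_map (X i) Y (f i)" and Y: "cvec.subspace Y"
  shows "lin_map (dsum I X) Y (\<lambda>z. \<Sum>i\<in>I. f i (z i))"
proof (rule lin_mapI)
  fix z z' c assume z: "z \<in> dsum I X"
  show "(\<Sum>i\<in>I. f i (z i)) \<in> Y"
    by (rule cvec.subspace_sum[OF Y]) (rule lin_map_in[OF f dsum_in[OF z]])
  show "(\<Sum>i\<in>I. f i ((c *\<^sub>C z) i)) = c *\<^sub>C (\<Sum>i\<in>I. f i (z i))"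
    unfolding cvec.scale_sum_right
    by (rule sum.cong[OF refl]) (simp add: lin_map_scale[OF f dsum_in[OF z]])
  assume z': "z' \<in> dsum I X"
  show "(\<Sum>i\<in>I. f i ((z + z') i)) = (\<Sum>i\<in>I. f i (z i)) + (\<Sum>i\<in>I. f i (z' i))"
    unfolding sum.distrib[symmetric]
    by (rule sum.cong[OF refl]) (simp add: lin_map_add[OF f dsum_in[OF z] dsum_in[OF z']])
qed

text \<open>The natural map goes from the sum of tensor products to the total module, whereas the
  isomorphism is wanted in the other direction; closure of \<open>Y\<close> under the operations
  lets the intertwining property pass to the inverse.\<close>

lemma bimod_isoI:
  assumes iso: "lin_iso (bspace Y) (bspace X) f" and sub: "cvec.subspace (bspace Y)"
    and act: "\<And>a y. a \<in> acarrier A \<Longrightarrow> y \<in> bspace Y \<Longrightarrow> bact Y a y \<in> bspace Y \<and> f (bact Y a y) = bact X a (f y)"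
    and mode: "\<And>u k y. u \<in> vspace U \<Longrightarrow> y \<in> bspace Y \<Longrightarrow> bmode Y u k y \<in> bspace Y \<and> f (bmode Y u k y) = bmode X u k (f y)"
  shows "bimod_iso A U X Y"
proof -
  let ?g = "inv_into (bspace Y) f"
  have b: "bij_betw f (bspace Y) (bspace X)" using iso by (simp add: lin_iso_def)
  have gY: "?g x \<in> bspace Y" if "x \<in> bspace X" for x using b that by (simp add: bij_betw_def inv_into_into)
  have fg: "f (?g x) = x" if "x \<in> bspace X" for x using b that by (simp add: bij_betw_def f_inv_into_f)
  have gf: "?g (f y) = y" if "y \<in> bspace Y" for y using b that by (simp add: bij_betw_def)
  have 1: "?g (bact X a x) = bact Y a (?g x)" if "a \<in> acarrier A" "x \<in> bspace X" for a x
    using act[OF that(1) gY[OF that(2)]] gf[of "bact Y a (?g x)"] fg[OF that(2)] by simp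
  have 2: "?g (bmode X u k x) = bmode Y u k (?g x)" if "u \<in> vspace U" "x \<in> bspace X" for u k x
    using mode[OF that(1) gY[OF that(2)], of k] gf[of "bmode Y u k (?g x)"] fg[OF that(2)] by simp
  show ?thesis
    unfolding bimod_iso_def using lin_iso_inv[OF iso sub] 1 2 by blast
qed

context stab_simple
begin

text \<open>On a tensor in normal form the entry of the image at \<open>q\<close> involves only the
  coset representative of \<open>q\<close>, since its \<open>\<phi>\<close> lands in the component
  \<open>q\<close>. Each entry thus reduces to a sum of values of homomorphisms at basis vectors
  inside the module of \<open>p\<close>.\<close>

lemma psi_coordinates:
  assumes B: "finite B" "cvec.independent B" "cvec.span B = W" and t: "t \<in> TT"
  shows "\<exists>h. (\<forall>q\<in>orbit. \<forall>b\<in>B. h q b \<in> Hom) \<and>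
    t = (\<Sum>q\<in>orbit. \<Sum>b\<in>B. tens Ft (tens Fi (bvec (coset_rep q, p)) b) (h q b)) \<and>
    (\<forall>q. psi t q = (if q \<in> orbit then \<phi> (coset_rep q) p (\<Sum>b\<in>B. h q b b) else 0))"
proof -
  obtain h where h: "\<forall>q\<in>orbit. \<forall>b\<in>B. h q b \<in> Hom"
    and th: "t = (\<Sum>q\<in>orbit. \<Sum>b\<in>B. tens Ft (tens Fi (bvec (coset_rep q, p)) b) (h q b))"
    using tensor_normal_form[OF B t] by blast
  have BW: "b \<in> W" if "b \<in> B" for b using that B(3) cvec.span_superset by blast
  have gen: "tens Ft (tens Fi (bvec (coset_rep q, p)) b) (h q b) \<in> TT" if "q \<in> orbit" "b \<in> B" for q b
    using coset_rep[OF that(1)] BW[OF that(2)] h that by (intro tens_in tens_Ind bvec_Dp) auto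
  have sTT: "cvec.subspace TT" by (rule subspace_tensor_space)
  have "psi t = (\<Sum>q\<in>orbit. psi (\<Sum>b\<in>B. tens Ft (tens Fi (bvec (coset_rep q, p)) b) (h q b)))"
    unfolding th by (rule lin_map_sum[OF lin_map_psi sTT]) (rule cvec.subspace_sum[OF sTT gen])
  also have "\<dots> = (\<Sum>q\<in>orbit. incl q (\<phi> (coset_rep q) p (\<Sum>b\<in>B. h q b b)))"
  proof (rule sum.cong[OF refl])
    fix q assume q: "q \<in> orbit"
    have c: "coset_rep q \<in> G" "lact (coset_rep q) p = q" using coset_rep[OF q] by auto
    have hb: "h q b b \<in> Msp p" if "b \<in> B" for b using h q that HomD(3)[OF _ BW[OF that]] by blast
    have l: "lin_map (Msp p) Tot (\<lambda>m. incl q (\<phi> (coset_rep q) p m))"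
      by (rule lin_mapI) (use phi(4)[OF p c(1)] lin_map_add[OF phi(2)[OF p c(1)]] lin_map_scale[OF phi(2)[OF p c(1)]]
        incl_in_Tot[OF lact_in[OF p c(1)]] c(2) in \<open>auto simp: incl_add incl_scale\<close>)
    have "psi (\<Sum>b\<in>B. tens Ft (tens Fi (bvec (coset_rep q, p)) b) (h q b))
        = (\<Sum>b\<in>B. psi (tens Ft (tens Fi (bvec (coset_rep q, p)) b) (h q b)))"
      by (rule lin_map_sum[OF lin_map_psi sTT gen[OF q]])
    also have "\<dots> = (\<Sum>b\<in>B. incl q (\<phi> (coset_rep q) p (h q b b)))"
    proof (rule sum.cong[OF refl])
      fix b assume b: "b \<in> B"
      have "h q b \<in> Hom" using h q b by blast
      from psi_generator[OF c(1) BW[OF b] this]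
      show "psi (tens Ft (tens Fi (bvec (coset_rep q, p)) b) (h q b)) = incl q (\<phi> (coset_rep q) p (h q b b))" unfolding c(2) .
    qed
    also have "\<dots> = incl q (\<phi> (coset_rep q) p (\<Sum>b\<in>B. h q b b))"
      by (rule lin_map_sum[OF l Msp_facts(1)[OF p] hb, symmetric])
    finally show "psi (\<Sum>b\<in>B. tens Ft (tens Fi (bvec (coset_rep q, p)) b) (h q b)) = incl q (\<phi> (coset_rep q) p (\<Sum>b\<in>B. h q b b))" .
  qed
  finally have "psi t q = (if q \<in> orbit then \<phi> (coset_rep q) p (\<Sum>b\<in>B. h q b b) else 0)" for q
    by (simp add: sum_apply incl_def sum.delta' finite_orbit)
  then show ?thesis using h th by blast
qed

end

context orbifold_decomposition
begin

abbreviation Ix where "Ix \<equiv> SIGMA j:J. \<Lambda> j"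
abbreviation Ind where "Ind j \<mu> \<equiv> induced_space V G S \<phi> (rep j) (W j \<mu>) (\<rho> j \<mu>)"
abbreviation Fi where "Fi j \<mu> \<equiv> induced_forms V G S \<phi> (rep j) (W j \<mu>) (\<rho> j \<mu>)"
abbreviation Ft where "Ft j \<mu> \<equiv> bilinear_forms (Ind j \<mu>) (Hom j \<mu>)"
abbreviation TT where "TT j \<mu> \<equiv> tensor_space (Ft j \<mu>) (Ind j \<mu>) (Hom j \<mu>)"
abbreviation psi where "psi j \<mu> \<equiv> stab_simple.psi V G S \<phi> (rep j) (W j \<mu>) (\<rho> j \<mu>)"
abbreviation Sum where "Sum \<equiv> dsum Ix (\<lambda>i. TT (fst i) (snd i))"
abbreviation orbit where "orbit j \<equiv> stab_simple.orbit V G S (rep j)"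
abbreviation coset_rep where "coset_rep j \<equiv> stab_simple.coset_rep V G S (rep j)"

lemma finite_Ix: "finite Ix"
  using finite_J finite_Lambda by (rule finite_SigmaI)

definition Psi where "Psi z = (\<Sum>i\<in>Ix. psi (fst i) (snd i) (z i))"

lemma psi_facts:
  assumes "i \<in> Ix"
  shows "lin_map (TT (fst i) (snd i)) Tot (psi (fst i) (snd i))" "stab_simple V G S \<phi> (rep (fst i)) (W (fst i) (snd i)) (\<rho> (fst i) (snd i))"
proof -
  have j: "fst i \<in> J" "snd i \<in> \<Lambda> (fst i)" using assms by auto
  show s: "stab_simple V G S \<phi> (rep (fst i)) (W (fst i) (snd i)) (\<rho> (fst i) (snd i))" by (rule stab_simpleI[OF j])
  show "lin_map (TT (fst i) (snd i)) Tot (psi (fst i) (snd i))" by (rule stab_simple.lin_map_psi[OF s])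
qed

lemma lin_map_Psi: "lin_map Sum Tot Psi"
  unfolding Psi_def by (rule lin_map_dsum) (use psi_facts(1) subspace_Tot in auto)

lemma subspace_Sum: "cvec.subspace Sum"
  by (rule subspace_dsum) (rule subspace_tensor_space)

lemma Psi_incl:
  assumes j: "j \<in> J" "\<mu> \<in> \<Lambda> j" and t: "t \<in> TT j \<mu>"
  shows "incl (j, \<mu>) t \<in> Sum" "Psi (incl (j, \<mu>) t) = psi j \<mu> t"
proof -
  have i: "(j, \<mu>) \<in> Ix" using j by simp
  show "incl (j, \<mu>) t \<in> Sum"
    by (rule incl_in_dsum) (use i t in \<open>auto simp: cvec.subspace_0[OF subspace_tensor_space]\<close>)
  have "Psi (incl (j, \<mu>) t) = (\<Sum>i\<in>{(j, \<mu>)}. psi (fst i) (snd i) (incl (j, \<mu>) t i))"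
    unfolding Psi_def
  proof (rule sum.mono_neutral_right[OF finite_Ix])
    show "\<forall>i\<in>Ix - {(j, \<mu>)}. psi (fst i) (snd i) (incl (j, \<mu>) t i) = 0"
    proof
      fix i assume "i \<in> Ix - {(j, \<mu>)}"
      then have i: "i \<in> Ix" "incl (j, \<mu>) t i = 0" by (auto simp: incl_def)
      show "psi (fst i) (snd i) (incl (j, \<mu>) t i) = 0"
        unfolding i(2) by (rule lin_map_zero[OF psi_facts(1)[OF i(1)] subspace_tensor_space])
    qed
  qed (use i in auto)
  then show "Psi (incl (j, \<mu>) t) = psi j \<mu> t" by (simp add: incl_def)
qed

text \<open>Look at the entry of \<open>Psi z\<close> at \<open>q\<close>: only the orbit containing
  \<open>q\<close> contributes, and up to the injective map of the coset representative the entry is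
  a sum of values of homomorphisms at basis vectors. By \<open>independent_images\<close> these
  homomorphisms vanish, hence so do the normal forms.\<close>

lemma Psi_inj: "inj_on Psi Sum"
proof (rule lin_map_inj_on[OF lin_map_Psi subspace_Sum])
  fix z assume z: "z \<in> Sum" and 0: "Psi z = 0"
  let ?t = "\<lambda>i q b. tens (Fi (fst i) (snd i)) (bvec (coset_rep (fst i) q, rep (fst i))) b"
  have "\<forall>i\<in>Ix. \<exists>h. (\<forall>q\<in>orbit (fst i). \<forall>b\<in>basis (fst i) (snd i). h q b \<in> Hom (fst i) (snd i)) \<and>
    z i = (\<Sum>q\<in>orbit (fst i). \<Sum>b\<in>basis (fst i) (snd i). tens (Ft (fst i) (snd i)) (?t i q b) (h q b)) \<and>
    (\<forall>q. psi (fst i) (snd i) (z i) q = (if q \<in> orbit (fst i) then \<phi> (coset_rep (fst i) q) (rep (fst i)) (\<Sum>b\<in>basis (fst i) (snd i). h q b b) else 0))"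
  proof
    fix i assume i: "i \<in> Ix"
    then have j: "fst i \<in> J" "snd i \<in> \<Lambda> (fst i)" by auto
    show "\<exists>h. (\<forall>q\<in>orbit (fst i). \<forall>b\<in>basis (fst i) (snd i). h q b \<in> Hom (fst i) (snd i)) \<and>
      z i = (\<Sum>q\<in>orbit (fst i). \<Sum>b\<in>basis (fst i) (snd i). tens (Ft (fst i) (snd i)) (?t i q b) (h q b)) \<and>
      (\<forall>q. psi (fst i) (snd i) (z i) q = (if q \<in> orbit (fst i) then \<phi> (coset_rep (fst i) q) (rep (fst i)) (\<Sum>b\<in>basis (fst i) (snd i). h q b b) else 0))"
      by (rule stab_simple.psi_coordinates[OF psi_facts(2)[OF i] basis(1-3)[OF j] dsum_in[OF z i]])
  qed
  then obtain h where h: "\<forall>i\<in>Ix. (\<forall>q\<in>orbit (fst i). \<forall>b\<in>basis (fst i) (snd i). h i q b \<in> Hom (fst i) (snd i)) \<and>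
    z i = (\<Sum>q\<in>orbit (fst i). \<Sum>b\<in>basis (fst i) (snd i). tens (Ft (fst i) (snd i)) (?t i q b) (h i q b)) \<and>
    (\<forall>q. psi (fst i) (snd i) (z i) q = (if q \<in> orbit (fst i) then \<phi> (coset_rep (fst i) q) (rep (fst i)) (\<Sum>b\<in>basis (fst i) (snd i). h i q b b) else 0))"
    by (rule bchoice[THEN exE])
  have hpsi: "psi j \<mu> (z (j, \<mu>)) q = (if q \<in> orbit j then \<phi> (coset_rep j q) (rep j) (\<Sum>b\<in>basis j \<mu>. h (j, \<mu>) q b b) else 0)"
    if "j \<in> J" "\<mu> \<in> \<Lambda> j" for j \<mu> q
  proof -
    have "(j, \<mu>) \<in> Ix" using that by simp
    from h[THEN bspec, OF this, THEN conjunct2, THEN conjunct2, THEN spec, of q] show ?thesis by (simp only: fst_conv snd_conv)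
  qed
  have h0: "h (j, \<mu>) q b = 0" if j: "j \<in> J" and \<mu>: "\<mu> \<in> \<Lambda> j" and q: "q \<in> orbit j" and b: "b \<in> basis j \<mu>" for j \<mu> q b
  proof -
    interpret A: stab_simple V G S \<phi> "rep j" "W j \<mu>" "\<rho> j \<mu>" by (rule stab_simpleI[OF j \<mu>])
    let ?c = "coset_rep j q"
    have c: "?c \<in> G" "lact ?c (rep j) = q" using A.coset_rep[OF q] by auto
    have hH: "h (j, \<nu>) q e \<in> Hom j \<nu>" if "\<nu> \<in> \<Lambda> j" "e \<in> basis j \<nu>" for \<nu> e
      using h[THEN bspec, of "(j, \<nu>)"] j q that by simp
    have hM: "(\<Sum>e\<in>basis j \<nu>. h (j, \<nu>) q e e) \<in> Msp (rep j)" if \<nu>: "\<nu> \<in> \<Lambda> j" for \<nu>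
    proof (rule cvec.subspace_sum[OF Msp_facts(1)[OF A.p]])
      fix e assume e: "e \<in> basis j \<nu>"
      show "h (j, \<nu>) q e e \<in> Msp (rep j)"
        using stab_simple.HomD(3)[OF stab_simpleI[OF j \<nu>] hH[OF \<nu> e]] basis(4)[OF j \<nu>] e by blast
    qed
    have other: "psi j' \<nu> (z (j', \<nu>)) q = 0" if j': "j' \<in> J" "\<nu> \<in> \<Lambda> j'" "j' \<noteq> j" for j' \<nu>
    proof -
      interpret B: stab_simple V G S \<phi> "rep j'" "W j' \<nu>" "\<rho> j' \<nu>" by (rule stab_simpleI[OF j'(1,2)])
      have "q \<notin> orbit j'"
      proof
        assume "q \<in> orbit j'"
        then obtain a where a: "a \<in> G" "lact a (rep j') = q" using B.coset_rep by blast
        have "j' = j" by (rule orbit_index_unique[OF j'(1) j a(1) c(1)]) (simp only: a(2) c(2))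
        then show False using j'(3) by simp
      qed
      then show ?thesis unfolding hpsi[OF j'(1,2)] by (rule if_not_P)
    qed
    have "0 = Psi z q" using 0 by simp
    also have "\<dots> = (\<Sum>j'\<in>J. \<Sum>\<nu>\<in>\<Lambda> j'. psi j' \<nu> (z (j', \<nu>)) q)"
      unfolding Psi_def sum_apply using finite_J finite_Lambda by (subst sum.Sigma) (auto simp: case_prod_unfold)
    also have "\<dots> = (\<Sum>j'\<in>{j}. \<Sum>\<nu>\<in>\<Lambda> j'. psi j' \<nu> (z (j', \<nu>)) q)"
      by (rule sum.mono_neutral_right[OF finite_J]) (use j other in \<open>auto intro!: sum.neutral\<close>)
    also have "\<dots> = (\<Sum>\<nu>\<in>\<Lambda> j. psi j \<nu> (z (j, \<nu>)) q)" by simp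
    also have "\<dots> = (\<Sum>\<nu>\<in>\<Lambda> j. \<phi> ?c (rep j) (\<Sum>e\<in>basis j \<nu>. h (j, \<nu>) q e e))"
    proof (rule sum.cong[OF refl])
      fix \<nu> assume \<nu>: "\<nu> \<in> \<Lambda> j"
      show "psi j \<nu> (z (j, \<nu>)) q = \<phi> ?c (rep j) (\<Sum>e\<in>basis j \<nu>. h (j, \<nu>) q e e)"
        unfolding hpsi[OF j \<nu>] using q by (rule if_P)
    qed
    also have "\<dots> = \<phi> ?c (rep j) (\<Sum>\<nu>\<in>\<Lambda> j. \<Sum>e\<in>basis j \<nu>. h (j, \<nu>) q e e)"
      by (rule lin_map_sum[OF phi(2)[OF A.p c(1)] Msp_facts(1)[OF A.p] hM, symmetric])
    finally have ph0: "\<phi> ?c (rep j) (\<Sum>\<nu>\<in>\<Lambda> j. \<Sum>e\<in>basis j \<nu>. h (j, \<nu>) q e e) = 0" by (rule sym)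
    have "(\<Sum>\<nu>\<in>\<Lambda> j. \<Sum>e\<in>basis j \<nu>. h (j, \<nu>) q e e) \<in> Msp (rep j)"
      by (rule cvec.subspace_sum[OF Msp_facts(1)[OF A.p] hM])
    from phi_zero_iff[OF A.p c(1) this, THEN iffD1, OF ph0]
    have 0: "(\<Sum>\<nu>\<in>\<Lambda> j. \<Sum>e\<in>basis j \<nu>. h (j, \<nu>) q e e) = 0" .
    show ?thesis
    proof (rule independent_images[OF j, where f = "\<lambda>\<nu> e. h (j, \<nu>) q e"])
      show "h (j, \<nu>) q e \<in> Hom j \<nu>" if "\<nu> \<in> \<Lambda> j" "e \<in> basis j \<nu>" for \<nu> e using that by (rule hH)
    qed (rule 0 \<mu> b)+
  qed
  have "z i = 0" if i: "i \<in> Ix" for i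
  proof -
    interpret A: stab_simple V G S \<phi> "rep (fst i)" "W (fst i) (snd i)" "\<rho> (fst i) (snd i)" by (rule psi_facts(2)[OF i])
    have j: "fst i \<in> J" "snd i \<in> \<Lambda> (fst i)" using i by auto
    have "z i = (\<Sum>q\<in>orbit (fst i). \<Sum>b\<in>basis (fst i) (snd i). tens (Ft (fst i) (snd i)) (?t i q b) (h i q b))"
      using h[THEN bspec, OF i] by blast
    also have "\<dots> = 0"
    proof (rule sum.neutral, rule ballI, rule sum.neutral, rule ballI)
      fix q b assume q: "q \<in> orbit (fst i)" and b: "b \<in> basis (fst i) (snd i)"
      have "h i q b = 0" using h0[OF j q b] by simp
      moreover have "?t i q b \<in> Ind (fst i) (snd i)"
        using A.tens_Ind[OF A.bvec_Dp] A.coset_rep[OF q] basis(4)[OF j] b by blast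
      ultimately show "tens (Ft (fst i) (snd i)) (?t i q b) (h i q b) = 0"
        using lin_map_zero[OF A.tens_lin2(2) A.subspace_Hom] by simp
    qed
    finally show ?thesis .
  qed
  moreover have "z i = 0" if "i \<notin> Ix" for i using z that by (rule dsum_out)
  ultimately have "z i = 0" for i by (cases "i \<in> Ix")
  then show "z = 0" by (simp add: fun_eq_iff)
qed

text \<open>A vector in the component \<open>q\<close> is \<open>\<phi> a\<close> of a vector at the
  orbit representative, whose module is spanned by values \<open>f u\<close>; the tensor of
  \<open>bvec (a, rep j)\<close>, \<open>u\<close> and \<open>f\<close> is a preimage for such a
  value.\<close>

lemma Psi_surj: "Psi ` Sum = Tot"
proof
  show "Psi ` Sum \<subseteq> Tot" using lin_map_in[OF lin_map_Psi] by blast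
  note sR = lin_map_image[OF lin_map_Psi subspace_Sum]
  have comp: "incl q m \<in> Psi ` Sum" if q: "q \<in> S" and m: "m \<in> Msp q" for q m
  proof -
    obtain j a where j: "j \<in> J" and a: "a \<in> G" "lact a (rep j) = q" using orbit_index[OF q] by blast
    let ?p = "rep j"
    note p = rep_S[OF j]
    have "m \<in> \<phi> a ?p ` Msp ?p" using phi(3)[OF p a(1)] m a(2) by (simp add: bij_betw_def)
    then obtain m' where m': "m' \<in> Msp ?p" "m = \<phi> a ?p m'" by blast
    have l: "lin_map (Msp ?p) Tot (\<lambda>m. incl q (\<phi> a ?p m))"
      by (rule lin_mapI) (use phi(4)[OF p a(1)] lin_map_add[OF phi(2)[OF p a(1)]] lin_map_scale[OF phi(2)[OF p a(1)]]
        incl_in_Tot[OF q] a(2) in \<open>auto simp: incl_add incl_scale\<close>)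
    have "incl q (\<phi> a ?p m') \<in> Psi ` Sum"
    proof (rule lin_map_span_image[where f = "\<lambda>m. incl q (\<phi> a ?p m)" and B = "{f u |\<mu> f u. \<mu> \<in> \<Lambda> j \<and> f \<in> Hom j \<mu> \<and> u \<in> W j \<mu>}",
          OF l Msp_facts(1)[OF p] _ _ sR])
      show "m' \<in> cvec.span {f u |\<mu> f u. \<mu> \<in> \<Lambda> j \<and> f \<in> Hom j \<mu> \<and> u \<in> W j \<mu>}" using m'(1) module_spanned[OF j] by simp
      show "{f u |\<mu> f u. \<mu> \<in> \<Lambda> j \<and> f \<in> Hom j \<mu> \<and> u \<in> W j \<mu>} \<subseteq> Msp ?p"
        unfolding module_spanned[OF j] by (rule cvec.span_superset)
      fix x assume "x \<in> {f u |\<mu> f u. \<mu> \<in> \<Lambda> j \<and> f \<in> Hom j \<mu> \<and> u \<in> W j \<mu>}"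
      then obtain \<mu> f u where x: "x = f u" and \<mu>: "\<mu> \<in> \<Lambda> j" and f: "f \<in> Hom j \<mu>" and u: "u \<in> W j \<mu>" by blast
      interpret A: stab_simple V G S \<phi> ?p "W j \<mu>" "\<rho> j \<mu>" by (rule stab_simpleI[OF j \<mu>])
      let ?t = "tens (Ft j \<mu>) (tens (Fi j \<mu>) (bvec (a, ?p)) u) f"
      have t: "?t \<in> TT j \<mu>" by (intro tens_in A.tens_Ind A.bvec_Dp a(1) u f)
      have "incl q (\<phi> a ?p x) = Psi (incl (j, \<mu>) ?t)"
        unfolding Psi_incl(2)[OF j \<mu> t] A.psi_generator[OF a(1) u f] x a(2) ..
      then show "incl q (\<phi> a ?p x) \<in> Psi ` Sum" using Psi_incl(1)[OF j \<mu> t] by (rule image_eqI)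
    qed
    then show ?thesis using m'(2) by simp
  qed
  show "Tot \<subseteq> Psi ` Sum"
  proof
    fix f assume f: "f \<in> Tot"
    have "(\<Sum>q\<in>S. incl q (f q)) = f" using finite_S f by (rule sum_incl)
    moreover have "(\<Sum>q\<in>S. incl q (f q)) \<in> Psi ` Sum"
    proof (rule cvec.subspace_sum[OF sR])
      show "incl q (f q) \<in> Psi ` Sum" if "q \<in> S" for q using that dsum_in[OF f that] by (rule comp)
    qed
    ultimately show "f \<in> Psi ` Sum" by simp
  qed
qed

lemma lin_iso_Psi: "lin_iso Sum Tot Psi"
  using lin_map_Psi Psi_inj Psi_surj by (simp add: lin_iso_def bij_betw_def)

lemma total_module_decomposition:
  "bimod_iso (stable_algebra V G S \<phi>) VG (total_bimod V G S \<phi>)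
    (bimod_dsum Ix (\<lambda>(j, \<mu>). bimod_tensor (Ind j \<mu>) (induced_act V G S \<phi> (rep j) (W j \<mu>) (\<rho> j \<mu>))
      (hom_mod V G S \<phi> (rep j) (W j \<mu>) (\<rho> j \<mu>))))"
    (is "bimod_iso ?A VG ?X ?Y")
proof (rule bimod_isoI[where f = Psi])
  have sY: "bspace ?Y = Sum"
    by (simp add: bimod_dsum_def bimod_tensor_def Let_def case_prod_unfold)
  have sX: "bspace ?X = Tot" by (simp add: total_bimod_def)
  show "lin_iso (bspace ?Y) (bspace ?X) Psi" unfolding sX sY by (rule lin_iso_Psi)
  show "cvec.subspace (bspace ?Y)" unfolding sY by (rule subspace_Sum)
  have aY: "bact ?Y x z = (\<lambda>i. if i \<in> Ix then
      tensor_map (Ft (fst i) (snd i)) (induced_act V G S \<phi> (rep (fst i)) (W (fst i) (snd i)) (\<rho> (fst i) (snd i)) x) id (z i) else 0)" for x z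
    by (simp add: bimod_dsum_def bimod_tensor_def Let_def case_prod_unfold cong: if_cong)
  have mY: "bmode ?Y u k z = (\<lambda>i. if i \<in> Ix then
      tensor_map (Ft (fst i) (snd i)) id (mmode (hom_mod V G S \<phi> (rep (fst i)) (W (fst i) (snd i)) (\<rho> (fst i) (snd i))) u k) (z i) else 0)" for u k z
    by (simp add: bimod_dsum_def bimod_tensor_def Let_def case_prod_unfold cong: if_cong)
  fix z assume "z \<in> bspace ?Y"
  then have z: "z \<in> Sum" by (simp only: sY)
  have pz: "psi (fst i) (snd i) (z i) \<in> Tot" if "i \<in> Ix" for i
    by (rule lin_map_in[OF psi_facts(1)[OF that] dsum_in[OF z that]])
  show "bact ?Y x z \<in> bspace ?Y \<and> Psi (bact ?Y x z) = bact ?X x (Psi z)" if "x \<in> acarrier ?A" for x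
  proof -
    have x: "x \<in> fspace (G \<times> S)" using that by (simp add: stable_algebra_def)
    note pa = stab_simple.psi_act[OF psi_facts(2) x dsum_in[OF z]]
    have 1: "bact ?Y x z \<in> Sum" unfolding aY by (rule dsumI) (use pa(1) in \<open>auto split: if_splits\<close>)
    have "Psi (bact ?Y x z) = (\<Sum>i\<in>Ix. tact x (psi (fst i) (snd i) (z i)))"
      unfolding Psi_def aY by (rule sum.cong[OF refl]) (simp only: if_True pa(2))
    also have "\<dots> = tact x (Psi z)"
      unfolding Psi_def by (rule lin_map_sum[OF lin_map_tact subspace_Tot pz, symmetric])
    finally show ?thesis using 1 unfolding sY tact_bact by blast
  qed
  show "bmode ?Y u k z \<in> bspace ?Y \<and> Psi (bmode ?Y u k z) = bmode ?X u k (Psi z)" if "u \<in> vspace VG" for u k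
  proof -
    have uV: "u \<in> vspace V" using that by simp
    note pm = stab_simple.psi_mode[OF psi_facts(2) that dsum_in[OF z]]
    have 1: "bmode ?Y u k z \<in> Sum" unfolding mY by (rule dsumI) (use pm(1) in \<open>auto split: if_splits\<close>)
    have "Psi (bmode ?Y u k z) = (\<Sum>i\<in>Ix. tmode u k (psi (fst i) (snd i) (z i)))"
      unfolding Psi_def mY by (rule sum.cong[OF refl]) (simp only: if_True pm(2))
    also have "\<dots> = tmode u k (Psi z)"
      unfolding Psi_def by (rule lin_map_sum[OF lin_map_tmode[OF uV] subspace_Tot pz, symmetric])
    finally show ?thesis using 1 unfolding sY tmode_bmode by blast
  qed
qed

end

section \<open>Arbitrary irreducible twisted modules\<close>

context automorphism_group
begin

text \<open>The automorphism \<open>a\<close> carries the eigenspaces of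
  \<open>inv a \<circ> g \<circ> a\<close> to those of \<open>g\<close> with the same index and
  respects the modes of \<open>V\<close>; so each axiom for the twist is the one for
  \<open>M\<close> at \<open>a u\<close> and \<open>a v\<close>.\<close>

lemma twisted_module_twist:
  assumes M: "twisted_module V g T M" and a: "a \<in> G"
  shows "twisted_module V (inv a \<circ> g \<circ> a) T (twist M a)"
proof -
  interpret M: twisted_module V g T M by (rule M)
  have aV: "a u \<in> vspace V" if "u \<in> vspace V" for u using autD(5)[OF a that] .
  have av: "a (vmode V u n v) = vmode V (a u) n (a v)" if "u \<in> vspace V" "v \<in> vspace V" for u v n
    using group a that by (simp add: finite_aut_group_def voa_aut_def)
  have E: "a u \<in> eigenspace_aut V g T r" if u: "u \<in> eigenspace_aut V (inv a \<circ> g \<circ> a) T r" for u r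
  proof -
    let ?c = "exp (- (2 * of_real pi * \<i> * of_nat r / of_nat T))"
    have uV: "u \<in> vspace V" and e: "inv a (g (a u)) = ?c *\<^sub>C u" using u by (auto simp: eigenspace_aut_def)
    have "g (a u) = a (inv a (g (a u)))" using bij[OF a] by (simp add: bij_is_surj surj_f_inv_f)
    also have "\<dots> = ?c *\<^sub>C a u" unfolding e by (rule lin_map_scale[OF autD(2)[OF a] uV])
    finally show ?thesis using aV[OF uV] by (simp add: eigenspace_aut_def)
  qed
  show ?thesis
  proof
    show "cvec.subspace (mspace (twist M a))" using M.subspace by simp
    show "lin_map (mspace (twist M a)) (mspace (twist M a)) (mmode (twist M a) u k)" if "u \<in> vspace V" for u k
      using M.mode_linear[OF aV[OF that]] by simp
    show "lin_map (vspace V) (mspace (twist M a)) (\<lambda>u. mmode (twist M a) u k w)" if "w \<in> mspace (twist M a)" for w k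
      unfolding twist_simps by (rule lin_map_comp[OF autD(2)[OF a] M.field_linear]) (use that in simp)
    show "\<exists>N. \<forall>k\<ge>N. mmode (twist M a) u k w = 0" if "u \<in> vspace V" "w \<in> mspace (twist M a)" for u w
      using M.truncation[OF aV[OF that(1)]] that(2) by simp
    show "mmode (twist M a) u k w = 0" if "r < T" "u \<in> eigenspace_aut V (inv a \<circ> g \<circ> a) T r"
      "w \<in> mspace (twist M a)" "k - of_nat r / of_nat T \<notin> \<int>" for r u w k
      unfolding twist_simps by (rule M.exponents[OF that(1) E[OF that(2)] _ that(4)]) (use that(3) in simp)
    show "mmode (twist M a) (vac V) k w = (if k = -1 then w else 0)" if "w \<in> mspace (twist M a)" for w k
      unfolding twist_simps autD(3)[OF a] by (rule M.vacuum) (use that in simp)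
    fix r u v w l and m n :: rat
    assume r: "r < T" and u: "u \<in> eigenspace_aut V (inv a \<circ> g \<circ> a) T r" and v: "v \<in> vspace V"
      and w: "w \<in> mspace (twist M a)" and m: "m - of_nat r / of_nat T \<in> \<int>"
    have uV: "u \<in> vspace V" using u by (simp add: eigenspace_aut_def)
    have w': "w \<in> mspace M" using w by simp
    show "Sum_any (\<lambda>i::nat. (of_rat m gchoose i) *\<^sub>C
        mmode (twist M a) (vmode V u (l + int i) v) (m + n - of_nat i) w) =
      Sum_any (\<lambda>i::nat. ((-1) ^ i * (of_int l gchoose i)) *\<^sub>C
        (mmode (twist M a) u (m + of_int l - of_nat i) (mmode (twist M a) v (n + of_nat i) w) -
         ((-1) powi l) *\<^sub>C mmode (twist M a) v (n + of_int l - of_nat i) (mmode (twist M a) u (m + of_nat i) w)))"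
      unfolding twist_simps av[OF uV v] by (rule M.jacobi[OF r E[OF u] aV[OF v] w' m])
  qed
qed

lemma irreducible_twisted_twist:
  assumes M: "irreducible_twisted V g T M" and a: "a \<in> G"
  shows "irreducible_twisted V (inv a \<circ> g \<circ> a) T (twist M a)"
proof -
  have "L0_eigenspace V (twist M a) c = L0_eigenspace V M c" for c
    by (simp add: L0_eigenspace_def autD(4)[OF a])
  then have "ordinary V (twist M a)" using M by (simp add: irreducible_twisted_def ordinary_def)
  moreover have "N = {0} \<or> N = mspace M" if N: "submod V (twist M a) N" for N
  proof -
    have "mmode M u k w \<in> N" if "u \<in> vspace V" "w \<in> N" for u k w
    proof -
      have "inv a u \<in> vspace V" by (rule autD(5)[OF inv_in[OF a] that(1)])
      then have "mmode (twist M a) (inv a u) k w \<in> N" using N that(2) unfolding submod_def by blast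
      then show ?thesis using bij[OF a] by (simp add: bij_is_surj surj_f_inv_f)
    qed
    then have "submod V M N" using N by (simp add: submod_def)
    then show ?thesis using M unfolding irreducible_twisted_def by blast
  qed
  ultimately show ?thesis
    using M twisted_module_twist[OF _ a] by (auto simp: irreducible_twisted_def)
qed

text \<open>A transversal, up to isomorphism, of the twists of \<open>N\<close> is a stable set consisting of one orbit.\<close>

lemma completely_reducible_twisted:
  fixes N :: "('v, 'm::complex_vector) tmod"
  assumes g: "g \<in> G" and N: "irreducible_twisted V g (card G) N"
  shows "completely_reducible (fixed_voa V G) N"
proof -
  define tw where "tw a = (inv a \<circ> g \<circ> a, twist N a)" for a
  define P where "P = tw ` G"
  define R where "R p q \<longleftrightarrow> fst p = fst q \<and> tmod_iso V (snd p) (snd q)" for p q :: "('v, 'm) tpair"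
  have P_D: "fst p \<in> G" "irreducible_twisted V (fst p) (card G) (snd p)" if "p \<in> P" for p
    using that g irreducible_twisted_twist[OF N] comp_in inv_in by (auto simp: P_def tw_def)
  have R_refl: "R p p" for p by (simp add: R_def tmod_iso_refl)
  have R_trans: "R p q \<Longrightarrow> R q s \<Longrightarrow> R p s" for p q s using tmod_iso_trans by (auto simp: R_def)
  have R_sym: "R q p" if "p \<in> P" "R p q" for p q
    using tmod_iso_sym[of V "snd p" "snd q"] irreducibleD[OF P_D(2)[OF that(1)]] that(2) by (auto simp: R_def)
  define p0 where "p0 = (g, N)"
  have p0: "p0 = tw id" by (simp add: p0_def tw_def twist_id)
  have p0P: "p0 \<in> P" unfolding p0 P_def using id_in by (rule imageI)
  \<comment> \<open>Within its class \<open>p0\<close> is preferred, so that the given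
    \<open>N\<close> itself, and not merely an isomorphic copy, belongs to the transversal.\<close>
  define sel where "sel p = (if R p p0 then p0 else (SOME q. q \<in> P \<and> R p q))" for p
  have sel: "sel p \<in> P \<and> R p (sel p)" if "p \<in> P" for p
    using someI[of "\<lambda>q. q \<in> P \<and> R p q" p] that p0P R_refl by (auto simp: sel_def)
  have sel_eq: "sel p = sel q" if "p \<in> P" "R p q" for p q
  proof -
    \<comment> \<open>Equivalent pairs are related to the same pairs, and \<open>sel\<close> depends
      on nothing else, so they receive the same representative.\<close>
    have "R p s = R q s" for s using R_trans[OF that(2), of s] R_trans[OF R_sym[OF that], of s] by blast
    then show ?thesis by (simp add: sel_def)
  qed
  define S where "S = sel ` P"
  have SP: "S \<subseteq> P" using sel by (auto simp: S_def)
  have S_eq: "p = q" if "p \<in> S" "q \<in> S" "R p q" for p q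
  proof -
    have "sel s = s" if s: "s \<in> S" for s
    proof -
      obtain t where t: "t \<in> P" "s = sel t" using s unfolding S_def by blast
      then show ?thesis using sel_eq[of t "sel t"] sel[OF t(1)] by simp
    qed
    then show ?thesis using sel_eq[of p q] that SP by auto
  qed
  have stab: "stable_set V G S"
  proof -
    have "finite S" using finite_H by (simp add: S_def P_def)
    moreover have "\<forall>(h, M)\<in>S. h \<in> G \<and> irreducible_twisted V h (card G) M" using P_D SP by force
    moreover have "\<forall>(h, M)\<in>S. \<forall>(h', M')\<in>S. h = h' \<and> tmod_iso V M M' \<longrightarrow> (h, M) = (h', M')"
      using S_eq by (auto simp: R_def)
    moreover have "\<exists>M'. (inv b \<circ> h \<circ> b, M') \<in> S \<and> tmod_iso V (twist M b) M'" if hM: "(h, M) \<in> S" and b: "b \<in> G" for h M b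
    proof -
      obtain a where a: "a \<in> G" "(h, M) = tw a" using hM SP unfolding P_def by blast
      have e: "(inv b \<circ> h \<circ> b, twist M b) = tw (a \<circ> b)"
        using a(2) by (simp add: tw_def inv_comp_distrib[OF a(1) b] twist_twist comp_assoc)
      have m: "tw (a \<circ> b) \<in> P" unfolding P_def using comp_in[OF a(1) b] by (rule imageI)
      obtain h' M' where s: "sel (tw (a \<circ> b)) = (h', M')" by (cases "sel (tw (a \<circ> b))")
      have "(h', M') \<in> S" unfolding s[symmetric] S_def using m by (rule imageI)
      moreover have "R (inv b \<circ> h \<circ> b, twist M b) (h', M')" unfolding e s[symmetric] using sel[OF m] ..
      ultimately show ?thesis by (auto simp: R_def)
    qed
    ultimately show ?thesis unfolding stable_set_def by blast
  qed
  have p0S: "p0 \<in> S" using p0P R_refl[of p0] by (auto simp: S_def sel_def intro!: image_eqI[of _ _ p0])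
  interpret SM: stable_modules V G S by unfold_locales (rule stab)
  obtain \<phi> where \<phi>: "intertwiners V G S \<phi>" using SM.intertwiners_exist by blast
  interpret O: orbifold V G S \<phi> by unfold_locales (rule \<phi>)
  have orb: "pact V S p0 ` G = S"
  proof
    show "pact V S p0 ` G \<subseteq> S" using SM.pact(1)[OF p0S] by blast
    show "S \<subseteq> pact V S p0 ` G"
    proof
      fix q assume q: "q \<in> S"
      then obtain a where a: "a \<in> G" "q = tw a" using SP unfolding P_def by blast
      have "pact V S p0 a = q"
        by (rule SM.pactI[OF p0S a(1) q]) (simp_all add: a(2) tw_def p0_def tmod_iso_refl)
      then show "q \<in> pact V S p0 ` G" using a(1) by blast
    qed
  qed
  let ?A = "stab_algebra V G S \<phi> p0"
  have "\<forall>\<mu>\<in>irr_characters ?A. \<exists>W :: (nat \<Rightarrow> complex) set. \<exists>\<rho>. simple_alg_module ?A W \<rho> \<and> alg_character ?A W \<rho> = \<mu>"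
    unfolding irr_characters_def by blast
  then obtain W :: "_ \<Rightarrow> (nat \<Rightarrow> complex) set" where
    "\<forall>\<mu>\<in>irr_characters ?A. \<exists>\<rho>. simple_alg_module ?A (W \<mu>) \<rho> \<and> alg_character ?A (W \<mu>) \<rho> = \<mu>"
    by (rule bchoice[THEN exE])
  then obtain \<rho> where W: "\<forall>\<mu>\<in>irr_characters ?A. simple_alg_module ?A (W \<mu>) (\<rho> \<mu>) \<and> alg_character ?A (W \<mu>) (\<rho> \<mu>) = \<mu>"
    by (rule bchoice[THEN exE])
  \<comment> \<open>There is one orbit, so the index set is a singleton; the modules are those that
    witness membership in \<open>irr_characters\<close>, carried by subspaces of
    \<open>nat \<Rightarrow> complex\<close>.\<close>
  have "orbifold_decomposition V G S \<phi> {()} (\<lambda>_. p0) (\<lambda>_. irr_characters ?A) (\<lambda>_. W) (\<lambda>_. \<rho>)"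
  proof
    show "orbit_representatives V G S {()} (\<lambda>_. p0)" unfolding orbit_representatives_def orb using p0S by (auto intro!: ex1I[of _ "()"])
  qed (use W in auto)
  from orbifold_decomposition.completely_reducible_rep[OF this, of "()"] show ?thesis by (simp add: p0_def)
qed

end

theorem theorem2:
  fixes V :: "'v::complex_vector voa"
    and G :: "('v \<Rightarrow> 'v) set"
    and S :: "('v, 'm::complex_vector) tpair set"
    and \<phi> :: "('v \<Rightarrow> 'v) \<Rightarrow> ('v, 'm) tpair \<Rightarrow> 'm \<Rightarrow> 'm"
    and J :: "'j set"
    and rep :: "'j \<Rightarrow> ('v, 'm) tpair"
    and \<Lambda> :: "'j \<Rightarrow> ((('v \<Rightarrow> 'v) \<Rightarrow> complex) \<Rightarrow> complex) set"
    and W :: "'j \<Rightarrow> ((('v \<Rightarrow> 'v) \<Rightarrow> complex) \<Rightarrow> complex) \<Rightarrow> 'w::complex_vector set"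
    and \<rho> :: "'j \<Rightarrow> ((('v \<Rightarrow> 'v) \<Rightarrow> complex) \<Rightarrow> complex) \<Rightarrow> (('v \<Rightarrow> 'v) \<Rightarrow> complex) \<Rightarrow> 'w \<Rightarrow> 'w"
  assumes "vertex_operator_algebra V"
    and "simple_voa V"
    and "finite_aut_group V G"
    and "stable_set V G S"
    and "intertwiners V G S \<phi>"
    and "orbit_representatives V G S J rep"
    and "\<And>j. j \<in> J \<Longrightarrow> \<Lambda> j = irr_characters (stab_algebra V G S \<phi> (rep j))"
    and "\<And>j \<mu>. j \<in> J \<Longrightarrow> \<mu> \<in> \<Lambda> j \<Longrightarrow>
      simple_alg_module (stab_algebra V G S \<phi> (rep j)) (W j \<mu>) (\<rho> j \<mu>) \<and>
      alg_character (stab_algebra V G S \<phi> (rep j)) (W j \<mu>) (\<rho> j \<mu>) = \<mu>"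
  shows "bimod_iso (stable_algebra V G S \<phi>) (fixed_voa V G)
      (total_bimod V G S \<phi>)
      (bimod_dsum (SIGMA j:J. \<Lambda> j) (\<lambda>(j, \<mu>).
        bimod_tensor
          (induced_space V G S \<phi> (rep j) (W j \<mu>) (\<rho> j \<mu>))
          (induced_act V G S \<phi> (rep j) (W j \<mu>) (\<rho> j \<mu>))
          (hom_mod V G S \<phi> (rep j) (W j \<mu>) (\<rho> j \<mu>)))) \<and>
    (\<forall>j\<in>J. \<forall>\<mu>\<in>\<Lambda> j.
      irreducible_mod (fixed_voa V G) (hom_mod V G S \<phi> (rep j) (W j \<mu>) (\<rho> j \<mu>))) \<and>
    (\<forall>j1\<in>J. \<forall>\<mu>1\<in>\<Lambda> j1. \<forall>j2\<in>J. \<forall>\<mu>2\<in>\<Lambda> j2.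
      tmod_iso (fixed_voa V G)
        (hom_mod V G S \<phi> (rep j1) (W j1 \<mu>1) (\<rho> j1 \<mu>1))
        (hom_mod V G S \<phi> (rep j2) (W j2 \<mu>2) (\<rho> j2 \<mu>2)) \<longleftrightarrow>
      j1 = j2 \<and> \<mu>1 = \<mu>2) \<and>
    (\<forall>g\<in>G. \<forall>N :: ('v, 'm) tmod.
      irreducible_twisted V g (card G) N \<longrightarrow> completely_reducible (fixed_voa V G) N)"
proof -
  interpret orbifold_decomposition V G S \<phi> J rep \<Lambda> W \<rho>
    by (intro orbifold_decomposition.intro orbifold.intro stable_modules.intro automorphism_group.intro
        orbifold_decomposition_axioms.intro orbifold_axioms.intro stable_modules_axioms.intro)
      (fact assms | (rule assms; assumption))+
  show ?thesis
  proof (intro conjI ballI allI impI)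
    show "bimod_iso (stable_algebra V G S \<phi>) (fixed_voa V G) (total_bimod V G S \<phi>)
      (bimod_dsum (SIGMA j:J. \<Lambda> j) (\<lambda>(j, \<mu>). bimod_tensor
          (induced_space V G S \<phi> (rep j) (W j \<mu>) (\<rho> j \<mu>)) (induced_act V G S \<phi> (rep j) (W j \<mu>) (\<rho> j \<mu>))
          (hom_mod V G S \<phi> (rep j) (W j \<mu>) (\<rho> j \<mu>))))"
      by (rule total_module_decomposition)
    show "irreducible_mod (fixed_voa V G) (hom_mod V G S \<phi> (rep j) (W j \<mu>) (\<rho> j \<mu>))" if "j \<in> J" "\<mu> \<in> \<Lambda> j" for j \<mu>
      by (rule stab_simple.irreducible_hom_mod[OF stab_simpleI[OF that]])
    show "tmod_iso (fixed_voa V G) (hom_mod V G S \<phi> (rep j1) (W j1 \<mu>1) (\<rho> j1 \<mu>1))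
        (hom_mod V G S \<phi> (rep j2) (W j2 \<mu>2) (\<rho> j2 \<mu>2)) \<longleftrightarrow> j1 = j2 \<and> \<mu>1 = \<mu>2"
      if "j1 \<in> J" "\<mu>1 \<in> \<Lambda> j1" "j2 \<in> J" "\<mu>2 \<in> \<Lambda> j2" for j1 \<mu>1 j2 \<mu>2
      using hom_mod_inequivalent[OF that] tmod_iso_refl by blast
    show "completely_reducible (fixed_voa V G) N" if "g \<in> G" "irreducible_twisted V g (card G) N" for g and N :: "('v, 'm) tmod"
      using that by (rule completely_reducible_twisted)
  qed
qed

end
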